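(* Let $(A,\mathfrak m,k)$ be a (not necessarily noetherian) local ring which is formally regular with the $\mathfrak m$-adic topology and separated for the $\mathfrak m$-adic topology (that is, $\bigcap_{n>0}\mathfrak m^n=0$). Then $A$ is a domain.
   Context: All rings are commutative. A local ring $(A,\mathfrak m,k)$ is a (not necessarily noetherian) ring $A$ with a unique maximal ideal $\mathfrak m$ and residue field $k=A/\mathfrak m$. For a ring homomorphism $A\to B$ with cotangent complex $\mathbb L_{B|A}$ and a $B$-module $M$, the André–Quillen cohomology modules are $\mathrm H^i(A,B,M)=\mathrm H^i(\mathrm{Hom}_B(\mathbb L_{B|A},M))$. A local ring $(A,\mathfrak m,k)$ is formally regular with the $\mathfrak m$-adic topology if $\varinjlim_n\mathrm H^2(A/\mathfrak m^n,k,M)=0$ for every $k$-module $M$. *)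

theory Defs
  imports "HOL-Algebra.Algebra"
begin

section \<open>Finitely supported functions, free modules and polynomial algebras\<close>

definition fin_supp :: "('r, 'q) ring_scheme \<Rightarrow> 'x set \<Rightarrow> ('x \<Rightarrow> 'r) set" where
  "fin_supp R V = {c. (\<forall>x. c x \<in> carrier R) \<and> finite {x. c x \<noteq> \<zero>\<^bsub>R\<^esub>} \<and>
                      (\<forall>x. c x \<noteq> \<zero>\<^bsub>R\<^esub> \<longrightarrow> x \<in> V)}"

text \<open>The map \<open>\<Sum> c\<^sub>x x \<mapsto> \<Sum> \<phi>(c\<^sub>x) f(x)\<close> on formal linear combinations.\<close>

definition push_forward ::
  "('r, 'q) ring_scheme \<Rightarrow> ('r1, 'q1) ring_scheme \<Rightarrow> ('r \<Rightarrow> 'r1) \<Rightarrow> ('x \<Rightarrow> 'y) \<Rightarrow> ('x \<Rightarrow> 'r) \<Rightarrow> ('y \<Rightarrow> 'r1)"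
where
  "push_forward R R1 \<phi> f c = (\<lambda>y. \<Oplus>\<^bsub>R1\<^esub> x \<in> {x. c x \<noteq> \<zero>\<^bsub>R\<^esub> \<and> f x = y}. \<phi> (c x))"

text \<open>The ring fields \<open>mult\<close> and \<open>one\<close> of a \<open>module\<close> record play no role in the locale \<open>module\<close>;
  they are left unspecified below.\<close>

definition free_module :: "('r, 'q) ring_scheme \<Rightarrow> 'x set \<Rightarrow> ('r, 'x \<Rightarrow> 'r) module" where
  "free_module R V =
    \<lparr>carrier = fin_supp R V, monoid.mult = undefined, one = undefined,
     ring.zero = (\<lambda>x. \<zero>\<^bsub>R\<^esub>), ring.add = (\<lambda>c d x. c x \<oplus>\<^bsub>R\<^esub> d x), smult = (\<lambda>a c x. a \<otimes>\<^bsub>R\<^esub> c x)\<rparr>"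

definition free_gen :: "('r, 'q) ring_scheme \<Rightarrow> 'x \<Rightarrow> ('x \<Rightarrow> 'r)" where
  "free_gen R x = (\<lambda>y. if y = x then \<one>\<^bsub>R\<^esub> else \<zero>\<^bsub>R\<^esub>)"

text \<open>The polynomial algebra \<open>R[V]\<close> on an arbitrary set \<open>V\<close> of indeterminates; a monomial is a finite
  multiset of indeterminates.\<close>

type_synonym ('r, 'x) mpoly = "'x multiset \<Rightarrow> 'r"

definition poly_alg :: "('r, 'q) ring_scheme \<Rightarrow> 'x set \<Rightarrow> ('r, 'x) mpoly ring" where
  "poly_alg R V =
    \<lparr>carrier = fin_supp R {m. set_mset m \<subseteq> V},
     monoid.mult = (\<lambda>p q m. \<Oplus>\<^bsub>R\<^esub> a \<in> {a. a \<subseteq># m}. p a \<otimes>\<^bsub>R\<^esub> q (m - a)),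
     one = free_gen R {#},
     ring.zero = (\<lambda>m. \<zero>\<^bsub>R\<^esub>), ring.add = (\<lambda>p q m. p m \<oplus>\<^bsub>R\<^esub> q m)\<rparr>"

definition poly_const :: "('r, 'q) ring_scheme \<Rightarrow> 'r \<Rightarrow> ('r, 'x) mpoly" where
  "poly_const R r = (\<lambda>m. if m = {#} then r else \<zero>\<^bsub>R\<^esub>)"

text \<open>For an \<open>R\<close>-algebra \<open>T\<close> with structure map \<open>h\<close>, the algebra map \<open>R[T] \<rightarrow> T\<close> sending the
  indeterminate indexed by \<open>t\<close> to \<open>t\<close>; and the map \<open>R[V] \<rightarrow> R1[W]\<close> induced by \<open>\<phi> : R \<rightarrow> R1\<close> and
  \<open>f : V \<rightarrow> W\<close>.\<close>

definition poly_counit ::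
  "('r, 'q) ring_scheme \<Rightarrow> ('t, 'w) ring_scheme \<Rightarrow> ('r \<Rightarrow> 't) \<Rightarrow> ('r, 't) mpoly \<Rightarrow> 't"
where
  "poly_counit R T h p =
    (\<Oplus>\<^bsub>T\<^esub> m \<in> {m. p m \<noteq> \<zero>\<^bsub>R\<^esub>}.
       h (p m) \<otimes>\<^bsub>T\<^esub> (\<Otimes>\<^bsub>T\<^esub> t \<in> set_mset m. t [^]\<^bsub>T\<^esub> count m t))"

definition poly_map ::
  "('r, 'q) ring_scheme \<Rightarrow> ('r1, 'q1) ring_scheme \<Rightarrow> ('r \<Rightarrow> 'r1) \<Rightarrow> ('x \<Rightarrow> 'y)
    \<Rightarrow> ('r, 'x) mpoly \<Rightarrow> ('r1, 'y) mpoly"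
where
  "poly_map R R1 \<phi> f = push_forward R R1 \<phi> (image_mset f)"


section \<open>Quotient modules and modules of homomorphisms\<close>

definition gen_submodule :: "('r, 'q) ring_scheme \<Rightarrow> ('r, 'x) module \<Rightarrow> 'x set \<Rightarrow> 'x set" where
  "gen_submodule R M G = \<Inter>{H. submodule H R M \<and> G \<subseteq> H}"

definition quot_module :: "('r, 'x) module \<Rightarrow> 'x set \<Rightarrow> ('r, 'x set) module" where
  "quot_module M N =
    \<lparr>carrier = a_rcosets\<^bsub>M\<^esub> N, monoid.mult = undefined, one = undefined,
     ring.zero = N, ring.add = set_add M, smult = (\<lambda>a C. \<Union>x\<in>C. N +>\<^bsub>M\<^esub> (a \<odot>\<^bsub>M\<^esub> x))\<rparr>"

text \<open>The map \<open>[x] \<mapsto> [f x]\<close> on cosets, with values in \<open>M/N\<close> (\<open>M\<close> a module or a ring).\<close>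

definition quot_map :: "('y, 'w) ring_scheme \<Rightarrow> 'y set \<Rightarrow> ('x \<Rightarrow> 'y) \<Rightarrow> 'x set \<Rightarrow> 'y set" where
  "quot_map M N f C = (\<Union>x\<in>C. N +>\<^bsub>M\<^esub> f x)"

definition hom_module ::
  "('s, 't) ring_scheme \<Rightarrow> ('s, 'x) module \<Rightarrow> ('s, 'y) module \<Rightarrow> ('s, 'x \<Rightarrow> 'y) module"
where
  "hom_module S L M =
    \<lparr>carrier = {\<phi> \<in> carrier L \<rightarrow>\<^sub>E carrier M.
                 (\<forall>x\<in>carrier L. \<forall>y\<in>carrier L. \<phi> (x \<oplus>\<^bsub>L\<^esub> y) = \<phi> x \<oplus>\<^bsub>M\<^esub> \<phi> y) \<and>
                 (\<forall>a\<in>carrier S. \<forall>x\<in>carrier L. \<phi> (a \<odot>\<^bsub>L\<^esub> x) = a \<odot>\<^bsub>M\<^esub> \<phi> x)},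
     monoid.mult = undefined, one = undefined,
     ring.zero = (\<lambda>x\<in>carrier L. \<zero>\<^bsub>M\<^esub>),
     ring.add = (\<lambda>\<phi> \<psi>. \<lambda>x\<in>carrier L. \<phi> x \<oplus>\<^bsub>M\<^esub> \<psi> x),
     smult = (\<lambda>a \<phi>. \<lambda>x\<in>carrier L. a \<odot>\<^bsub>M\<^esub> \<phi> x)\<rparr>"

text \<open>The map \<open>Hom(f, M)\<close> for \<open>f\<close> with source \<open>L\<close>.\<close>

definition hom_pull :: "('s, 'x) module \<Rightarrow> ('x \<Rightarrow> 'z) \<Rightarrow> ('z \<Rightarrow> 'y) \<Rightarrow> ('x \<Rightarrow> 'y)" where
  "hom_pull L f \<phi> = (\<lambda>x\<in>carrier L. \<phi> (f x))"


section \<open>Kaehler differentials and extension of scalars\<close>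

text \<open>\<open>\<Omega>\<^bsub>P|R\<^esub>\<close>, for an \<open>R\<close>-algebra \<open>P\<close> with structure map \<open>u\<close>, is the \<open>P\<close>-module generated by symbols
  \<open>d x\<close>, \<open>x \<in> P\<close>, modulo additivity, the Leibniz rule and \<open>d (u r) = 0\<close>.\<close>

definition kaehler_rel ::
  "('r, 'q) ring_scheme \<Rightarrow> ('p, 'w) ring_scheme \<Rightarrow> ('r \<Rightarrow> 'p) \<Rightarrow> ('p \<Rightarrow> 'p) set"
where
  "kaehler_rel R P u =
    (let F = free_module P (carrier P); d = free_gen P in
     gen_submodule P F
      ({d (x \<oplus>\<^bsub>P\<^esub> y) \<ominus>\<^bsub>F\<^esub> (d x \<oplus>\<^bsub>F\<^esub> d y) | x y. x \<in> carrier P \<and> y \<in> carrier P} \<union>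
       {d (x \<otimes>\<^bsub>P\<^esub> y) \<ominus>\<^bsub>F\<^esub> (x \<odot>\<^bsub>F\<^esub> d y \<oplus>\<^bsub>F\<^esub> y \<odot>\<^bsub>F\<^esub> d x) | x y. x \<in> carrier P \<and> y \<in> carrier P} \<union>
       {d (u r) | r. r \<in> carrier R}))"

definition kaehler ::
  "('r, 'q) ring_scheme \<Rightarrow> ('p, 'w) ring_scheme \<Rightarrow> ('r \<Rightarrow> 'p) \<Rightarrow> ('p, ('p \<Rightarrow> 'p) set) module"
where
  "kaehler R P u = quot_module (free_module P (carrier P)) (kaehler_rel R P u)"

text \<open>The map \<open>a d x \<mapsto> f(a) d(f x)\<close> into \<open>\<Omega>\<^bsub>P1|R1\<^esub>\<close> induced by a ring map \<open>f : P \<rightarrow> P1\<close>.\<close>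

definition kaehler_map ::
  "('p, 'w) ring_scheme \<Rightarrow> ('r1, 'q1) ring_scheme \<Rightarrow> ('p1, 'w1) ring_scheme \<Rightarrow> ('r1 \<Rightarrow> 'p1)
    \<Rightarrow> ('p \<Rightarrow> 'p1) \<Rightarrow> ('p \<Rightarrow> 'p) set \<Rightarrow> ('p1 \<Rightarrow> 'p1) set"
where
  "kaehler_map P R1 P1 u1 f =
    quot_map (free_module P1 (carrier P1)) (kaehler_rel R1 P1 u1) (push_forward P P1 f f)"

text \<open>\<open>N \<otimes>\<^sub>P S\<close>, for a ring map \<open>e : P \<rightarrow> S\<close>, is the \<open>S\<close>-module generated by symbols \<open>[x] = x \<otimes> 1\<close>,
  \<open>x \<in> N\<close>, modulo additivity and \<open>[p x] = e(p) [x]\<close>.\<close>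

definition ext_scalars_rel ::
  "('p, 'w) ring_scheme \<Rightarrow> ('s, 't) ring_scheme \<Rightarrow> ('p \<Rightarrow> 's) \<Rightarrow> ('p, 'x) module \<Rightarrow> ('x \<Rightarrow> 's) set"
where
  "ext_scalars_rel P S e N =
    (let F = free_module S (carrier N); g = free_gen S in
     gen_submodule S F
      ({g (x \<oplus>\<^bsub>N\<^esub> y) \<ominus>\<^bsub>F\<^esub> (g x \<oplus>\<^bsub>F\<^esub> g y) | x y. x \<in> carrier N \<and> y \<in> carrier N} \<union>
       {g (p \<odot>\<^bsub>N\<^esub> x) \<ominus>\<^bsub>F\<^esub> (e p \<odot>\<^bsub>F\<^esub> g x) | p x. p \<in> carrier P \<and> x \<in> carrier N}))"

definition ext_scalars ::
  "('p, 'w) ring_scheme \<Rightarrow> ('s, 't) ring_scheme \<Rightarrow> ('p \<Rightarrow> 's) \<Rightarrow> ('p, 'x) module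
    \<Rightarrow> ('s, ('x \<Rightarrow> 's) set) module"
where
  "ext_scalars P S e N = quot_module (free_module S (carrier N)) (ext_scalars_rel P S e N)"

definition ext_scalars_map ::
  "('s, 't) ring_scheme \<Rightarrow> ('p1, 'w1) ring_scheme \<Rightarrow> ('p1 \<Rightarrow> 's) \<Rightarrow> ('p1, 'y) module
    \<Rightarrow> ('x \<Rightarrow> 'y) \<Rightarrow> ('x \<Rightarrow> 's) set \<Rightarrow> ('y \<Rightarrow> 's) set"
where
  "ext_scalars_map S P1 e1 N1 g =
    quot_map (free_module S (carrier N1)) (ext_scalars_rel P1 S e1 N1) (push_forward S S id g)"


section \<open>The cotangent complex\<close>

text \<open>
  Let \<open>h : R \<rightarrow> S\<close> be a ring map.  Writing \<open>F T = R[T]\<close> for the polynomial algebra on the underlying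
  set of an \<open>R\<close>-algebra \<open>T\<close> and \<open>\<epsilon> : F T \<rightarrow> T\<close> for the counit, the standard simplicial resolution of
  \<open>S\<close> by polynomial \<open>R\<close>-algebras has \<open>P\<^sub>n = F\<^sup>n\<^sup>+\<^sup>1 S\<close> with faces
  \<open>d\<^sub>i = F\<^sup>i \<epsilon> : P\<^sub>n \<rightarrow> P\<^sub>n\<^sub>-\<^sub>1\<close>, \<open>0 \<le> i \<le> n\<close>, and augmentation \<open>\<epsilon> : P\<^sub>0 \<rightarrow> S\<close>.  The cotangent complex is the
  chain complex of \<open>S\<close>-modules \<open>L\<^sub>n = \<Omega>\<^bsub>P\<^sub>n|R\<^esub> \<otimes> S\<close>, the tensor product being over \<open>P\<^sub>n\<close>, with
  differential \<open>\<Sum> (-1)\<^sup>i d\<^sub>i\<close>.  The types of the \<open>P\<^sub>n\<close> grow with \<open>n\<close>; the degrees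
  \<open>n \<le> 3\<close> are written out, which is all that enters the second cohomology module.
\<close>

type_synonym ('r, 's) bar0 = "('r, 's) mpoly"
type_synonym ('r, 's) bar1 = "('r, ('r, 's) bar0) mpoly"
type_synonym ('r, 's) bar2 = "('r, ('r, 's) bar1) mpoly"
type_synonym ('r, 's) bar3 = "('r, ('r, 's) bar2) mpoly"

type_synonym ('p, 's) cot = "(('p \<Rightarrow> 'p) set \<Rightarrow> 's) set"

definition bar0 :: "('r, 'q) ring_scheme \<Rightarrow> ('s, 't) ring_scheme \<Rightarrow> ('r, 's) bar0 ring" where
  "bar0 R S = poly_alg R (carrier S)"

definition bar1 :: "('r, 'q) ring_scheme \<Rightarrow> ('s, 't) ring_scheme \<Rightarrow> ('r, 's) bar1 ring" where
  "bar1 R S = poly_alg R (carrier (bar0 R S))"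

definition bar2 :: "('r, 'q) ring_scheme \<Rightarrow> ('s, 't) ring_scheme \<Rightarrow> ('r, 's) bar2 ring" where
  "bar2 R S = poly_alg R (carrier (bar1 R S))"

definition bar3 :: "('r, 'q) ring_scheme \<Rightarrow> ('s, 't) ring_scheme \<Rightarrow> ('r, 's) bar3 ring" where
  "bar3 R S = poly_alg R (carrier (bar2 R S))"

definition bar_lift :: "('r, 'q) ring_scheme \<Rightarrow> ('x \<Rightarrow> 'y) \<Rightarrow> ('r, 'x) mpoly \<Rightarrow> ('r, 'y) mpoly" where
  "bar_lift R f = poly_map R R id f"

definition counit0 ::
  "('r, 'q) ring_scheme \<Rightarrow> ('s, 't) ring_scheme \<Rightarrow> ('r \<Rightarrow> 's) \<Rightarrow> ('r, 's) bar0 \<Rightarrow> 's" where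
  "counit0 R S h = poly_counit R S h"

definition counit1 ::
  "('r, 'q) ring_scheme \<Rightarrow> ('s, 't) ring_scheme \<Rightarrow> ('r, 's) bar1 \<Rightarrow> ('r, 's) bar0" where
  "counit1 R S = poly_counit R (bar0 R S) (poly_const R)"

definition counit2 ::
  "('r, 'q) ring_scheme \<Rightarrow> ('s, 't) ring_scheme \<Rightarrow> ('r, 's) bar2 \<Rightarrow> ('r, 's) bar1" where
  "counit2 R S = poly_counit R (bar1 R S) (poly_const R)"

definition counit3 ::
  "('r, 'q) ring_scheme \<Rightarrow> ('s, 't) ring_scheme \<Rightarrow> ('r, 's) bar3 \<Rightarrow> ('r, 's) bar2" where
  "counit3 R S = poly_counit R (bar2 R S) (poly_const R)"

definition aug1 ::
  "('r, 'q) ring_scheme \<Rightarrow> ('s, 't) ring_scheme \<Rightarrow> ('r \<Rightarrow> 's) \<Rightarrow> ('r, 's) bar1 \<Rightarrow> 's" where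
  "aug1 R S h = counit0 R S h \<circ> counit1 R S"

definition aug2 ::
  "('r, 'q) ring_scheme \<Rightarrow> ('s, 't) ring_scheme \<Rightarrow> ('r \<Rightarrow> 's) \<Rightarrow> ('r, 's) bar2 \<Rightarrow> 's" where
  "aug2 R S h = aug1 R S h \<circ> counit2 R S"

definition aug3 ::
  "('r, 'q) ring_scheme \<Rightarrow> ('s, 't) ring_scheme \<Rightarrow> ('r \<Rightarrow> 's) \<Rightarrow> ('r, 's) bar3 \<Rightarrow> 's" where
  "aug3 R S h = aug2 R S h \<circ> counit3 R S"

text \<open>\<open>\<Omega>\<^bsub>P|R\<^esub> \<otimes>\<^sub>P S\<close> for a polynomial algebra \<open>P\<close> over \<open>R\<close> with a ring map \<open>e : P \<rightarrow> S\<close>, and the map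
  \<open>\<Omega>\<^bsub>P|R\<^esub> \<otimes>\<^sub>P S \<rightarrow> \<Omega>\<^bsub>P1|R1\<^esub> \<otimes>\<^bsub>P1\<^esub> S\<close> induced by a ring map \<open>f : P \<rightarrow> P1\<close> over \<open>S\<close>.\<close>

definition cot_term ::
  "('r, 'q) ring_scheme \<Rightarrow> ('s, 't) ring_scheme \<Rightarrow> ('r, 'x) mpoly ring \<Rightarrow> (('r, 'x) mpoly \<Rightarrow> 's)
    \<Rightarrow> ('s, (('r, 'x) mpoly, 's) cot) module"
where
  "cot_term R S P e = ext_scalars P S e (kaehler R P (poly_const R))"

definition cot_map ::
  "('s, 't) ring_scheme \<Rightarrow> ('r, 'x) mpoly ring
    \<Rightarrow> ('r1, 'q1) ring_scheme \<Rightarrow> ('r1, 'y) mpoly ring \<Rightarrow> (('r1, 'y) mpoly \<Rightarrow> 's)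
    \<Rightarrow> (('r, 'x) mpoly \<Rightarrow> ('r1, 'y) mpoly)
    \<Rightarrow> (('r, 'x) mpoly, 's) cot \<Rightarrow> (('r1, 'y) mpoly, 's) cot"
where
  "cot_map S P R1 P1 e1 f =
    ext_scalars_map S P1 e1 (kaehler R1 P1 (poly_const R1)) (kaehler_map P R1 P1 (poly_const R1) f)"

definition cot0 ::
  "('r, 'q) ring_scheme \<Rightarrow> ('s, 't) ring_scheme \<Rightarrow> ('r \<Rightarrow> 's) \<Rightarrow> ('s, (('r, 's) bar0, 's) cot) module" where
  "cot0 R S h = cot_term R S (bar0 R S) (counit0 R S h)"

definition cot1 ::
  "('r, 'q) ring_scheme \<Rightarrow> ('s, 't) ring_scheme \<Rightarrow> ('r \<Rightarrow> 's) \<Rightarrow> ('s, (('r, 's) bar1, 's) cot) module" where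
  "cot1 R S h = cot_term R S (bar1 R S) (aug1 R S h)"

definition cot2 ::
  "('r, 'q) ring_scheme \<Rightarrow> ('s, 't) ring_scheme \<Rightarrow> ('r \<Rightarrow> 's) \<Rightarrow> ('s, (('r, 's) bar2, 's) cot) module" where
  "cot2 R S h = cot_term R S (bar2 R S) (aug2 R S h)"

definition cot3 ::
  "('r, 'q) ring_scheme \<Rightarrow> ('s, 't) ring_scheme \<Rightarrow> ('r \<Rightarrow> 's) \<Rightarrow> ('s, (('r, 's) bar3, 's) cot) module" where
  "cot3 R S h = cot_term R S (bar3 R S) (aug3 R S h)"

definition cot_diff1 ::
  "('r, 'q) ring_scheme \<Rightarrow> ('s, 't) ring_scheme \<Rightarrow> ('r \<Rightarrow> 's)
    \<Rightarrow> (('r, 's) bar1, 's) cot \<Rightarrow> (('r, 's) bar0, 's) cot"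
where
  "cot_diff1 R S h x =
    (let D = cot_map S (bar1 R S) R (bar0 R S) (counit0 R S h) in
     D (counit1 R S) x
     \<ominus>\<^bsub>cot0 R S h\<^esub> D (bar_lift R (counit0 R S h)) x)"

definition cot_diff2 ::
  "('r, 'q) ring_scheme \<Rightarrow> ('s, 't) ring_scheme \<Rightarrow> ('r \<Rightarrow> 's)
    \<Rightarrow> (('r, 's) bar2, 's) cot \<Rightarrow> (('r, 's) bar1, 's) cot"
where
  "cot_diff2 R S h x =
    (let D = cot_map S (bar2 R S) R (bar1 R S) (aug1 R S h) in
     D (counit2 R S) x
     \<ominus>\<^bsub>cot1 R S h\<^esub> D (bar_lift R (counit1 R S)) x
     \<oplus>\<^bsub>cot1 R S h\<^esub> D (bar_lift R (bar_lift R (counit0 R S h))) x)"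

definition cot_diff3 ::
  "('r, 'q) ring_scheme \<Rightarrow> ('s, 't) ring_scheme \<Rightarrow> ('r \<Rightarrow> 's)
    \<Rightarrow> (('r, 's) bar3, 's) cot \<Rightarrow> (('r, 's) bar2, 's) cot"
where
  "cot_diff3 R S h x =
    (let D = cot_map S (bar3 R S) R (bar2 R S) (aug2 R S h) in
     D (counit3 R S) x
     \<ominus>\<^bsub>cot2 R S h\<^esub> D (bar_lift R (counit2 R S)) x
     \<oplus>\<^bsub>cot2 R S h\<^esub> D (bar_lift R (bar_lift R (counit1 R S))) x
     \<ominus>\<^bsub>cot2 R S h\<^esub> D (bar_lift R (bar_lift R (bar_lift R (counit0 R S h)))) x)"


section \<open>The second Andre-Quillen cohomology module\<close>

definition aq_cocycles2 ::
  "('r, 'q) ring_scheme \<Rightarrow> ('s, 't) ring_scheme \<Rightarrow> ('r \<Rightarrow> 's) \<Rightarrow> ('s, 'b) module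
    \<Rightarrow> ((('r, 's) bar2, 's) cot \<Rightarrow> 'b) set"
where
  "aq_cocycles2 R S h M =
    {\<phi> \<in> carrier (hom_module S (cot2 R S h) M).
       hom_pull (cot3 R S h) (cot_diff3 R S h) \<phi> = \<zero>\<^bsub>hom_module S (cot3 R S h) M\<^esub>}"

definition aq_coboundaries2 ::
  "('r, 'q) ring_scheme \<Rightarrow> ('s, 't) ring_scheme \<Rightarrow> ('r \<Rightarrow> 's) \<Rightarrow> ('s, 'b) module
    \<Rightarrow> ((('r, 's) bar2, 's) cot \<Rightarrow> 'b) set"
where
  "aq_coboundaries2 R S h M =
    hom_pull (cot2 R S h) (cot_diff2 R S h) ` carrier (hom_module S (cot1 R S h) M)"

definition aq_cocycle_module2 ::
  "('r, 'q) ring_scheme \<Rightarrow> ('s, 't) ring_scheme \<Rightarrow> ('r \<Rightarrow> 's) \<Rightarrow> ('s, 'b) module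
    \<Rightarrow> ('s, (('r, 's) bar2, 's) cot \<Rightarrow> 'b) module"
where
  "aq_cocycle_module2 R S h M =
    (hom_module S (cot2 R S h) M)\<lparr>carrier := aq_cocycles2 R S h M\<rparr>"

definition aq_cohomology2 ::
  "('r, 'q) ring_scheme \<Rightarrow> ('s, 't) ring_scheme \<Rightarrow> ('r \<Rightarrow> 's) \<Rightarrow> ('s, 'b) module
    \<Rightarrow> ('s, ((('r, 's) bar2, 's) cot \<Rightarrow> 'b) set) module"
where
  "aq_cohomology2 R S h M = quot_module (aq_cocycle_module2 R S h M) (aq_coboundaries2 R S h M)"

text \<open>For \<open>\<pi> : R1 \<rightarrow> R\<close> and \<open>h1 = h \<circ> \<pi> : R1 \<rightarrow> S\<close>, the map \<open>H\<^sup>2(R, S, M) \<rightarrow> H\<^sup>2(R1, S, M)\<close> induced by the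
  map of resolutions that applies \<open>\<pi>\<close> to all coefficients.\<close>

definition bar2_base_change ::
  "('r1, 'q1) ring_scheme \<Rightarrow> ('r, 'q) ring_scheme \<Rightarrow> ('r1 \<Rightarrow> 'r) \<Rightarrow> ('r1, 's) bar2 \<Rightarrow> ('r, 's) bar2"
where
  "bar2_base_change R1 R \<pi> = poly_map R1 R \<pi> (poly_map R1 R \<pi> (poly_map R1 R \<pi> id))"

definition aq_cohomology2_map ::
  "('r1, 'q1) ring_scheme \<Rightarrow> ('r, 'q) ring_scheme \<Rightarrow> ('r1 \<Rightarrow> 'r) \<Rightarrow> ('s, 't) ring_scheme
    \<Rightarrow> ('r1 \<Rightarrow> 's) \<Rightarrow> ('r \<Rightarrow> 's) \<Rightarrow> ('s, 'b) module
    \<Rightarrow> ((('r, 's) bar2, 's) cot \<Rightarrow> 'b) set \<Rightarrow> ((('r1, 's) bar2, 's) cot \<Rightarrow> 'b) set"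
where
  "aq_cohomology2_map R1 R \<pi> S h1 h M =
    quot_map (aq_cocycle_module2 R1 S h1 M) (aq_coboundaries2 R1 S h1 M)
      (hom_pull (cot2 R1 S h1)
        (cot_map S (bar2 R1 S) R (bar2 R S) (aug2 R S h) (bar2_base_change R1 R \<pi>)))"


section \<open>Direct limits\<close>

definition dir_lim_rel ::
  "'i::order set \<Rightarrow> ('i \<Rightarrow> ('s, 'x) module) \<Rightarrow> ('i \<Rightarrow> 'i \<Rightarrow> 'x \<Rightarrow> 'x) \<Rightarrow> (('i \<times> 'x) \<times> ('i \<times> 'x)) set"
where
  "dir_lim_rel I H f =
    {((i, x), (j, y)). i \<in> I \<and> j \<in> I \<and> x \<in> carrier (H i) \<and> y \<in> carrier (H j) \<and>
                       (\<exists>l\<in>I. i \<le> l \<and> j \<le> l \<and> f i l x = f j l y)}"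

definition dir_lim ::
  "'i::order set \<Rightarrow> ('i \<Rightarrow> ('s, 'x) module) \<Rightarrow> ('i \<Rightarrow> 'i \<Rightarrow> 'x \<Rightarrow> 'x) \<Rightarrow> ('s, ('i \<times> 'x) set) module"
where
  "dir_lim I H f =
    \<lparr>carrier = (SIGMA i:I. carrier (H i)) // dir_lim_rel I H f,
     monoid.mult = undefined, one = undefined,
     ring.zero = dir_lim_rel I H f `` {(i, \<zero>\<^bsub>H i\<^esub>) | i. i \<in> I},
     ring.add = (\<lambda>C D. dir_lim_rel I H f `` {(i, x \<oplus>\<^bsub>H i\<^esub> y) | i x y. (i, x) \<in> C \<and> (i, y) \<in> D}),
     smult = (\<lambda>a C. dir_lim_rel I H f `` {(i, a \<odot>\<^bsub>H i\<^esub> x) | i x. (i, x) \<in> C})\<rparr>"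


section \<open>Formally regular local rings\<close>

definition local_ring :: "('a, 'q) ring_scheme \<Rightarrow> 'a set \<Rightarrow> bool" where
  "local_ring A \<mm> \<longleftrightarrow> cring A \<and> maximalideal \<mm> A \<and> (\<forall>J. maximalideal J A \<longrightarrow> J = \<mm>)"

abbreviation ideal_pow :: "('a, 'q) ring_scheme \<Rightarrow> 'a set \<Rightarrow> nat \<Rightarrow> 'a set" where
  "ideal_pow A I n \<equiv> I [^]\<^bsub>ideals_set A\<^esub> n"

text \<open>The module \<open>H\<^sup>2(A/\<mm>\<^sup>n, k, M)\<close> and, for \<open>i \<le> j\<close>, the map \<open>H\<^sup>2(A/\<mm>\<^sup>i, k, M) \<rightarrow> H\<^sup>2(A/\<mm>\<^sup>j, k, M)\<close>.  The
  projection \<open>A/I \<rightarrow> A/J\<close> for ideals \<open>I \<subseteq> J\<close> is \<open>quot_map A J id\<close>.\<close>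

definition adic_aq ::
  "('a, 'q) ring_scheme \<Rightarrow> 'a set \<Rightarrow> ('a set, 'b) module \<Rightarrow> nat
    \<Rightarrow> ('a set, ((('a set, 'a set) bar2, 'a set) cot \<Rightarrow> 'b) set) module"
where
  "adic_aq A \<mm> M n = aq_cohomology2 (A Quot ideal_pow A \<mm> n) (A Quot \<mm>) (quot_map A \<mm> id) M"

definition adic_aq_map ::
  "('a, 'q) ring_scheme \<Rightarrow> 'a set \<Rightarrow> ('a set, 'b) module \<Rightarrow> nat \<Rightarrow> nat
    \<Rightarrow> ((('a set, 'a set) bar2, 'a set) cot \<Rightarrow> 'b) set
    \<Rightarrow> ((('a set, 'a set) bar2, 'a set) cot \<Rightarrow> 'b) set"
where
  "adic_aq_map A \<mm> M i j =
    aq_cohomology2_map (A Quot ideal_pow A \<mm> j) (A Quot ideal_pow A \<mm> i)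
      (quot_map A (ideal_pow A \<mm> i) id) (A Quot \<mm>) (quot_map A \<mm> id) (quot_map A \<mm> id) M"

text \<open>HOL does not quantify over types inside a formula, so the type \<open>'b\<close> carrying the modules \<open>M\<close> is a
  parameter.  For a field \<open>k\<close> one has \<open>H\<^sup>2(R, k, M) = Hom\<^sub>k (H\<^sub>2(R, k, k), M)\<close>, naturally in \<open>R\<close>; testing
  on \<open>M = H\<^sub>2(A/\<mm>\<^sup>n, k, k)\<close> shows that the limit vanishes for all \<open>M\<close> as soon as it vanishes for
  these, and they have cardinality at most \<open>max |A| \<aleph>\<^sub>0\<close>.  Hence every \<open>'b\<close> at least as large as
  \<open>'a list\<close> gives the same predicate, the one with no restriction on \<open>M\<close>.\<close>

definition formally_regular :: "'b itself \<Rightarrow> ('a, 'q) ring_scheme \<Rightarrow> 'a set \<Rightarrow> bool" where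
  "formally_regular _ A \<mm> \<longleftrightarrow>
    (\<forall>M :: ('a set, 'b) module. module (A Quot \<mm>) M \<longrightarrow>
       carrier (dir_lim {1..} (adic_aq A \<mm> M) (adic_aq_map A \<mm> M)) =
       {\<zero>\<^bsub>dir_lim {1..} (adic_aq A \<mm> M) (adic_aq_map A \<mm> M)\<^esub>})"

end

theory Submission
  imports Defs
begin

text \<open>
  The cohomological hypothesis enters through one relation.  Let \<open>I\<close> be an ideal with
  \<open>\<mm>\<^sup>n \<subseteq> I \<subseteq> \<mm>\<close> and \<open>\<mm> = tA + I\<close> for some \<open>t \<in> \<mm>\<close>, and put \<open>D = A/I\<close>.  Multiplication
  by \<open>t\<close> on \<open>D\<close> is a crossed module with cokernel \<open>k\<close> and kernel the annihilator of \<open>t\<close>, hence has a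
  class in \<open>H\<^sup>2(A/\<mm>\<^sup>n, k, Ann t)\<close>; on the standard resolution it is the cocycle \<open>\<Delta>\<close> of the
  locale \<open>crossed\<close>.  Formal regularity makes this class vanish over some \<open>A/\<mm>\<^sup>l\<close> with
  \<open>l \<ge> n\<close> (\<open>colimit_vanishing\<close>).  A cochain with coboundary \<open>\<Delta>\<close> contains an \<open>A\<close>-linear map
  \<open>\<theta> : \<mm> \<rightarrow> A/I\<close> with \<open>t \<theta>(a) = a\<close> modulo \<open>I\<close> (\<open>section_of_coboundary\<close>,
  \<open>formally_regular_splitting\<close>).  By linearity \<open>\<theta>\<close> kills \<open>I\<mm>\<close>, and \<open>\<theta>(t u) = t \<theta>(u) = u\<close>
  modulo \<open>I\<close> for \<open>u \<in> \<mm>\<close>.  Therefore \<open>t u \<in> I\<mm>\<close> implies \<open>u \<in> I\<close>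
  (\<open>formally_regular_relation\<close>).

  The rest is about orders of vanishing.  Call an ideal \<open>J \<subseteq> \<mm>\<close> transversal if
  \<open>J \<inter> \<mm>\<^sup>2 \<subseteq> J\<mm>\<close>.  If \<open>K\<close> is transversal and \<open>\<mm> = K + tA + \<mm>\<^sup>2\<close> with
  \<open>t \<notin> K + \<mm>\<^sup>2\<close>, then \<open>A/K\<close> behaves like a smooth curve with parameter \<open>t\<close>: the relation, applied
  to \<open>I = K + \<mm>\<^sup>V\<close>, shows inductively that \<open>t\<^sup>V \<notin> K + \<mm>\<^sup>V\<^sup>+\<^sup>1\<close> (\<open>curve_order\<close>).

  Suppose now that \<open>a b = 0\<close> with \<open>a, b \<noteq> 0\<close>.  Separatedness gives both elements a finite order, and
  their leading forms involve only finitely many elements \<open>x\<^sub>1, \<dots>, x\<^sub>r\<close> of \<open>\<mm>\<close>; a shortest choice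
  is independent modulo \<open>\<mm>\<^sup>2\<close>.  A maximal transversal ideal \<open>J\<close> for which the \<open>x\<^sub>i\<close> stay independent satisfies
  \<open>\<mm> = J + (x\<^sub>1, \<dots>, x\<^sub>r) + \<mm>\<^sup>2\<close> (\<open>transversal_complement\<close>), so that modulo \<open>J\<close> and any power of
  \<open>\<mm>\<close> the elements \<open>a\<close> and \<open>b\<close> are polynomials in the \<open>x\<^sub>i\<close> whose coefficients are zero or units, and some
  coefficient is nonzero (\<open>nonzero_series\<close>).  If \<open>r = 0\<close>, then \<open>a\<close> and \<open>b\<close> are units.  Otherwise restrict to the curve \<open>x\<^sub>i = t\<^sup>e\<close>, where \<open>t = x\<^sub>r\<close>
  and \<open>e\<close> is the \<open>(r - i)\<close>-th power of a large number \<open>B\<close>: adding the elements \<open>x\<^sub>i - t\<^sup>e\<close> to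
  \<open>J\<close> gives an ideal \<open>K\<close> as above (\<open>curve_ideal\<close>).  For large \<open>B\<close> the monomial with the
  lexicographically least exponent dominates, whence \<open>a = c t\<^sup>W\<close> and \<open>b = d t\<^sup>V\<close> modulo \<open>K\<close> and higher
  powers of \<open>\<mm>\<close>, with units \<open>c\<close> and \<open>d\<close> (\<open>leading_term\<close>).  Multiplying yields
  \<open>t\<^sup>W\<^sup>+\<^sup>V \<in> K + \<mm>\<^sup>W\<^sup>+\<^sup>V\<^sup>+\<^sup>1\<close>, a contradiction.
\<close>

section \<open>Finitely supported functions\<close>

definition single :: "('r, 'q) ring_scheme \<Rightarrow> 'x \<Rightarrow> 'r \<Rightarrow> ('x \<Rightarrow> 'r)" where
  "single R x r = (\<lambda>y. if y = x then r else \<zero>\<^bsub>R\<^esub>)"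

lemma free_gen_eq_single: "free_gen R x = single R x \<one>\<^bsub>R\<^esub>"
  by (simp add: free_gen_def single_def)

lemma poly_const_eq_single: "poly_const R r = single R {#} r"
  by (simp add: poly_const_def single_def)

lemma fin_suppD:
  assumes "c \<in> fin_supp R V"
  shows "c x \<in> carrier R" "finite {x. c x \<noteq> \<zero>\<^bsub>R\<^esub>}" "c x \<noteq> \<zero>\<^bsub>R\<^esub> \<Longrightarrow> x \<in> V"
  using assms by (auto simp: fin_supp_def)

lemma fin_suppI:
  assumes "\<And>x. c x \<in> carrier R" "finite A" "A \<subseteq> V" "\<And>x. x \<notin> A \<Longrightarrow> c x = \<zero>\<^bsub>R\<^esub>"
  shows "c \<in> fin_supp R V"
proof -
  have "{x. c x \<noteq> \<zero>\<^bsub>R\<^esub>} \<subseteq> A" using assms(4) by blast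
  then show ?thesis using assms finite_subset[OF _ assms(2)] by (auto simp: fin_supp_def)
qed

context abelian_group
begin

lemma fin_supp_zero: "(\<lambda>x. \<zero>) \<in> fin_supp G V"
  by (simp add: fin_supp_def)

lemma fin_supp_single: "\<lbrakk>x \<in> V; r \<in> carrier G\<rbrakk> \<Longrightarrow> single G x r \<in> fin_supp G V"
  by (rule fin_suppI[where A="{x}"]) (auto simp: single_def)

lemma fin_supp_add:
  assumes "c \<in> fin_supp G V" "d \<in> fin_supp G V"
  shows "(\<lambda>x. c x \<oplus> d x) \<in> fin_supp G V"
  by (rule fin_suppI[where A="{x. c x \<noteq> \<zero>} \<union> {x. d x \<noteq> \<zero>}"])
     (use fin_suppD[OF assms(1)] fin_suppD[OF assms(2)] in auto)

lemma fin_supp_induct [consumes 1, case_names zero add]: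
  assumes "c \<in> fin_supp G V"
    and zero: "P (\<lambda>x. \<zero>)"
    and add: "\<And>x r c. \<lbrakk>x \<in> V; r \<in> carrier G; c \<in> fin_supp G V; P c\<rbrakk> \<Longrightarrow> P (\<lambda>y. single G x r y \<oplus> c y)"
  shows "P c"
proof -
  have "finite A \<Longrightarrow> \<forall>c. c \<in> fin_supp G V \<and> {x. c x \<noteq> \<zero>} \<subseteq> A \<longrightarrow> P c" for A
  proof (induction A rule: finite_induct)
    case empty
    have "c = (\<lambda>x. \<zero>)" if "{x. c x \<noteq> \<zero>} \<subseteq> {}" for c using that by auto
    then show ?case using zero by blast
  next
    case (insert x A)
    show ?case
    proof (intro allI impI)
      fix c assume c: "c \<in> fin_supp G V \<and> {x. c x \<noteq> \<zero>} \<subseteq> insert x A"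
      show "P c"
      proof (cases "c x = \<zero>")
        case True
        then have "{x. c x \<noteq> \<zero>} \<subseteq> A" using c by auto
        then show ?thesis using insert c by blast
      next
        case False
        let ?d = "\<lambda>y. if y = x then \<zero> else c y"
        have cc: "\<And>y. c y \<in> carrier G" using fin_suppD(1)[OF conjunct1[OF c]] .
        have d: "?d \<in> fin_supp G V"
          by (rule fin_suppI[where A="{x. c x \<noteq> \<zero>}"])
             (use cc fin_suppD(2,3)[OF conjunct1[OF c]] in auto)
        moreover have "{x. ?d x \<noteq> \<zero>} \<subseteq> A" using c by auto
        ultimately have "P ?d" using insert by blast
        moreover have "c = (\<lambda>y. single G x (c x) y \<oplus> ?d y)"
          using cc by (auto simp: single_def)
        moreover have "x \<in> V" using fin_suppD(3)[OF conjunct1[OF c]] False by blast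
        ultimately show ?thesis using add[OF _ _ d, of x "c x"] cc by simp
      qed
    qed
  qed
  then show ?thesis using assms(1) fin_suppD(2)[OF assms(1)] by blast
qed

end

text \<open>Summing over the support makes \<open>fsum\<close> the common form of evaluations of polynomials, linear extensions
  and push-forwards.  These are additive as soon as each summand \<open>g x\<close> is (locale \<open>additive_family\<close>).\<close>

definition fsum ::
  "('r, 'q) ring_scheme \<Rightarrow> ('g, 'w) ring_scheme \<Rightarrow> ('x \<Rightarrow> 'r \<Rightarrow> 'g) \<Rightarrow> ('x \<Rightarrow> 'r) \<Rightarrow> 'g" where
  "fsum R G g c = (\<Oplus>\<^bsub>G\<^esub> x \<in> {x. c x \<noteq> \<zero>\<^bsub>R\<^esub>}. g x (c x))"

locale additive_family = R: abelian_group R + G: abelian_group G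
  for R :: "('r, 'q) ring_scheme" and G :: "('g, 'w) ring_scheme" +
  fixes V :: "'x set" and g :: "'x \<Rightarrow> 'r \<Rightarrow> 'g"
  assumes g_closed: "\<lbrakk>x \<in> V; r \<in> carrier R\<rbrakk> \<Longrightarrow> g x r \<in> carrier G"
    and g_add: "\<lbrakk>x \<in> V; r \<in> carrier R; s \<in> carrier R\<rbrakk> \<Longrightarrow> g x (r \<oplus>\<^bsub>R\<^esub> s) = g x r \<oplus>\<^bsub>G\<^esub> g x s"
begin

lemma g_zero: "x \<in> V \<Longrightarrow> g x \<zero>\<^bsub>R\<^esub> = \<zero>\<^bsub>G\<^esub>"
  using g_add[of x "\<zero>\<^bsub>R\<^esub>" "\<zero>\<^bsub>R\<^esub>"] g_closed[of x "\<zero>\<^bsub>R\<^esub>"]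
  by (metis G.add.l_cancel_one' R.r_zero R.zero_closed)

lemma fsum_superset:
  assumes c: "c \<in> fin_supp R V" and A: "finite A" "{x. c x \<noteq> \<zero>\<^bsub>R\<^esub>} \<subseteq> A" "A \<subseteq> V"
  shows "fsum R G g c = (\<Oplus>\<^bsub>G\<^esub> x \<in> A. g x (c x))"
  unfolding fsum_def
proof (rule G.add.finprod_mono_neutral_cong_left[OF A(1,2)])
  show "\<And>i. i \<in> A - {x. c x \<noteq> \<zero>\<^bsub>R\<^esub>} \<Longrightarrow> g i (c i) = \<zero>\<^bsub>G\<^esub>" using g_zero A by auto
  show "(\<lambda>x. g x (c x)) \<in> A \<rightarrow> carrier G" using g_closed A fin_suppD[OF c] by auto
qed auto

lemma fsum_closed: "c \<in> fin_supp R V \<Longrightarrow> fsum R G g c \<in> carrier G"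
  unfolding fsum_def by (rule G.finsum_closed) (auto intro!: g_closed dest: fin_suppD(1,3))

lemma fsum_zero: "fsum R G g (\<lambda>x. \<zero>\<^bsub>R\<^esub>) = \<zero>\<^bsub>G\<^esub>"
  unfolding fsum_def by simp

lemma fsum_single:
  assumes "x \<in> V" "r \<in> carrier R"
  shows "fsum R G g (single R x r) = g x r"
proof -
  have "fsum R G g (single R x r) = (\<Oplus>\<^bsub>G\<^esub> y \<in> {x}. g y (single R x r y))"
    by (rule fsum_superset[OF R.fin_supp_single[OF assms]]) (use assms in \<open>auto simp: single_def\<close>)
  also have "\<dots> = g x r"
    using assms g_closed by (simp add: single_def)
  finally show ?thesis .
qed

lemma fsum_add:
  assumes c: "c \<in> fin_supp R V" and d: "d \<in> fin_supp R V"
  shows "fsum R G g (\<lambda>x. c x \<oplus>\<^bsub>R\<^esub> d x) = fsum R G g c \<oplus>\<^bsub>G\<^esub> fsum R G g d"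
proof -
  let ?A = "{x. c x \<noteq> \<zero>\<^bsub>R\<^esub>} \<union> {x. d x \<noteq> \<zero>\<^bsub>R\<^esub>}"
  have A: "finite ?A" "?A \<subseteq> V" using fin_suppD[OF c] fin_suppD[OF d] by auto
  have gc: "(\<lambda>x. g x (c x)) \<in> ?A \<rightarrow> carrier G" "(\<lambda>x. g x (d x)) \<in> ?A \<rightarrow> carrier G"
    using g_closed A(2) fin_suppD(1)[OF c] fin_suppD(1)[OF d] by blast+
  have "fsum R G g (\<lambda>x. c x \<oplus>\<^bsub>R\<^esub> d x) = (\<Oplus>\<^bsub>G\<^esub> x \<in> ?A. g x (c x \<oplus>\<^bsub>R\<^esub> d x))"
    by (rule fsum_superset[OF R.fin_supp_add[OF c d] A(1) _ A(2)]) auto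
  also have "\<dots> = (\<Oplus>\<^bsub>G\<^esub> x \<in> ?A. g x (c x) \<oplus>\<^bsub>G\<^esub> g x (d x))"
    by (rule G.finsum_cong')
       (use gc A(2) fin_suppD(1)[OF c] fin_suppD(1)[OF d] in \<open>auto intro!: g_add\<close>)
  also have "\<dots> = (\<Oplus>\<^bsub>G\<^esub> x \<in> ?A. g x (c x)) \<oplus>\<^bsub>G\<^esub> (\<Oplus>\<^bsub>G\<^esub> x \<in> ?A. g x (d x))"
    by (rule G.finsum_addf[OF gc])
  also have "\<dots> = fsum R G g c \<oplus>\<^bsub>G\<^esub> fsum R G g d"
    using fsum_superset[OF c A(1) _ A(2)] fsum_superset[OF d A(1) _ A(2)] by simp
  finally show ?thesis .
qed

end

locale push_forward_data = R: abelian_group R + R1: abelian_group R1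
  for R :: "('r, 'q) ring_scheme" and R1 :: "('r1, 'q1) ring_scheme" +
  fixes V :: "'x set" and W :: "'y set" and \<phi> :: "'r \<Rightarrow> 'r1" and f :: "'x \<Rightarrow> 'y"
  assumes phi_closed: "r \<in> carrier R \<Longrightarrow> \<phi> r \<in> carrier R1"
    and phi_add: "\<lbrakk>r \<in> carrier R; s \<in> carrier R\<rbrakk> \<Longrightarrow> \<phi> (r \<oplus>\<^bsub>R\<^esub> s) = \<phi> r \<oplus>\<^bsub>R1\<^esub> \<phi> s"
    and f_closed: "x \<in> V \<Longrightarrow> f x \<in> W"
begin

lemma fiber: "additive_family R R1 V (\<lambda>x r. if f x = y then \<phi> r else \<zero>\<^bsub>R1\<^esub>)"
  by unfold_locales (use phi_closed phi_add in auto)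

lemma push_forward_eq_fsum:
  assumes c: "c \<in> fin_supp R V"
  shows "push_forward R R1 \<phi> f c y = fsum R R1 (\<lambda>x r. if f x = y then \<phi> r else \<zero>\<^bsub>R1\<^esub>) c"
  unfolding push_forward_def fsum_def
  by (rule R1.add.finprod_mono_neutral_cong_left)
     (use fin_suppD[OF c] phi_closed in auto)

lemma push_forward_zero: "push_forward R R1 \<phi> f (\<lambda>x. \<zero>\<^bsub>R\<^esub>) = (\<lambda>y. \<zero>\<^bsub>R1\<^esub>)"
  by (simp add: push_forward_def)

lemma push_forward_single:
  assumes "x \<in> V" "r \<in> carrier R"
  shows "push_forward R R1 \<phi> f (single R x r) = single R1 (f x) (\<phi> r)"
  using push_forward_eq_fsum[OF R.fin_supp_single[OF assms]] additive_family.fsum_single[OF fiber assms]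
  by (auto simp: single_def)

lemma push_forward_add:
  assumes "c \<in> fin_supp R V" "d \<in> fin_supp R V"
  shows "push_forward R R1 \<phi> f (\<lambda>x. c x \<oplus>\<^bsub>R\<^esub> d x) =
    (\<lambda>y. push_forward R R1 \<phi> f c y \<oplus>\<^bsub>R1\<^esub> push_forward R R1 \<phi> f d y)"
  using push_forward_eq_fsum assms R.fin_supp_add[OF assms] additive_family.fsum_add[OF fiber assms]
  by auto

lemma push_forward_closed:
  assumes "c \<in> fin_supp R V"
  shows "push_forward R R1 \<phi> f c \<in> fin_supp R1 W"
  using assms
proof (induction rule: R.fin_supp_induct)
  case zero
  then show ?case by (simp add: push_forward_zero R1.fin_supp_zero)
next
  case (add x r c)
  then show ?case
    by (simp add: push_forward_add R.fin_supp_single push_forward_single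
        R1.fin_supp_add R1.fin_supp_single f_closed phi_closed)
qed

end

section \<open>Polynomial algebras\<close>

text \<open>The coefficient of a product of polynomials at \<open>m\<close> is a sum over the factorizations of the
  monomial \<open>m\<close>, which must be a finite set.\<close>

lemma finite_submultisets: "finite {a. a \<subseteq># (m::'x multiset)}"
proof (induction m)
  case empty
  then show ?case by simp
next
  case (add x m)
  have "{a. a \<subseteq># add_mset x m} \<subseteq> {a. a \<subseteq># m} \<union> add_mset x ` {a. a \<subseteq># m}"
  proof
    fix a assume a: "a \<in> {a. a \<subseteq># add_mset x m}"
    show "a \<in> {a. a \<subseteq># m} \<union> add_mset x ` {a. a \<subseteq># m}"
    proof (cases "x \<in># a")
      case True
      then obtain b where "a = add_mset x b" by (metis mset_add)
      then show ?thesis using a by auto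
    next
      case False
      have "count a t \<le> count m t" for t
        using a False by (cases "t = x") (auto simp: subseteq_mset_def not_in_iff dest: spec[of _ t])
      then have "a \<subseteq># m" by (simp add: subseteq_mset_def)
      then show ?thesis by blast
    qed
  qed
  then show ?case using add finite_subset by blast
qed

definition mprod :: "('t, 'w) ring_scheme \<Rightarrow> ('x \<Rightarrow> 't) \<Rightarrow> 'x multiset \<Rightarrow> 't" where
  "mprod T f m = (\<Otimes>\<^bsub>T\<^esub> t \<in> set_mset m. f t [^]\<^bsub>T\<^esub> count m t)"

definition poly_eval ::
  "('r, 'q) ring_scheme \<Rightarrow> ('t, 'w) ring_scheme \<Rightarrow> ('r \<Rightarrow> 't) \<Rightarrow> ('x \<Rightarrow> 't) \<Rightarrow> ('r, 'x) mpoly \<Rightarrow> 't"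
where
  "poly_eval R T h f = fsum R T (\<lambda>m r. h r \<otimes>\<^bsub>T\<^esub> mprod T f m)"

lemma poly_counit_eq_poly_eval: "poly_counit R T h = poly_eval R T h (\<lambda>t. t)"
  by (simp add: poly_counit_def poly_eval_def fsum_def mprod_def fun_eq_iff)

context cring
begin

lemma mprod_empty: "mprod R f {#} = \<one>"
  by (simp add: mprod_def)

lemma mprod_closed: "(\<And>x. x \<in># m \<Longrightarrow> f x \<in> carrier R) \<Longrightarrow> mprod R f m \<in> carrier R"
  unfolding mprod_def by (rule finprod_closed) auto

lemma mprod_add_mset:
  assumes "\<And>x. x \<in># add_mset y m \<Longrightarrow> f x \<in> carrier R"
  shows "mprod R f (add_mset y m) = f y \<otimes> mprod R f m"
proof -
  have fy: "f y \<in> carrier R" and fm: "\<And>x. x \<in># m \<Longrightarrow> f x \<in> carrier R" using assms by auto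
  let ?S = "set_mset m - {y}"
  have *: "(\<Otimes>t \<in> ?S. f t [^] count (add_mset y m) t) = (\<Otimes>t \<in> ?S. f t [^] count m t)"
    by (rule finprod_cong') (use fm in auto)
  have cl: "(\<Otimes>t \<in> ?S. f t [^] count m t) \<in> carrier R"
    by (rule finprod_closed) (use fm in auto)
  have l: "mprod R f (add_mset y m) = f y [^] count (add_mset y m) y \<otimes> (\<Otimes>t \<in> ?S. f t [^] count m t)"
  proof -
    have "set_mset (add_mset y m) = insert y ?S" by auto
    then have "mprod R f (add_mset y m) = (\<Otimes>t \<in> insert y ?S. f t [^] count (add_mset y m) t)"
      unfolding mprod_def by metis
    also have "\<dots> = f y [^] count (add_mset y m) y \<otimes> (\<Otimes>t \<in> ?S. f t [^] count (add_mset y m) t)"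
      by (rule finprod_insert) (use fm fy in auto)
    finally show ?thesis using * by simp
  qed
  have r: "mprod R f m = f y [^] count m y \<otimes> (\<Otimes>t \<in> ?S. f t [^] count m t)"
  proof (cases "y \<in># m")
    case True
    then have "set_mset m = insert y ?S" by auto
    then have "mprod R f m = (\<Otimes>t \<in> insert y ?S. f t [^] count m t)"
      unfolding mprod_def by metis
    also have "\<dots> = f y [^] count m y \<otimes> (\<Otimes>t \<in> ?S. f t [^] count m t)"
      by (rule finprod_insert) (use fm fy in auto)
    finally show ?thesis .
  next
    case False
    then show ?thesis using cl by (simp add: mprod_def not_in_iff)
  qed
  show ?thesis unfolding l r using fy cl
    by (simp add: m_assoc m_lcomm)
qed

lemma mprod_union:
  assumes "\<And>x. x \<in># m + n \<Longrightarrow> f x \<in> carrier R"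
  shows "mprod R f (m + n) = mprod R f m \<otimes> mprod R f n"
  using assms
proof (induction m)
  case empty
  then show ?case by (simp add: mprod_empty mprod_closed)
next
  case (add x m)
  have 1: "mprod R f (add_mset x (m + n)) = f x \<otimes> mprod R f (m + n)"
    by (rule mprod_add_mset) (use add.prems in auto)
  have 2: "mprod R f (add_mset x m) = f x \<otimes> mprod R f m"
    by (rule mprod_add_mset) (use add.prems in auto)
  show ?case using add 1 2 by (simp add: mprod_closed m_assoc)
qed

end

abbreviation mons :: "'x set \<Rightarrow> 'x multiset set" where
  "mons V \<equiv> {m. set_mset m \<subseteq> V}"

context cring
begin

lemma poly_alg_simps:
  "carrier (poly_alg R V) = fin_supp R (mons V)"
  "\<zero>\<^bsub>poly_alg R V\<^esub> = (\<lambda>m. \<zero>)"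
  "\<one>\<^bsub>poly_alg R V\<^esub> = single R {#} \<one>"
  "p \<oplus>\<^bsub>poly_alg R V\<^esub> q = (\<lambda>m. p m \<oplus> q m)"
  by (simp_all add: poly_alg_def free_gen_eq_single)

lemma poly_mult: "(p \<otimes>\<^bsub>poly_alg R V\<^esub> q) = (\<lambda>m. \<Oplus>a \<in> {a. a \<subseteq># m}. p a \<otimes> q (m - a))"
  by (simp add: poly_alg_def)

lemma poly_mult_l_distr:
  assumes "\<And>m. p m \<in> carrier R" "\<And>m. p' m \<in> carrier R" "\<And>m. q m \<in> carrier R"
  shows "(\<lambda>m. p m \<oplus> p' m) \<otimes>\<^bsub>poly_alg R V\<^esub> q
    = (\<lambda>m. (p \<otimes>\<^bsub>poly_alg R V\<^esub> q) m \<oplus> (p' \<otimes>\<^bsub>poly_alg R V\<^esub> q) m)"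
  using assms by (auto simp: poly_mult l_distr finsum_addf fun_eq_iff Pi_def cong: finsum_cong)

lemma poly_mult_r_distr:
  assumes "\<And>m. p m \<in> carrier R" "\<And>m. p' m \<in> carrier R" "\<And>m. q m \<in> carrier R"
  shows "q \<otimes>\<^bsub>poly_alg R V\<^esub> (\<lambda>m. p m \<oplus> p' m)
    = (\<lambda>m. (q \<otimes>\<^bsub>poly_alg R V\<^esub> p) m \<oplus> (q \<otimes>\<^bsub>poly_alg R V\<^esub> p') m)"
  using assms by (auto simp: poly_mult r_distr finsum_addf fun_eq_iff Pi_def cong: finsum_cong)

lemma poly_mult_zero:
  assumes "\<And>m. q m \<in> carrier R"
  shows "(\<lambda>m. \<zero>) \<otimes>\<^bsub>poly_alg R V\<^esub> q = (\<lambda>m. \<zero>)" "q \<otimes>\<^bsub>poly_alg R V\<^esub> (\<lambda>m. \<zero>) = (\<lambda>m. \<zero>)"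
  using assms by (auto simp: poly_mult fun_eq_iff cong: finsum_cong)

lemma poly_mult_single:
  assumes "r \<in> carrier R" "s \<in> carrier R"
  shows "single R m r \<otimes>\<^bsub>poly_alg R V\<^esub> single R n s = single R (m + n) (r \<otimes> s)"
proof
  fix k
  have "(single R m r \<otimes>\<^bsub>poly_alg R V\<^esub> single R n s) k
      = (\<Oplus>a \<in> {a. a \<subseteq># k}. if m = a then (if k = m + n then r \<otimes> s else \<zero>) else \<zero>)"
    unfolding poly_mult
    by (rule finsum_cong') (use assms in \<open>auto simp: single_def\<close>)
  also have "\<dots> = single R (m + n) (r \<otimes> s) k"
  proof (cases "m \<subseteq># k")
    case True
    then show ?thesis
      using finsum_singleton[of m "{a. a \<subseteq># k}" "\<lambda>a. if k = m + n then r \<otimes> s else \<zero>"] assms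
      by (auto simp: finite_submultisets single_def)
  next
    case False
    have "(\<Oplus>a \<in> {a. a \<subseteq># k}. if m = a then (if k = m + n then r \<otimes> s else \<zero>) else \<zero>) = (\<Oplus>a \<in> {a. a \<subseteq># k}. \<zero>)"
      by (rule finsum_cong') (use False in auto)
    then show ?thesis using False by (auto simp: single_def)
  qed
  finally show "(single R m r \<otimes>\<^bsub>poly_alg R V\<^esub> single R n s) k = single R (m + n) (r \<otimes> s) k" .
qed

text \<open>The ring axioms of \<open>poly_alg\<close> are additive in each variable and so reduce, by \<open>fin_supp_induct\<close>,
  to single terms, where they become identities for sums of multisets and products of coefficients.\<close>

lemma single_closed: "r \<in> carrier R \<Longrightarrow> single R x r y \<in> carrier R"
  by (simp add: single_def)

lemma poly_mult_closed_single:
  assumes "m \<in> mons V" "r \<in> carrier R" "q \<in> fin_supp R (mons V)"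
  shows "single R m r \<otimes>\<^bsub>poly_alg R V\<^esub> q \<in> fin_supp R (mons V)"
  using assms(3)
proof (induction rule: fin_supp_induct)
  case zero
  then show ?case using assms by (simp add: poly_mult_zero single_closed fin_supp_zero)
next
  case (add n s q)
  then show ?case
    using assms fin_suppD(1)[OF \<open>q \<in> _\<close>]
    by (simp add: poly_mult_r_distr poly_mult_single single_closed fin_supp_add fin_supp_single)
qed

lemma poly_mult_closed:
  assumes "p \<in> fin_supp R (mons V)" "q \<in> fin_supp R (mons V)"
  shows "p \<otimes>\<^bsub>poly_alg R V\<^esub> q \<in> fin_supp R (mons V)"
  using assms(1)
proof (induction rule: fin_supp_induct)
  case zero
  then show ?case using fin_suppD(1)[OF assms(2)] fin_supp_zero by (simp add: poly_mult_zero)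
next
  case (add n s p)
  then show ?case
    using assms fin_suppD(1)[OF \<open>p \<in> _\<close>] fin_suppD(1)[OF assms(2)]
    by (simp add: poly_mult_l_distr single_closed fin_supp_add poly_mult_closed_single)
qed

lemmas poly_distr_simps = poly_mult_l_distr poly_mult_r_distr poly_mult_zero
  poly_mult_single single_closed

lemma poly_mult_comm:
  assumes p: "p \<in> fin_supp R (mons V)" and q: "q \<in> fin_supp R (mons V)"
  shows "p \<otimes>\<^bsub>poly_alg R V\<^esub> q = q \<otimes>\<^bsub>poly_alg R V\<^esub> p"
  using p
proof (induction rule: fin_supp_induct)
  case zero
  then show ?case using fin_suppD(1)[OF q] by (simp add: poly_mult_zero)
next
  case (add m r p)
  have "single R m r \<otimes>\<^bsub>poly_alg R V\<^esub> q = q \<otimes>\<^bsub>poly_alg R V\<^esub> single R m r"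
    using q
  proof (induction rule: fin_supp_induct)
    case zero
    then show ?case using add by (simp add: poly_distr_simps)
  next
    case (add n s q)
    then show ?case using \<open>r \<in> carrier R\<close> fin_suppD(1)[OF \<open>q \<in> _\<close>]
      by (simp add: poly_distr_simps m_comm add.commute)
  qed
  then show ?case using add fin_suppD(1)[OF q] fin_suppD(1)[OF \<open>p \<in> _\<close>]
    by (simp add: poly_distr_simps)
qed

lemma poly_mult_assoc:
  assumes p: "p \<in> fin_supp R (mons V)" and q: "q \<in> fin_supp R (mons V)" and l: "l \<in> fin_supp R (mons V)"
  shows "(p \<otimes>\<^bsub>poly_alg R V\<^esub> q) \<otimes>\<^bsub>poly_alg R V\<^esub> l = p \<otimes>\<^bsub>poly_alg R V\<^esub> (q \<otimes>\<^bsub>poly_alg R V\<^esub> l)"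
  using p
proof (induction rule: fin_supp_induct)
  case zero
  then show ?case using fin_suppD(1)[OF q] fin_suppD(1)[OF l] fin_suppD(1)[OF poly_mult_closed[OF q l]]
    by (simp add: poly_mult_zero)
next
  case (add m r p)
  note r = \<open>r \<in> carrier R\<close> and m = \<open>m \<in> mons V\<close>
  have "(single R m r \<otimes>\<^bsub>poly_alg R V\<^esub> q) \<otimes>\<^bsub>poly_alg R V\<^esub> l = single R m r \<otimes>\<^bsub>poly_alg R V\<^esub> (q \<otimes>\<^bsub>poly_alg R V\<^esub> l)"
    using q
  proof (induction rule: fin_supp_induct)
    case zero
    then show ?case using r fin_suppD(1)[OF l] by (simp add: poly_distr_simps)
  next
    case (add n s q)
    note s = \<open>s \<in> carrier R\<close> and n = \<open>n \<in> mons V\<close>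
    have "(single R m r \<otimes>\<^bsub>poly_alg R V\<^esub> single R n s) \<otimes>\<^bsub>poly_alg R V\<^esub> l
        = single R m r \<otimes>\<^bsub>poly_alg R V\<^esub> (single R n s \<otimes>\<^bsub>poly_alg R V\<^esub> l)"
      using l
    proof (induction rule: fin_supp_induct)
      case zero
      then show ?case using r s by (simp add: poly_distr_simps)
    next
      case (add k t l)
      then show ?case
        using r s fin_suppD(1)[OF poly_mult_closed_single[OF n s \<open>l \<in> _\<close>]] fin_suppD(1)[OF \<open>l \<in> _\<close>]
        by (simp add: poly_distr_simps m_assoc add.assoc)
    qed
    then show ?case
      using r s add fin_suppD(1)[OF \<open>q \<in> _\<close>] fin_suppD(1)[OF l]
        fin_suppD(1)[OF poly_mult_closed_single[OF n s l]]
        fin_suppD(1)[OF poly_mult_closed_single[OF m r \<open>q \<in> _\<close>]]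
        fin_suppD(1)[OF poly_mult_closed[OF \<open>q \<in> _\<close> l]]
      by (simp add: poly_distr_simps)
  qed
  then show ?case
    using r add fin_suppD(1)[OF \<open>p \<in> _\<close>] fin_suppD(1)[OF q] fin_suppD(1)[OF l]
      fin_suppD(1)[OF poly_mult_closed_single[OF m r q]]
      fin_suppD(1)[OF poly_mult_closed[OF \<open>p \<in> _\<close> q]]
      fin_suppD(1)[OF poly_mult_closed[OF q l]]
    by (simp add: poly_distr_simps)
qed

lemma poly_one_mult:
  assumes p: "p \<in> fin_supp R (mons V)"
  shows "single R {#} \<one> \<otimes>\<^bsub>poly_alg R V\<^esub> p = p"
  using p
proof (induction rule: fin_supp_induct)
  case zero
  then show ?case by (simp add: poly_distr_simps)
next
  case (add m r p)
  then show ?case using fin_suppD(1)[OF \<open>p \<in> _\<close>] by (simp add: poly_distr_simps)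
qed

lemma fin_supp_neg:
  assumes "p \<in> fin_supp R V"
  shows "(\<lambda>m. \<ominus> p m) \<in> fin_supp R V"
  by (rule fin_suppI[where A="{x. p x \<noteq> \<zero>}"]) (use fin_suppD[OF assms] in auto)

lemma fin_supp_abelian_group:
  assumes "carrier F = fin_supp R V" "\<zero>\<^bsub>F\<^esub> = (\<lambda>x. \<zero>)" "\<And>c d. c \<oplus>\<^bsub>F\<^esub> d = (\<lambda>x. c x \<oplus> d x)"
  shows "abelian_group F"
proof (rule abelian_groupI, unfold assms)
  fix x y z assume "x \<in> fin_supp R V" "y \<in> fin_supp R V" "z \<in> fin_supp R V"
  then show "(\<lambda>m. x m \<oplus> y m \<oplus> z m) = (\<lambda>m. x m \<oplus> (y m \<oplus> z m))"
    by (simp add: a_assoc fin_suppD(1)[of _ R V])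
next
  fix x y assume "x \<in> fin_supp R V" "y \<in> fin_supp R V"
  then show "(\<lambda>m. x m \<oplus> y m) = (\<lambda>m. y m \<oplus> x m)"
    by (simp add: a_comm fin_suppD(1)[of _ R V])
next
  fix x assume x: "x \<in> fin_supp R V"
  then show "(\<lambda>m. \<zero> \<oplus> x m) = x" by (simp add: fin_suppD(1)[of _ R V])
  show "\<exists>y\<in>fin_supp R V. (\<lambda>m. y m \<oplus> x m) = (\<lambda>m. \<zero>)"
    by (rule bexI[OF _ fin_supp_neg[OF x]]) (simp add: l_neg fin_suppD(1)[OF x])
qed (auto intro: fin_supp_add fin_supp_zero)

lemma poly_alg_cring: "cring (poly_alg R V)"
proof (rule cringI)
  show "abelian_group (poly_alg R V)"
    by (rule fin_supp_abelian_group) (simp_all add: poly_alg_simps)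
  show "comm_monoid (poly_alg R V)"
    by (rule comm_monoidI)
       (auto simp: poly_alg_simps poly_mult_closed poly_mult_assoc poly_one_mult
             intro: poly_mult_comm fin_supp_single)
next
  fix x y z assume "x \<in> carrier (poly_alg R V)" "y \<in> carrier (poly_alg R V)" "z \<in> carrier (poly_alg R V)"
  then show "(x \<oplus>\<^bsub>poly_alg R V\<^esub> y) \<otimes>\<^bsub>poly_alg R V\<^esub> z
    = x \<otimes>\<^bsub>poly_alg R V\<^esub> z \<oplus>\<^bsub>poly_alg R V\<^esub> y \<otimes>\<^bsub>poly_alg R V\<^esub> z"
    by (simp add: poly_alg_simps poly_mult_l_distr fin_suppD(1))
qed

lemma single_add: "\<lbrakk>r \<in> carrier R; s \<in> carrier R\<rbrakk> \<Longrightarrow> single R x (r \<oplus> s) = (\<lambda>y. single R x r y \<oplus> single R x s y)"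
  by (auto simp: single_def)

lemma poly_const_hom: "poly_const R \<in> ring_hom R (poly_alg R V)"
  by (rule ring_hom_memI)
     (simp_all add: poly_const_eq_single poly_alg_simps poly_mult_single fin_supp_single single_add)

lemma poly_var_closed: "x \<in> V \<Longrightarrow> free_gen R {#x#} \<in> carrier (poly_alg R V)"
  by (simp add: free_gen_eq_single poly_alg_simps fin_supp_single)

text \<open>A term is obtained from a constant by multiplying with variables one at a time; this is why
  constants and variables determine a ring homomorphism.\<close>

lemma single_add_mset:
  assumes "r \<in> carrier R"
  shows "single R (add_mset x m) r = free_gen R {#x#} \<otimes>\<^bsub>poly_alg R V\<^esub> single R m r"
  using assms by (simp add: free_gen_eq_single poly_mult_single)

lemma poly_hom_ext:
  assumes T: "cring T" and \<phi>: "\<phi> \<in> ring_hom (poly_alg R V) T" and \<psi>: "\<psi> \<in> ring_hom (poly_alg R V) T"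
    and const: "\<And>r. r \<in> carrier R \<Longrightarrow> \<phi> (poly_const R r) = \<psi> (poly_const R r)"
    and var: "\<And>x. x \<in> V \<Longrightarrow> \<phi> (free_gen R {#x#}) = \<psi> (free_gen R {#x#})"
    and p: "p \<in> carrier (poly_alg R V)"
  shows "\<phi> p = \<psi> p"
proof -
  interpret P: cring "poly_alg R V" by (rule poly_alg_cring)
  interpret T: cring T by (rule T)
  have mon: "\<phi> (single R m r) = \<psi> (single R m r)" if "set_mset m \<subseteq> V" "r \<in> carrier R" for m r
    using that(1)
  proof (induction m)
    case empty
    then show ?case using const[OF that(2)] by (simp add: poly_const_eq_single)
  next
    case (add x m)
    then show ?case
      using var[of x] poly_var_closed[of x V] fin_supp_single[of m "mons V" r] that(2)
        ring_hom_mult[OF \<phi>, of "free_gen R {#x#}" "single R m r"]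
        ring_hom_mult[OF \<psi>, of "free_gen R {#x#}" "single R m r"]
      by (simp add: single_add_mset[of r x m V] poly_alg_simps)
  qed
  show ?thesis
    using p unfolding poly_alg_simps
  proof (induction rule: fin_supp_induct)
    case zero
    have "\<phi> \<zero>\<^bsub>poly_alg R V\<^esub> = \<psi> \<zero>\<^bsub>poly_alg R V\<^esub>"
      using ring_hom_zero[OF \<phi> P.ring_axioms T.ring_axioms] ring_hom_zero[OF \<psi> P.ring_axioms T.ring_axioms]
      by simp
    then show ?case by (simp add: poly_alg_simps)
  next
    case (add m r c)
    have "single R m r \<in> carrier (poly_alg R V)" "c \<in> carrier (poly_alg R V)"
      using add by (simp_all add: poly_alg_simps fin_supp_single)
    from ring_hom_add[OF \<phi> this] ring_hom_add[OF \<psi> this] show ?case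
      using add mon[of m r] by (simp add: poly_alg_simps)
  qed
qed

lemma poly_homI:
  assumes T: "cring T"
    and zero: "\<Phi> (\<lambda>m. \<zero>) = \<zero>\<^bsub>T\<^esub>"
    and add: "\<And>p q. \<lbrakk>p \<in> fin_supp R (mons V); q \<in> fin_supp R (mons V)\<rbrakk>
      \<Longrightarrow> \<Phi> (\<lambda>m. p m \<oplus> q m) = \<Phi> p \<oplus>\<^bsub>T\<^esub> \<Phi> q"
    and closed: "\<And>p. p \<in> fin_supp R (mons V) \<Longrightarrow> \<Phi> p \<in> carrier T"
    and mult: "\<And>m n r s. \<lbrakk>set_mset m \<subseteq> V; set_mset n \<subseteq> V; r \<in> carrier R; s \<in> carrier R\<rbrakk>
      \<Longrightarrow> \<Phi> (single R (m + n) (r \<otimes> s)) = \<Phi> (single R m r) \<otimes>\<^bsub>T\<^esub> \<Phi> (single R n s)"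
    and one: "\<Phi> (single R {#} \<one>) = \<one>\<^bsub>T\<^esub>"
  shows "\<Phi> \<in> ring_hom (poly_alg R V) T"
proof (rule ring_hom_memI)
  interpret T: cring T by (rule T)
  have mon: "\<Phi> (single R m r \<otimes>\<^bsub>poly_alg R V\<^esub> q) = \<Phi> (single R m r) \<otimes>\<^bsub>T\<^esub> \<Phi> q"
    if m: "m \<in> mons V" and r: "r \<in> carrier R" and q: "q \<in> fin_supp R (mons V)" for m r q
    using q
  proof (induction rule: fin_supp_induct)
    case zero
    then show ?case using r m
      by (simp add: poly_mult_zero single_closed assms fin_supp_single)
  next
    case (add n s q)
    then show ?case
      using r m fin_suppD(1)[OF add(3)] mult[of m n r s] poly_mult_closed_single[OF m r add(3)]
      by (simp add: poly_mult_r_distr single_closed poly_mult_single assms(3) fin_supp_single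
          closed T.r_distr)
  qed
  show "\<Phi> (p \<otimes>\<^bsub>poly_alg R V\<^esub> q) = \<Phi> p \<otimes>\<^bsub>T\<^esub> \<Phi> q"
    if "p \<in> carrier (poly_alg R V)" "q \<in> carrier (poly_alg R V)" for p q
  proof -
    have q: "q \<in> fin_supp R (mons V)" using that by (simp add: poly_alg_simps)
    show ?thesis
      using that(1) unfolding poly_alg_simps
    proof (induction rule: fin_supp_induct)
      case zero
      then show ?case using fin_suppD(1)[OF q] closed[OF q]
        by (simp add: poly_mult_zero assms(2))
    next
      case (add n s p)
      then show ?case
        using fin_suppD(1)[OF add(3)] fin_suppD(1)[OF q] mon[OF add(1,2) q] q
          poly_mult_closed_single[OF add(1,2) q] poly_mult_closed[OF add(3) q]
        by (simp add: poly_mult_l_distr single_closed assms(3) fin_supp_single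
            closed T.l_distr)
    qed
  qed
qed (use assms in \<open>simp_all add: poly_alg_simps\<close>)

lemma poly_eval_family:
  assumes T: "cring T" and h: "h \<in> ring_hom R T" and f: "f \<in> V \<rightarrow> carrier T"
  shows "additive_family R T (mons V) (\<lambda>m r. h r \<otimes>\<^bsub>T\<^esub> mprod T f m)"
proof -
  interpret T: cring T by (rule T)
  have "mprod T f m \<in> carrier T" if "m \<in> mons V" for m
    by (rule T.mprod_closed) (use that f in auto)
  then show ?thesis
    by unfold_locales (use h in \<open>simp_all add: ring_hom_closed ring_hom_add T.l_distr\<close>)
qed

lemma poly_eval_hom:
  assumes T: "cring T" and h: "h \<in> ring_hom R T" and f: "f \<in> V \<rightarrow> carrier T"
  shows "poly_eval R T h f \<in> ring_hom (poly_alg R V) T"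
proof -
  interpret T: cring T by (rule T)
  interpret F: additive_family R T "mons V" "\<lambda>m r. h r \<otimes>\<^bsub>T\<^esub> mprod T f m"
    by (rule poly_eval_family[OF assms])
  have cl: "mprod T f m \<in> carrier T" if "set_mset m \<subseteq> V" for m
    by (rule T.mprod_closed) (use that f in auto)
  show ?thesis
  proof (rule poly_homI[OF T], goal_cases)
    case (4 m n r s)
    have "mprod T f (m + n) = mprod T f m \<otimes>\<^bsub>T\<^esub> mprod T f n"
      by (rule T.mprod_union) (use 4 f in auto)
    then show ?case
      using 4 cl[of m] cl[of n] h
      by (simp add: poly_eval_def F.fsum_single ring_hom_mult ring_hom_closed T.m_ac)
  qed (use h in \<open>simp_all add: poly_eval_def F.fsum_zero F.fsum_add F.fsum_closed F.fsum_single
         T.mprod_empty ring_hom_one\<close>)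
qed

lemma poly_eval_const:
  assumes T: "cring T" and h: "h \<in> ring_hom R T" and f: "f \<in> V \<rightarrow> carrier T" and r: "r \<in> carrier R"
  shows "poly_eval R T h f (poly_const R r) = h r"
proof -
  interpret T: cring T by (rule T)
  show ?thesis
    using additive_family.fsum_single[OF poly_eval_family[OF T h f], of "{#}" r] r h
    by (simp add: poly_eval_def poly_const_eq_single T.mprod_empty ring_hom_closed)
qed

lemma poly_eval_var:
  assumes T: "cring T" and h: "h \<in> ring_hom R T" and f: "f \<in> V \<rightarrow> carrier T" and x: "x \<in> V"
  shows "poly_eval R T h f (free_gen R {#x#}) = f x"
proof -
  interpret T: cring T by (rule T)
  have "mprod T f {#x#} = f x"
    using T.mprod_add_mset[of x "{#}" f] T.mprod_empty[of f] x f by auto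
  then show ?thesis
    using additive_family.fsum_single[OF poly_eval_family[OF T h f], of "{#x#}" \<one>] x h f
    by (auto simp: poly_eval_def free_gen_eq_single ring_hom_one dest: funcset_mem)
qed

end

lemma push_forward_data_mset:
  assumes "cring R" "cring R1" and \<phi>: "\<phi> \<in> ring_hom R R1" and f: "f \<in> V \<rightarrow> W"
  shows "push_forward_data R R1 (mons V) (mons W) \<phi> (image_mset f)"
proof -
  interpret R: cring R by fact
  interpret R1: cring R1 by fact
  show ?thesis
    by unfold_locales (use \<phi> f in \<open>auto simp: ring_hom_closed ring_hom_add\<close>)
qed

lemma poly_map_hom:
  assumes R: "cring R" and R1: "cring R1" and \<phi>: "\<phi> \<in> ring_hom R R1" and f: "f \<in> V \<rightarrow> W"
  shows "poly_map R R1 \<phi> f \<in> ring_hom (poly_alg R V) (poly_alg R1 W)"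
proof -
  interpret R: cring R by fact
  interpret R1: cring R1 by fact
  interpret F: push_forward_data R R1 "mons V" "mons W" \<phi> "image_mset f"
    by (rule push_forward_data_mset[OF assms])
  show ?thesis
    by (rule R.poly_homI[OF R1.poly_alg_cring])
       (use \<phi> in \<open>simp_all add: poly_map_def R1.poly_alg_simps F.push_forward_zero F.push_forward_add
         F.push_forward_closed F.push_forward_single R1.poly_mult_single ring_hom_closed ring_hom_mult ring_hom_one\<close>)
qed

lemma poly_map_const:
  assumes R: "cring R" and R1: "cring R1" and \<phi>: "\<phi> \<in> ring_hom R R1" and r: "r \<in> carrier R"
  shows "poly_map R R1 \<phi> f (poly_const R r) = poly_const R1 (\<phi> r)"
proof -
  interpret F: push_forward_data R R1 "mons UNIV" "mons UNIV" \<phi> "image_mset f"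
    by (rule push_forward_data_mset[OF R R1 \<phi>]) simp
  show ?thesis using r by (simp add: poly_map_def poly_const_eq_single F.push_forward_single)
qed

lemma poly_map_var:
  assumes R: "cring R" and R1: "cring R1" and \<phi>: "\<phi> \<in> ring_hom R R1"
  shows "poly_map R R1 \<phi> f (free_gen R {#x#}) = free_gen R1 {#f x#}"
proof -
  interpret R: cring R by fact
  interpret F: push_forward_data R R1 "mons UNIV" "mons UNIV" \<phi> "image_mset f"
    by (rule push_forward_data_mset[OF R R1 \<phi>]) simp
  show ?thesis using \<phi> by (simp add: poly_map_def free_gen_eq_single F.push_forward_single ring_hom_one)
qed

section \<open>Semilinear maps, free modules and quotient modules\<close>

text \<open>Allowing a change of rings \<open>\<phi>\<close> treats at once linear maps, the universal map \<open>N \<rightarrow> N \<otimes> S\<close> and the maps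
  of Kaehler differentials induced by ring maps.\<close>

definition semilinear ::
  "('r, 'q) ring_scheme \<Rightarrow> ('r \<Rightarrow> 's) \<Rightarrow> ('r, 'x) module \<Rightarrow> ('s, 'y) module \<Rightarrow> ('x \<Rightarrow> 'y) \<Rightarrow> bool"
where
  "semilinear R \<phi> N M g \<longleftrightarrow>
    (\<forall>x\<in>carrier N. g x \<in> carrier M) \<and>
    (\<forall>x\<in>carrier N. \<forall>y\<in>carrier N. g (x \<oplus>\<^bsub>N\<^esub> y) = g x \<oplus>\<^bsub>M\<^esub> g y) \<and>
    (\<forall>a\<in>carrier R. \<forall>x\<in>carrier N. g (a \<odot>\<^bsub>N\<^esub> x) = \<phi> a \<odot>\<^bsub>M\<^esub> g x)"

lemma semilinearD:
  assumes "semilinear R \<phi> N M g"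
  shows "x \<in> carrier N \<Longrightarrow> g x \<in> carrier M"
    and "\<lbrakk>x \<in> carrier N; y \<in> carrier N\<rbrakk> \<Longrightarrow> g (x \<oplus>\<^bsub>N\<^esub> y) = g x \<oplus>\<^bsub>M\<^esub> g y"
    and "\<lbrakk>a \<in> carrier R; x \<in> carrier N\<rbrakk> \<Longrightarrow> g (a \<odot>\<^bsub>N\<^esub> x) = \<phi> a \<odot>\<^bsub>M\<^esub> g x"
  using assms by (auto simp: semilinear_def)

locale semilinear_map = N: module R N + M: module S M
  for R :: "('r, 'q) ring_scheme" and S :: "('s, 't) ring_scheme"
    and N :: "('r, 'x) module" and M :: "('s, 'y) module" +
  fixes \<phi> :: "'r \<Rightarrow> 's" and g :: "'x \<Rightarrow> 'y"
  assumes phi: "\<phi> \<in> ring_hom R S" and semilinear: "semilinear R \<phi> N M g"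
begin

lemmas closed = semilinearD(1)[OF semilinear]
lemmas add = semilinearD(2)[OF semilinear]
lemmas smult = semilinearD(3)[OF semilinear]

lemma zero: "g \<zero>\<^bsub>N\<^esub> = \<zero>\<^bsub>M\<^esub>"
  using add[of "\<zero>\<^bsub>N\<^esub>" "\<zero>\<^bsub>N\<^esub>"] closed[of "\<zero>\<^bsub>N\<^esub>"]
  by (metis M.add.l_cancel_one' N.M.r_zero N.M.zero_closed)

lemma neg: "x \<in> carrier N \<Longrightarrow> g (\<ominus>\<^bsub>N\<^esub> x) = \<ominus>\<^bsub>M\<^esub> g x"
  using add[of "\<ominus>\<^bsub>N\<^esub> x" x] closed zero
  by (metis M.M.minus_equality N.M.a_inv_closed N.M.l_neg)

lemma minus: "\<lbrakk>x \<in> carrier N; y \<in> carrier N\<rbrakk> \<Longrightarrow> g (x \<ominus>\<^bsub>N\<^esub> y) = g x \<ominus>\<^bsub>M\<^esub> g y"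
  by (simp add: a_minus_def add neg)

lemma preimage_submodule:
  assumes H: "submodule H S M"
  shows "submodule {x \<in> carrier N. g x \<in> H} R N"
proof -
  note HE = M.submoduleE[OF H]
  have z: "\<zero>\<^bsub>M\<^esub> \<in> H" using HE(2,3,5) M.M.r_neg HE(1) by (metis equals0I subsetD)
  show ?thesis
    by (rule N.submoduleI) (use HE z phi in \<open>auto simp: zero neg add smult ring_hom_closed\<close>)
qed

end

locale plain_module = module R M for R :: "('r, 'q) ring_scheme" and M :: "('r, 'x) module"
begin

lemma submodule_zero: "submodule H R M \<Longrightarrow> \<zero>\<^bsub>M\<^esub> \<in> H"
  using subgroup.one_closed[OF submodule.axioms(1)] by fastforce

lemma gen_submodule_is_submodule:
  assumes "G \<subseteq> carrier M"
  shows "submodule (gen_submodule R M G) R M"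
proof (rule submoduleI)
  show "gen_submodule R M G \<subseteq> carrier M"
    using assms carrier_is_submodule by (auto simp: gen_submodule_def)
  show "\<zero>\<^bsub>M\<^esub> \<in> gen_submodule R M G"
    by (simp add: gen_submodule_def submodule_zero)
next
  fix a assume "a \<in> gen_submodule R M G"
  then show "\<ominus>\<^bsub>M\<^esub> a \<in> gen_submodule R M G"
    by (simp add: gen_submodule_def submoduleE(3))
next
  fix a b assume "a \<in> gen_submodule R M G" "b \<in> gen_submodule R M G"
  then show "a \<oplus>\<^bsub>M\<^esub> b \<in> gen_submodule R M G"
    by (simp add: gen_submodule_def submoduleE(5))
next
  fix a x assume "a \<in> carrier R" "x \<in> gen_submodule R M G"
  then show "a \<odot>\<^bsub>M\<^esub> x \<in> gen_submodule R M G"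
    by (simp add: gen_submodule_def submoduleE(4))
qed

lemma gen_submodule_incl: "G \<subseteq> gen_submodule R M G"
  by (auto simp: gen_submodule_def)

lemma gen_submodule_minimal: "\<lbrakk>submodule H R M; G \<subseteq> H\<rbrakk> \<Longrightarrow> gen_submodule R M G \<subseteq> H"
  by (auto simp: gen_submodule_def)

lemma zero_submodule: "submodule {\<zero>\<^bsub>M\<^esub>} R M"
  by (rule submoduleI) auto

end

locale quotient = plain_module R M for R :: "('r, 'q) ring_scheme" and M :: "('r, 'x) module" +
  fixes N assumes N: "submodule N R M"
begin

abbreviation Q where "Q \<equiv> quot_module M N"

abbreviation cls where "cls x \<equiv> N +>\<^bsub>M\<^esub> x"

sublocale ag: abelian_subgroup N M
  by (rule abelian_subgroupI3[OF additive_subgroupI[OF submodule.axioms(1)[OF N]] abelian_group_axioms])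

lemma carrier_Q: "carrier Q = cls ` carrier M"
  by (auto simp: quot_module_def A_RCOSETS_def' a_r_coset_def')

lemma cls_closed: "x \<in> carrier M \<Longrightarrow> cls x \<in> carrier Q"
  by (simp add: carrier_Q)

lemma cls_eq_iff:
  assumes "x \<in> carrier M" "y \<in> carrier M"
  shows "cls x = cls y \<longleftrightarrow> x \<ominus>\<^bsub>M\<^esub> y \<in> N"
proof -
  have "x \<ominus>\<^bsub>M\<^esub> y \<in> N \<longleftrightarrow> x \<in> cls y"
    using ag.a_rcos_module[OF assms(2,1)] by (simp add: a_minus_def)
  then show ?thesis
    using ag.a_repr_independence'[of x y] ag.a_rcos_self[OF assms(1)] assms(2) by auto
qed

lemma cls_rep: "\<lbrakk>x \<in> carrier M; y \<in> cls x\<rbrakk> \<Longrightarrow> y \<in> carrier M \<and> cls y = cls x"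
  using ag.a_elemrcos_carrier[of x y] ag.a_repr_independence'[of y x] by simp

lemma cls_self: "x \<in> carrier M \<Longrightarrow> x \<in> cls x"
  by (rule ag.a_rcos_self)

lemma cls_add: "\<lbrakk>x \<in> carrier M; y \<in> carrier M\<rbrakk> \<Longrightarrow> cls x \<oplus>\<^bsub>Q\<^esub> cls y = cls (x \<oplus>\<^bsub>M\<^esub> y)"
  by (simp add: quot_module_def ag.a_rcos_sum)

lemma cls_zero: "\<zero>\<^bsub>Q\<^esub> = cls \<zero>\<^bsub>M\<^esub>"
  by (simp add: quot_module_def ag.a_subset)

lemma smult_minus:
  "\<lbrakk>a \<in> carrier R; x \<in> carrier M; y \<in> carrier M\<rbrakk> \<Longrightarrow> a \<odot>\<^bsub>M\<^esub> (x \<ominus>\<^bsub>M\<^esub> y) = a \<odot>\<^bsub>M\<^esub> x \<ominus>\<^bsub>M\<^esub> a \<odot>\<^bsub>M\<^esub> y"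
  by (simp add: a_minus_def smult_r_distr smult_r_minus)

lemma cls_smult:
  assumes a: "a \<in> carrier R" and x: "x \<in> carrier M"
  shows "a \<odot>\<^bsub>Q\<^esub> cls x = cls (a \<odot>\<^bsub>M\<^esub> x)"
proof -
  have *: "cls (a \<odot>\<^bsub>M\<^esub> y) = cls (a \<odot>\<^bsub>M\<^esub> x)" if "y \<in> cls x" for y
  proof -
    have y: "y \<in> carrier M" "y \<ominus>\<^bsub>M\<^esub> x \<in> N" using cls_rep[OF x that] cls_eq_iff[of y x] x by auto
    then have "a \<odot>\<^bsub>M\<^esub> y \<ominus>\<^bsub>M\<^esub> a \<odot>\<^bsub>M\<^esub> x \<in> N"
      using smult_minus[OF a y(1) x] submoduleE(4)[OF N a y(2)] by simp
    then show ?thesis using cls_eq_iff[of "a \<odot>\<^bsub>M\<^esub> y" "a \<odot>\<^bsub>M\<^esub> x"] a x y(1) by blast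
  qed
  have "(\<Union>y\<in>cls x. cls (a \<odot>\<^bsub>M\<^esub> y)) = (\<Union>y\<in>cls x. cls (a \<odot>\<^bsub>M\<^esub> x))"
    by (rule SUP_cong[OF refl *])
  also have "\<dots> = cls (a \<odot>\<^bsub>M\<^esub> x)" using cls_self[OF x] by blast
  finally show ?thesis by (simp only: quot_module_def module.simps)
qed

lemma Q_E:
  assumes "C \<in> carrier Q"
  obtains x where "x \<in> carrier M" "C = cls x"
  using assms by (auto simp: carrier_Q)

lemma cls_zero_add: "x \<in> carrier M \<Longrightarrow> \<zero>\<^bsub>Q\<^esub> \<oplus>\<^bsub>Q\<^esub> cls x = cls x"
  using cls_add[of "\<zero>\<^bsub>M\<^esub>" x] by (simp only: cls_zero M.zero_closed M.l_zero)

lemma cls_neg_add: "x \<in> carrier M \<Longrightarrow> cls (\<ominus>\<^bsub>M\<^esub> x) \<oplus>\<^bsub>Q\<^esub> cls x = \<zero>\<^bsub>Q\<^esub>"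
  using cls_add[of "\<ominus>\<^bsub>M\<^esub> x" x] by (simp only: cls_zero M.a_inv_closed M.l_neg)

lemma Q_module: "module R Q"
proof (rule moduleI[OF cring_axioms])
  show "abelian_group Q"
  proof (rule abelian_groupI)
    fix C D assume "C \<in> carrier Q" "D \<in> carrier Q"
    then show "C \<oplus>\<^bsub>Q\<^esub> D \<in> carrier Q" "C \<oplus>\<^bsub>Q\<^esub> D = D \<oplus>\<^bsub>Q\<^esub> C"
      by (auto elim!: Q_E simp: cls_add cls_closed M.a_comm)
  next
    fix C D E assume "C \<in> carrier Q" "D \<in> carrier Q" "E \<in> carrier Q"
    then show "C \<oplus>\<^bsub>Q\<^esub> D \<oplus>\<^bsub>Q\<^esub> E = C \<oplus>\<^bsub>Q\<^esub> (D \<oplus>\<^bsub>Q\<^esub> E)"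
      by (auto elim!: Q_E simp: cls_add M.a_assoc)
  next
    show "\<zero>\<^bsub>Q\<^esub> \<in> carrier Q" unfolding cls_zero by (rule cls_closed) simp
  next
    fix C assume "C \<in> carrier Q"
    then obtain x where x: "x \<in> carrier M" "C = cls x" by (rule Q_E)
    then show "\<zero>\<^bsub>Q\<^esub> \<oplus>\<^bsub>Q\<^esub> C = C" by (simp only: cls_zero_add)
    show "\<exists>D\<in>carrier Q. D \<oplus>\<^bsub>Q\<^esub> C = \<zero>\<^bsub>Q\<^esub>"
      using x by (intro bexI[of _ "cls (\<ominus>\<^bsub>M\<^esub> x)"]) (simp_all only: cls_neg_add cls_closed M.a_inv_closed)
  qed
qed (auto elim!: Q_E simp: cls_add cls_smult cls_closed smult_l_distr smult_r_distr smult_assoc1)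

end

lemma (in quotient) lift:
  assumes M': "module S M'" and \<phi>: "\<phi> \<in> ring_hom R S" and L: "semilinear R \<phi> M M' L"
    and kill: "\<And>x. x \<in> N \<Longrightarrow> L x = \<zero>\<^bsub>M'\<^esub>"
  shows "\<exists>L'. semilinear R \<phi> Q M' L' \<and> (\<forall>x\<in>carrier M. L' (cls x) = L x)"
proof -
  interpret L: semilinear_map R S M M' \<phi> L
    by (intro semilinear_map.intro semilinear_map_axioms.intro module_axioms M' \<phi> L)
  have eq: "L x = L y" if "x \<in> carrier M" "y \<in> carrier M" "cls x = cls y" for x y
  proof -
    have "L x \<ominus>\<^bsub>M'\<^esub> L y = \<zero>\<^bsub>M'\<^esub>" using kill[of "x \<ominus>\<^bsub>M\<^esub> y"] that L.minus cls_eq_iff by simp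
    then show ?thesis using L.closed that
      by (metis L.M.M.minus_equality L.M.M.minus_minus L.M.M.a_inv_closed a_minus_def)
  qed
  define L' where "L' = (\<lambda>C. L (SOME x. x \<in> carrier M \<and> C = cls x))"
  have L': "L' (cls x) = L x" if "x \<in> carrier M" for x
  proof -
    have "(SOME y. y \<in> carrier M \<and> cls x = cls y) \<in> carrier M \<and>
        cls x = cls (SOME y. y \<in> carrier M \<and> cls x = cls y)"
      by (rule someI[of _ x]) (simp add: that)
    then show ?thesis unfolding L'_def using eq[of _ x] that by metis
  qed
  have "semilinear R \<phi> Q M' L'"
    unfolding semilinear_def carrier_Q
    by (auto simp: cls_add cls_smult L' L.closed L.add L.smult)
  then show ?thesis using L' by blast
qed

lemma quot_map_cls:
  assumes q: "quotient R M N" and q1: "quotient S M1 N1" and \<phi>: "\<phi> \<in> ring_hom R S"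
    and f: "semilinear R \<phi> M M1 f" and fN: "f ` N \<subseteq> N1"
  shows "x \<in> carrier M \<Longrightarrow> quot_map M1 N1 f (N +>\<^bsub>M\<^esub> x) = N1 +>\<^bsub>M1\<^esub> f x"
    and "semilinear R \<phi> (quot_module M N) (quot_module M1 N1) (quot_map M1 N1 f)"
proof -
  interpret q: quotient R M N by (rule q)
  interpret q1: quotient S M1 N1 by (rule q1)
  interpret f: semilinear_map R S M M1 \<phi> f
    by (intro semilinear_map.intro semilinear_map_axioms.intro q.module_axioms q1.module_axioms \<phi> f)
  have 1: "quot_map M1 N1 f (N +>\<^bsub>M\<^esub> x) = N1 +>\<^bsub>M1\<^esub> f x" if x: "x \<in> carrier M" for x
  proof -
    have *: "N1 +>\<^bsub>M1\<^esub> f y = N1 +>\<^bsub>M1\<^esub> f x" if y: "y \<in> N +>\<^bsub>M\<^esub> x" for y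
    proof -
      have "y \<ominus>\<^bsub>M\<^esub> x \<in> N" "y \<in> carrier M" using q.cls_rep[OF x y] q.cls_eq_iff[of y x] x by auto
      then have "f y \<ominus>\<^bsub>M1\<^esub> f x \<in> N1" using fN f.minus x by force
      then show ?thesis using q1.cls_eq_iff f.closed x \<open>y \<in> carrier M\<close> by simp
    qed
    have "(\<Union>y\<in>N +>\<^bsub>M\<^esub> x. N1 +>\<^bsub>M1\<^esub> f y) = (\<Union>y\<in>N +>\<^bsub>M\<^esub> x. N1 +>\<^bsub>M1\<^esub> f x)"
      by (rule SUP_cong[OF refl *])
    also have "\<dots> = N1 +>\<^bsub>M1\<^esub> f x" using q.cls_self[OF x] by blast
    finally show ?thesis by (simp only: quot_map_def)
  qed
  then show "x \<in> carrier M \<Longrightarrow> quot_map M1 N1 f (N +>\<^bsub>M\<^esub> x) = N1 +>\<^bsub>M1\<^esub> f x" .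
  show "semilinear R \<phi> (quot_module M N) (quot_module M1 N1) (quot_map M1 N1 f)"
    unfolding semilinear_def q.carrier_Q q1.carrier_Q
    by (auto simp: q.cls_add q.cls_smult q1.cls_add q1.cls_smult 1 f.closed f.add f.smult
        ring_hom_closed[OF \<phi>])
qed

context cring
begin

lemma free_module_simps:
  "carrier (free_module R V) = fin_supp R V"
  "\<zero>\<^bsub>free_module R V\<^esub> = (\<lambda>x. \<zero>)"
  "c \<oplus>\<^bsub>free_module R V\<^esub> d = (\<lambda>x. c x \<oplus> d x)"
  "a \<odot>\<^bsub>free_module R V\<^esub> c = (\<lambda>x. a \<otimes> c x)"
  by (simp_all add: free_module_def)

lemma fin_supp_smult:
  assumes "a \<in> carrier R" "c \<in> fin_supp R V"
  shows "(\<lambda>x. a \<otimes> c x) \<in> fin_supp R V"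
  by (rule fin_suppI[where A="{x. c x \<noteq> \<zero>}"]) (use assms(1) fin_suppD[OF assms(2)] in auto)

lemma free_module_module: "module R (free_module R V)"
proof (rule moduleI[OF cring_axioms])
  show "abelian_group (free_module R V)"
    by (rule fin_supp_abelian_group) (simp_all add: free_module_simps)
qed (auto simp: free_module_simps fin_supp_smult l_distr r_distr m_assoc fin_suppD(1)[of _ R V])

lemma free_gen_closed: "x \<in> V \<Longrightarrow> free_gen R x \<in> carrier (free_module R V)"
  by (simp add: free_module_simps free_gen_eq_single fin_supp_single)

lemma smult_free_gen: "a \<in> carrier R \<Longrightarrow> a \<odot>\<^bsub>free_module R V\<^esub> free_gen R x = single R x a"
  by (auto simp: free_module_simps free_gen_eq_single single_def)

lemma lin_ext:
  assumes M: "module S M" and \<phi>: "\<phi> \<in> ring_hom R S" and g: "g \<in> V \<rightarrow> carrier M"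
  shows "\<exists>L. semilinear R \<phi> (free_module R V) M L \<and> (\<forall>x\<in>V. L (free_gen R x) = g x)"
proof -
  interpret M: module S M by (rule M)
  interpret F: additive_family R M V "\<lambda>x r. \<phi> r \<odot>\<^bsub>M\<^esub> g x"
    by unfold_locales (use \<phi> g in \<open>auto simp: ring_hom_closed ring_hom_add M.smult_l_distr Pi_iff\<close>)
  define L where "L = fsum R M (\<lambda>x r. \<phi> r \<odot>\<^bsub>M\<^esub> g x)"
  have sm: "L (\<lambda>x. a \<otimes> c x) = \<phi> a \<odot>\<^bsub>M\<^esub> L c" if a: "a \<in> carrier R" and c: "c \<in> fin_supp R V" for a c
    using c
  proof (induction rule: fin_supp_induct)
    case zero
    then show ?case using a F.fsum_zero \<phi> by (simp add: L_def ring_hom_closed)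
  next
    case (add x r c)
    have "(\<lambda>y. a \<otimes> (single R x r y \<oplus> c y)) = (\<lambda>y. single R x (a \<otimes> r) y \<oplus> a \<otimes> c y)"
      using add a fin_suppD(1)[OF add(3)] by (auto simp: single_def r_distr)
    then show ?case
      using add a \<phi> g
      by (simp add: L_def F.fsum_add F.fsum_single F.fsum_closed fin_supp_single fin_supp_smult
          M.smult_r_distr ring_hom_closed Pi_iff M.smult_assoc1 ring_hom_mult)
  qed
  have "L (free_gen R x) = g x" if "x \<in> V" for x
    using that funcset_mem[OF g that] \<phi> by (simp add: L_def free_gen_eq_single F.fsum_single ring_hom_one)
  moreover have "semilinear R \<phi> (free_module R V) M L"
    using sm by (simp add: semilinear_def free_module_simps) (simp add: L_def F.fsum_closed F.fsum_add)
  ultimately show ?thesis by blast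
qed

lemma push_forward_semilinear:
  assumes R1: "cring R1" and \<phi>: "\<phi> \<in> ring_hom R R1" and f: "f \<in> V \<rightarrow> W"
  shows "semilinear R \<phi> (free_module R V) (free_module R1 W) (push_forward R R1 \<phi> f)"
    and "x \<in> V \<Longrightarrow> push_forward R R1 \<phi> f (free_gen R x) = free_gen R1 (f x)"
proof -
  interpret R1: cring R1 by (rule R1)
  interpret F: push_forward_data R R1 V W \<phi> f
    by unfold_locales (use \<phi> f in \<open>auto simp: ring_hom_closed ring_hom_add\<close>)
  have sm: "push_forward R R1 \<phi> f (\<lambda>x. a \<otimes> c x) = (\<lambda>y. \<phi> a \<otimes>\<^bsub>R1\<^esub> push_forward R R1 \<phi> f c y)"
    if a: "a \<in> carrier R" and c: "c \<in> fin_supp R V" for a c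
    using c
  proof (induction rule: fin_supp_induct)
    case zero
    then show ?case using a \<phi> by (simp add: F.push_forward_zero ring_hom_closed)
  next
    case (add x r c)
    have "(\<lambda>y. a \<otimes> (single R x r y \<oplus> c y)) = (\<lambda>y. single R x (a \<otimes> r) y \<oplus> a \<otimes> c y)"
      using add a fin_suppD(1)[OF add(3)] by (auto simp: single_def r_distr)
    moreover have "\<phi> a \<otimes>\<^bsub>R1\<^esub> single R1 (f x) (\<phi> r) y = single R1 (f x) (\<phi> (a \<otimes> r)) y" for y
      using add a \<phi> by (simp add: single_def ring_hom_closed ring_hom_mult)
    ultimately show ?case
      using add a \<phi> f fin_suppD(1)[OF F.push_forward_closed[OF add(3)]]
      by (simp add: F.push_forward_add F.push_forward_single fin_supp_single fin_supp_smult
          ring_hom_closed R1.r_distr R1.single_closed)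
  qed
  show "semilinear R \<phi> (free_module R V) (free_module R1 W) (push_forward R R1 \<phi> f)"
    unfolding semilinear_def free_module_simps R1.free_module_simps
    using sm F.push_forward_closed F.push_forward_add by simp
  show "x \<in> V \<Longrightarrow> push_forward R R1 \<phi> f (free_gen R x) = free_gen R1 (f x)"
    using \<phi> by (simp add: free_gen_eq_single F.push_forward_single ring_hom_one)
qed

lemma quotient_free_ext:
  assumes q: "quotient R (free_module R V) N" and M: "module S M" and \<phi>: "\<phi> \<in> ring_hom R S"
    and g: "semilinear R \<phi> (quot_module (free_module R V) N) M g"
    and h: "semilinear R \<phi> (quot_module (free_module R V) N) M h"
    and gens: "\<And>x. x \<in> V \<Longrightarrow> g (N +>\<^bsub>free_module R V\<^esub> free_gen R x) = h (N +>\<^bsub>free_module R V\<^esub> free_gen R x)"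
    and y: "y \<in> carrier (quot_module (free_module R V) N)"
  shows "g y = h y"
proof -
  interpret q: quotient R "free_module R V" N by (rule q)
  interpret g: semilinear_map R S q.Q M \<phi> g
    by (intro semilinear_map.intro semilinear_map_axioms.intro q.Q_module M \<phi> g)
  interpret h: semilinear_map R S q.Q M \<phi> h
    by (intro semilinear_map.intro semilinear_map_axioms.intro q.Q_module M \<phi> h)
  obtain c where c: "c \<in> fin_supp R V" "y = q.cls c"
    using y by (auto simp: q.carrier_Q free_module_simps)
  have "g (q.cls c) = h (q.cls c)"
    using c(1)
  proof (induction rule: fin_supp_induct)
    case zero
    then show ?case using g.zero h.zero by (simp add: q.cls_zero free_module_simps)
  next
    case (add x r c)
    have "(\<lambda>y. single R x r y \<oplus> c y)
        = (r \<odot>\<^bsub>free_module R V\<^esub> free_gen R x) \<oplus>\<^bsub>free_module R V\<^esub> c"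
      using add by (simp add: smult_free_gen) (simp add: free_module_simps)
    then have "q.cls (\<lambda>y. single R x r y \<oplus> c y) = (r \<odot>\<^bsub>q.Q\<^esub> q.cls (free_gen R x)) \<oplus>\<^bsub>q.Q\<^esub> q.cls c"
      using add free_gen_closed[of x V] by (simp add: q.cls_add q.cls_smult free_module_simps(1)[symmetric])
    moreover have "q.cls c \<in> carrier q.Q" "q.cls (free_gen R x) \<in> carrier q.Q"
      using add free_gen_closed[of x V] by (simp_all add: q.cls_closed free_module_simps(1)[symmetric])
    ultimately show ?case
      using add gens[of x] q.Q_module
      by (simp add: g.add h.add g.smult h.smult module.smult_closed)
  qed
  then show ?thesis using c by simp
qed

end

lemma id_ring_hom: "id \<in> ring_hom S S"
  by (rule ring_hom_memI) auto

section \<open>Kaehler differentials\<close>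

text \<open>An \<open>R\<close>-derivation of \<open>P\<close> with values in the \<open>S\<close>-module \<open>M\<close>, on which \<open>P\<close> acts through \<open>e\<close>.\<close>

definition derivation ::
  "('r, 'q) ring_scheme \<Rightarrow> ('p, 'w) ring_scheme \<Rightarrow> ('r \<Rightarrow> 'p) \<Rightarrow> ('p \<Rightarrow> 's) \<Rightarrow> ('s, 'y) module \<Rightarrow> ('p \<Rightarrow> 'y) \<Rightarrow> bool"
where
  "derivation R P u e M D \<longleftrightarrow>
    (\<forall>x\<in>carrier P. D x \<in> carrier M) \<and>
    (\<forall>x\<in>carrier P. \<forall>y\<in>carrier P. D (x \<oplus>\<^bsub>P\<^esub> y) = D x \<oplus>\<^bsub>M\<^esub> D y) \<and>
    (\<forall>x\<in>carrier P. \<forall>y\<in>carrier P. D (x \<otimes>\<^bsub>P\<^esub> y) = e x \<odot>\<^bsub>M\<^esub> D y \<oplus>\<^bsub>M\<^esub> e y \<odot>\<^bsub>M\<^esub> D x) \<and>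
    (\<forall>r\<in>carrier R. D (u r) = \<zero>\<^bsub>M\<^esub>)"

definition kaehler_d ::
  "('r, 'q) ring_scheme \<Rightarrow> ('p, 'w) ring_scheme \<Rightarrow> ('r \<Rightarrow> 'p) \<Rightarrow> 'p \<Rightarrow> ('p \<Rightarrow> 'p) set"
where
  "kaehler_d R P u x = kaehler_rel R P u +>\<^bsub>free_module P (carrier P)\<^esub> free_gen P x"

locale kaehler_setup = P: cring P for R :: "('r, 'q) ring_scheme" and P :: "('p, 'w) ring_scheme" +
  fixes u :: "'r \<Rightarrow> 'p"
  assumes u_closed: "r \<in> carrier R \<Longrightarrow> u r \<in> carrier P"
begin

abbreviation FP where "FP \<equiv> free_module P (carrier P)"

sublocale F: plain_module P FP
  by (intro plain_module.intro P.free_module_module)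

lemma gen_closed: "x \<in> carrier P \<Longrightarrow> free_gen P x \<in> carrier FP"
  by (rule P.free_gen_closed)

definition rels where
  "rels = {free_gen P (x \<oplus>\<^bsub>P\<^esub> y) \<ominus>\<^bsub>FP\<^esub> (free_gen P x \<oplus>\<^bsub>FP\<^esub> free_gen P y) | x y. x \<in> carrier P \<and> y \<in> carrier P} \<union>
     {free_gen P (x \<otimes>\<^bsub>P\<^esub> y) \<ominus>\<^bsub>FP\<^esub> (x \<odot>\<^bsub>FP\<^esub> free_gen P y \<oplus>\<^bsub>FP\<^esub> y \<odot>\<^bsub>FP\<^esub> free_gen P x) | x y. x \<in> carrier P \<and> y \<in> carrier P} \<union>
     {free_gen P (u r) | r. r \<in> carrier R}"

lemma kaehler_rel_eq: "kaehler_rel R P u = gen_submodule P FP rels"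
  by (simp add: kaehler_rel_def rels_def Let_def)

lemma rels_closed: "rels \<subseteq> carrier FP"
  by (auto simp: rels_def gen_closed u_closed)

sublocale q: quotient P FP "kaehler_rel R P u"
  by (intro quotient.intro quotient_axioms.intro F.plain_module_axioms)
     (simp add: kaehler_rel_eq F.gen_submodule_is_submodule[OF rels_closed])

lemma kaehler_eq: "kaehler R P u = q.Q"
  by (simp add: kaehler_def)

lemma kaehler_module: "module P (kaehler R P u)"
  unfolding kaehler_eq by (rule q.Q_module)

lemma d_eq: "kaehler_d R P u x = q.cls (free_gen P x)"
  by (simp add: kaehler_d_def)

lemma d_derivation: "derivation R P u id (kaehler R P u) (kaehler_d R P u)"
proof -
  have rel: "y \<in> kaehler_rel R P u" if "y \<in> rels" for y
    using that F.gen_submodule_incl kaehler_rel_eq by blast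
  have minus: "x \<ominus>\<^bsub>FP\<^esub> y \<in> kaehler_rel R P u \<Longrightarrow> x \<in> carrier FP \<Longrightarrow> y \<in> carrier FP \<Longrightarrow> q.cls x = q.cls y" for x y
    using q.cls_eq_iff by blast
  have add: "q.cls (free_gen P (x \<oplus>\<^bsub>P\<^esub> y)) = q.cls (free_gen P x \<oplus>\<^bsub>FP\<^esub> free_gen P y)"
    if "x \<in> carrier P" "y \<in> carrier P" for x y
    by (rule minus[OF rel]) (use that in \<open>unfold rels_def, blast, simp_all add: gen_closed\<close>)
  have mult: "q.cls (free_gen P (x \<otimes>\<^bsub>P\<^esub> y)) = q.cls (x \<odot>\<^bsub>FP\<^esub> free_gen P y \<oplus>\<^bsub>FP\<^esub> y \<odot>\<^bsub>FP\<^esub> free_gen P x)"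
    if "x \<in> carrier P" "y \<in> carrier P" for x y
    by (rule minus[OF rel]) (use that in \<open>unfold rels_def, blast, simp_all add: gen_closed\<close>)
  have "q.cls (free_gen P (u r)) = \<zero>\<^bsub>q.Q\<^esub>" if "r \<in> carrier R" for r
  proof -
    have "free_gen P (u r) \<in> kaehler_rel R P u" by (rule rel, unfold rels_def) (use that in blast)
    then show ?thesis using q.ag.a_rcos_const by (simp add: quot_module_def)
  qed
  then show ?thesis
    unfolding derivation_def kaehler_eq d_eq
    using add mult by (simp add: gen_closed q.cls_closed q.cls_add q.cls_smult)
qed

text \<open>Universal property of the Kaehler differentials: the linear extension of \<open>D\<close> to the free module on
  the symbols \<open>d x\<close> kills the defining relations exactly because \<open>D\<close> is a derivation.\<close>

lemma kaehler_lift: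
  assumes M: "module S M" and e: "e \<in> ring_hom P S" and D: "derivation R P u e M D"
  shows "\<exists>g. semilinear P e (kaehler R P u) M g \<and> (\<forall>x\<in>carrier P. g (kaehler_d R P u x) = D x)"
proof -
  interpret M: plain_module S M by (intro plain_module.intro M)
  have Dc: "D \<in> carrier P \<rightarrow> carrier M" using D by (auto simp: derivation_def)
  obtain L where L: "semilinear P e FP M L" and Lg: "\<And>x. x \<in> carrier P \<Longrightarrow> L (free_gen P x) = D x"
    using P.lin_ext[OF M e Dc] by blast
  interpret L: semilinear_map P S FP M e L
    by (intro semilinear_map.intro semilinear_map_axioms.intro F.module_axioms M e L)
  have minus_self: "a \<ominus>\<^bsub>M\<^esub> a = \<zero>\<^bsub>M\<^esub>" if "a \<in> carrier M" for a
    using that by (simp add: a_minus_def M.r_neg)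
  have "kaehler_rel R P u \<subseteq> {x \<in> carrier FP. L x \<in> {\<zero>\<^bsub>M\<^esub>}}"
    unfolding kaehler_rel_eq
  proof (rule F.gen_submodule_minimal[OF L.preimage_submodule[OF M.zero_submodule]], rule subsetI)
    fix y assume y: "y \<in> rels"
    then have yc: "y \<in> carrier FP" using rels_closed by blast
    have cl: "D x \<in> carrier M" "e x \<in> carrier S" if "x \<in> carrier P" for x
      using that Dc e by (auto simp: ring_hom_closed)
    have "L y = \<zero>\<^bsub>M\<^esub>"
      using y unfolding rels_def
    proof (elim UnE CollectE exE conjE)
      fix a b assume "y = free_gen P (a \<oplus>\<^bsub>P\<^esub> b) \<ominus>\<^bsub>FP\<^esub> (free_gen P a \<oplus>\<^bsub>FP\<^esub> free_gen P b)"
        "a \<in> carrier P" "b \<in> carrier P"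
      then show ?thesis using D
        by (simp add: L.minus L.add gen_closed Lg derivation_def minus_self cl)
    next
      fix a b assume "y = free_gen P (a \<otimes>\<^bsub>P\<^esub> b) \<ominus>\<^bsub>FP\<^esub> (a \<odot>\<^bsub>FP\<^esub> free_gen P b \<oplus>\<^bsub>FP\<^esub> b \<odot>\<^bsub>FP\<^esub> free_gen P a)"
        "a \<in> carrier P" "b \<in> carrier P"
      then show ?thesis using D
        by (simp add: L.minus L.add L.smult gen_closed Lg derivation_def minus_self cl)
    next
      fix r assume "y = free_gen P (u r)" "r \<in> carrier R"
      then show ?thesis using D by (simp add: Lg u_closed derivation_def)
    qed
    then show "y \<in> {x \<in> carrier FP. L x \<in> {\<zero>\<^bsub>M\<^esub>}}" using yc by simp
  qed
  then have "L y = \<zero>\<^bsub>M\<^esub>" if "y \<in> kaehler_rel R P u" for y using that by blast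
  from q.lift[OF M e L this] show ?thesis
    unfolding kaehler_eq d_eq using Lg gen_closed by auto
qed

end

section \<open>Extension of scalars\<close>

definition tens ::
  "('p, 'w) ring_scheme \<Rightarrow> ('s, 't) ring_scheme \<Rightarrow> ('p \<Rightarrow> 's) \<Rightarrow> ('p, 'x) module \<Rightarrow> 'x \<Rightarrow> ('x \<Rightarrow> 's) set"
where
  "tens P S e N y = ext_scalars_rel P S e N +>\<^bsub>free_module S (carrier N)\<^esub> free_gen S y"

locale ext_setup = N: plain_module P N + S: cring S
  for P :: "('p, 'w) ring_scheme" and S :: "('s, 't) ring_scheme" and N :: "('p, 'x) module" +
  fixes e :: "'p \<Rightarrow> 's"
  assumes e: "e \<in> ring_hom P S"
begin

abbreviation FS where "FS \<equiv> free_module S (carrier N)"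

sublocale F: plain_module S FS
  by (intro plain_module.intro S.free_module_module)

lemma gen_closed: "x \<in> carrier N \<Longrightarrow> free_gen S x \<in> carrier FS"
  by (rule S.free_gen_closed)

definition rels where
  "rels = {free_gen S (x \<oplus>\<^bsub>N\<^esub> y) \<ominus>\<^bsub>FS\<^esub> (free_gen S x \<oplus>\<^bsub>FS\<^esub> free_gen S y) | x y. x \<in> carrier N \<and> y \<in> carrier N} \<union>
     {free_gen S (p \<odot>\<^bsub>N\<^esub> x) \<ominus>\<^bsub>FS\<^esub> (e p \<odot>\<^bsub>FS\<^esub> free_gen S x) | p x. p \<in> carrier P \<and> x \<in> carrier N}"

lemma rel_eq: "ext_scalars_rel P S e N = gen_submodule S FS rels"
  by (simp add: ext_scalars_rel_def rels_def Let_def)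

lemma rels_closed: "rels \<subseteq> carrier FS"
  using e by (auto simp: rels_def gen_closed ring_hom_closed)

sublocale q: quotient S FS "ext_scalars_rel P S e N"
  by (intro quotient.intro quotient_axioms.intro F.plain_module_axioms)
     (simp add: rel_eq F.gen_submodule_is_submodule[OF rels_closed])

lemma ext_scalars_eq: "ext_scalars P S e N = q.Q"
  by (simp add: ext_scalars_def)

lemma ext_scalars_module: "module S (ext_scalars P S e N)"
  unfolding ext_scalars_eq by (rule q.Q_module)

lemma tens_eq: "tens P S e N x = q.cls (free_gen S x)"
  by (simp add: tens_def)

lemma tens_semilinear: "semilinear P e N (ext_scalars P S e N) (tens P S e N)"
proof -
  have rel: "y \<in> ext_scalars_rel P S e N" if "y \<in> rels" for y
    using that F.gen_submodule_incl rel_eq by blast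
  have minus: "x \<ominus>\<^bsub>FS\<^esub> y \<in> ext_scalars_rel P S e N \<Longrightarrow> x \<in> carrier FS \<Longrightarrow> y \<in> carrier FS \<Longrightarrow> q.cls x = q.cls y" for x y
    using q.cls_eq_iff by blast
  have add: "q.cls (free_gen S (x \<oplus>\<^bsub>N\<^esub> y)) = q.cls (free_gen S x \<oplus>\<^bsub>FS\<^esub> free_gen S y)"
    if "x \<in> carrier N" "y \<in> carrier N" for x y
    by (rule minus[OF rel]) (use that in \<open>unfold rels_def, blast, simp_all add: gen_closed\<close>)
  have smult: "q.cls (free_gen S (p \<odot>\<^bsub>N\<^esub> x)) = q.cls (e p \<odot>\<^bsub>FS\<^esub> free_gen S x)"
    if "x \<in> carrier N" "p \<in> carrier P" for x p
    by (rule minus[OF rel]) (use that in \<open>unfold rels_def, blast, simp_all add: gen_closed ring_hom_closed[OF e]\<close>)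
  show ?thesis
    unfolding semilinear_def ext_scalars_eq tens_eq
    using add smult by (simp add: gen_closed q.cls_closed q.cls_add q.cls_smult ring_hom_closed[OF e])
qed

lemma rel_killed:
  assumes M: "module S M" and L: "semilinear S id FS M L" and g: "semilinear P e N M g"
    and Lg: "\<And>x. x \<in> carrier N \<Longrightarrow> L (free_gen S x) = g x"
    and y: "y \<in> ext_scalars_rel P S e N"
  shows "L y = \<zero>\<^bsub>M\<^esub>"
proof -
  interpret M: plain_module S M by (intro plain_module.intro M)
  interpret L: semilinear_map S S FS M id L
    by (intro semilinear_map.intro semilinear_map_axioms.intro F.module_axioms M id_ring_hom L)
  have minus_self: "a \<ominus>\<^bsub>M\<^esub> a = \<zero>\<^bsub>M\<^esub>" if "a \<in> carrier M" for a
    using that by (simp add: a_minus_def M.r_neg)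
  have "ext_scalars_rel P S e N \<subseteq> {x \<in> carrier FS. L x \<in> {\<zero>\<^bsub>M\<^esub>}}"
    unfolding rel_eq
  proof (rule F.gen_submodule_minimal[OF L.preimage_submodule[OF M.zero_submodule]], rule subsetI)
    fix y assume y: "y \<in> rels"
    then have yc: "y \<in> carrier FS" using rels_closed by blast
    have "L y = \<zero>\<^bsub>M\<^esub>"
      using y unfolding rels_def
    proof (elim UnE CollectE exE conjE)
      fix a b assume "y = free_gen S (a \<oplus>\<^bsub>N\<^esub> b) \<ominus>\<^bsub>FS\<^esub> (free_gen S a \<oplus>\<^bsub>FS\<^esub> free_gen S b)"
        "a \<in> carrier N" "b \<in> carrier N"
      then show ?thesis
        by (simp add: L.minus L.add gen_closed Lg minus_self semilinearD[OF g])
    next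
      fix p a assume "y = free_gen S (p \<odot>\<^bsub>N\<^esub> a) \<ominus>\<^bsub>FS\<^esub> (e p \<odot>\<^bsub>FS\<^esub> free_gen S a)"
        "p \<in> carrier P" "a \<in> carrier N"
      then show ?thesis
        by (simp add: L.minus L.smult gen_closed Lg minus_self semilinearD[OF g] ring_hom_closed[OF e])
    qed
    then show "y \<in> {x \<in> carrier FS. L x \<in> {\<zero>\<^bsub>M\<^esub>}}" using yc by simp
  qed
  then show ?thesis using y by blast
qed

lemma ext_scalars_lift:
  assumes M: "module S M" and g: "semilinear P e N M g"
  shows "\<exists>h. semilinear S id (ext_scalars P S e N) M h \<and> (\<forall>x\<in>carrier N. h (tens P S e N x) = g x)"
proof -
  have gc: "g \<in> carrier N \<rightarrow> carrier M" using semilinearD(1)[OF g] by auto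
  obtain L where L: "semilinear S id FS M L" and Lg: "\<And>x. x \<in> carrier N \<Longrightarrow> L (free_gen S x) = g x"
    using S.lin_ext[OF M id_ring_hom gc] by blast
  from q.lift[OF M id_ring_hom L rel_killed[OF M L g Lg]] show ?thesis
    unfolding ext_scalars_eq tens_eq using Lg gen_closed by auto
qed

end

section \<open>The terms of the cotangent complex\<close>

text \<open>The universal derivation \<open>x \<mapsto> d x \<otimes> 1\<close>.\<close>

definition cot_d ::
  "('r, 'q) ring_scheme \<Rightarrow> ('s, 't) ring_scheme \<Rightarrow> ('r, 'x) mpoly ring \<Rightarrow> (('r, 'x) mpoly \<Rightarrow> 's)
    \<Rightarrow> ('r, 'x) mpoly \<Rightarrow> (('r, 'x) mpoly, 's) cot"
where
  "cot_d R S P e x = tens P S e (kaehler R P (poly_const R)) (kaehler_d R P (poly_const R) x)"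

locale cot_setup = P: cring P + S: cring S
  for R :: "('r, 'q) ring_scheme" and S :: "('s, 't) ring_scheme" and P :: "('r, 'x) mpoly ring" +
  fixes e :: "('r, 'x) mpoly \<Rightarrow> 's"
  assumes const_closed: "r \<in> carrier R \<Longrightarrow> poly_const R r \<in> carrier P"
    and e_hom: "e \<in> ring_hom P S"
begin

sublocale k: kaehler_setup R P "poly_const R"
  by unfold_locales (rule const_closed)

sublocale x: ext_setup P S "kaehler R P (poly_const R)" e
  by (intro ext_setup.intro plain_module.intro k.kaehler_module S.cring_axioms ext_setup_axioms.intro e_hom)

lemma cot_term_module: "module S (cot_term R S P e)"
  unfolding cot_term_def by (rule x.ext_scalars_module)

lemma cot_d_derivation: "derivation R P (poly_const R) e (cot_term R S P e) (cot_d R S P e)"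
proof -
  interpret t: semilinear_map P S "kaehler R P (poly_const R)" "cot_term R S P e" e
    "tens P S e (kaehler R P (poly_const R))"
    by (intro semilinear_map.intro semilinear_map_axioms.intro k.kaehler_module cot_term_module e_hom
        x.tens_semilinear[folded cot_term_def])
  let ?K = "kaehler R P (poly_const R)" and ?d = "kaehler_d R P (poly_const R)"
  have dc: "\<And>x. x \<in> carrier P \<Longrightarrow> ?d x \<in> carrier ?K"
    and da: "\<And>x y. \<lbrakk>x \<in> carrier P; y \<in> carrier P\<rbrakk> \<Longrightarrow> ?d (x \<oplus>\<^bsub>P\<^esub> y) = ?d x \<oplus>\<^bsub>?K\<^esub> ?d y"
    and dm: "\<And>x y. \<lbrakk>x \<in> carrier P; y \<in> carrier P\<rbrakk> \<Longrightarrow> ?d (x \<otimes>\<^bsub>P\<^esub> y) = x \<odot>\<^bsub>?K\<^esub> ?d y \<oplus>\<^bsub>?K\<^esub> y \<odot>\<^bsub>?K\<^esub> ?d x"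
    and d0: "\<And>r. r \<in> carrier R \<Longrightarrow> ?d (poly_const R r) = \<zero>\<^bsub>?K\<^esub>"
    using k.d_derivation unfolding derivation_def id_apply by blast+
  have sc: "\<And>p x. \<lbrakk>p \<in> carrier P; x \<in> carrier P\<rbrakk> \<Longrightarrow> p \<odot>\<^bsub>?K\<^esub> ?d x \<in> carrier ?K"
    using dc module.smult_closed[OF k.kaehler_module] by blast
  show ?thesis
    unfolding derivation_def cot_d_def
  proof (intro conjI ballI)
    fix x assume "x \<in> carrier P"
    then show "tens P S e ?K (?d x) \<in> carrier (cot_term R S P e)" by (intro t.closed dc)
  next
    fix x y assume xy: "x \<in> carrier P" "y \<in> carrier P"
    show "tens P S e ?K (?d (x \<oplus>\<^bsub>P\<^esub> y)) = tens P S e ?K (?d x) \<oplus>\<^bsub>cot_term R S P e\<^esub> tens P S e ?K (?d y)"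
      by (simp only: da[OF xy] t.add[OF dc[OF xy(1)] dc[OF xy(2)]])
    show "tens P S e ?K (?d (x \<otimes>\<^bsub>P\<^esub> y)) = e x \<odot>\<^bsub>cot_term R S P e\<^esub> tens P S e ?K (?d y)
        \<oplus>\<^bsub>cot_term R S P e\<^esub> e y \<odot>\<^bsub>cot_term R S P e\<^esub> tens P S e ?K (?d x)"
      by (simp only: dm[OF xy] t.add[OF sc[OF xy] sc[OF xy(2,1)]] t.smult[OF xy(1) dc[OF xy(2)]]
          t.smult[OF xy(2) dc[OF xy(1)]])
  next
    fix r assume r: "r \<in> carrier R"
    show "tens P S e ?K (?d (poly_const R r)) = \<zero>\<^bsub>cot_term R S P e\<^esub>"
      by (simp only: d0[OF r] t.zero)
  qed
qed

lemmas cot_d_closed = bspec[OF cot_d_derivation[unfolded derivation_def, THEN conjunct1]]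

text \<open>Together with \<open>cot_ext\<close> this identifies the linear maps from \<open>\<Omega>\<^bsub>P|R\<^esub> \<otimes> S\<close> to \<open>M\<close> with the
  derivations from \<open>P\<close> to \<open>M\<close>; from here on cochains are handled as derivations.\<close>

lemma cot_lift:
  assumes M: "module S M" and D: "derivation R P (poly_const R) e M D"
  shows "\<exists>h. semilinear S id (cot_term R S P e) M h \<and> (\<forall>x\<in>carrier P. h (cot_d R S P e x) = D x)"
proof -
  obtain g where g: "semilinear P e (kaehler R P (poly_const R)) M g"
    "\<And>x. x \<in> carrier P \<Longrightarrow> g (kaehler_d R P (poly_const R) x) = D x"
    using k.kaehler_lift[OF M e_hom D] by blast
  from x.ext_scalars_lift[OF M g(1)] show ?thesis
    using g(2) k.d_derivation by (auto simp: cot_term_def cot_d_def derivation_def)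
qed

lemma cot_ext:
  assumes M: "module S M" and g: "semilinear S id (cot_term R S P e) M g" and h: "semilinear S id (cot_term R S P e) M h"
    and gens: "\<And>x. x \<in> carrier P \<Longrightarrow> g (cot_d R S P e x) = h (cot_d R S P e x)"
    and y: "y \<in> carrier (cot_term R S P e)"
  shows "g y = h y"
proof -
  let ?K = "kaehler R P (poly_const R)"
  let ?t = "tens P S e ?K"
  have comp: "semilinear P e ?K M (\<lambda>z. f (?t z))" if "semilinear S id (cot_term R S P e) M f" for f
    using that x.tens_semilinear ring_hom_closed[OF e_hom]
    by (simp add: semilinear_def cot_term_def)
  have "g (?t z) = h (?t z)" if "z \<in> carrier ?K" for z
    by (rule P.quotient_free_ext[OF k.q.quotient_axioms M e_hom, where g="\<lambda>z. g (?t z)" and h="\<lambda>z. h (?t z)",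
            folded kaehler_def kaehler_d_def])
       (use that gens comp[OF g] comp[OF h] in \<open>simp_all add: cot_d_def\<close>)
  note eq = this
  show ?thesis
    by (rule S.quotient_free_ext[OF x.q.quotient_axioms M id_ring_hom,
            folded ext_scalars_def cot_term_def tens_def, OF g h _ y])
       (rule eq)
qed

end

locale cot_map_setup = p: cot_setup R S P e + p1: cot_setup R1 S P1 e1
  for R :: "('r, 'q) ring_scheme" and S :: "('s, 't) ring_scheme" and P :: "('r, 'x) mpoly ring" and e
    and R1 :: "('r1, 'q1) ring_scheme" and P1 :: "('r1, 'y) mpoly ring" and e1 +
  fixes f :: "('r, 'x) mpoly \<Rightarrow> ('r1, 'y) mpoly"
  assumes f: "f \<in> ring_hom P P1"
    and f_const: "r \<in> carrier R \<Longrightarrow> f (poly_const R r) \<in> poly_const R1 ` carrier R1"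
    and f_over: "x \<in> carrier P \<Longrightarrow> e1 (f x) = e x"
begin

lemma kaehler_map:
  "semilinear P f (kaehler R P (poly_const R)) (kaehler R1 P1 (poly_const R1))
     (kaehler_map P R1 P1 (poly_const R1) f)"
  "x \<in> carrier P \<Longrightarrow>
     kaehler_map P R1 P1 (poly_const R1) f (kaehler_d R P (poly_const R) x) = kaehler_d R1 P1 (poly_const R1) (f x)"
proof -
  have fc: "f \<in> carrier P \<rightarrow> carrier P1" using ring_hom_closed[OF f] by auto
  note pf = p.P.push_forward_semilinear[OF p1.P.cring_axioms f fc]
  interpret L: semilinear_map P P1 p.k.FP p1.k.FP f "push_forward P P1 f f"
    by (intro semilinear_map.intro semilinear_map_axioms.intro p.k.F.module_axioms p1.k.F.module_axioms f pf(1))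
  have "kaehler_rel R P (poly_const R) \<subseteq> {x \<in> carrier p.k.FP. push_forward P P1 f f x \<in> kaehler_rel R1 P1 (poly_const R1)}"
    unfolding p.k.kaehler_rel_eq
  proof (rule p.k.F.gen_submodule_minimal[OF L.preimage_submodule[OF p1.k.q.N]], rule subsetI)
    fix y assume y: "y \<in> p.k.rels"
    then have yc: "y \<in> carrier p.k.FP" using p.k.rels_closed by blast
    have "push_forward P P1 f f y \<in> p1.k.rels"
      using y unfolding p.k.rels_def
    proof (elim UnE CollectE exE conjE)
      fix a b assume "y = free_gen P (a \<oplus>\<^bsub>P\<^esub> b) \<ominus>\<^bsub>p.k.FP\<^esub> (free_gen P a \<oplus>\<^bsub>p.k.FP\<^esub> free_gen P b)"
        and ab: "a \<in> carrier P" "b \<in> carrier P"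
      then have "push_forward P P1 f f y = free_gen P1 (f a \<oplus>\<^bsub>P1\<^esub> f b) \<ominus>\<^bsub>p1.k.FP\<^esub> (free_gen P1 (f a) \<oplus>\<^bsub>p1.k.FP\<^esub> free_gen P1 (f b))"
        by (simp add: L.minus L.add p.k.gen_closed pf(2) ring_hom_add[OF f])
      then show ?thesis using ab ring_hom_closed[OF f] unfolding p1.k.rels_def by blast
    next
      fix a b assume "y = free_gen P (a \<otimes>\<^bsub>P\<^esub> b) \<ominus>\<^bsub>p.k.FP\<^esub> (a \<odot>\<^bsub>p.k.FP\<^esub> free_gen P b \<oplus>\<^bsub>p.k.FP\<^esub> b \<odot>\<^bsub>p.k.FP\<^esub> free_gen P a)"
        and ab: "a \<in> carrier P" "b \<in> carrier P"
      then have "push_forward P P1 f f y = free_gen P1 (f a \<otimes>\<^bsub>P1\<^esub> f b) \<ominus>\<^bsub>p1.k.FP\<^esub>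
          (f a \<odot>\<^bsub>p1.k.FP\<^esub> free_gen P1 (f b) \<oplus>\<^bsub>p1.k.FP\<^esub> f b \<odot>\<^bsub>p1.k.FP\<^esub> free_gen P1 (f a))"
        by (simp add: L.minus L.add L.smult p.k.gen_closed pf(2) ring_hom_mult[OF f])
      then show ?thesis using ab ring_hom_closed[OF f] unfolding p1.k.rels_def by blast
    next
      fix r assume r: "y = free_gen P (poly_const R r)" "r \<in> carrier R"
      then have "push_forward P P1 f f y = free_gen P1 (f (poly_const R r))"
        by (simp add: pf(2) p.const_closed)
      then show ?thesis using f_const[OF r(2)] unfolding p1.k.rels_def by auto
    qed
    then show "y \<in> {x \<in> carrier p.k.FP. push_forward P P1 f f x \<in> kaehler_rel R1 P1 (poly_const R1)}"
      using yc p1.k.F.gen_submodule_incl p1.k.kaehler_rel_eq by blast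
  qed
  then have kN: "push_forward P P1 f f ` kaehler_rel R P (poly_const R) \<subseteq> kaehler_rel R1 P1 (poly_const R1)"
    by blast
  note qm = quot_map_cls[OF p.k.q.quotient_axioms p1.k.q.quotient_axioms f pf(1) kN]
  show "semilinear P f (kaehler R P (poly_const R)) (kaehler R1 P1 (poly_const R1))
     (kaehler_map P R1 P1 (poly_const R1) f)"
    unfolding kaehler_map_def kaehler_def by (rule qm(2))
  show "kaehler_map P R1 P1 (poly_const R1) f (kaehler_d R P (poly_const R) x) = kaehler_d R1 P1 (poly_const R1) (f x)"
    if "x \<in> carrier P"
    unfolding kaehler_map_def kaehler_d_def using qm(1)[OF p.k.gen_closed[OF that]] pf(2)[OF that] by simp
qed

lemma cot_map:
  "semilinear S id (cot_term R S P e) (cot_term R1 S P1 e1) (cot_map S P R1 P1 e1 f)"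
  "x \<in> carrier P \<Longrightarrow> cot_map S P R1 P1 e1 f (cot_d R S P e x) = cot_d R1 S P1 e1 (f x)"
proof -
  let ?g = "kaehler_map P R1 P1 (poly_const R1) f"
  let ?K = "kaehler R P (poly_const R)" and ?K1 = "kaehler R1 P1 (poly_const R1)"
  note g = kaehler_map
  have gc: "?g \<in> carrier ?K \<rightarrow> carrier ?K1" using semilinearD(1)[OF g(1)] by auto
  note pf = p.S.push_forward_semilinear[OF p.S.cring_axioms id_ring_hom gc]
  interpret L: semilinear_map S S p.x.FS p1.x.FS id "push_forward S S id ?g"
    by (intro semilinear_map.intro semilinear_map_axioms.intro p.x.F.module_axioms p1.x.F.module_axioms id_ring_hom pf(1))
  have "ext_scalars_rel P S e ?K \<subseteq> {x \<in> carrier p.x.FS. push_forward S S id ?g x \<in> ext_scalars_rel P1 S e1 ?K1}"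
    unfolding p.x.rel_eq
  proof (rule p.x.F.gen_submodule_minimal[OF L.preimage_submodule[OF p1.x.q.N]], rule subsetI)
    fix y assume y: "y \<in> p.x.rels"
    then have yc: "y \<in> carrier p.x.FS" using p.x.rels_closed by blast
    have "push_forward S S id ?g y \<in> p1.x.rels"
      using y unfolding p.x.rels_def
    proof (elim UnE CollectE exE conjE)
      fix a b assume "y = free_gen S (a \<oplus>\<^bsub>?K\<^esub> b) \<ominus>\<^bsub>p.x.FS\<^esub> (free_gen S a \<oplus>\<^bsub>p.x.FS\<^esub> free_gen S b)"
        and ab: "a \<in> carrier ?K" "b \<in> carrier ?K"
      then have "push_forward S S id ?g y = free_gen S (?g a \<oplus>\<^bsub>?K1\<^esub> ?g b) \<ominus>\<^bsub>p1.x.FS\<^esub> (free_gen S (?g a) \<oplus>\<^bsub>p1.x.FS\<^esub> free_gen S (?g b))"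
        by (simp add: L.minus L.add p.x.gen_closed pf(2) semilinearD[OF g(1)])
      then show ?thesis using ab semilinearD(1)[OF g(1)] unfolding p1.x.rels_def by blast
    next
      fix q a assume "y = free_gen S (q \<odot>\<^bsub>?K\<^esub> a) \<ominus>\<^bsub>p.x.FS\<^esub> (e q \<odot>\<^bsub>p.x.FS\<^esub> free_gen S a)"
        and qa: "q \<in> carrier P" "a \<in> carrier ?K"
      then have "push_forward S S id ?g y = free_gen S (f q \<odot>\<^bsub>?K1\<^esub> ?g a) \<ominus>\<^bsub>p1.x.FS\<^esub> (e1 (f q) \<odot>\<^bsub>p1.x.FS\<^esub> free_gen S (?g a))"
        by (simp add: L.minus L.smult p.x.gen_closed pf(2) semilinearD[OF g(1)] f_over ring_hom_closed[OF p.e_hom])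
      then show ?thesis using qa semilinearD(1)[OF g(1)] ring_hom_closed[OF f] unfolding p1.x.rels_def by blast
    qed
    then show "y \<in> {x \<in> carrier p.x.FS. push_forward S S id ?g x \<in> ext_scalars_rel P1 S e1 ?K1}"
      using yc p1.x.F.gen_submodule_incl p1.x.rel_eq by blast
  qed
  then have kN: "push_forward S S id ?g ` ext_scalars_rel P S e ?K \<subseteq> ext_scalars_rel P1 S e1 ?K1"
    by blast
  note qm = quot_map_cls[OF p.x.q.quotient_axioms p1.x.q.quotient_axioms id_ring_hom pf(1) kN]
  show "semilinear S id (cot_term R S P e) (cot_term R1 S P1 e1) (cot_map S P R1 P1 e1 f)"
    unfolding cot_map_def cot_term_def ext_scalars_map_def ext_scalars_def by (rule qm(2))
  show "cot_map S P R1 P1 e1 f (cot_d R S P e x) = cot_d R1 S P1 e1 (f x)" if "x \<in> carrier P"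
  proof -
    have d: "kaehler_d R P (poly_const R) x \<in> carrier ?K"
      using p.k.d_derivation that by (simp add: derivation_def)
    show ?thesis
      unfolding cot_map_def ext_scalars_map_def cot_d_def tens_def
      using qm(1)[OF p.x.gen_closed[OF d]] pf(2)[OF d] g(2)[OF that] by simp
  qed
qed

end

section \<open>The simplicial resolution in low degrees\<close>

lemma comp_ring_hom: "\<lbrakk>f \<in> ring_hom R S; g \<in> ring_hom S T\<rbrakk> \<Longrightarrow> (\<lambda>x. g (f x)) \<in> ring_hom R T"
  using ring_hom_trans[of f R S g T] by (simp add: comp_def)

context cring
begin

lemma bar_lift_hom: "f \<in> V \<rightarrow> W \<Longrightarrow> bar_lift R f \<in> ring_hom (poly_alg R V) (poly_alg R W)"
  unfolding bar_lift_def by (rule poly_map_hom[OF cring_axioms cring_axioms id_ring_hom])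

lemma bar_lift_const: "r \<in> carrier R \<Longrightarrow> bar_lift R f (poly_const R r) = poly_const R r"
  unfolding bar_lift_def using poly_map_const[OF cring_axioms cring_axioms id_ring_hom] by simp

lemma bar_lift_var: "bar_lift R f (free_gen R {#x#}) = free_gen R {#f x#}"
  unfolding bar_lift_def by (rule poly_map_var[OF cring_axioms cring_axioms id_ring_hom])

lemma bar_lift_square:
  assumes "f \<in> V \<rightarrow> W" "g \<in> W \<rightarrow> U" "f' \<in> V \<rightarrow> W'" "g' \<in> W' \<rightarrow> U"
    and "\<And>x. x \<in> V \<Longrightarrow> g (f x) = g' (f' x)" and p: "p \<in> carrier (poly_alg R V)"
  shows "bar_lift R g (bar_lift R f p) = bar_lift R g' (bar_lift R f' p)"
  by (rule poly_hom_ext[OF poly_alg_cring comp_ring_hom[OF bar_lift_hom[OF assms(1)] bar_lift_hom[OF assms(2)]]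
        comp_ring_hom[OF bar_lift_hom[OF assms(3)] bar_lift_hom[OF assms(4)]] _ _ p])
     (simp_all add: bar_lift_const bar_lift_var assms(5))

lemma poly_counit_hom:
  assumes "cring T" "h \<in> ring_hom R T"
  shows "poly_counit R T h \<in> ring_hom (poly_alg R (carrier T)) T"
  unfolding poly_counit_eq_poly_eval by (rule poly_eval_hom[OF assms]) auto

lemma poly_counit_const:
  assumes "cring T" "h \<in> ring_hom R T" "r \<in> carrier R"
  shows "poly_counit R T h (poly_const R r) = h r"
  unfolding poly_counit_eq_poly_eval by (rule poly_eval_const[OF assms(1,2) _ assms(3), of _ "carrier T"]) auto

lemma poly_counit_var:
  assumes "cring T" "h \<in> ring_hom R T" "x \<in> carrier T"
  shows "poly_counit R T h (free_gen R {#x#}) = x"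
  unfolding poly_counit_eq_poly_eval by (rule poly_eval_var[OF assms(1,2) _ assms(3)]) auto

text \<open>Naturality of the counit: both sides are ring homomorphisms that agree on constants and variables.\<close>

lemma poly_counit_natural:
  assumes T: "cring T" and T1: "cring T1" and h: "h \<in> ring_hom R T" and h1: "h1 \<in> ring_hom R T1"
    and f: "f \<in> ring_hom T T1" and fh: "\<And>r. r \<in> carrier R \<Longrightarrow> f (h r) = h1 r"
    and p: "p \<in> carrier (poly_alg R (carrier T))"
  shows "poly_counit R T1 h1 (bar_lift R f p) = f (poly_counit R T h p)"
proof -
  have fc: "f \<in> carrier T \<rightarrow> carrier T1" using ring_hom_closed[OF f] by auto
  show ?thesis
    by (rule poly_hom_ext[OF T1 comp_ring_hom[OF bar_lift_hom[OF fc] poly_counit_hom[OF T1 h1]]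
          comp_ring_hom[OF poly_counit_hom[OF T h] f] _ _ p])
       (simp_all add: bar_lift_const bar_lift_var poly_counit_const[OF T1 h1] poly_counit_const[OF T h]
          poly_counit_var[OF T1 h1] poly_counit_var[OF T h] ring_hom_closed[OF f] fh)
qed

end

locale bar = R: cring R + S: cring S
  for R :: "('r, 'q) ring_scheme" and S :: "('s, 't) ring_scheme" +
  fixes h :: "'r \<Rightarrow> 's"
  assumes h: "h \<in> ring_hom R S"
begin

abbreviation "P0 \<equiv> bar0 R S"
abbreviation "P1 \<equiv> bar1 R S"
abbreviation "P2 \<equiv> bar2 R S"
abbreviation "P3 \<equiv> bar3 R S"
abbreviation "\<epsilon> \<equiv> counit0 R S h"
abbreviation "d10 \<equiv> counit1 R S"
abbreviation "d11 \<equiv> bar_lift R (counit0 R S h)"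
abbreviation "d20 \<equiv> counit2 R S"
abbreviation "d21 \<equiv> bar_lift R (counit1 R S)"
abbreviation "d22 \<equiv> bar_lift R (bar_lift R (counit0 R S h))"
abbreviation "d30 \<equiv> counit3 R S"
abbreviation "d31 \<equiv> bar_lift R (counit2 R S)"
abbreviation "d32 \<equiv> bar_lift R (bar_lift R (counit1 R S))"
abbreviation "d33 \<equiv> bar_lift R (bar_lift R (bar_lift R (counit0 R S h)))"
abbreviation var :: "'x \<Rightarrow> ('r, 'x) mpoly" where "var x \<equiv> free_gen R {#x#}"

lemma bar_crings: "cring P0" "cring P1" "cring P2" "cring P3"
  by (simp_all add: bar0_def bar1_def bar2_def bar3_def R.poly_alg_cring)

lemma const_homs:
  "poly_const R \<in> ring_hom R P0" "poly_const R \<in> ring_hom R P1"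
  "poly_const R \<in> ring_hom R P2" "poly_const R \<in> ring_hom R P3"
  by (simp_all add: bar0_def bar1_def bar2_def bar3_def R.poly_const_hom)

lemma var_closed:
  "c \<in> carrier S \<Longrightarrow> var c \<in> carrier P0" "p \<in> carrier P0 \<Longrightarrow> var p \<in> carrier P1"
  "q \<in> carrier P1 \<Longrightarrow> var q \<in> carrier P2"
  by (simp_all add: bar0_def[of R S] bar1_def[of R S] bar2_def[of R S] R.poly_var_closed)

lemma \<epsilon>_hom: "\<epsilon> \<in> ring_hom P0 S"
  unfolding bar0_def counit0_def by (rule R.poly_counit_hom[OF S.cring_axioms h])

lemma hom_Pi: "f \<in> ring_hom T T' \<Longrightarrow> f \<in> carrier T \<rightarrow> carrier T'"
  by (auto simp: ring_hom_closed)

lemma d1_homs: "d10 \<in> ring_hom P1 P0" "d11 \<in> ring_hom P1 P0"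
proof -
  show "d10 \<in> ring_hom P1 P0"
    unfolding bar1_def counit1_def by (rule R.poly_counit_hom[OF bar_crings(1) const_homs(1)])
  show "d11 \<in> ring_hom P1 P0"
    unfolding bar1_def using R.bar_lift_hom[OF hom_Pi[OF \<epsilon>_hom]] by (simp add: bar0_def)
qed

lemma d2_homs: "d20 \<in> ring_hom P2 P1" "d21 \<in> ring_hom P2 P1" "d22 \<in> ring_hom P2 P1"
proof -
  show "d20 \<in> ring_hom P2 P1"
    unfolding bar2_def counit2_def by (rule R.poly_counit_hom[OF bar_crings(2) const_homs(2)])
  show "d21 \<in> ring_hom P2 P1" "d22 \<in> ring_hom P2 P1"
    unfolding bar2_def using d1_homs[THEN hom_Pi, THEN R.bar_lift_hom] by (simp_all add: bar1_def)
qed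

lemma d3_homs: "d30 \<in> ring_hom P3 P2" "d31 \<in> ring_hom P3 P2" "d32 \<in> ring_hom P3 P2" "d33 \<in> ring_hom P3 P2"
proof -
  show "d30 \<in> ring_hom P3 P2"
    unfolding bar3_def counit3_def by (rule R.poly_counit_hom[OF bar_crings(3) const_homs(3)])
  show "d31 \<in> ring_hom P3 P2" "d32 \<in> ring_hom P3 P2" "d33 \<in> ring_hom P3 P2"
    unfolding bar3_def using d2_homs[THEN hom_Pi, THEN R.bar_lift_hom] by (simp_all add: bar2_def)
qed

lemma \<epsilon>_const: "r \<in> carrier R \<Longrightarrow> \<epsilon> (poly_const R r) = h r"
  and \<epsilon>_var: "c \<in> carrier S \<Longrightarrow> \<epsilon> (var c) = c"
  unfolding counit0_def
  by (simp_all add: R.poly_counit_const[OF S.cring_axioms h] R.poly_counit_var[OF S.cring_axioms h])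

lemma d10_const: "r \<in> carrier R \<Longrightarrow> d10 (poly_const R r) = poly_const R r"
  and d10_var: "p \<in> carrier P0 \<Longrightarrow> d10 (var p) = p"
  unfolding counit1_def
  by (simp_all add: R.poly_counit_const[OF bar_crings(1) const_homs(1)] R.poly_counit_var[OF bar_crings(1) const_homs(1)])

lemma d20_const: "r \<in> carrier R \<Longrightarrow> d20 (poly_const R r) = poly_const R r"
  and d20_var: "p \<in> carrier P1 \<Longrightarrow> d20 (var p) = p"
  unfolding counit2_def
  by (simp_all add: R.poly_counit_const[OF bar_crings(2) const_homs(2)] R.poly_counit_var[OF bar_crings(2) const_homs(2)])

lemma d30_const: "r \<in> carrier R \<Longrightarrow> d30 (poly_const R r) = poly_const R r"
  unfolding counit3_def by (rule R.poly_counit_const[OF bar_crings(3) const_homs(3)])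

lemma \<epsilon>_d1: "q \<in> carrier P1 \<Longrightarrow> \<epsilon> (d11 q) = \<epsilon> (d10 q)"
  unfolding counit1_def counit0_def[of R S h]
  by (rule R.poly_counit_natural[OF bar_crings(1) S.cring_axioms const_homs(1) h \<epsilon>_hom[unfolded counit0_def]])
     (simp_all add: \<epsilon>_const[unfolded counit0_def] bar1_def)

lemma natural1:
  assumes "f \<in> ring_hom P1 P0" "\<And>r. r \<in> carrier R \<Longrightarrow> f (poly_const R r) = poly_const R r" "p \<in> carrier P2"
  shows "d10 (bar_lift R f p) = f (d20 p)"
  unfolding counit1_def[of R S] counit2_def
  by (rule R.poly_counit_natural[OF bar_crings(2,1) const_homs(2,1) assms(1)]) (use assms in \<open>simp_all add: bar2_def\<close>)

lemma natural2:
  assumes "f \<in> ring_hom P2 P1" "\<And>r. r \<in> carrier R \<Longrightarrow> f (poly_const R r) = poly_const R r" "p \<in> carrier P3"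
  shows "d20 (bar_lift R f p) = f (d30 p)"
  unfolding counit2_def[of R S] counit3_def
  by (rule R.poly_counit_natural[OF bar_crings(3,2) const_homs(3,2) assms(1)]) (use assms in \<open>simp_all add: bar3_def\<close>)

lemma simplicial1:
  assumes p: "p \<in> carrier P2"
  shows "d10 (d21 p) = d10 (d20 p)" "d10 (d22 p) = d11 (d20 p)" "d11 (d22 p) = d11 (d21 p)"
proof -
  show "d10 (d21 p) = d10 (d20 p)" by (rule natural1[OF d1_homs(1) d10_const p])
  show "d10 (d22 p) = d11 (d20 p)" by (rule natural1[OF d1_homs(2) R.bar_lift_const p])
  show "d11 (d22 p) = d11 (d21 p)"
    by (rule R.bar_lift_square[OF hom_Pi[OF d1_homs(2)] hom_Pi[OF \<epsilon>_hom] hom_Pi[OF d1_homs(1)] hom_Pi[OF \<epsilon>_hom]])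
       (use p in \<open>simp_all add: \<epsilon>_d1 bar2_def\<close>)
qed

lemma simplicial2:
  assumes p: "p \<in> carrier P3"
  shows "d20 (d31 p) = d20 (d30 p)" "d20 (d32 p) = d21 (d30 p)" "d20 (d33 p) = d22 (d30 p)"
    "d21 (d32 p) = d21 (d31 p)" "d21 (d33 p) = d22 (d31 p)" "d22 (d33 p) = d22 (d32 p)"
proof -
  show "d20 (d31 p) = d20 (d30 p)" by (rule natural2[OF d2_homs(1) d20_const p])
  show "d20 (d32 p) = d21 (d30 p)" by (rule natural2[OF d2_homs(2) R.bar_lift_const p])
  show "d20 (d33 p) = d22 (d30 p)" by (rule natural2[OF d2_homs(3) R.bar_lift_const p])
  have p': "p \<in> carrier (poly_alg R (carrier P2))" using p by (simp add: bar3_def)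
  note H = d1_homs[THEN hom_Pi] d2_homs[THEN hom_Pi]
  show "d21 (d32 p) = d21 (d31 p)"
    by (rule R.bar_lift_square[OF H(4,1,3,1) _ p']) (rule simplicial1)
  show "d21 (d33 p) = d22 (d31 p)"
    by (rule R.bar_lift_square[OF H(5,1,3,2) _ p']) (rule simplicial1)
  show "d22 (d33 p) = d22 (d32 p)"
    by (rule R.bar_lift_square[OF H(5,2,4,2) _ p']) (rule simplicial1)
qed

abbreviation "a1 \<equiv> aug1 R S h"
abbreviation "a2 \<equiv> aug2 R S h"
abbreviation "a3 \<equiv> aug3 R S h"

lemma aug_homs: "a1 \<in> ring_hom P1 S" "a2 \<in> ring_hom P2 S" "a3 \<in> ring_hom P3 S"
proof -
  show 1: "a1 \<in> ring_hom P1 S" unfolding aug1_def by (rule ring_hom_trans[OF d1_homs(1) \<epsilon>_hom])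
  show 2: "a2 \<in> ring_hom P2 S" unfolding aug2_def by (rule ring_hom_trans[OF d2_homs(1) 1])
  show "a3 \<in> ring_hom P3 S" unfolding aug3_def by (rule ring_hom_trans[OF d3_homs(1) 2])
qed

lemma aug1_eq: "a1 q = \<epsilon> (d10 q)" by (simp add: aug1_def)

lemma aug1_const: "r \<in> carrier R \<Longrightarrow> a1 (poly_const R r) = h r"
  by (simp add: aug1_def d10_const \<epsilon>_const)

lemma aug2_faces:
  assumes p: "p \<in> carrier P2"
  shows "a1 (d20 p) = a2 p" "a1 (d21 p) = a2 p" "a1 (d22 p) = a2 p"
  using simplicial1[OF p] \<epsilon>_d1 ring_hom_closed[OF d2_homs(1) p]
  by (simp_all add: aug2_def aug1_def)

lemma aug3_faces:
  assumes p: "p \<in> carrier P3"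
  shows "a2 (d30 p) = a3 p" "a2 (d31 p) = a3 p" "a2 (d32 p) = a3 p" "a2 (d33 p) = a3 p"
  using simplicial2[OF p] aug2_faces[of "d30 p"] ring_hom_closed[OF d3_homs(1) p]
  by (simp_all add: aug3_def aug2_def)

lemma cot_setups: "cot_setup R S P1 a1" "cot_setup R S P2 a2" "cot_setup R S P3 a3"
  by (intro cot_setup.intro cot_setup_axioms.intro bar_crings S.cring_axioms aug_homs
      ring_hom_closed[OF const_homs(2)] ring_hom_closed[OF const_homs(3)] ring_hom_closed[OF const_homs(4)]; assumption)+

lemma cot_eqs: "cot1 R S h = cot_term R S P1 a1" "cot2 R S h = cot_term R S P2 a2" "cot3 R S h = cot_term R S P3 a3"
  by (simp_all add: cot1_def cot2_def cot3_def)

lemma face2_setup: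
  assumes "f \<in> ring_hom P2 P1" "\<And>r. r \<in> carrier R \<Longrightarrow> f (poly_const R r) = poly_const R r"
    "\<And>p. p \<in> carrier P2 \<Longrightarrow> a1 (f p) = a2 p"
  shows "cot_map_setup R S P2 a2 R P1 a1 f"
  by (intro cot_map_setup.intro cot_map_setup_axioms.intro cot_setups(2) cot_setups(1))
     (use assms in auto)

lemma face3_setup:
  assumes "f \<in> ring_hom P3 P2" "\<And>r. r \<in> carrier R \<Longrightarrow> f (poly_const R r) = poly_const R r"
    "\<And>p. p \<in> carrier P3 \<Longrightarrow> a2 (f p) = a3 p"
  shows "cot_map_setup R S P3 a3 R P2 a2 f"
  by (intro cot_map_setup.intro cot_map_setup_axioms.intro cot_setups(3) cot_setups(2))
     (use assms in auto)

lemma face2: "cot_map_setup R S P2 a2 R P1 a1 d20" "cot_map_setup R S P2 a2 R P1 a1 d21"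
    "cot_map_setup R S P2 a2 R P1 a1 d22"
  by (rule face2_setup; simp add: d2_homs d20_const R.bar_lift_const aug2_faces)+

lemma face3: "cot_map_setup R S P3 a3 R P2 a2 d30" "cot_map_setup R S P3 a3 R P2 a2 d31"
    "cot_map_setup R S P3 a3 R P2 a2 d32" "cot_map_setup R S P3 a3 R P2 a2 d33"
  by (rule face3_setup; simp add: d3_homs d30_const R.bar_lift_const aug3_faces)+

end

section \<open>Cocycles and coboundaries as derivations\<close>

lemma hom_module_carrier:
  "\<phi> \<in> carrier (hom_module S L M) \<longleftrightarrow> \<phi> \<in> extensional (carrier L) \<and> semilinear S id L M \<phi>"
  by (auto simp: hom_module_def semilinear_def PiE_def)

lemma hom_module_restrict:
  assumes "module S L" "semilinear S id L M g"
  shows "restrict g (carrier L) \<in> carrier (hom_module S L M)"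
proof -
  interpret L: module S L by fact
  show ?thesis using assms(2) by (simp add: hom_module_carrier semilinear_def)
qed

lemma semilinear_comp:
  "\<lbrakk>semilinear S id L M f; semilinear S id M N g\<rbrakk> \<Longrightarrow> semilinear S id L N (\<lambda>x. g (f x))"
  by (simp add: semilinear_def)

lemma semilinear_alternating:
  assumes M: "module S M"
    and f: "semilinear S id L M f0" "semilinear S id L M f1" "semilinear S id L M f2" "semilinear S id L M f3"
  shows "semilinear S id L M (\<lambda>x. f0 x \<ominus>\<^bsub>M\<^esub> f1 x \<oplus>\<^bsub>M\<^esub> f2 x \<ominus>\<^bsub>M\<^esub> f3 x)"
proof -
  interpret M: module S M by (rule M)
  show ?thesis
    using f by (simp add: semilinear_def a_minus_def M.smult_r_distr M.smult_r_minus M.minus_add M.a_ac)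
qed

context bar
begin

text \<open>The cocycle condition is one between linear maps on the cotangent module of \<open>P3\<close>, so it can be
  tested on the universal derivation, where it is the alternating sum of \<open>\<Delta>\<close> over the faces.\<close>

lemma cocycle_of_derivation:
  assumes M: "module S M" and \<Delta>: "derivation R P2 (poly_const R) a2 M \<Delta>"
    and cocycle: "\<And>x. x \<in> carrier P3 \<Longrightarrow>
      \<Delta> (d30 x) \<ominus>\<^bsub>M\<^esub> \<Delta> (d31 x) \<oplus>\<^bsub>M\<^esub> \<Delta> (d32 x) \<ominus>\<^bsub>M\<^esub> \<Delta> (d33 x) = \<zero>\<^bsub>M\<^esub>"
  shows "\<exists>\<phi>\<in>aq_cocycles2 R S h M. \<forall>x\<in>carrier P2. \<phi> (cot_d R S P2 a2 x) = \<Delta> x"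
proof -
  interpret M: module S M by (rule M)
  obtain g where g: "semilinear S id (cot2 R S h) M g" and g\<Delta>: "\<And>x. x \<in> carrier P2 \<Longrightarrow> g (cot_d R S P2 a2 x) = \<Delta> x"
    using cot_setup.cot_lift[OF cot_setups(2) M \<Delta>] unfolding cot_eqs by blast
  define \<phi> where "\<phi> = restrict g (carrier (cot2 R S h))"
  have \<phi>: "\<phi> \<in> carrier (hom_module S (cot2 R S h) M)"
    unfolding \<phi>_def by (rule hom_module_restrict[OF _ g]) (simp add: cot_eqs cot_setup.cot_term_module[OF cot_setups(2)])
  have \<phi>s: "semilinear S id (cot2 R S h) M \<phi>" using \<phi> by (simp add: hom_module_carrier)
  have \<phi>\<Delta>: "\<phi> (cot_d R S P2 a2 x) = \<Delta> x" if "x \<in> carrier P2" for x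
    using g\<Delta>[OF that] cot_setup.cot_d_closed[OF cot_setups(2) that] by (simp add: \<phi>_def cot_eqs)
  interpret T2: module S "cot2 R S h" unfolding cot_eqs by (rule cot_setup.cot_term_module[OF cot_setups(2)])
  interpret F: semilinear_map S S "cot2 R S h" M id \<phi>
    by (intro semilinear_map.intro semilinear_map_axioms.intro T2.module_axioms M id_ring_hom \<phi>s)
  let ?D = "cot_map S P3 R P2 a2"
  note fs = face3[THEN cot_map_setup.cot_map(1), folded cot_eqs]
  note fd = face3[THEN cot_map_setup.cot_map(2)]
  have "\<phi> (cot_diff3 R S h y) = \<zero>\<^bsub>M\<^esub>" if y: "y \<in> carrier (cot3 R S h)" for y
  proof -
    note cl = fs[THEN semilinearD(1), OF y]
    have "\<phi> (cot_diff3 R S h y) = \<phi> (?D d30 y) \<ominus>\<^bsub>M\<^esub> \<phi> (?D d31 y) \<oplus>\<^bsub>M\<^esub> \<phi> (?D d32 y) \<ominus>\<^bsub>M\<^esub> \<phi> (?D d33 y)"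
      using cl by (simp add: cot_diff3_def Let_def F.minus F.add)
    also have "\<dots> = \<zero>\<^bsub>M\<^esub>"
    proof (rule cot_setup.cot_ext[OF cot_setups(3) M semilinear_alternating[OF M], where h="\<lambda>_. \<zero>\<^bsub>M\<^esub>"])
      show "semilinear S id (cot_term R S P3 a3) M (\<lambda>_. \<zero>\<^bsub>M\<^esub>)" by (simp add: semilinear_def)
      show "y \<in> carrier (cot_term R S P3 a3)" using y by (simp add: cot_eqs)
      fix x assume x: "x \<in> carrier P3"
      note dx = d3_homs[THEN ring_hom_closed, OF x]
      show "\<phi> (?D d30 (cot_d R S P3 a3 x)) \<ominus>\<^bsub>M\<^esub> \<phi> (?D d31 (cot_d R S P3 a3 x)) \<oplus>\<^bsub>M\<^esub> \<phi> (?D d32 (cot_d R S P3 a3 x))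
          \<ominus>\<^bsub>M\<^esub> \<phi> (?D d33 (cot_d R S P3 a3 x)) = \<zero>\<^bsub>M\<^esub>"
        using cocycle[OF x] by (simp only: fd[OF x] dx[THEN \<phi>\<Delta>])
    qed (use fs[THEN semilinear_comp[OF _ \<phi>s]] in \<open>simp_all only: cot_eqs\<close>)
    finally show ?thesis .
  qed
  then have "\<phi> \<in> aq_cocycles2 R S h M"
    using \<phi> by (auto simp: aq_cocycles2_def hom_pull_def hom_module_def[of S "cot3 R S h"] intro!: restrict_ext)
  then show ?thesis using \<phi>\<Delta> by blast
qed

text \<open>The coboundary is recorded on the variables of \<open>P2\<close> only: there the faces of \<open>var q\<close> are \<open>q\<close>,
  \<open>var (d10 q)\<close> and \<open>var (d11 q)\<close>, and the formula involves nothing but \<open>P1\<close>.\<close>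

lemma derivation_of_coboundary:
  assumes M: "module S M" and \<chi>: "\<chi> \<in> aq_coboundaries2 R S h M"
  shows "\<exists>E. derivation R P1 (poly_const R) a1 M E \<and>
    (\<forall>q\<in>carrier P1. \<chi> (cot_d R S P2 a2 (var q)) = E q \<ominus>\<^bsub>M\<^esub> E (var (d10 q)) \<oplus>\<^bsub>M\<^esub> E (var (d11 q)))"
proof -
  interpret M: module S M by (rule M)
  obtain \<psi> where \<psi>: "\<psi> \<in> carrier (hom_module S (cot1 R S h) M)"
    and \<chi>\<psi>: "\<chi> = hom_pull (cot2 R S h) (cot_diff2 R S h) \<psi>"
    using \<chi> by (auto simp: aq_coboundaries2_def)
  have \<psi>s: "semilinear S id (cot1 R S h) M \<psi>" using \<psi> by (simp add: hom_module_carrier)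
  interpret T1: module S "cot1 R S h" unfolding cot_eqs by (rule cot_setup.cot_term_module[OF cot_setups(1)])
  interpret F: semilinear_map S S "cot1 R S h" M id \<psi>
    by (intro semilinear_map.intro semilinear_map_axioms.intro T1.module_axioms M id_ring_hom \<psi>s)
  define E where "E q = \<psi> (cot_d R S P1 a1 q)" for q
  have "derivation R P1 (poly_const R) a1 M E"
    using cot_setup.cot_d_derivation[OF cot_setups(1), folded cot_eqs] ring_hom_closed[OF aug_homs(1)]
    by (simp add: derivation_def E_def F.closed F.add F.smult F.zero)
  moreover have "\<chi> (cot_d R S P2 a2 (var q)) = E q \<ominus>\<^bsub>M\<^esub> E (var (d10 q)) \<oplus>\<^bsub>M\<^esub> E (var (d11 q))"
    if q: "q \<in> carrier P1" for q
  proof -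
    have v: "var q \<in> carrier P2" using q by (rule var_closed)
    have c: "cot_d R S P1 a1 x \<in> carrier (cot1 R S h)" if "x \<in> carrier P1" for x
      using cot_setup.cot_d_closed[OF cot_setups(1) that] by (simp add: cot_eqs)
    have "\<chi> (cot_d R S P2 a2 (var q)) = \<psi> (cot_diff2 R S h (cot_d R S P2 a2 (var q)))"
      using cot_setup.cot_d_closed[OF cot_setups(2) v] by (simp add: \<chi>\<psi> hom_pull_def cot_eqs)
    also have "cot_diff2 R S h (cot_d R S P2 a2 (var q)) =
        cot_d R S P1 a1 q \<ominus>\<^bsub>cot1 R S h\<^esub> cot_d R S P1 a1 (var (d10 q)) \<oplus>\<^bsub>cot1 R S h\<^esub> cot_d R S P1 a1 (var (d11 q))"
      unfolding cot_diff2_def Let_def face2[THEN cot_map_setup.cot_map(2), OF v] R.bar_lift_var d20_var[OF q] ..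
    also have "\<psi> \<dots> = E q \<ominus>\<^bsub>M\<^esub> E (var (d10 q)) \<oplus>\<^bsub>M\<^esub> E (var (d11 q))"
      using q ring_hom_closed[OF d1_homs(1) q] ring_hom_closed[OF d1_homs(2) q] var_closed(2)
      by (simp add: E_def F.minus F.add c)
    finally show ?thesis .
  qed
  ultimately show ?thesis by blast
qed

end

section \<open>Change of the base ring\<close>

text \<open>A map \<open>R1 \<rightarrow> R\<close> over \<open>S\<close> acts on the standard resolutions through the coefficients; the maps \<open>bc0\<close>, \<open>bc1\<close>
  and \<open>bc2\<close> below commute with faces and augmentations.\<close>

locale bar_change = b1: bar R1 S h1 + b: bar R S h
  for R1 :: "('r1, 'q1) ring_scheme" and R :: "('r, 'q) ring_scheme" and S :: "('s, 't) ring_scheme" and h1 h +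
  fixes \<pi> :: "'r1 \<Rightarrow> 'r"
  assumes \<pi>: "\<pi> \<in> ring_hom R1 R" and h_\<pi>: "r \<in> carrier R1 \<Longrightarrow> h (\<pi> r) = h1 r"
begin

abbreviation "bc0 \<equiv> poly_map R1 R \<pi> id"
abbreviation "bc1 \<equiv> poly_map R1 R \<pi> bc0"
abbreviation "bc2 \<equiv> bar2_base_change R1 R \<pi>"

lemma bc_homs: "bc0 \<in> ring_hom (bar0 R1 S) (bar0 R S)" "bc1 \<in> ring_hom (bar1 R1 S) (bar1 R S)"
  "bc2 \<in> ring_hom (bar2 R1 S) (bar2 R S)"
proof -
  note h = poly_map_hom[OF b1.R.cring_axioms b.R.cring_axioms \<pi>]
  show 0: "bc0 \<in> ring_hom (bar0 R1 S) (bar0 R S)" unfolding bar0_def by (rule h) simp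
  show 1: "bc1 \<in> ring_hom (bar1 R1 S) (bar1 R S)" unfolding bar1_def by (rule h[OF b.hom_Pi[OF 0]])
  show "bc2 \<in> ring_hom (bar2 R1 S) (bar2 R S)" unfolding bar2_def bar2_base_change_def by (rule h[OF b.hom_Pi[OF 1]])
qed

lemmas bc_const = poly_map_const[OF b1.R.cring_axioms b.R.cring_axioms \<pi>]
lemmas bc_var = poly_map_var[OF b1.R.cring_axioms b.R.cring_axioms \<pi>]

lemma bc2_var: "bc2 (b1.var q) = b.var (bc1 q)"
  unfolding bar2_base_change_def by (rule bc_var)

lemma \<epsilon>_bc: "p \<in> carrier (bar0 R1 S) \<Longrightarrow> b.\<epsilon> (bc0 p) = b1.\<epsilon> p"
  unfolding bar0_def
  by (rule b1.R.poly_hom_ext[OF b1.S.cring_axioms comp_ring_hom[OF bc_homs(1) b.\<epsilon>_hom, unfolded bar0_def]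
        b1.\<epsilon>_hom[unfolded bar0_def]])
     (simp_all add: bc_const bc_var b.\<epsilon>_const b1.\<epsilon>_const b.\<epsilon>_var b1.\<epsilon>_var h_\<pi> ring_hom_closed[OF \<pi>])

lemma d1_bc:
  assumes q: "q \<in> carrier (bar1 R1 S)"
  shows "b.d10 (bc1 q) = bc0 (b1.d10 q)" "b.d11 (bc1 q) = bc0 (b1.d11 q)"
proof -
  have q': "q \<in> carrier (poly_alg R1 (carrier (bar0 R1 S)))" using q by (simp add: bar1_def)
  show "b.d10 (bc1 q) = bc0 (b1.d10 q)"
    by (rule b1.R.poly_hom_ext[OF b.bar_crings(1) comp_ring_hom[OF bc_homs(2) b.d1_homs(1), unfolded bar1_def]
          comp_ring_hom[OF b1.d1_homs(1) bc_homs(1), unfolded bar1_def] _ _ q'])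
       (simp_all add: bc_const bc_var b.d10_const b1.d10_const b.d10_var b1.d10_var
          ring_hom_closed[OF \<pi>] ring_hom_closed[OF bc_homs(1)])
  show "b.d11 (bc1 q) = bc0 (b1.d11 q)"
    by (rule b1.R.poly_hom_ext[OF b.bar_crings(1) comp_ring_hom[OF bc_homs(2) b.d1_homs(2), unfolded bar1_def]
          comp_ring_hom[OF b1.d1_homs(2) bc_homs(1), unfolded bar1_def] _ _ q'])
       (simp_all add: bc_const bc_var b.R.bar_lift_const b1.R.bar_lift_const b.R.bar_lift_var b1.R.bar_lift_var
          ring_hom_closed[OF \<pi>] \<epsilon>_bc)
qed

lemma d20_bc:
  assumes q: "q \<in> carrier (bar2 R1 S)"
  shows "b.d20 (bc2 q) = bc1 (b1.d20 q)"
proof -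
  have q': "q \<in> carrier (poly_alg R1 (carrier (bar1 R1 S)))" using q by (simp add: bar2_def)
  show ?thesis
    by (rule b1.R.poly_hom_ext[OF b.bar_crings(2) comp_ring_hom[OF bc_homs(3) b.d2_homs(1), unfolded bar2_def]
          comp_ring_hom[OF b1.d2_homs(1) bc_homs(2), unfolded bar2_def] _ _ q'])
       (simp_all add: bar2_base_change_def bc_const bc_var b.d20_const b1.d20_const b.d20_var b1.d20_var
          ring_hom_closed[OF \<pi>] ring_hom_closed[OF bc_homs(2)])
qed

lemma aug1_bc: "q \<in> carrier (bar1 R1 S) \<Longrightarrow> b.a1 (bc1 q) = b1.a1 q"
  by (simp add: aug1_def d1_bc \<epsilon>_bc ring_hom_closed[OF b1.d1_homs(1)])

lemma aug2_bc: "q \<in> carrier (bar2 R1 S) \<Longrightarrow> b.a2 (bc2 q) = b1.a2 q"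
  by (simp add: aug2_def d20_bc aug1_bc ring_hom_closed[OF b1.d2_homs(1)])

lemma bc2_setup: "cot_map_setup R1 S (bar2 R1 S) b1.a2 R (bar2 R S) b.a2 bc2"
  by (intro cot_map_setup.intro cot_map_setup_axioms.intro b1.cot_setups(2) b.cot_setups(2) bc_homs aug2_bc)
     (auto simp: bar2_base_change_def bc_const ring_hom_closed[OF \<pi>])

end

section \<open>Vanishing in the direct limit\<close>

text \<open>An element whose class in the direct limit is zero agrees at some later stage with the image of a
  zero element, possibly that of another stage \<open>j\<close>.\<close>

lemma dir_lim_vanish:
  assumes zero: "carrier (dir_lim I H f) = {\<zero>\<^bsub>dir_lim I H f\<^esub>}"
    and n: "n \<in> I" and x: "x \<in> carrier (H n)"
  shows "\<exists>j\<in>I. \<exists>l\<in>I. n \<le> l \<and> j \<le> l \<and> f n l x = f j l \<zero>\<^bsub>H j\<^esub>"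
proof -
  have "dir_lim_rel I H f `` {(n, x)} \<in> carrier (dir_lim I H f)"
    using n x by (auto simp: dir_lim_def intro!: quotientI)
  then have eq: "dir_lim_rel I H f `` {(n, x)} = dir_lim_rel I H f `` {(i, \<zero>\<^bsub>H i\<^esub>) | i. i \<in> I}"
    using zero by (simp add: dir_lim_def)
  have "(n, x) \<in> dir_lim_rel I H f `` {(n, x)}"
    using n x by (auto simp: dir_lim_rel_def)
  then obtain j where "j \<in> I" "((j, \<zero>\<^bsub>H j\<^esub>), (n, x)) \<in> dir_lim_rel I H f"
    unfolding eq by auto
  then show ?thesis by (auto simp: dir_lim_rel_def) metis
qed

context bar
begin

lemma cot_diff2_closed:
  assumes "y \<in> carrier (cot2 R S h)"
  shows "cot_diff2 R S h y \<in> carrier (cot1 R S h)"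
proof -
  interpret T1: module S "cot1 R S h" unfolding cot_eqs by (rule cot_setup.cot_term_module[OF cot_setups(1)])
  note fs = face2[THEN cot_map_setup.cot_map(1), folded cot_eqs]
  show ?thesis unfolding cot_diff2_def Let_def
    using fs[THEN semilinearD(1), OF assms] by simp
qed

lemma zero_coboundary:
  assumes M: "module S M"
  shows "(\<lambda>x\<in>carrier (cot2 R S h). \<zero>\<^bsub>M\<^esub>) \<in> aq_coboundaries2 R S h M"
proof -
  interpret M: module S M by (rule M)
  let ?z = "\<lambda>x\<in>carrier (cot1 R S h). \<zero>\<^bsub>M\<^esub>"
  have "?z \<in> carrier (hom_module S (cot1 R S h) M)"
    by (rule hom_module_restrict) (simp_all add: cot_eqs cot_setup.cot_term_module[OF cot_setups(1)] semilinear_def)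
  moreover have "(\<lambda>x\<in>carrier (cot2 R S h). \<zero>\<^bsub>M\<^esub>) = hom_pull (cot2 R S h) (cot_diff2 R S h) ?z"
    by (auto simp: hom_pull_def cot_diff2_closed intro!: restrict_ext)
  ultimately show ?thesis by (auto simp: aq_coboundaries2_def)
qed

end

lemma cocycle_module_coset:
  "N +>\<^bsub>aq_cocycle_module2 R S h M\<^esub> \<phi> = {\<lambda>x\<in>carrier (cot2 R S h). c x \<oplus>\<^bsub>M\<^esub> \<phi> x | c. c \<in> N}"
  by (auto simp: a_r_coset_def' aq_cocycle_module2_def hom_module_def)

text \<open>The zero class at stage \<open>j\<close> is the set of coboundaries over \<open>A/\<mm>\<^sup>j\<close>.  Its image at stage \<open>l\<close>
  is therefore the union of the cosets of their pullbacks, and comparing representatives produces, besides the coboundary \<open>\<chi>\<close>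
  over \<open>A/\<mm>\<^sup>l\<close>, the pullback of a coboundary \<open>\<chi>'\<close> over \<open>A/\<mm>\<^sup>j\<close>.\<close>

lemma colimit_vanishing:
  fixes A :: "('a, 'q) ring_scheme" and M :: "('a set, 'b) module"
  assumes reg: "formally_regular TYPE('b) A \<mm>" and M: "module (A Quot \<mm>) M"
    and bar: "\<And>n. n \<ge> 1 \<Longrightarrow> bar (A Quot ideal_pow A \<mm> n) (A Quot \<mm>) (quot_map A \<mm> id)"
    and change: "\<And>i l. \<lbrakk>1 \<le> i; i \<le> l\<rbrakk> \<Longrightarrow> bar_change (A Quot ideal_pow A \<mm> l) (A Quot ideal_pow A \<mm> i) (A Quot \<mm>)
      (quot_map A \<mm> id) (quot_map A \<mm> id) (quot_map A (ideal_pow A \<mm> i) id)"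
    and n: "n \<ge> 1" and \<phi>: "\<phi> \<in> aq_cocycles2 (A Quot ideal_pow A \<mm> n) (A Quot \<mm>) (quot_map A \<mm> id) M"
  defines "C \<equiv> \<lambda>i. aq_coboundaries2 (A Quot ideal_pow A \<mm> i) (A Quot \<mm>) (quot_map A \<mm> id) M"
    and "T \<equiv> \<lambda>i. cot2 (A Quot ideal_pow A \<mm> i) (A Quot \<mm>) (quot_map A \<mm> id)"
    and "pr \<equiv> \<lambda>i l. cot_map (A Quot \<mm>) (bar2 (A Quot ideal_pow A \<mm> l) (A Quot \<mm>))
      (A Quot ideal_pow A \<mm> i) (bar2 (A Quot ideal_pow A \<mm> i) (A Quot \<mm>))
      (aug2 (A Quot ideal_pow A \<mm> i) (A Quot \<mm>) (quot_map A \<mm> id))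
      (bar2_base_change (A Quot ideal_pow A \<mm> l) (A Quot ideal_pow A \<mm> i) (quot_map A (ideal_pow A \<mm> i) id))"
  shows "\<exists>j l. 1 \<le> j \<and> n \<le> l \<and> j \<le> l \<and> (\<exists>\<chi>\<in>C l. \<exists>\<chi>'\<in>C j. \<forall>x\<in>carrier (T l).
    \<phi> (pr n l x) = \<chi> x \<oplus>\<^bsub>M\<^esub> \<chi>' (pr j l x))"
proof -
  interpret M: module "A Quot \<mm>" M by (rule M)
  let ?Z = "\<lambda>i. aq_cocycle_module2 (A Quot ideal_pow A \<mm> i) (A Quot \<mm>) (quot_map A \<mm> id) M"
  let ?pull = "\<lambda>i l. hom_pull (T l) (pr i l)"
  have f_eq: "adic_aq_map A \<mm> M i l x = (\<Union>\<psi>\<in>x. C l +>\<^bsub>?Z l\<^esub> ?pull i l \<psi>)" for i l x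
    by (simp add: adic_aq_map_def aq_cohomology2_map_def quot_map_def C_def T_def pr_def)
  have coset: "N +>\<^bsub>?Z i\<^esub> \<psi> = {\<lambda>x\<in>carrier (T i). c x \<oplus>\<^bsub>M\<^esub> \<psi> x | c. c \<in> N}" for N i \<psi>
    unfolding T_def by (rule cocycle_module_coset)
  have \<phi>_hom: "\<phi> \<in> extensional (carrier (T n))" "\<And>x. x \<in> carrier (T n) \<Longrightarrow> \<phi> x \<in> carrier M"
    using \<phi> by (auto simp: aq_cocycles2_def hom_module_carrier T_def semilinear_def)
  define c where "c = C n +>\<^bsub>?Z n\<^esub> \<phi>"
  have z: "(\<lambda>x\<in>carrier (T i). \<zero>\<^bsub>M\<^esub>) \<in> C i" if "i \<ge> 1" for i
    unfolding T_def C_def by (rule bar.zero_coboundary[OF bar[OF that] M])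
  have \<phi>c: "\<phi> \<in> c"
  proof -
    have "\<phi> = (\<lambda>x\<in>carrier (T n). (\<lambda>x\<in>carrier (T n). \<zero>\<^bsub>M\<^esub>) x \<oplus>\<^bsub>M\<^esub> \<phi> x)"
      using \<phi>_hom by (intro extensionalityI[of _ "carrier (T n)"]) auto
    then show ?thesis unfolding c_def coset using z[OF n] by (intro CollectI exI conjI)
  qed
  have "c \<in> carrier (adic_aq A \<mm> M n)"
    using \<phi> by (auto simp: adic_aq_def aq_cohomology2_def quot_module_def c_def C_def A_RCOSETS_def'
        a_r_coset_def' aq_cocycle_module2_def)
  moreover have "carrier (dir_lim {1..} (adic_aq A \<mm> M) (adic_aq_map A \<mm> M)) =
      {\<zero>\<^bsub>dir_lim {1..} (adic_aq A \<mm> M) (adic_aq_map A \<mm> M)\<^esub>}"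
    using reg M by (simp add: formally_regular_def)
  ultimately obtain j l where jl: "1 \<le> j" "n \<le> l" "j \<le> l" "1 \<le> l"
    and eq: "adic_aq_map A \<mm> M n l c = adic_aq_map A \<mm> M j l \<zero>\<^bsub>adic_aq A \<mm> M j\<^esub>"
    using dir_lim_vanish[of "{1..}" "adic_aq A \<mm> M" "adic_aq_map A \<mm> M" n c] n by auto
  have zj: "\<zero>\<^bsub>adic_aq A \<mm> M j\<^esub> = C j"
    by (simp add: adic_aq_def aq_cohomology2_def quot_module_def C_def)
  have "(\<lambda>x\<in>carrier (T l). (\<lambda>x\<in>carrier (T l). \<zero>\<^bsub>M\<^esub>) x \<oplus>\<^bsub>M\<^esub> ?pull n l \<phi> x) \<in> adic_aq_map A \<mm> M n l c"
    unfolding f_eq coset using \<phi>c z[OF jl(4)] by blast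
  then have "(\<lambda>x\<in>carrier (T l). (\<lambda>x\<in>carrier (T l). \<zero>\<^bsub>M\<^esub>) x \<oplus>\<^bsub>M\<^esub> ?pull n l \<phi> x)
      \<in> (\<Union>\<psi>\<in>C j. C l +>\<^bsub>?Z l\<^esub> ?pull j l \<psi>)"
    unfolding eq unfolding f_eq zj .
  then obtain \<chi>' \<chi> where \<chi>: "\<chi>' \<in> C j" "\<chi> \<in> C l"
    and e: "(\<lambda>x\<in>carrier (T l). (\<lambda>x\<in>carrier (T l). \<zero>\<^bsub>M\<^esub>) x \<oplus>\<^bsub>M\<^esub> ?pull n l \<phi> x) =
      (\<lambda>x\<in>carrier (T l). \<chi> x \<oplus>\<^bsub>M\<^esub> ?pull j l \<chi>' x)"
    unfolding coset by blast
  have "\<phi> (pr n l x) = \<chi> x \<oplus>\<^bsub>M\<^esub> \<chi>' (pr j l x)" if x: "x \<in> carrier (T l)" for x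
  proof -
    have "pr n l x \<in> carrier (T n)"
      using semilinearD(1)[OF cot_map_setup.cot_map(1)[OF bar_change.bc2_setup[OF change[OF n jl(2)]]]] x
      by (simp add: pr_def T_def cot2_def)
    then show ?thesis using fun_cong[OF e, of x] x \<phi>_hom(2) by (simp add: hom_pull_def)
  qed
  then show ?thesis using jl \<chi> by blast
qed

section \<open>The cocycle of a principal crossed module\<close>

text \<open>The ring of 1-simplices of the nerve of the crossed module \<open>t : D \<rightarrow> D\<close>.  An element \<open>(n, e)\<close> is an edge from
  \<open>e + t n\<close> to \<open>e\<close>; the product is the one for which source and target are ring homomorphisms:
  \<open>(e + t n) (e' + t n') = e e' + t (n e' + e n' + t n n')\<close>.\<close>

definition crossed_ring :: "('d, 'w) ring_scheme \<Rightarrow> 'd \<Rightarrow> ('d \<times> 'd) ring" where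
  "crossed_ring D t =
    \<lparr>carrier = carrier D \<times> carrier D,
     monoid.mult = (\<lambda>(n, e) (n', e'). ((n \<otimes>\<^bsub>D\<^esub> e' \<oplus>\<^bsub>D\<^esub> e \<otimes>\<^bsub>D\<^esub> n') \<oplus>\<^bsub>D\<^esub> t \<otimes>\<^bsub>D\<^esub> (n \<otimes>\<^bsub>D\<^esub> n'), e \<otimes>\<^bsub>D\<^esub> e')),
     one = (\<zero>\<^bsub>D\<^esub>, \<one>\<^bsub>D\<^esub>), ring.zero = (\<zero>\<^bsub>D\<^esub>, \<zero>\<^bsub>D\<^esub>),
     ring.add = (\<lambda>(n, e) (n', e'). (n \<oplus>\<^bsub>D\<^esub> n', e \<oplus>\<^bsub>D\<^esub> e'))\<rparr>"

lemma (in cring) crossed_ring_cring: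
  assumes t: "t \<in> carrier R"
  shows "cring (crossed_ring R t)"
proof (rule cringI)
  show "abelian_group (crossed_ring R t)"
  proof (rule abelian_groupI)
    fix x assume "x \<in> carrier (crossed_ring R t)"
    then show "\<exists>y\<in>carrier (crossed_ring R t). y \<oplus>\<^bsub>crossed_ring R t\<^esub> x = \<zero>\<^bsub>crossed_ring R t\<^esub>"
      by (intro bexI[of _ "(\<ominus> fst x, \<ominus> snd x)"]) (auto simp: crossed_ring_def l_neg)
  qed (auto simp: crossed_ring_def a_ac)
  show "comm_monoid (crossed_ring R t)"
    by (rule comm_monoidI) (use t in \<open>auto simp: crossed_ring_def r_distr l_distr a_ac m_ac\<close>)
qed (use t in \<open>auto simp: crossed_ring_def r_distr l_distr a_ac m_ac\<close>)

text \<open>The crossed module \<open>t : D \<rightarrow> D\<close> of an \<open>R\<close>-algebra \<open>D\<close> with \<open>D/tD = S\<close>.  Its class is the obstruction to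
  extending the identity of \<open>S\<close> to a map from the standard resolution to the nerve of the crossed module.  In degree 0 the map is
  \<open>\<sigma>\<close>, determined by a set-theoretic section \<open>sec\<close> of \<open>\<rho>\<close>; in degree 1 it is \<open>Bh\<close>, whose first
  component is called \<open>B\<close>; in degree 2 the obstruction \<open>\<Delta>\<close> appears.\<close>

locale crossed = bar R S h + D: cring D
  for R :: "('r, 'q) ring_scheme" and S :: "('s, 't) ring_scheme" and h and D :: "('d, 'w) ring_scheme" +
  fixes g :: "'r \<Rightarrow> 'd" and \<rho> :: "'d \<Rightarrow> 's" and t :: 'd
  assumes g: "g \<in> ring_hom R D" and \<rho>: "\<rho> \<in> ring_hom D S"
    and \<rho>g: "r \<in> carrier R \<Longrightarrow> \<rho> (g r) = h r"
    and t: "t \<in> carrier D"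
    and \<rho>_surj: "c \<in> carrier S \<Longrightarrow> \<exists>d\<in>carrier D. \<rho> d = c"
    and \<rho>_ker: "d \<in> carrier D \<Longrightarrow> \<rho> d = \<zero>\<^bsub>S\<^esub> \<longleftrightarrow> (\<exists>e\<in>carrier D. d = t \<otimes>\<^bsub>D\<^esub> e)"
begin

definition "sec c = (SOME d. d \<in> carrier D \<and> \<rho> d = c)"

lemma sec: "c \<in> carrier S \<Longrightarrow> sec c \<in> carrier D \<and> \<rho> (sec c) = c"
  unfolding sec_def using \<rho>_surj[of c] by (intro someI_ex[of "\<lambda>d. d \<in> carrier D \<and> \<rho> d = c"]) blast

definition "\<sigma> = poly_eval R D g sec"

lemma sec_Pi: "sec \<in> carrier S \<rightarrow> carrier D" using sec by auto

lemma \<sigma>_hom: "\<sigma> \<in> ring_hom P0 D"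
  unfolding \<sigma>_def bar0_def by (rule R.poly_eval_hom[OF D.cring_axioms g sec_Pi])

lemma \<sigma>_const: "r \<in> carrier R \<Longrightarrow> \<sigma> (poly_const R r) = g r"
  unfolding \<sigma>_def by (rule R.poly_eval_const[OF D.cring_axioms g sec_Pi])

lemma \<sigma>_var: "c \<in> carrier S \<Longrightarrow> \<sigma> (var c) = sec c"
  unfolding \<sigma>_def by (rule R.poly_eval_var[OF D.cring_axioms g sec_Pi])

lemma \<rho>_\<sigma>: "p \<in> carrier P0 \<Longrightarrow> \<rho> (\<sigma> p) = \<epsilon> p"
  unfolding bar0_def
  by (rule R.poly_hom_ext[OF S.cring_axioms comp_ring_hom[OF \<sigma>_hom \<rho>, unfolded bar0_def] \<epsilon>_hom[unfolded bar0_def]])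
     (simp_all add: \<sigma>_const \<sigma>_var \<rho>g \<epsilon>_const \<epsilon>_var sec)

lemma ker_diff:
  assumes "d \<in> carrier D" "d' \<in> carrier D" "\<rho> d = \<rho> d'"
  shows "\<exists>e\<in>carrier D. t \<otimes>\<^bsub>D\<^esub> e = d \<ominus>\<^bsub>D\<^esub> d'"
proof -
  interpret r: ring_hom_cring D S \<rho>
    by (intro ring_hom_cring.intro ring_hom_cring_axioms.intro D.cring_axioms S.cring_axioms \<rho>)
  have "\<rho> (d \<ominus>\<^bsub>D\<^esub> d') = \<zero>\<^bsub>S\<^esub>" using assms by (simp add: a_minus_def S.r_neg)
  then show ?thesis using \<rho>_ker[of "d \<ominus>\<^bsub>D\<^esub> d'"] assms by auto
qed

text \<open>The edge chosen for a variable \<open>var p\<close> of \<open>P1\<close>.  It must join the images under \<open>\<sigma>\<close> of the faces \<open>p\<close> and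
  \<open>var (\<epsilon> p)\<close>, and \<open>\<sigma> (var (\<epsilon> p)) = sec (\<epsilon> p)\<close>.\<close>

definition "\<beta> p = (SOME b. b \<in> carrier D \<and> t \<otimes>\<^bsub>D\<^esub> b = \<sigma> p \<ominus>\<^bsub>D\<^esub> sec (\<epsilon> p))"

lemma \<beta>:
  assumes p: "p \<in> carrier P0"
  shows "\<beta> p \<in> carrier D \<and> t \<otimes>\<^bsub>D\<^esub> \<beta> p = \<sigma> p \<ominus>\<^bsub>D\<^esub> sec (\<epsilon> p)"
proof -
  have "\<exists>e\<in>carrier D. t \<otimes>\<^bsub>D\<^esub> e = \<sigma> p \<ominus>\<^bsub>D\<^esub> sec (\<epsilon> p)"
    using ker_diff[of "\<sigma> p" "sec (\<epsilon> p)"] \<rho>_\<sigma>[OF p] sec[OF ring_hom_closed[OF \<epsilon>_hom p]] ring_hom_closed[OF \<sigma>_hom p]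
    by simp
  then show ?thesis unfolding \<beta>_def by (intro someI_ex[of "\<lambda>b. b \<in> carrier D \<and> t \<otimes>\<^bsub>D\<^esub> b = \<sigma> p \<ominus>\<^bsub>D\<^esub> sec (\<epsilon> p)"]) blast
qed

abbreviation "G \<equiv> crossed_ring D t"

definition "Bh = poly_eval R G (\<lambda>r. (\<zero>\<^bsub>D\<^esub>, g r)) (\<lambda>p. (\<beta> p, sec (\<epsilon> p)))"
definition "B q = fst (Bh q)"

lemma G_cring: "cring G" by (rule D.crossed_ring_cring[OF t])

lemma gG: "(\<lambda>r. (\<zero>\<^bsub>D\<^esub>, g r)) \<in> ring_hom R G"
  by (rule ring_hom_memI)
     (use g t in \<open>simp_all add: crossed_ring_def ring_hom_closed ring_hom_mult ring_hom_add ring_hom_one\<close>)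

lemma varG: "(\<lambda>p. (\<beta> p, sec (\<epsilon> p))) \<in> carrier P0 \<rightarrow> carrier G"
  using \<beta> sec ring_hom_closed[OF \<epsilon>_hom] by (auto simp: crossed_ring_def)

lemma Bh_hom: "Bh \<in> ring_hom P1 G"
  unfolding Bh_def bar1_def by (rule R.poly_eval_hom[OF G_cring gG varG])

lemma Bh_const: "r \<in> carrier R \<Longrightarrow> Bh (poly_const R r) = (\<zero>\<^bsub>D\<^esub>, g r)"
  unfolding Bh_def by (rule R.poly_eval_const[OF G_cring gG varG])

lemma Bh_var: "p \<in> carrier P0 \<Longrightarrow> Bh (var p) = (\<beta> p, sec (\<epsilon> p))"
  unfolding Bh_def by (rule R.poly_eval_var[OF G_cring gG varG])

lemma snd_hom: "snd \<in> ring_hom G D"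
  by (rule ring_hom_memI) (auto simp: crossed_ring_def)

lemma src_hom: "(\<lambda>x. snd x \<oplus>\<^bsub>D\<^esub> t \<otimes>\<^bsub>D\<^esub> fst x) \<in> ring_hom G D"
  by (rule ring_hom_memI)
     (use t in \<open>auto simp: crossed_ring_def D.r_distr D.l_distr D.a_ac D.m_ac\<close>)

lemma B_tgt:
  assumes q: "q \<in> carrier P1"
  shows "snd (Bh q) = \<sigma> (d11 q)"
proof -
  have q': "q \<in> carrier (poly_alg R (carrier P0))" using q by (simp add: bar1_def)
  show ?thesis
    by (rule R.poly_hom_ext[OF D.cring_axioms comp_ring_hom[OF Bh_hom snd_hom, unfolded bar1_def]
          comp_ring_hom[OF d1_homs(2) \<sigma>_hom, unfolded bar1_def] _ _ q'])
       (simp_all add: Bh_const Bh_var R.bar_lift_const R.bar_lift_var \<sigma>_const \<sigma>_var ring_hom_closed[OF \<epsilon>_hom])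
qed

text \<open>With \<open>B_tgt\<close>: the edge \<open>Bh q\<close> runs from \<open>\<sigma> (d10 q)\<close> to \<open>\<sigma> (d11 q)\<close>.  Both ends are ring
  homomorphisms in \<open>q\<close>, so variables suffice, where this is the choice of \<open>\<beta>\<close>.\<close>

lemma B_src:
  assumes q: "q \<in> carrier P1"
  shows "\<sigma> (d11 q) \<oplus>\<^bsub>D\<^esub> t \<otimes>\<^bsub>D\<^esub> B q = \<sigma> (d10 q)"
proof -
  have q': "q \<in> carrier (poly_alg R (carrier P0))" using q by (simp add: bar1_def)
  have var: "sec (\<epsilon> p) \<oplus>\<^bsub>D\<^esub> t \<otimes>\<^bsub>D\<^esub> \<beta> p = \<sigma> p" if p: "p \<in> carrier P0" for p
    using \<beta>[OF p] sec[OF ring_hom_closed[OF \<epsilon>_hom p]] ring_hom_closed[OF \<sigma>_hom p]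
    by (simp add: a_minus_def D.a_lcomm D.r_neg)
  have "snd (Bh q) \<oplus>\<^bsub>D\<^esub> t \<otimes>\<^bsub>D\<^esub> fst (Bh q) = \<sigma> (d10 q)"
    by (rule R.poly_hom_ext[OF D.cring_axioms comp_ring_hom[OF Bh_hom src_hom, unfolded bar1_def]
          comp_ring_hom[OF d1_homs(1) \<sigma>_hom, unfolded bar1_def] _ _ q'])
       (simp_all add: Bh_const Bh_var d10_const d10_var \<sigma>_const var t ring_hom_closed[OF g])
  then show ?thesis by (simp add: B_tgt[OF q] B_def)
qed

lemma B_closed: "q \<in> carrier P1 \<Longrightarrow> B q \<in> carrier D"
  using ring_hom_closed[OF Bh_hom, of q] by (auto simp: B_def crossed_ring_def)

lemma B_add: "\<lbrakk>q \<in> carrier P1; q' \<in> carrier P1\<rbrakk> \<Longrightarrow> B (q \<oplus>\<^bsub>P1\<^esub> q') = B q \<oplus>\<^bsub>D\<^esub> B q'"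
  by (simp add: B_def ring_hom_add[OF Bh_hom]) (simp add: crossed_ring_def split_beta)

lemma B_mult: "\<lbrakk>q \<in> carrier P1; q' \<in> carrier P1\<rbrakk> \<Longrightarrow>
    B (q \<otimes>\<^bsub>P1\<^esub> q') = (B q \<otimes>\<^bsub>D\<^esub> \<sigma> (d11 q') \<oplus>\<^bsub>D\<^esub> \<sigma> (d11 q) \<otimes>\<^bsub>D\<^esub> B q') \<oplus>\<^bsub>D\<^esub> t \<otimes>\<^bsub>D\<^esub> (B q \<otimes>\<^bsub>D\<^esub> B q')"
  by (simp add: B_def ring_hom_mult[OF Bh_hom] flip: B_tgt) (simp add: crossed_ring_def split_beta)

lemma B_const: "r \<in> carrier R \<Longrightarrow> B (poly_const R r) = \<zero>\<^bsub>D\<^esub>"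
  by (simp add: B_def Bh_const)

lemma B_var: "p \<in> carrier P0 \<Longrightarrow> B (var p) = \<beta> p"
  by (simp add: B_def Bh_var)

lemma B_const_mult:
  assumes "r \<in> carrier R" "q \<in> carrier P1"
  shows "B (poly_const R r \<otimes>\<^bsub>P1\<^esub> q) = g r \<otimes>\<^bsub>D\<^esub> B q"
  using assms B_mult[OF ring_hom_closed[OF const_homs(2)]] B_closed t
    ring_hom_closed[OF g] ring_hom_closed[OF \<sigma>_hom] ring_hom_closed[OF d1_homs(2)]
  by (simp add: B_const R.bar_lift_const \<sigma>_const)

text \<open>The kernel of the crossed module, as an \<open>S\<close>-module.  Elements of \<open>D\<close> with the same image in \<open>S\<close> differ by a multiple of \<open>t\<close>
  and act alike, so any lift of a scalar, in particular \<open>sec c\<close>, defines the action.\<close>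

definition ann :: "('s, 'd) module" where
  "ann = \<lparr>carrier = {x \<in> carrier D. t \<otimes>\<^bsub>D\<^esub> x = \<zero>\<^bsub>D\<^esub>}, monoid.mult = undefined, one = undefined,
     ring.zero = \<zero>\<^bsub>D\<^esub>, ring.add = ring.add D, smult = (\<lambda>c x. sec c \<otimes>\<^bsub>D\<^esub> x)\<rparr>"

lemma ann_simps:
  "x \<in> carrier ann \<longleftrightarrow> x \<in> carrier D \<and> t \<otimes>\<^bsub>D\<^esub> x = \<zero>\<^bsub>D\<^esub>"
  "\<zero>\<^bsub>ann\<^esub> = \<zero>\<^bsub>D\<^esub>" "x \<oplus>\<^bsub>ann\<^esub> y = x \<oplus>\<^bsub>D\<^esub> y" "c \<odot>\<^bsub>ann\<^esub> x = sec c \<otimes>\<^bsub>D\<^esub> x"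
  by (simp_all add: ann_def)

lemma ann_action:
  assumes "d \<in> carrier D" "d' \<in> carrier D" "\<rho> d = \<rho> d'" "x \<in> carrier ann"
  shows "d \<otimes>\<^bsub>D\<^esub> x = d' \<otimes>\<^bsub>D\<^esub> x"
proof -
  obtain e where e: "e \<in> carrier D" "t \<otimes>\<^bsub>D\<^esub> e = d \<ominus>\<^bsub>D\<^esub> d'" using ker_diff[OF assms(1-3)] by blast
  have x: "x \<in> carrier D" "t \<otimes>\<^bsub>D\<^esub> x = \<zero>\<^bsub>D\<^esub>" using assms(4) by (auto simp: ann_simps)
  have "d = d' \<oplus>\<^bsub>D\<^esub> t \<otimes>\<^bsub>D\<^esub> e" using e assms by (simp add: a_minus_def D.a_lcomm D.r_neg)
  then have "d \<otimes>\<^bsub>D\<^esub> x = d' \<otimes>\<^bsub>D\<^esub> x \<oplus>\<^bsub>D\<^esub> e \<otimes>\<^bsub>D\<^esub> (t \<otimes>\<^bsub>D\<^esub> x)"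
  proof -
    have "d \<otimes>\<^bsub>D\<^esub> x = (d' \<oplus>\<^bsub>D\<^esub> t \<otimes>\<^bsub>D\<^esub> e) \<otimes>\<^bsub>D\<^esub> x" using \<open>d = _\<close> by simp
    also have "\<dots> = d' \<otimes>\<^bsub>D\<^esub> x \<oplus>\<^bsub>D\<^esub> e \<otimes>\<^bsub>D\<^esub> (t \<otimes>\<^bsub>D\<^esub> x)"
      using e(1) x(1) assms(1,2) t by algebra
    finally show ?thesis .
  qed
  then show ?thesis using e x assms by simp
qed

lemma sec_action: "\<lbrakk>d \<in> carrier D; x \<in> carrier ann\<rbrakk> \<Longrightarrow> \<rho> d \<odot>\<^bsub>ann\<^esub> x = d \<otimes>\<^bsub>D\<^esub> x"
  unfolding ann_simps(4) using sec[of "\<rho> d"] ring_hom_closed[OF \<rho>, of d]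
  by (intro ann_action) auto

lemma ann_module: "module S ann"
proof (rule moduleI[OF S.cring_axioms])
  show "abelian_group ann"
  proof (rule abelian_groupI)
    fix x assume "x \<in> carrier ann"
    then show "\<exists>y\<in>carrier ann. y \<oplus>\<^bsub>ann\<^esub> x = \<zero>\<^bsub>ann\<^esub>"
      using t by (intro bexI[of _ "\<ominus>\<^bsub>D\<^esub> x"]) (auto simp: ann_simps D.l_neg D.r_minus)
  qed (use t in \<open>auto simp: ann_simps D.a_ac D.r_distr\<close>)
  fix a b x y assume a: "a \<in> carrier S" and b: "b \<in> carrier S" and x: "x \<in> carrier ann" and y: "y \<in> carrier ann"
  have xD: "x \<in> carrier D" "t \<otimes>\<^bsub>D\<^esub> x = \<zero>\<^bsub>D\<^esub>" and yD: "y \<in> carrier D" using x y by (auto simp: ann_simps)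
  note sa = sec[OF a] and sb = sec[OF b]
  show "a \<odot>\<^bsub>ann\<^esub> x \<in> carrier ann"
    using sa xD t D.m_lcomm[of t "sec a" x] by (simp add: ann_simps)
  show "(a \<oplus>\<^bsub>S\<^esub> b) \<odot>\<^bsub>ann\<^esub> x = a \<odot>\<^bsub>ann\<^esub> x \<oplus>\<^bsub>ann\<^esub> b \<odot>\<^bsub>ann\<^esub> x"
    using sec_action[of "sec a \<oplus>\<^bsub>D\<^esub> sec b" x] sa sb x xD ring_hom_add[OF \<rho>, of "sec a" "sec b"]
    by (simp add: ann_simps D.l_distr)
  show "a \<odot>\<^bsub>ann\<^esub> (x \<oplus>\<^bsub>ann\<^esub> y) = a \<odot>\<^bsub>ann\<^esub> x \<oplus>\<^bsub>ann\<^esub> a \<odot>\<^bsub>ann\<^esub> y"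
    using sa xD yD by (simp add: ann_simps D.r_distr)
  show "(a \<otimes>\<^bsub>S\<^esub> b) \<odot>\<^bsub>ann\<^esub> x = a \<odot>\<^bsub>ann\<^esub> (b \<odot>\<^bsub>ann\<^esub> x)"
    using sec_action[of "sec a \<otimes>\<^bsub>D\<^esub> sec b" x] sa sb x xD ring_hom_mult[OF \<rho>, of "sec a" "sec b"]
    by (simp add: ann_simps D.m_assoc)
next
  fix x assume x: "x \<in> carrier ann"
  show "\<one>\<^bsub>S\<^esub> \<odot>\<^bsub>ann\<^esub> x = x"
    using sec_action[of "\<one>\<^bsub>D\<^esub>" x] x ring_hom_one[OF \<rho>] by (simp add: ann_simps)
qed

lemma ann_minus: "\<lbrakk>x \<in> carrier ann; y \<in> carrier ann\<rbrakk> \<Longrightarrow> x \<ominus>\<^bsub>ann\<^esub> y = x \<ominus>\<^bsub>D\<^esub> y"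
proof -
  assume xy: "x \<in> carrier ann" "y \<in> carrier ann"
  interpret M: module S ann by (rule ann_module)
  have "\<ominus>\<^bsub>ann\<^esub> y = \<ominus>\<^bsub>D\<^esub> y"
    using xy t by (intro M.minus_equality) (auto simp: ann_simps D.l_neg D.r_minus)
  then show ?thesis by (simp add: a_minus_def ann_simps)
qed

text \<open>Three edges \<open>b0, b1, b2\<close> that bound a triangle bound a 2-simplex of the nerve iff \<open>b1 = b0 + b2\<close>.\<close>

definition "\<Delta> p = B (d20 p) \<ominus>\<^bsub>D\<^esub> B (d21 p) \<oplus>\<^bsub>D\<^esub> B (d22 p)"

text \<open>The three edges \<open>B (d20 p)\<close>, \<open>B (d21 p)\<close>, \<open>B (d22 p)\<close> fit together at their end points by the simplicial identities;
  this determines the products of \<open>t\<close> with them in terms of \<open>w\<close>, the last vertex.\<close>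

lemma \<Delta>_data:
  assumes p: "p \<in> carrier P2"
  obtains b0 b1 b2 w where "b0 = B (d20 p)" "b1 = B (d21 p)" "b2 = B (d22 p)"
    "b0 \<in> carrier D" "b1 \<in> carrier D" "b2 \<in> carrier D" "w \<in> carrier D"
    "\<sigma> (d11 (d20 p)) = w \<oplus>\<^bsub>D\<^esub> t \<otimes>\<^bsub>D\<^esub> b2" "\<sigma> (d11 (d21 p)) = w" "\<sigma> (d11 (d22 p)) = w"
    "t \<otimes>\<^bsub>D\<^esub> b1 = t \<otimes>\<^bsub>D\<^esub> b0 \<oplus>\<^bsub>D\<^esub> t \<otimes>\<^bsub>D\<^esub> b2" "\<rho> w = a2 p"
proof -
  note d = d2_homs[THEN ring_hom_closed, OF p]
  define w where "w = \<sigma> (d11 (d21 p))"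
  have cl: "B (d20 p) \<in> carrier D" "B (d21 p) \<in> carrier D" "B (d22 p) \<in> carrier D" "w \<in> carrier D"
    unfolding w_def using d B_closed ring_hom_closed[OF \<sigma>_hom] ring_hom_closed[OF d1_homs(2)] by auto
  have w0: "\<sigma> (d11 (d20 p)) = w \<oplus>\<^bsub>D\<^esub> t \<otimes>\<^bsub>D\<^esub> B (d22 p)"
    using B_src[OF d(3)] simplicial1[OF p] by (simp add: w_def)
  have "w \<oplus>\<^bsub>D\<^esub> t \<otimes>\<^bsub>D\<^esub> B (d21 p) = w \<oplus>\<^bsub>D\<^esub> (t \<otimes>\<^bsub>D\<^esub> B (d20 p) \<oplus>\<^bsub>D\<^esub> t \<otimes>\<^bsub>D\<^esub> B (d22 p))"
    using B_src[OF d(1)] B_src[OF d(2)] simplicial1[OF p] w0 cl t by (simp add: w_def[symmetric] D.a_ac)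
  then have "t \<otimes>\<^bsub>D\<^esub> B (d21 p) = t \<otimes>\<^bsub>D\<^esub> B (d20 p) \<oplus>\<^bsub>D\<^esub> t \<otimes>\<^bsub>D\<^esub> B (d22 p)"
    using cl t by simp
  moreover have "\<rho> w = a2 p"
    unfolding w_def using \<rho>_\<sigma>[OF ring_hom_closed[OF d1_homs(2) d(2)]] \<epsilon>_d1[OF d(2)] aug2_faces[OF p]
    by (simp add: aug1_eq)
  ultimately show ?thesis using that[OF refl refl refl cl w0] simplicial1[OF p] by (simp add: w_def)
qed

text \<open>\<open>B\<close> is multiplicative only up to the term \<open>t b c\<close>.  In \<open>\<Delta> (p p')\<close> these terms cancel against the difference of the
  end points of the edges, because \<open>b0 - b1 + b2\<close> is annihilated by \<open>t\<close>.\<close>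

lemma \<Delta>_derivation: "derivation R P2 (poly_const R) a2 ann \<Delta>"
proof -
  have cl: "\<Delta> p \<in> carrier ann" if p: "p \<in> carrier P2" for p
    by (rule \<Delta>_data[OF p]) (use t in \<open>simp add: \<Delta>_def ann_simps a_minus_def D.r_distr D.r_minus D.a_ac D.r_neg D.r_neg1 D.minus_add\<close>)
  have add: "\<Delta> (p \<oplus>\<^bsub>P2\<^esub> p') = \<Delta> p \<oplus>\<^bsub>D\<^esub> \<Delta> p'" if p: "p \<in> carrier P2" "p' \<in> carrier P2" for p p'
    using d2_homs[THEN ring_hom_closed, OF p(1)] d2_homs[THEN ring_hom_closed, OF p(2)] d2_homs[THEN ring_hom_add, OF p]
    by (simp add: \<Delta>_def B_add B_closed a_minus_def D.minus_add D.a_ac)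
  have mult: "\<Delta> (p \<otimes>\<^bsub>P2\<^esub> p') = a2 p \<odot>\<^bsub>ann\<^esub> \<Delta> p' \<oplus>\<^bsub>ann\<^esub> a2 p' \<odot>\<^bsub>ann\<^esub> \<Delta> p"
    if p: "p \<in> carrier P2" and p': "p' \<in> carrier P2" for p p'
  proof -
    obtain b0 b1 b2 w where b: "b0 = B (d20 p)" "b1 = B (d21 p)" "b2 = B (d22 p)"
      "b0 \<in> carrier D" "b1 \<in> carrier D" "b2 \<in> carrier D" "w \<in> carrier D"
      "\<sigma> (d11 (d20 p)) = w \<oplus>\<^bsub>D\<^esub> t \<otimes>\<^bsub>D\<^esub> b2" "\<sigma> (d11 (d21 p)) = w" "\<sigma> (d11 (d22 p)) = w"
      "t \<otimes>\<^bsub>D\<^esub> b1 = t \<otimes>\<^bsub>D\<^esub> b0 \<oplus>\<^bsub>D\<^esub> t \<otimes>\<^bsub>D\<^esub> b2" "\<rho> w = a2 p" by (rule \<Delta>_data[OF p])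
    obtain c0 c1 c2 v where c: "c0 = B (d20 p')" "c1 = B (d21 p')" "c2 = B (d22 p')"
      "c0 \<in> carrier D" "c1 \<in> carrier D" "c2 \<in> carrier D" "v \<in> carrier D"
      "\<sigma> (d11 (d20 p')) = v \<oplus>\<^bsub>D\<^esub> t \<otimes>\<^bsub>D\<^esub> c2" "\<sigma> (d11 (d21 p')) = v" "\<sigma> (d11 (d22 p')) = v"
      "t \<otimes>\<^bsub>D\<^esub> c1 = t \<otimes>\<^bsub>D\<^esub> c0 \<oplus>\<^bsub>D\<^esub> t \<otimes>\<^bsub>D\<^esub> c2" "\<rho> v = a2 p'" by (rule \<Delta>_data[OF p'])
    note bc = b(4-7) c(4-7) t
    \<comment> \<open>Expand \<open>(t b1) c1\<close> with \<open>t b1 = t b0 + t b2\<close> and \<open>t c1 = t c0 + t c2\<close>.\<close>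
    have "t \<otimes>\<^bsub>D\<^esub> (b1 \<otimes>\<^bsub>D\<^esub> c1) = b1 \<otimes>\<^bsub>D\<^esub> (t \<otimes>\<^bsub>D\<^esub> c1)" using bc by (simp add: D.m_lcomm)
    also have "\<dots> = t \<otimes>\<^bsub>D\<^esub> b1 \<otimes>\<^bsub>D\<^esub> c0 \<oplus>\<^bsub>D\<^esub> t \<otimes>\<^bsub>D\<^esub> b1 \<otimes>\<^bsub>D\<^esub> c2"
      unfolding c(11) using bc by (simp add: D.r_distr D.m_ac)
    also have "\<dots> = (t \<otimes>\<^bsub>D\<^esub> (b0 \<otimes>\<^bsub>D\<^esub> c0) \<oplus>\<^bsub>D\<^esub> t \<otimes>\<^bsub>D\<^esub> (b2 \<otimes>\<^bsub>D\<^esub> c0)) \<oplus>\<^bsub>D\<^esub>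
        (t \<otimes>\<^bsub>D\<^esub> (b0 \<otimes>\<^bsub>D\<^esub> c2) \<oplus>\<^bsub>D\<^esub> t \<otimes>\<^bsub>D\<^esub> (b2 \<otimes>\<^bsub>D\<^esub> c2))"
      unfolding b(11) using bc by (simp add: D.l_distr D.m_assoc)
    finally have tbc: "t \<otimes>\<^bsub>D\<^esub> (b1 \<otimes>\<^bsub>D\<^esub> c1) = (t \<otimes>\<^bsub>D\<^esub> (b0 \<otimes>\<^bsub>D\<^esub> c0) \<oplus>\<^bsub>D\<^esub> t \<otimes>\<^bsub>D\<^esub> (b2 \<otimes>\<^bsub>D\<^esub> c0)) \<oplus>\<^bsub>D\<^esub>
        (t \<otimes>\<^bsub>D\<^esub> (b0 \<otimes>\<^bsub>D\<^esub> c2) \<oplus>\<^bsub>D\<^esub> t \<otimes>\<^bsub>D\<^esub> (b2 \<otimes>\<^bsub>D\<^esub> c2))" .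
    have "\<Delta> (p \<otimes>\<^bsub>P2\<^esub> p') =
       (((b0 \<otimes>\<^bsub>D\<^esub> (v \<oplus>\<^bsub>D\<^esub> t \<otimes>\<^bsub>D\<^esub> c2) \<oplus>\<^bsub>D\<^esub> (w \<oplus>\<^bsub>D\<^esub> t \<otimes>\<^bsub>D\<^esub> b2) \<otimes>\<^bsub>D\<^esub> c0) \<oplus>\<^bsub>D\<^esub> t \<otimes>\<^bsub>D\<^esub> (b0 \<otimes>\<^bsub>D\<^esub> c0)) \<ominus>\<^bsub>D\<^esub>
       ((b1 \<otimes>\<^bsub>D\<^esub> v \<oplus>\<^bsub>D\<^esub> w \<otimes>\<^bsub>D\<^esub> c1) \<oplus>\<^bsub>D\<^esub> t \<otimes>\<^bsub>D\<^esub> (b1 \<otimes>\<^bsub>D\<^esub> c1))) \<oplus>\<^bsub>D\<^esub>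
       ((b2 \<otimes>\<^bsub>D\<^esub> v \<oplus>\<^bsub>D\<^esub> w \<otimes>\<^bsub>D\<^esub> c2) \<oplus>\<^bsub>D\<^esub> t \<otimes>\<^bsub>D\<^esub> (b2 \<otimes>\<^bsub>D\<^esub> c2))"
      unfolding \<Delta>_def d2_homs[THEN ring_hom_mult, OF p p']
      by (simp add: B_mult d2_homs[THEN ring_hom_closed, OF p] d2_homs[THEN ring_hom_closed, OF p'] b(8-10) c(8-10)
          flip: b(1-3) c(1-3))
    also have "\<dots> = w \<otimes>\<^bsub>D\<^esub> (c0 \<ominus>\<^bsub>D\<^esub> c1 \<oplus>\<^bsub>D\<^esub> c2) \<oplus>\<^bsub>D\<^esub> v \<otimes>\<^bsub>D\<^esub> (b0 \<ominus>\<^bsub>D\<^esub> b1 \<oplus>\<^bsub>D\<^esub> b2)"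
      unfolding tbc using bc by algebra
    also have "\<dots> = w \<otimes>\<^bsub>D\<^esub> \<Delta> p' \<oplus>\<^bsub>D\<^esub> v \<otimes>\<^bsub>D\<^esub> \<Delta> p"
      by (simp add: \<Delta>_def flip: b(1-3) c(1-3))
    also have "\<dots> = a2 p \<odot>\<^bsub>ann\<^esub> \<Delta> p' \<oplus>\<^bsub>ann\<^esub> a2 p' \<odot>\<^bsub>ann\<^esub> \<Delta> p"
      using sec_action[OF b(7) cl[OF p']] sec_action[OF c(7) cl[OF p]] b(12) c(12) by (simp add: ann_simps)
    finally show ?thesis .
  qed
  have "\<Delta> (poly_const R r) = \<zero>\<^bsub>D\<^esub>" if "r \<in> carrier R" for r
    using that by (simp add: \<Delta>_def d20_const R.bar_lift_const B_const a_minus_def)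
  then show ?thesis
    using cl add mult by (simp add: derivation_def ann_simps(2,3))
qed

lemma \<Delta>_closed: "p \<in> carrier P2 \<Longrightarrow> \<Delta> p \<in> carrier ann"
  using \<Delta>_derivation by (simp add: derivation_def)

text \<open>\<open>\<Delta>\<close> is by definition the coboundary of the function \<open>B\<close>, which is not a derivation; the simplicial
  identities alone give the cocycle condition.\<close>

lemma \<Delta>_cocycle:
  assumes x: "x \<in> carrier P3"
  shows "\<Delta> (d30 x) \<ominus>\<^bsub>ann\<^esub> \<Delta> (d31 x) \<oplus>\<^bsub>ann\<^esub> \<Delta> (d32 x) \<ominus>\<^bsub>ann\<^esub> \<Delta> (d33 x) = \<zero>\<^bsub>ann\<^esub>"
proof -
  interpret M: module S ann by (rule ann_module)
  note d = d3_homs[THEN ring_hom_closed, OF x]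
  note dc = d[THEN \<Delta>_closed]
  note e = d2_homs(1)[THEN ring_hom_closed, OF d(1), THEN B_closed] d2_homs(2)[THEN ring_hom_closed, OF d(1), THEN B_closed]
    d2_homs(3)[THEN ring_hom_closed, OF d(1), THEN B_closed] d2_homs(2)[THEN ring_hom_closed, OF d(2), THEN B_closed]
    d2_homs(3)[THEN ring_hom_closed, OF d(2), THEN B_closed] d2_homs(3)[THEN ring_hom_closed, OF d(3), THEN B_closed]
  have alg: "(((a \<ominus>\<^bsub>D\<^esub> b) \<oplus>\<^bsub>D\<^esub> c) \<ominus>\<^bsub>D\<^esub> ((a \<ominus>\<^bsub>D\<^esub> d) \<oplus>\<^bsub>D\<^esub> e) \<oplus>\<^bsub>D\<^esub> ((b \<ominus>\<^bsub>D\<^esub> d) \<oplus>\<^bsub>D\<^esub> f)) \<ominus>\<^bsub>D\<^esub> ((c \<ominus>\<^bsub>D\<^esub> e) \<oplus>\<^bsub>D\<^esub> f) = \<zero>\<^bsub>D\<^esub>"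
    if "a \<in> carrier D" "b \<in> carrier D" "c \<in> carrier D" "d \<in> carrier D" "e \<in> carrier D" "f \<in> carrier D" for a b c d e f
    using that by algebra
  have "\<Delta> (d30 x) \<ominus>\<^bsub>ann\<^esub> \<Delta> (d31 x) \<oplus>\<^bsub>ann\<^esub> \<Delta> (d32 x) \<ominus>\<^bsub>ann\<^esub> \<Delta> (d33 x)
      = \<Delta> (d30 x) \<ominus>\<^bsub>D\<^esub> \<Delta> (d31 x) \<oplus>\<^bsub>D\<^esub> \<Delta> (d32 x) \<ominus>\<^bsub>D\<^esub> \<Delta> (d33 x)"
    using dc M.a_closed[OF M.minus_closed[OF dc(1,2)] dc(3)] by (simp add: ann_minus ann_simps(3))
  also have "\<dots> = \<zero>\<^bsub>D\<^esub>"
    unfolding \<Delta>_def simplicial2[OF x] using e by (intro alg)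
  finally show ?thesis by (simp add: ann_simps)
qed

lemma \<Delta>_var:
  assumes q: "q \<in> carrier P1"
  shows "\<Delta> (var q) = B q \<ominus>\<^bsub>D\<^esub> \<beta> (d10 q) \<oplus>\<^bsub>D\<^esub> \<beta> (d11 q)"
  using q ring_hom_closed[OF d1_homs(1) q] ring_hom_closed[OF d1_homs(2) q]
  by (simp add: \<Delta>_def d20_var R.bar_lift_var B_var)

text \<open>Suppose that \<open>\<Delta>\<close>, pulled back along \<open>\<pi>\<close>, is the coboundary of a derivation \<open>E\<close>.  Then \<open>B' = B - E\<close>
  is still additive and \<open>R1\<close>-linear, and \<open>B' q = b' (d10 q) - b' (d11 q)\<close> for the function \<open>b' p = B' (var p)\<close>.  Evaluated on
  sums and multiples of variables indexed by constants \<open>a\<close> in the kernel of \<open>h1\<close>, where \<open>d11\<close> forgets \<open>a\<close>, this shows that \<open>a \<mapsto> b' a\<close> is linear up to a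
  translation.  Since \<open>t b' a = g (\<pi> a) - sec 0\<close>, subtracting the value at \<open>0\<close> gives the linear map \<open>\<theta>\<close>.\<close>

lemma section_of_coboundary:
  fixes R1 :: "('r1, 'q1) ring_scheme"
  assumes bc: "bar_change R1 R S h1 h \<pi>"
    and E: "derivation R1 (bar1 R1 S) (poly_const R1) (aug1 R1 S h1) ann E"
    and eq': "\<forall>q\<in>carrier (bar1 R1 S). \<Delta> (var (poly_map R1 R \<pi> (poly_map R1 R \<pi> id) q)) =
      E q \<ominus>\<^bsub>ann\<^esub> E (free_gen R1 {#counit1 R1 S q#}) \<oplus>\<^bsub>ann\<^esub> E (free_gen R1 {#bar_lift R1 (counit0 R1 S h1) q#})"
  shows "\<exists>\<theta>. (\<forall>a\<in>carrier R1. h1 a = \<zero>\<^bsub>S\<^esub> \<longrightarrow> \<theta> a \<in> carrier D \<and> t \<otimes>\<^bsub>D\<^esub> \<theta> a = g (\<pi> a)) \<and>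
    (\<forall>a\<in>carrier R1. \<forall>b\<in>carrier R1. h1 a = \<zero>\<^bsub>S\<^esub> \<longrightarrow> h1 b = \<zero>\<^bsub>S\<^esub> \<longrightarrow> \<theta> (a \<oplus>\<^bsub>R1\<^esub> b) = \<theta> a \<oplus>\<^bsub>D\<^esub> \<theta> b) \<and>
    (\<forall>r\<in>carrier R1. \<forall>a\<in>carrier R1. h1 a = \<zero>\<^bsub>S\<^esub> \<longrightarrow> \<theta> (r \<otimes>\<^bsub>R1\<^esub> a) = g (\<pi> r) \<otimes>\<^bsub>D\<^esub> \<theta> a)"
proof -
  interpret C: bar_change R1 R S h1 h \<pi> by (rule bc)
  note eq = bspec[OF eq']
  interpret M: module S ann by (rule ann_module)
  interpret Q0: cring "bar0 R1 S" by (rule C.b1.bar_crings)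
  interpret Q1: cring "bar1 R1 S" by (rule C.b1.bar_crings)
  let ?c = "poly_const R1" and ?v = "C.b1.var"
  have Ea: "E q \<in> carrier ann" if "q \<in> carrier (bar1 R1 S)" for q
    using E that by (simp add: derivation_def)
  have Ec: "E q \<in> carrier D" "t \<otimes>\<^bsub>D\<^esub> E q = \<zero>\<^bsub>D\<^esub>" if "q \<in> carrier (bar1 R1 S)" for q
    using Ea[OF that] by (simp_all add: ann_simps)
  define b' where "b' p = \<beta> (C.bc0 p) \<ominus>\<^bsub>D\<^esub> E (?v p)" for p
  define B' where "B' q = B (C.bc1 q) \<ominus>\<^bsub>D\<^esub> E q" for q
  note v0 = C.b1.var_closed(1) and v1 = C.b1.var_closed(2)
  note d10c = ring_hom_closed[OF C.b1.d1_homs(1)] and d11c = ring_hom_closed[OF C.b1.d1_homs(2)]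
  note c0 = ring_hom_closed[OF C.b1.const_homs(1)] and c1 = ring_hom_closed[OF C.b1.const_homs(2)]
  note bc0c = ring_hom_closed[OF C.bc_homs(1)] and bc1c = ring_hom_closed[OF C.bc_homs(2)]
  note pc = ring_hom_closed[OF C.\<pi>]
  have b'c: "b' p \<in> carrier D" if "p \<in> carrier (bar0 R1 S)" for p
    using \<beta>[OF bc0c[OF that]] Ec(1)[OF v1[OF that]] by (simp add: b'_def)
  have B'c: "B' q \<in> carrier D" if "q \<in> carrier (bar1 R1 S)" for q
    using B_closed[OF bc1c[OF that]] Ec(1)[OF that] by (simp add: B'_def)
  have key: "B' q = b' (C.b1.d10 q) \<ominus>\<^bsub>D\<^esub> b' (C.b1.d11 q)" if q: "q \<in> carrier (bar1 R1 S)" for q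
  proof -
    note Eq = Ea[OF q] Ea[OF v1[OF d10c[OF q]]] Ea[OF v1[OF d11c[OF q]]]
    note cl = B_closed[OF bc1c[OF q]] Ec(1)[OF q] Ec(1)[OF v1[OF d10c[OF q]]] Ec(1)[OF v1[OF d11c[OF q]]]
      conjunct1[OF \<beta>[OF bc0c[OF d10c[OF q]]]] conjunct1[OF \<beta>[OF bc0c[OF d11c[OF q]]]]
    have alg: "x \<ominus>\<^bsub>D\<^esub> u = (y \<ominus>\<^bsub>D\<^esub> v) \<ominus>\<^bsub>D\<^esub> (z \<ominus>\<^bsub>D\<^esub> w)"
      if "x \<ominus>\<^bsub>D\<^esub> y \<oplus>\<^bsub>D\<^esub> z = u \<ominus>\<^bsub>D\<^esub> v \<oplus>\<^bsub>D\<^esub> w"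
        "x \<in> carrier D" "y \<in> carrier D" "z \<in> carrier D" "u \<in> carrier D" "v \<in> carrier D" "w \<in> carrier D"
      for x y z u v w
    proof -
      have "x \<ominus>\<^bsub>D\<^esub> u = (x \<ominus>\<^bsub>D\<^esub> y \<oplus>\<^bsub>D\<^esub> z) \<oplus>\<^bsub>D\<^esub> (y \<ominus>\<^bsub>D\<^esub> z \<ominus>\<^bsub>D\<^esub> u)" using that(2-) by algebra
      also have "\<dots> = (u \<ominus>\<^bsub>D\<^esub> v \<oplus>\<^bsub>D\<^esub> w) \<oplus>\<^bsub>D\<^esub> (y \<ominus>\<^bsub>D\<^esub> z \<ominus>\<^bsub>D\<^esub> u)" using that(1) by simp
      also have "\<dots> = (y \<ominus>\<^bsub>D\<^esub> v) \<ominus>\<^bsub>D\<^esub> (z \<ominus>\<^bsub>D\<^esub> w)" using that(2-) by algebra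
      finally show ?thesis .
    qed
    have "B (C.bc1 q) \<ominus>\<^bsub>D\<^esub> \<beta> (C.bc0 (C.b1.d10 q)) \<oplus>\<^bsub>D\<^esub> \<beta> (C.bc0 (C.b1.d11 q))
        = E q \<ominus>\<^bsub>D\<^esub> E (?v (C.b1.d10 q)) \<oplus>\<^bsub>D\<^esub> E (?v (C.b1.d11 q))"
      using eq[OF q] \<Delta>_var[OF bc1c[OF q]] Eq
      by (simp add: C.d1_bc[OF q] ann_minus ann_simps(3))
    from alg[OF this] show ?thesis unfolding B'_def b'_def using cl by blast
  qed
  have B'_var: "B' (?v p) = b' p" if "p \<in> carrier (bar0 R1 S)" for p
    using that by (simp add: B'_def b'_def C.bc_var B_var bc0c)
  have B'_add: "B' (q \<oplus>\<^bsub>bar1 R1 S\<^esub> q') = B' q \<oplus>\<^bsub>D\<^esub> B' q'"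
    if q: "q \<in> carrier (bar1 R1 S)" "q' \<in> carrier (bar1 R1 S)" for q q'
  proof -
    have "E (q \<oplus>\<^bsub>bar1 R1 S\<^esub> q') = E q \<oplus>\<^bsub>D\<^esub> E q'" using E q by (simp add: derivation_def ann_simps)
    moreover have "(x \<oplus>\<^bsub>D\<^esub> y) \<ominus>\<^bsub>D\<^esub> (u \<oplus>\<^bsub>D\<^esub> v) = (x \<ominus>\<^bsub>D\<^esub> u) \<oplus>\<^bsub>D\<^esub> (y \<ominus>\<^bsub>D\<^esub> v)"
      if "x \<in> carrier D" "y \<in> carrier D" "u \<in> carrier D" "v \<in> carrier D" for x y u v
      using that by algebra
    ultimately show ?thesis
      using q by (simp add: B'_def ring_hom_add[OF C.bc_homs(2)] B_add bc1c B_closed Ec)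
  qed
  have B'_smult: "B' (?c r \<otimes>\<^bsub>bar1 R1 S\<^esub> q) = g (\<pi> r) \<otimes>\<^bsub>D\<^esub> B' q"
    if r: "r \<in> carrier R1" and q: "q \<in> carrier (bar1 R1 S)" for r q
  proof -
    have gc: "g (\<pi> r) \<in> carrier D" using ring_hom_closed[OF g pc[OF r]] .
    have "E (?c r \<otimes>\<^bsub>bar1 R1 S\<^esub> q) = h1 r \<odot>\<^bsub>ann\<^esub> E q \<oplus>\<^bsub>ann\<^esub> aug1 R1 S h1 q \<odot>\<^bsub>ann\<^esub> \<zero>\<^bsub>ann\<^esub>"
      using E c1[OF r] q r by (simp add: derivation_def C.b1.aug1_const)
    also have "\<dots> = \<rho> (g (\<pi> r)) \<odot>\<^bsub>ann\<^esub> E q"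
      using Ea[OF q] ring_hom_closed[OF C.b1.aug_homs(1) q] ring_hom_closed[OF C.b1.h r]
      by (simp add: \<rho>g[OF pc[OF r]] C.h_\<pi>[OF r])
    also have "\<dots> = g (\<pi> r) \<otimes>\<^bsub>D\<^esub> E q" by (rule sec_action[OF gc Ea[OF q]])
    finally show ?thesis
      using q r gc by (simp add: B'_def ring_hom_mult[OF C.bc_homs(2)] c1 C.bc_const B_const_mult pc bc1c
          B_closed Ec a_minus_def D.r_distr D.r_minus)
  qed
  let ?z = "?c \<zero>\<^bsub>R1\<^esub>"
  define \<theta> where "\<theta> a = b' (?c a) \<ominus>\<^bsub>D\<^esub> b' ?z" for a
  have zero: "h1 \<zero>\<^bsub>R1\<^esub> = \<zero>\<^bsub>S\<^esub>"
    using ring_hom_zero[OF C.b1.h C.b1.R.ring_axioms S.ring_axioms] .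
  have tc: "\<theta> a \<in> carrier D" if "a \<in> carrier R1" for a
    using b'c c0 that by (simp add: \<theta>_def)
  have tb': "t \<otimes>\<^bsub>D\<^esub> b' (?c a) = g (\<pi> a) \<ominus>\<^bsub>D\<^esub> sec \<zero>\<^bsub>S\<^esub>" if a: "a \<in> carrier R1" "h1 a = \<zero>\<^bsub>S\<^esub>" for a
  proof -
    have p: "?c a \<in> carrier (bar0 R1 S)" by (rule c0[OF a(1)])
    have "t \<otimes>\<^bsub>D\<^esub> b' (?c a) = t \<otimes>\<^bsub>D\<^esub> \<beta> (C.bc0 (?c a))"
    proof -
      have "t \<otimes>\<^bsub>D\<^esub> (x \<ominus>\<^bsub>D\<^esub> y) = t \<otimes>\<^bsub>D\<^esub> x \<ominus>\<^bsub>D\<^esub> t \<otimes>\<^bsub>D\<^esub> y" if "x \<in> carrier D" "y \<in> carrier D" for x y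
        using that t by algebra
      moreover have "x \<ominus>\<^bsub>D\<^esub> \<zero>\<^bsub>D\<^esub> = x" if "x \<in> carrier D" for x using that by algebra
      ultimately show ?thesis
        using conjunct1[OF \<beta>[OF bc0c[OF p]]] Ec[OF v1[OF p]] t by (simp add: b'_def)
    qed
    also have "\<dots> = g (\<pi> a) \<ominus>\<^bsub>D\<^esub> sec \<zero>\<^bsub>S\<^esub>"
      using \<beta>[OF bc0c[OF p]] C.\<epsilon>_bc[OF p] a by (simp add: C.bc_const \<sigma>_const pc C.b1.\<epsilon>_const)
    finally show ?thesis .
  qed
  have tt: "t \<otimes>\<^bsub>D\<^esub> \<theta> a = g (\<pi> a)" if a: "a \<in> carrier R1" "h1 a = \<zero>\<^bsub>S\<^esub>" for a
  proof -
    have z0: "g (\<pi> \<zero>\<^bsub>R1\<^esub>) = \<zero>\<^bsub>D\<^esub>"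
      using ring_hom_zero[OF C.\<pi> C.b1.R.ring_axioms R.ring_axioms] ring_hom_zero[OF g R.ring_axioms D.ring_axioms] by simp
    have s: "sec \<zero>\<^bsub>S\<^esub> \<in> carrier D" using sec[of "\<zero>\<^bsub>S\<^esub>"] by simp
    have gc: "g (\<pi> a) \<in> carrier D" using ring_hom_closed[OF g pc[OF a(1)]] .
    have "t \<otimes>\<^bsub>D\<^esub> \<theta> a = t \<otimes>\<^bsub>D\<^esub> b' (?c a) \<ominus>\<^bsub>D\<^esub> t \<otimes>\<^bsub>D\<^esub> b' ?z"
      using t b'c[OF c0[OF a(1)]] b'c[OF c0[of "\<zero>\<^bsub>R1\<^esub>"]] by (simp add: \<theta>_def a_minus_def D.r_distr D.r_minus)
    also have "\<dots> = (g (\<pi> a) \<ominus>\<^bsub>D\<^esub> sec \<zero>\<^bsub>S\<^esub>) \<ominus>\<^bsub>D\<^esub> (\<zero>\<^bsub>D\<^esub> \<ominus>\<^bsub>D\<^esub> sec \<zero>\<^bsub>S\<^esub>)"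
      using tb'[OF a] tb'[OF _ zero] z0 by simp
    also have "\<dots> = g (\<pi> a)" using s gc by algebra
    finally show ?thesis .
  qed
  \<comment> \<open>On \<open>[a] + [b]\<close> and \<open>r[a]\<close> the second face only depends on the images of \<open>a\<close> and \<open>b\<close> in \<open>S\<close>, which vanish.\<close>
  have addz: "b' (?c a) \<oplus>\<^bsub>D\<^esub> b' (?c b) = b' (?c (a \<oplus>\<^bsub>R1\<^esub> b)) \<ominus>\<^bsub>D\<^esub> b' (?v \<zero>\<^bsub>S\<^esub> \<oplus>\<^bsub>bar0 R1 S\<^esub> ?v \<zero>\<^bsub>S\<^esub>)"
    if a: "a \<in> carrier R1" "h1 a = \<zero>\<^bsub>S\<^esub>" and b: "b \<in> carrier R1" "h1 b = \<zero>\<^bsub>S\<^esub>" for a b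
  proof -
    let ?q = "?v (?c a) \<oplus>\<^bsub>bar1 R1 S\<^esub> ?v (?c b)"
    note va = v1[OF c0[OF a(1)]] and vb = v1[OF c0[OF b(1)]]
    have "B' ?q = b' (?c a) \<oplus>\<^bsub>D\<^esub> b' (?c b)" using B'_add[OF va vb] B'_var c0 a b by simp
    moreover have "C.b1.d10 ?q = ?c (a \<oplus>\<^bsub>R1\<^esub> b)"
      using ring_hom_add[OF C.b1.d1_homs(1) va vb] ring_hom_add[OF C.b1.const_homs(1) a(1) b(1)] c0 a b
      by (simp add: C.b1.d10_var)
    moreover have "C.b1.d11 ?q = ?v \<zero>\<^bsub>S\<^esub> \<oplus>\<^bsub>bar0 R1 S\<^esub> ?v \<zero>\<^bsub>S\<^esub>"
      using ring_hom_add[OF C.b1.d1_homs(2) va vb] a b by (simp add: C.b1.R.bar_lift_var C.b1.\<epsilon>_const)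
    ultimately show ?thesis using key[of ?q] va vb by simp
  qed
  have smultz: "g (\<pi> r) \<otimes>\<^bsub>D\<^esub> b' (?c a) = b' (?c (r \<otimes>\<^bsub>R1\<^esub> a)) \<ominus>\<^bsub>D\<^esub> b' (?c r \<otimes>\<^bsub>bar0 R1 S\<^esub> ?v \<zero>\<^bsub>S\<^esub>)"
    if r: "r \<in> carrier R1" and a: "a \<in> carrier R1" "h1 a = \<zero>\<^bsub>S\<^esub>" for r a
  proof -
    let ?q = "?c r \<otimes>\<^bsub>bar1 R1 S\<^esub> ?v (?c a)"
    note va = v1[OF c0[OF a(1)]]
    have "B' ?q = g (\<pi> r) \<otimes>\<^bsub>D\<^esub> b' (?c a)" using B'_smult[OF r va] B'_var c0 a by simp
    moreover have "C.b1.d10 ?q = ?c (r \<otimes>\<^bsub>R1\<^esub> a)"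
      using ring_hom_mult[OF C.b1.d1_homs(1) c1[OF r] va] ring_hom_mult[OF C.b1.const_homs(1) r a(1)] c0 a r
      by (simp add: C.b1.d10_var C.b1.d10_const)
    moreover have "C.b1.d11 ?q = ?c r \<otimes>\<^bsub>bar0 R1 S\<^esub> ?v \<zero>\<^bsub>S\<^esub>"
      using ring_hom_mult[OF C.b1.d1_homs(2) c1[OF r] va] a r
      by (simp add: C.b1.R.bar_lift_var C.b1.R.bar_lift_const C.b1.\<epsilon>_const)
    ultimately show ?thesis using key[of ?q] va c1[OF r] by simp
  qed
  have vz: "?v \<zero>\<^bsub>S\<^esub> \<in> carrier (bar0 R1 S)" by (rule v0) simp
  have addt: "\<theta> (a \<oplus>\<^bsub>R1\<^esub> b) = \<theta> a \<oplus>\<^bsub>D\<^esub> \<theta> b"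
    if a: "a \<in> carrier R1" "h1 a = \<zero>\<^bsub>S\<^esub>" and b: "b \<in> carrier R1" "h1 b = \<zero>\<^bsub>S\<^esub>" for a b
  proof -
    let ?w = "b' (?v \<zero>\<^bsub>S\<^esub> \<oplus>\<^bsub>bar0 R1 S\<^esub> ?v \<zero>\<^bsub>S\<^esub>)"
    have cl: "?w \<in> carrier D" "b' ?z \<in> carrier D" "b' (?c a) \<in> carrier D" "b' (?c b) \<in> carrier D" "b' (?c (a \<oplus>\<^bsub>R1\<^esub> b)) \<in> carrier D"
      using vz a b by (auto intro!: b'c c0)
    have 1: "b' ?z \<oplus>\<^bsub>D\<^esub> b' ?z = b' ?z \<ominus>\<^bsub>D\<^esub> ?w" using addz[of "\<zero>\<^bsub>R1\<^esub>" "\<zero>\<^bsub>R1\<^esub>"] zero by simp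
    have "b' ?z = (b' ?z \<oplus>\<^bsub>D\<^esub> b' ?z) \<ominus>\<^bsub>D\<^esub> b' ?z" using cl by algebra
    also have "\<dots> = \<ominus>\<^bsub>D\<^esub> ?w" unfolding 1 using cl by algebra
    finally have w: "b' ?z = \<ominus>\<^bsub>D\<^esub> ?w" .
    have 2: "b' (?c a) \<oplus>\<^bsub>D\<^esub> b' (?c b) = b' (?c (a \<oplus>\<^bsub>R1\<^esub> b)) \<ominus>\<^bsub>D\<^esub> ?w" by (rule addz[OF a b])
    have alg1: "(x \<ominus>\<^bsub>D\<^esub> z) \<oplus>\<^bsub>D\<^esub> (y \<ominus>\<^bsub>D\<^esub> z) = (x \<oplus>\<^bsub>D\<^esub> y) \<ominus>\<^bsub>D\<^esub> (z \<oplus>\<^bsub>D\<^esub> z)"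
      if "x \<in> carrier D" "y \<in> carrier D" "z \<in> carrier D" for x y z using that by algebra
    have alg2: "(y \<ominus>\<^bsub>D\<^esub> w) \<ominus>\<^bsub>D\<^esub> ((\<ominus>\<^bsub>D\<^esub> w) \<oplus>\<^bsub>D\<^esub> (\<ominus>\<^bsub>D\<^esub> w)) = y \<ominus>\<^bsub>D\<^esub> (\<ominus>\<^bsub>D\<^esub> w)"
      if "w \<in> carrier D" "y \<in> carrier D" for w y using that by algebra
    have "\<theta> a \<oplus>\<^bsub>D\<^esub> \<theta> b = (b' (?c a) \<oplus>\<^bsub>D\<^esub> b' (?c b)) \<ominus>\<^bsub>D\<^esub> (b' ?z \<oplus>\<^bsub>D\<^esub> b' ?z)"
      unfolding \<theta>_def by (rule alg1[OF cl(3,4,2)])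
    also have "\<dots> = \<theta> (a \<oplus>\<^bsub>R1\<^esub> b)" unfolding 2 \<theta>_def w by (rule alg2[OF cl(1,5)])
    finally show ?thesis by (rule sym)
  qed
  have smultt: "\<theta> (r \<otimes>\<^bsub>R1\<^esub> a) = g (\<pi> r) \<otimes>\<^bsub>D\<^esub> \<theta> a"
    if r: "r \<in> carrier R1" and a: "a \<in> carrier R1" "h1 a = \<zero>\<^bsub>S\<^esub>" for r a
  proof -
    let ?w = "b' (?c r \<otimes>\<^bsub>bar0 R1 S\<^esub> ?v \<zero>\<^bsub>S\<^esub>)"
    have cl: "?w \<in> carrier D" "b' ?z \<in> carrier D" "b' (?c a) \<in> carrier D" "b' (?c (r \<otimes>\<^bsub>R1\<^esub> a)) \<in> carrier D"
      "g (\<pi> r) \<in> carrier D"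
      using vz a r by (auto intro!: b'c c0 ring_hom_closed[OF g] pc)
    have 1: "g (\<pi> r) \<otimes>\<^bsub>D\<^esub> b' ?z = b' ?z \<ominus>\<^bsub>D\<^esub> ?w" using smultz[OF r, of "\<zero>\<^bsub>R1\<^esub>"] zero r by simp
    have alg1: "k \<otimes>\<^bsub>D\<^esub> (x \<ominus>\<^bsub>D\<^esub> z) = k \<otimes>\<^bsub>D\<^esub> x \<ominus>\<^bsub>D\<^esub> k \<otimes>\<^bsub>D\<^esub> z"
      if "k \<in> carrier D" "x \<in> carrier D" "z \<in> carrier D" for k x z using that by algebra
    have alg2: "(y \<ominus>\<^bsub>D\<^esub> w) \<ominus>\<^bsub>D\<^esub> (z \<ominus>\<^bsub>D\<^esub> w) = y \<ominus>\<^bsub>D\<^esub> z"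
      if "w \<in> carrier D" "y \<in> carrier D" "z \<in> carrier D" for w y z using that by algebra
    have "g (\<pi> r) \<otimes>\<^bsub>D\<^esub> \<theta> a = g (\<pi> r) \<otimes>\<^bsub>D\<^esub> b' (?c a) \<ominus>\<^bsub>D\<^esub> g (\<pi> r) \<otimes>\<^bsub>D\<^esub> b' ?z"
      unfolding \<theta>_def by (rule alg1[OF cl(5,3,2)])
    also have "\<dots> = \<theta> (r \<otimes>\<^bsub>R1\<^esub> a)" unfolding 1 smultz[OF r a] \<theta>_def by (rule alg2[OF cl(1,4,2)])
    finally show ?thesis by (rule sym)
  qed
  show ?thesis
    by (intro exI[of _ \<theta>] conjI ballI impI)
       (rule tc tt addt smultt; assumption)+
qed

end

section \<open>Transport of modules and derivations\<close>

text \<open>Renames the elements of a module along an injection.  The annihilator above consists of cosets, that is of sets of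
  elements of \<open>A\<close>, whereas the regularity hypothesis speaks of modules carried by sets of lists.\<close>

definition transport_module :: "('x \<Rightarrow> 'y) \<Rightarrow> ('s, 'x) module \<Rightarrow> ('s, 'y) module" where
  "transport_module \<iota> M =
    (let j = inv_into (carrier M) \<iota> in
     \<lparr>carrier = \<iota> ` carrier M, monoid.mult = undefined, one = undefined, ring.zero = \<iota> \<zero>\<^bsub>M\<^esub>,
      ring.add = (\<lambda>x y. \<iota> (j x \<oplus>\<^bsub>M\<^esub> j y)), smult = (\<lambda>a x. \<iota> (a \<odot>\<^bsub>M\<^esub> j x))\<rparr>)"

lemma transport_module:
  assumes M: "module S M" and inj: "inj_on \<iota> (carrier M)"
  shows "module S (transport_module \<iota> M)"
    and "semilinear S id M (transport_module \<iota> M) \<iota>"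
    and "semilinear S id (transport_module \<iota> M) M (inv_into (carrier M) \<iota>)"
proof -
  interpret M: module S M by (rule M)
  have j: "inv_into (carrier M) \<iota> (\<iota> x) = x" if "x \<in> carrier M" for x
    using inj that by (rule inv_into_f_f)
  note simps = transport_module_def Let_def
  show "module S (transport_module \<iota> M)"
  proof (rule moduleI[OF M.R.cring_axioms])
    show "abelian_group (transport_module \<iota> M)"
    proof (rule abelian_groupI)
      fix x assume "x \<in> carrier (transport_module \<iota> M)"
      then obtain y where "y \<in> carrier M" "x = \<iota> y" by (auto simp: simps)
      then show "\<exists>z\<in>carrier (transport_module \<iota> M). z \<oplus>\<^bsub>transport_module \<iota> M\<^esub> x = \<zero>\<^bsub>transport_module \<iota> M\<^esub>"
        by (intro bexI[of _ "\<iota> (\<ominus>\<^bsub>M\<^esub> y)"]) (auto simp: simps j M.M.l_neg)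
    qed (auto simp: simps j M.M.a_ac)
  qed (auto simp: simps j M.smult_l_distr M.smult_r_distr M.smult_assoc1)
  show "semilinear S id M (transport_module \<iota> M) \<iota>"
    by (auto simp: semilinear_def simps j)
  show "semilinear S id (transport_module \<iota> M) M (inv_into (carrier M) \<iota>)"
    by (auto simp: semilinear_def simps j)
qed

lemma derivation_compose:
  assumes "module S M" "module S N" "semilinear S id M N f" "e \<in> ring_hom P S" "derivation R P u e M E"
  shows "derivation R P u e N (\<lambda>x. f (E x))"
proof -
  interpret f: semilinear_map S S M N id f
    by (intro semilinear_map.intro semilinear_map_axioms.intro assms id_ring_hom)
  show ?thesis
    using assms(5) ring_hom_closed[OF assms(4)]
    by (simp add: derivation_def f.closed f.add f.smult f.zero)
qed

lemma derivation_add: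
  assumes "module S M" "e \<in> ring_hom P S" "derivation R P u e M E" "derivation R P u e M E'"
  shows "derivation R P u e M (\<lambda>x. E x \<oplus>\<^bsub>M\<^esub> E' x)"
proof -
  interpret M: module S M by fact
  show ?thesis
    using assms(3,4) ring_hom_closed[OF assms(2)]
    by (simp add: derivation_def M.smult_r_distr M.M.a_ac)
qed

lemma (in bar_change) derivation_bc:
  assumes M: "module S M" and E: "derivation R (bar1 R S) (poly_const R) b.a1 M E"
  shows "derivation R1 (bar1 R1 S) (poly_const R1) b1.a1 M (\<lambda>q. E (bc1 q))"
  using E ring_hom_closed[OF bc_homs(2)] ring_hom_add[OF bc_homs(2)] ring_hom_mult[OF bc_homs(2)]
    ring_hom_closed[OF \<pi>]
  by (simp add: derivation_def aug1_bc bc_const)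

section \<open>Splitting the maximal ideal over a principal quotient\<close>

lemma quot_proj:
  assumes A: "cring A" and I: "ideal I A" and J: "ideal J A" and sub: "I \<subseteq> J"
  shows "a \<in> carrier A \<Longrightarrow> quot_map A J id (I +>\<^bsub>A\<^esub> a) = J +>\<^bsub>A\<^esub> a"
    and "quot_map A J id \<in> ring_hom (A Quot I) (A Quot J)"
proof -
  interpret A: cring A by (rule A)
  interpret I: ideal I A by (rule I)
  interpret J: ideal J A by (rule J)
  have 1: "quot_map A J id (I +>\<^bsub>A\<^esub> a) = J +>\<^bsub>A\<^esub> a" if a: "a \<in> carrier A" for a
  proof -
    have *: "J +>\<^bsub>A\<^esub> b = J +>\<^bsub>A\<^esub> a" if "b \<in> I +>\<^bsub>A\<^esub> a" for b
    proof -
      have "b \<in> J +>\<^bsub>A\<^esub> a" using that sub by (auto simp: a_r_coset_def')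
      then show ?thesis using J.a_repr_independence'[OF _ a] by simp
    qed
    have "a \<in> I +>\<^bsub>A\<^esub> a" using I.a_rcos_self[OF a] .
    have "(\<Union>b\<in>I +>\<^bsub>A\<^esub> a. J +>\<^bsub>A\<^esub> b) = (\<Union>b\<in>I +>\<^bsub>A\<^esub> a. J +>\<^bsub>A\<^esub> a)" by (rule SUP_cong[OF refl *])
    also have "\<dots> = J +>\<^bsub>A\<^esub> a" using \<open>a \<in> I +>\<^bsub>A\<^esub> a\<close> by blast
    finally show ?thesis by (simp add: quot_map_def)
  qed
  then show "a \<in> carrier A \<Longrightarrow> quot_map A J id (I +>\<^bsub>A\<^esub> a) = J +>\<^bsub>A\<^esub> a" .
  have rep: "\<exists>a\<in>carrier A. x = I +>\<^bsub>A\<^esub> a" if "x \<in> carrier (A Quot I)" for x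
    using that by (auto simp: FactRing_def A_RCOSETS_def' a_r_coset_def')
  note hI = I.rcos_ring_hom and hJ = J.rcos_ring_hom
  show "quot_map A J id \<in> ring_hom (A Quot I) (A Quot J)"
  proof (rule ring_hom_memI)
    fix x assume "x \<in> carrier (A Quot I)"
    then obtain a where a: "a \<in> carrier A" "x = I +>\<^bsub>A\<^esub> a" using rep by blast
    then show "quot_map A J id x \<in> carrier (A Quot J)" using 1 ring_hom_closed[OF hJ a(1)] by simp
    fix y assume "y \<in> carrier (A Quot I)"
    then obtain b where b: "b \<in> carrier A" "y = I +>\<^bsub>A\<^esub> b" using rep by blast
    show "quot_map A J id (x \<otimes>\<^bsub>A Quot I\<^esub> y) = quot_map A J id x \<otimes>\<^bsub>A Quot J\<^esub> quot_map A J id y"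
      unfolding a(2) b(2) ring_hom_mult[OF hI a(1) b(1), symmetric]
      by (simp add: 1 a(1) b(1) ring_hom_mult[OF hJ a(1) b(1)])
    show "quot_map A J id (x \<oplus>\<^bsub>A Quot I\<^esub> y) = quot_map A J id x \<oplus>\<^bsub>A Quot J\<^esub> quot_map A J id y"
      unfolding a(2) b(2) ring_hom_add[OF hI a(1) b(1), symmetric]
      by (simp add: 1 a(1) b(1) ring_hom_add[OF hJ a(1) b(1)])
  next
    show "quot_map A J id \<one>\<^bsub>A Quot I\<^esub> = \<one>\<^bsub>A Quot J\<^esub>"
      using 1[of "\<one>\<^bsub>A\<^esub>"] ring_hom_one[OF hI] ring_hom_one[OF hJ] by simp
  qed
qed

lemma ideal_pow_ideal:
  assumes "cring A" "ideal \<mm> A"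
  shows "ideal (ideal_pow A \<mm> n) A"
proof -
  interpret A: cring A by fact
  interpret I: comm_monoid "ideals_set A" by (rule A.ideals_set_is_comm_monoid)
  have "\<mm> \<in> carrier (ideals_set A)" using assms by (simp add: ideals_set_def)
  then have "ideal_pow A \<mm> n \<in> carrier (ideals_set A)" by simp
  then show ?thesis by (simp add: ideals_set_def)
qed

lemma ideal_pow_0: "ideal_pow A \<mm> 0 = carrier A"
  by (simp add: ideals_set_def)

lemma ideal_pow_Suc: "ideal_pow A \<mm> (Suc n) = ideal_pow A \<mm> n \<cdot>\<^bsub>A\<^esub> \<mm>"
  by (simp add: ideals_set_def nat_pow_def)

lemma ideal_pow_mono:
  assumes "cring A" "ideal \<mm> A" "i \<le> l"
  shows "ideal_pow A \<mm> l \<subseteq> ideal_pow A \<mm> i"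
  using assms(3)
proof (induction l rule: dec_induct)
  case (step n)
  interpret A: cring A by fact
  show ?case
    using step A.ideal_prod_inter[OF ideal_pow_ideal[OF assms(1,2), of n] assms(2)]
    by (auto simp: ideal_pow_Suc simp del: nat_pow_Suc)
qed simp

lemma ideal_pow_1:
  assumes "cring A" "ideal \<mm> A"
  shows "ideal_pow A \<mm> (Suc 0) = \<mm>"
proof -
  interpret A: cring A by fact
  interpret I: comm_monoid "ideals_set A" by (rule A.ideals_set_is_comm_monoid)
  show ?thesis by (rule I.nat_pow_eone[unfolded One_nat_def]) (simp add: ideals_set_def assms)
qed

text \<open>The crossed module is multiplication by \<open>t\<close> on \<open>D = A/I\<close>, viewed over \<open>A/\<mm>\<^sup>n\<close>; the hypothesis \<open>gen\<close> says
  that \<open>D/tD\<close> is the residue field.\<close>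

theorem formally_regular_splitting:
  fixes A :: "('a, 'q) ring_scheme"
  assumes A: "cring A" and mm: "ideal \<mm> A" and reg: "formally_regular TYPE('a list set) A \<mm>"
    and I: "ideal I A" and n: "1 \<le> n" and sub: "ideal_pow A \<mm> n \<subseteq> I" "I \<subseteq> \<mm>"
    and t: "t \<in> \<mm>" and gen: "\<And>x. x \<in> \<mm> \<Longrightarrow> \<exists>a\<in>carrier A. \<exists>i\<in>I. x = t \<otimes>\<^bsub>A\<^esub> a \<oplus>\<^bsub>A\<^esub> i"
  shows "\<exists>\<theta>. (\<forall>a\<in>\<mm>. \<theta> a \<in> carrier (A Quot I) \<and> (I +>\<^bsub>A\<^esub> t) \<otimes>\<^bsub>A Quot I\<^esub> \<theta> a = I +>\<^bsub>A\<^esub> a) \<and>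
    (\<forall>a\<in>\<mm>. \<forall>b\<in>\<mm>. \<theta> (a \<oplus>\<^bsub>A\<^esub> b) = \<theta> a \<oplus>\<^bsub>A Quot I\<^esub> \<theta> b) \<and>
    (\<forall>r\<in>carrier A. \<forall>a\<in>\<mm>. \<theta> (r \<otimes>\<^bsub>A\<^esub> a) = (I +>\<^bsub>A\<^esub> r) \<otimes>\<^bsub>A Quot I\<^esub> \<theta> a)"
proof -
  interpret A: cring A by (rule A)
  interpret mm: ideal \<mm> A by (rule mm)
  interpret I: ideal I A by (rule I)
  let ?P = "\<lambda>i. ideal_pow A \<mm> i"
  let ?R = "\<lambda>i. A Quot ?P i" and ?k = "A Quot \<mm>" and ?D = "A Quot I" and ?h = "quot_map A \<mm> id"
  note Pid = ideal_pow_ideal[OF A mm]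
  have Pm: "?P i \<subseteq> \<mm>" if "1 \<le> i" for i
    using ideal_pow_mono[OF A mm, of "Suc 0" i] ideal_pow_1[OF A mm] that by simp
  have Rc: "cring (?R i)" for i by (rule ideal.quotient_is_cring[OF Pid A])
  have kc: "cring ?k" and Dc: "cring ?D" by (rule mm.quotient_is_cring[OF A], rule I.quotient_is_cring[OF A])
  have rep: "\<exists>a\<in>carrier A. x = J +>\<^bsub>A\<^esub> a" if "x \<in> carrier (A Quot J)" for x J
    using that by (auto simp: FactRing_def A_RCOSETS_def' a_r_coset_def')
  have hh: "?h \<in> ring_hom (?R i) ?k" if "1 \<le> i" for i by (rule quot_proj(2)[OF A Pid mm Pm[OF that]])
  have bar: "bar (?R i) ?k ?h" if "1 \<le> i" for i
    by (intro bar.intro bar_axioms.intro Rc kc hh[OF that])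
  have change: "bar_change (?R l) (?R i) ?k ?h ?h (quot_map A (?P i) id)" if il: "1 \<le> i" "i \<le> l" for i l
  proof (intro bar_change.intro bar_change_axioms.intro bar)
    note pr = quot_proj[OF A Pid Pid ideal_pow_mono[OF A mm il(2)]]
    show "quot_map A (?P i) id \<in> ring_hom (?R l) (?R i)" by (rule pr(2))
    fix r assume "r \<in> carrier (?R l)"
    then obtain a where "a \<in> carrier A" "r = ?P l +>\<^bsub>A\<^esub> a" using rep by blast
    then show "?h (quot_map A (?P i) id r) = ?h r"
      using quot_proj(1)[OF A Pid mm Pm] pr(1) il by simp
  qed (use il in auto)
  have tA: "t \<in> carrier A" using t mm.Icarr by blast
  note pI = quot_proj[OF A Pid I sub(1)] and pm = quot_proj[OF A I mm sub(2)]
  interpret crossed "?R n" ?k ?h ?D "quot_map A I id" ?h "I +>\<^bsub>A\<^esub> t"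
  proof (intro crossed.intro crossed_axioms.intro bar n Dc pI(2) pm(2))
    fix r assume "r \<in> carrier (?R n)"
    then obtain a where "a \<in> carrier A" "r = ?P n +>\<^bsub>A\<^esub> a" using rep by blast
    then show "?h (quot_map A I id r) = ?h r"
      using quot_proj(1)[OF A Pid mm Pm[OF n]] pI(1) pm(1) by simp
  next
    show "I +>\<^bsub>A\<^esub> t \<in> carrier ?D" using ring_hom_closed[OF I.rcos_ring_hom tA] .
  next
    fix c assume "c \<in> carrier ?k"
    then obtain a where "a \<in> carrier A" "c = \<mm> +>\<^bsub>A\<^esub> a" using rep by blast
    then show "\<exists>d\<in>carrier ?D. ?h d = c"
      using pm(1) ring_hom_closed[OF I.rcos_ring_hom] by (intro bexI[of _ "I +>\<^bsub>A\<^esub> a"]) auto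
  next
    fix d assume "d \<in> carrier ?D"
    then obtain a where a: "a \<in> carrier A" "d = I +>\<^bsub>A\<^esub> a" using rep by blast
    have hd: "?h d = \<mm> +>\<^bsub>A\<^esub> a" using a pm(1) by simp
    have z: "\<zero>\<^bsub>?k\<^esub> = \<mm>" by (simp add: FactRing_def)
    show "?h d = \<zero>\<^bsub>?k\<^esub> \<longleftrightarrow> (\<exists>e\<in>carrier ?D. d = (I +>\<^bsub>A\<^esub> t) \<otimes>\<^bsub>?D\<^esub> e)"
    proof
      assume "?h d = \<zero>\<^bsub>?k\<^esub>"
      then have "a \<in> \<mm>" using hd z mm.a_rcos_self[OF a(1)] by simp
      then obtain b i where bi: "b \<in> carrier A" "i \<in> I" "a = t \<otimes>\<^bsub>A\<^esub> b \<oplus>\<^bsub>A\<^esub> i" using gen by blast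
      have iA: "i \<in> carrier A" using bi I.Icarr by blast
      have "I +>\<^bsub>A\<^esub> a = (I +>\<^bsub>A\<^esub> (t \<otimes>\<^bsub>A\<^esub> b)) \<oplus>\<^bsub>?D\<^esub> (I +>\<^bsub>A\<^esub> i)"
        using ring_hom_add[OF I.rcos_ring_hom, of "t \<otimes>\<^bsub>A\<^esub> b" i] bi tA iA by simp
      also have "I +>\<^bsub>A\<^esub> i = \<zero>\<^bsub>?D\<^esub>" using I.a_rcos_const[OF bi(2)] by (simp add: FactRing_def)
      also have "(I +>\<^bsub>A\<^esub> (t \<otimes>\<^bsub>A\<^esub> b)) \<oplus>\<^bsub>?D\<^esub> \<zero>\<^bsub>?D\<^esub> = I +>\<^bsub>A\<^esub> (t \<otimes>\<^bsub>A\<^esub> b)"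
        using bi tA by (intro abelian_monoid.r_zero[OF abelian_group.axioms(1)[OF ring.axioms(1)[OF cring.axioms(1)[OF Dc]]]]
            ring_hom_closed[OF I.rcos_ring_hom]) simp
      also have "\<dots> = (I +>\<^bsub>A\<^esub> t) \<otimes>\<^bsub>?D\<^esub> (I +>\<^bsub>A\<^esub> b)" using ring_hom_mult[OF I.rcos_ring_hom tA bi(1)] .
      finally show "\<exists>e\<in>carrier ?D. d = (I +>\<^bsub>A\<^esub> t) \<otimes>\<^bsub>?D\<^esub> e"
        using a(2) ring_hom_closed[OF I.rcos_ring_hom bi(1)] by auto
    next
      assume "\<exists>e\<in>carrier ?D. d = (I +>\<^bsub>A\<^esub> t) \<otimes>\<^bsub>?D\<^esub> e"
      then obtain b where b: "b \<in> carrier A" "d = (I +>\<^bsub>A\<^esub> t) \<otimes>\<^bsub>?D\<^esub> (I +>\<^bsub>A\<^esub> b)" using rep by blast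
      have "d = I +>\<^bsub>A\<^esub> (t \<otimes>\<^bsub>A\<^esub> b)" using ring_hom_mult[OF I.rcos_ring_hom tA b(1)] b(2) by simp
      then have "?h d = \<mm> +>\<^bsub>A\<^esub> (t \<otimes>\<^bsub>A\<^esub> b)" using pm(1) tA b by simp
      also have "\<dots> = \<mm>" using mm.a_rcos_const mm.I_r_closed[OF t b(1)] by simp
      finally show "?h d = \<zero>\<^bsub>?k\<^esub>" using z by simp
    qed
  qed
  \<comment> \<open>Cosets become sets of singleton lists.\<close>
  define \<iota> :: "'a set \<Rightarrow> 'a list set" where "\<iota> = image (\<lambda>a. [a])"
  have inj: "inj_on \<iota> V" for V
    unfolding \<iota>_def by (rule inj_on_subset[of _ UNIV]) (simp_all add: inj_image_eq_iff inj_def)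
  let ?M = "transport_module \<iota> ann" and ?j = "inv_into (carrier ann) \<iota>"
  note tr = transport_module[OF ann_module inj]
  interpret up: semilinear_map ?k ?k ann ?M id \<iota>
    by (intro semilinear_map.intro semilinear_map_axioms.intro ann_module tr id_ring_hom)
  interpret down: semilinear_map ?k ?k ?M ann id ?j
    by (intro semilinear_map.intro semilinear_map_axioms.intro ann_module tr id_ring_hom)
  interpret ann: module ?k ann by (rule ann_module)
  have \<Delta>': "derivation (?R n) P2 (poly_const (?R n)) a2 ?M (\<lambda>x. \<iota> (\<Delta> x))"
    by (rule derivation_compose[OF ann_module tr(1,2) aug_homs(2) \<Delta>_derivation])
  have "\<iota> (\<Delta> (d30 x)) \<ominus>\<^bsub>?M\<^esub> \<iota> (\<Delta> (d31 x)) \<oplus>\<^bsub>?M\<^esub> \<iota> (\<Delta> (d32 x)) \<ominus>\<^bsub>?M\<^esub> \<iota> (\<Delta> (d33 x)) = \<zero>\<^bsub>?M\<^esub>"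
    if x: "x \<in> carrier P3" for x
    using \<Delta>_cocycle[OF x] d3_homs[THEN ring_hom_closed, OF x, THEN \<Delta>_closed] up.zero
    by (simp flip: up.minus up.add)
  then obtain \<phi> where \<phi>: "\<phi> \<in> aq_cocycles2 (?R n) ?k ?h ?M"
    and \<phi>\<Delta>: "\<And>x. x \<in> carrier P2 \<Longrightarrow> \<phi> (cot_d (?R n) ?k P2 a2 x) = \<iota> (\<Delta> x)"
    using cocycle_of_derivation[OF tr(1) \<Delta>'] by blast
  obtain j l \<chi> \<chi>' where jl: "1 \<le> j" "n \<le> l" "j \<le> l"
    and \<chi>: "\<chi> \<in> aq_coboundaries2 (?R l) ?k ?h ?M" "\<chi>' \<in> aq_coboundaries2 (?R j) ?k ?h ?M"
    and eq: "\<And>x. x \<in> carrier (cot2 (?R l) ?k ?h) \<Longrightarrow>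
      \<phi> (cot_map ?k (bar2 (?R l) ?k) (?R n) (bar2 (?R n) ?k) (aug2 (?R n) ?k ?h)
          (bar2_base_change (?R l) (?R n) (quot_map A (?P n) id)) x) =
      \<chi> x \<oplus>\<^bsub>?M\<^esub> \<chi>' (cot_map ?k (bar2 (?R l) ?k) (?R j) (bar2 (?R j) ?k) (aug2 (?R j) ?k ?h)
          (bar2_base_change (?R l) (?R j) (quot_map A (?P j) id)) x)"
    using colimit_vanishing[OF reg tr(1) bar change n \<phi>] by blast
  have l1: "1 \<le> l" using jl by simp
  interpret Cn: bar_change "?R l" "?R n" ?k ?h ?h "quot_map A (?P n) id" by (rule change[OF n jl(2)])
  interpret Cj: bar_change "?R l" "?R j" ?k ?h ?h "quot_map A (?P j) id" by (rule change[OF jl(1,3)])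
  obtain E where E: "derivation (?R l) (bar1 (?R l) ?k) (poly_const (?R l)) (aug1 (?R l) ?k ?h) ?M E"
    and Eq: "\<And>q. q \<in> carrier (bar1 (?R l) ?k) \<Longrightarrow> \<chi> (cot_d (?R l) ?k (bar2 (?R l) ?k) (aug2 (?R l) ?k ?h) (Cn.b1.var q)) =
      E q \<ominus>\<^bsub>?M\<^esub> E (Cn.b1.var (Cn.b1.d10 q)) \<oplus>\<^bsub>?M\<^esub> E (Cn.b1.var (Cn.b1.d11 q))"
    using Cn.b1.derivation_of_coboundary[OF tr(1) \<chi>(1)] by blast
  obtain E' where E': "derivation (?R j) (bar1 (?R j) ?k) (poly_const (?R j)) (aug1 (?R j) ?k ?h) ?M E'"
    and Eq': "\<And>q. q \<in> carrier (bar1 (?R j) ?k) \<Longrightarrow> \<chi>' (cot_d (?R j) ?k (bar2 (?R j) ?k) (aug2 (?R j) ?k ?h) (Cj.b.var q)) =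
      E' q \<ominus>\<^bsub>?M\<^esub> E' (Cj.b.var (Cj.b.d10 q)) \<oplus>\<^bsub>?M\<^esub> E' (Cj.b.var (Cj.b.d11 q))"
    using Cj.b.derivation_of_coboundary[OF tr(1) \<chi>(2)] by blast
  \<comment> \<open>The two coboundaries combine to one over \<open>A/\<mm>\<^sup>l\<close>.\<close>
  define F where "F q = E q \<oplus>\<^bsub>?M\<^esub> E' (Cj.bc1 q)" for q
  have F: "derivation (?R l) (bar1 (?R l) ?k) (poly_const (?R l)) (aug1 (?R l) ?k ?h) ?M F"
    unfolding F_def by (rule derivation_add[OF tr(1) Cn.b1.aug_homs(1) E Cj.derivation_bc[OF tr(1) E']])
  have Fc: "F q \<in> carrier ?M" if "q \<in> carrier (bar1 (?R l) ?k)" for q using F that by (simp add: derivation_def)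
  have F_eq: "\<iota> (\<Delta> (var (Cn.bc1 q))) = F q \<ominus>\<^bsub>?M\<^esub> F (Cn.b1.var (Cn.b1.d10 q)) \<oplus>\<^bsub>?M\<^esub> F (Cn.b1.var (Cn.b1.d11 q))"
    if q: "q \<in> carrier (bar1 (?R l) ?k)" for q
  proof -
    let ?x = "cot_d (?R l) ?k (bar2 (?R l) ?k) (aug2 (?R l) ?k ?h) (Cn.b1.var q)"
    have v: "Cn.b1.var q \<in> carrier (bar2 (?R l) ?k)" by (rule Cn.b1.var_closed(3)[OF q])
    have x: "?x \<in> carrier (cot2 (?R l) ?k ?h)"
      using cot_setup.cot_d_closed[OF Cn.b1.cot_setups(2) v] by (simp add: cot2_def)
    have "\<phi> (cot_map ?k (bar2 (?R l) ?k) (?R n) (bar2 (?R n) ?k) (aug2 (?R n) ?k ?h)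
          (bar2_base_change (?R l) (?R n) (quot_map A (?P n) id)) ?x) = \<iota> (\<Delta> (var (Cn.bc1 q)))"
      using cot_map_setup.cot_map(2)[OF Cn.bc2_setup v] \<phi>\<Delta>[OF var_closed(3)[OF ring_hom_closed[OF Cn.bc_homs(2) q]]]
      by (simp add: Cn.bc2_var)
    moreover have "cot_map ?k (bar2 (?R l) ?k) (?R j) (bar2 (?R j) ?k) (aug2 (?R j) ?k ?h)
          (bar2_base_change (?R l) (?R j) (quot_map A (?P j) id)) ?x =
        cot_d (?R j) ?k (bar2 (?R j) ?k) (aug2 (?R j) ?k ?h) (Cj.b.var (Cj.bc1 q))"
      using cot_map_setup.cot_map(2)[OF Cj.bc2_setup v] by (simp add: Cj.bc2_var)
    ultimately have e: "\<iota> (\<Delta> (var (Cn.bc1 q))) =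
        (E q \<ominus>\<^bsub>?M\<^esub> E (Cn.b1.var (Cn.b1.d10 q)) \<oplus>\<^bsub>?M\<^esub> E (Cn.b1.var (Cn.b1.d11 q))) \<oplus>\<^bsub>?M\<^esub>
        (E' (Cj.bc1 q) \<ominus>\<^bsub>?M\<^esub> E' (Cj.bc1 (Cn.b1.var (Cn.b1.d10 q))) \<oplus>\<^bsub>?M\<^esub> E' (Cj.bc1 (Cn.b1.var (Cn.b1.d11 q))))"
      using eq[OF x] Eq[OF q] Eq'[OF ring_hom_closed[OF Cj.bc_homs(2) q]] Cj.d1_bc[OF q]
      by (simp add: Cj.bc_var)
    note vc = Cn.b1.var_closed(2)[OF ring_hom_closed[OF Cn.b1.d1_homs(1) q]] Cn.b1.var_closed(2)[OF ring_hom_closed[OF Cn.b1.d1_homs(2) q]]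
    have Ec: "E q \<in> carrier ?M" "E' (Cj.bc1 q) \<in> carrier ?M" if "q \<in> carrier (bar1 (?R l) ?k)" for q
      using E E' ring_hom_closed[OF Cj.bc_homs(2) that] that by (simp_all add: derivation_def)
    show ?thesis
      unfolding e F_def using Ec[OF q] Ec[OF vc(1)] Ec[OF vc(2)]
      by (simp add: a_minus_def up.M.M.minus_add up.M.M.a_ac)
  qed
  let ?E = "\<lambda>q. ?j (F q)"
  have jE: "derivation (?R l) (bar1 (?R l) ?k) (poly_const (?R l)) (aug1 (?R l) ?k ?h) ann ?E"
    by (rule derivation_compose[OF tr(1) ann_module tr(3) Cn.b1.aug_homs(1) F])
  have j\<iota>: "?j (\<iota> x) = x" if "x \<in> carrier ann" for x using inj that by (rule inv_into_f_f)
  have "\<forall>q\<in>carrier (bar1 (?R l) ?k). \<Delta> (var (Cn.bc1 q)) =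
    ?E q \<ominus>\<^bsub>ann\<^esub> ?E (Cn.b1.var (Cn.b1.d10 q)) \<oplus>\<^bsub>ann\<^esub> ?E (Cn.b1.var (Cn.b1.d11 q))"
  proof
    fix q assume q: "q \<in> carrier (bar1 (?R l) ?k)"
    note vc = Cn.b1.var_closed(2)[OF ring_hom_closed[OF Cn.b1.d1_homs(1) q]] Cn.b1.var_closed(2)[OF ring_hom_closed[OF Cn.b1.d1_homs(2) q]]
    have "\<Delta> (var (Cn.bc1 q)) = ?j (\<iota> (\<Delta> (var (Cn.bc1 q))))"
      using j\<iota>[OF \<Delta>_closed[OF var_closed(3)[OF ring_hom_closed[OF Cn.bc_homs(2) q]]]] by simp
    also have "\<dots> = ?E q \<ominus>\<^bsub>ann\<^esub> ?E (Cn.b1.var (Cn.b1.d10 q)) \<oplus>\<^bsub>ann\<^esub> ?E (Cn.b1.var (Cn.b1.d11 q))"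
      unfolding F_eq[OF q] using Fc[OF q] Fc[OF vc(1)] Fc[OF vc(2)] by (simp add: down.add down.minus)
    finally show "\<Delta> (var (Cn.bc1 q)) = ?E q \<ominus>\<^bsub>ann\<^esub> ?E (Cn.b1.var (Cn.b1.d10 q)) \<oplus>\<^bsub>ann\<^esub> ?E (Cn.b1.var (Cn.b1.d11 q))" .
  qed
  from section_of_coboundary[OF Cn.bar_change_axioms jE this]
  obtain \<theta> where \<theta>1: "\<forall>a\<in>carrier (?R l). ?h a = \<zero>\<^bsub>?k\<^esub> \<longrightarrow>
        \<theta> a \<in> carrier ?D \<and> (I +>\<^bsub>A\<^esub> t) \<otimes>\<^bsub>?D\<^esub> \<theta> a = quot_map A I id (quot_map A (?P n) id a)"
    and \<theta>2: "\<forall>a\<in>carrier (?R l). \<forall>b\<in>carrier (?R l). ?h a = \<zero>\<^bsub>?k\<^esub> \<longrightarrow> ?h b = \<zero>\<^bsub>?k\<^esub> \<longrightarrow>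
        \<theta> (a \<oplus>\<^bsub>?R l\<^esub> b) = \<theta> a \<oplus>\<^bsub>?D\<^esub> \<theta> b"
    and \<theta>3: "\<forall>r\<in>carrier (?R l). \<forall>a\<in>carrier (?R l). ?h a = \<zero>\<^bsub>?k\<^esub> \<longrightarrow>
        \<theta> (r \<otimes>\<^bsub>?R l\<^esub> a) = quot_map A I id (quot_map A (?P n) id r) \<otimes>\<^bsub>?D\<^esub> \<theta> a"
    by (elim exE conjE)
  interpret Pl: ideal "?P l" A by (rule Pid)
  have cl: "?P l +>\<^bsub>A\<^esub> a \<in> carrier (?R l)" if "a \<in> carrier A" for a
    using ring_hom_closed[OF Pl.rcos_ring_hom that] .
  have hz: "?h (?P l +>\<^bsub>A\<^esub> a) = \<zero>\<^bsub>?k\<^esub>" if "a \<in> \<mm>" for a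
    using quot_proj(1)[OF A Pid mm Pm[OF l1]] mm.Icarr[OF that] mm.a_rcos_const[OF that] by (simp add: FactRing_def)
  have gp: "quot_map A I id (quot_map A (?P n) id (?P l +>\<^bsub>A\<^esub> a)) = I +>\<^bsub>A\<^esub> a" if "a \<in> carrier A" for a
    using quot_proj(1)[OF A Pid Pid ideal_pow_mono[OF A mm jl(2)] that] pI(1)[OF that] by simp
  show ?thesis
  proof (intro exI[of _ "\<lambda>a. \<theta> (?P l +>\<^bsub>A\<^esub> a)"] conjI ballI)
    fix a assume a: "a \<in> \<mm>"
    note aA = mm.Icarr[OF a]
    show "\<theta> (?P l +>\<^bsub>A\<^esub> a) \<in> carrier ?D" "(I +>\<^bsub>A\<^esub> t) \<otimes>\<^bsub>?D\<^esub> \<theta> (?P l +>\<^bsub>A\<^esub> a) = I +>\<^bsub>A\<^esub> a"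
      using \<theta>1[rule_format, OF cl[OF aA] hz[OF a]] gp[OF aA] by (simp_all only:)
    {
      fix b assume b: "b \<in> \<mm>"
      note bA = mm.Icarr[OF b]
      show "\<theta> (?P l +>\<^bsub>A\<^esub> (a \<oplus>\<^bsub>A\<^esub> b)) = \<theta> (?P l +>\<^bsub>A\<^esub> a) \<oplus>\<^bsub>?D\<^esub> \<theta> (?P l +>\<^bsub>A\<^esub> b)"
        using \<theta>2[rule_format, OF cl[OF aA] cl[OF bA] hz[OF a] hz[OF b]] ring_hom_add[OF Pl.rcos_ring_hom aA bA] by simp
    }
    fix r assume r: "r \<in> carrier A"
    show "\<theta> (?P l +>\<^bsub>A\<^esub> (r \<otimes>\<^bsub>A\<^esub> a)) = (I +>\<^bsub>A\<^esub> r) \<otimes>\<^bsub>?D\<^esub> \<theta> (?P l +>\<^bsub>A\<^esub> a)"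
      using \<theta>3[rule_format, OF cl[OF r] cl[OF aA] hz[OF a]] ring_hom_mult[OF Pl.rcos_ring_hom r aA] gp[OF r] by simp
  qed
qed

section \<open>Ideals and congruences\<close>

context cring
begin

lemma ideal_closed:
  assumes "ideal I R"
  shows "x \<in> I \<Longrightarrow> x \<in> carrier R" "\<zero> \<in> I"
    and "\<lbrakk>x \<in> I; y \<in> I\<rbrakk> \<Longrightarrow> x \<oplus> y \<in> I" "x \<in> I \<Longrightarrow> \<ominus> x \<in> I" "\<lbrakk>x \<in> I; y \<in> I\<rbrakk> \<Longrightarrow> x \<ominus> y \<in> I"
    and "\<lbrakk>a \<in> carrier R; x \<in> I\<rbrakk> \<Longrightarrow> a \<otimes> x \<in> I" "\<lbrakk>a \<in> carrier R; x \<in> I\<rbrakk> \<Longrightarrow> x \<otimes> a \<in> I"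
proof -
  interpret ideal I R by (rule assms)
  show "x \<in> I \<Longrightarrow> x \<in> carrier R" "\<zero> \<in> I"
    "\<lbrakk>x \<in> I; y \<in> I\<rbrakk> \<Longrightarrow> x \<oplus> y \<in> I" "x \<in> I \<Longrightarrow> \<ominus> x \<in> I" "\<lbrakk>x \<in> I; y \<in> I\<rbrakk> \<Longrightarrow> x \<ominus> y \<in> I"
    "\<lbrakk>a \<in> carrier R; x \<in> I\<rbrakk> \<Longrightarrow> a \<otimes> x \<in> I" "\<lbrakk>a \<in> carrier R; x \<in> I\<rbrakk> \<Longrightarrow> x \<otimes> a \<in> I"
    by (auto simp: a_minus_def I_l_closed I_r_closed)
qed

lemma in_sum: "x \<in> I <+>\<^bsub>R\<^esub> J \<longleftrightarrow> (\<exists>i\<in>I. \<exists>j\<in>J. x = i \<oplus> j)"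
  by (auto simp: set_add_def')

lemma in_sumI: "\<lbrakk>i \<in> I; j \<in> J\<rbrakk> \<Longrightarrow> i \<oplus> j \<in> I <+>\<^bsub>R\<^esub> J"
  unfolding in_sum by blast

lemma in_sumE:
  assumes "x \<in> I <+>\<^bsub>R\<^esub> J"
  obtains i j where "i \<in> I" "j \<in> J" "x = i \<oplus> j"
  using assms unfolding in_sum by blast

lemma sum_left:
  assumes "ideal I R" "ideal J R"
  shows "I \<subseteq> I <+>\<^bsub>R\<^esub> J"
proof
  fix x assume x: "x \<in> I"
  then have "x = x \<oplus> \<zero>" using ideal_closed(1)[OF assms(1)] by simp
  then show "x \<in> I <+>\<^bsub>R\<^esub> J" using x ideal_closed(2)[OF assms(2)] unfolding in_sum by blast
qed

lemma sum_right:
  assumes "ideal I R" "ideal J R"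
  shows "J \<subseteq> I <+>\<^bsub>R\<^esub> J"
proof
  fix x assume x: "x \<in> J"
  then have "x = \<zero> \<oplus> x" using ideal_closed(1)[OF assms(2)] by simp
  then show "x \<in> I <+>\<^bsub>R\<^esub> J" using x ideal_closed(2)[OF assms(1)] unfolding in_sum by blast
qed

lemma sum_least:
  assumes "ideal K R" "I \<subseteq> K" "J \<subseteq> K"
  shows "I <+>\<^bsub>R\<^esub> J \<subseteq> K"
  unfolding subset_iff in_sum using assms(2,3) ideal_closed(3)[OF assms(1)] by blast

lemma sum_mono: "\<lbrakk>I \<subseteq> I'; J \<subseteq> J'\<rbrakk> \<Longrightarrow> I <+>\<^bsub>R\<^esub> J \<subseteq> I' <+>\<^bsub>R\<^esub> J'"
  unfolding subset_iff in_sum by blast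

lemma sum_commute:
  assumes "ideal I R" "ideal J R"
  shows "I <+>\<^bsub>R\<^esub> J = J <+>\<^bsub>R\<^esub> I"
  by (rule subset_antisym; rule sum_least) (use assms sum_left sum_right add_ideals in auto)

lemma sum_right_commute:
  assumes I: "ideal I R" and J: "ideal J R" and K: "ideal K R"
  shows "(I <+>\<^bsub>R\<^esub> J) <+>\<^bsub>R\<^esub> K = (I <+>\<^bsub>R\<^esub> K) <+>\<^bsub>R\<^esub> J"
proof -
  have "(I <+>\<^bsub>R\<^esub> J) <+>\<^bsub>R\<^esub> K \<subseteq> (I <+>\<^bsub>R\<^esub> K) <+>\<^bsub>R\<^esub> J"
    if "ideal J R" "ideal K R" for J K
    using sum_left[OF I that(2)] sum_right[OF I that(2)]
      sum_left[OF add_ideals[OF I that(2)] that(1)] sum_right[OF add_ideals[OF I that(2)] that(1)]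
    by (intro sum_least add_ideals I that) auto
  then show ?thesis using J K by (intro subset_antisym)
qed

lemma prod_least:
  assumes K: "ideal K R" and le: "\<And>x y. \<lbrakk>x \<in> I; y \<in> J\<rbrakk> \<Longrightarrow> x \<otimes> y \<in> K"
  shows "I \<cdot> J \<subseteq> K"
proof
  fix x assume "x \<in> I \<cdot> J"
  then show "x \<in> K" by (induction rule: ideal_prod.induct) (use le ideal_closed(3)[OF K] in auto)
qed

lemma prod_mono:
  assumes "I \<subseteq> I'" "J \<subseteq> J'"
  shows "I \<cdot> J \<subseteq> I' \<cdot> J'"
proof
  fix x assume "x \<in> I \<cdot> J"
  then show "x \<in> I' \<cdot> J'"
    by (induction rule: ideal_prod.induct) (use assms in \<open>auto intro: ideal_prod.intros\<close>)
qed

lemma principal: "x \<in> PIdl y \<longleftrightarrow> (\<exists>a\<in>carrier R. x = a \<otimes> y)"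
  by (auto simp: cgenideal_def)

lemma principal_self: "y \<in> carrier R \<Longrightarrow> y \<in> PIdl y"
  by (rule cgenideal_self)

lemma principal_least: "\<lbrakk>ideal K R; y \<in> K\<rbrakk> \<Longrightarrow> PIdl y \<subseteq> K"
  by (rule cgenideal_minimal)

lemma colon_ideal:
  assumes K: "ideal K R" and y: "y \<in> carrier R"
  shows "ideal {x \<in> carrier R. x \<otimes> y \<in> K} R"
proof (rule idealI[OF ring_axioms])
  show "subgroup {x \<in> carrier R. x \<otimes> y \<in> K} (add_monoid R)"
    by (rule subgroup.intro)
       (use y ideal_closed[OF K] in \<open>auto simp: l_distr l_minus simp flip: a_inv_def\<close>)
next
  fix a x assume a: "a \<in> {x \<in> carrier R. x \<otimes> y \<in> K}" and x: "x \<in> carrier R"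
  then have "(x \<otimes> a) \<otimes> y = x \<otimes> (a \<otimes> y)" "(a \<otimes> x) \<otimes> y = x \<otimes> (a \<otimes> y)" using y by (auto simp: m_ac)
  then show "x \<otimes> a \<in> {x \<in> carrier R. x \<otimes> y \<in> K}" "a \<otimes> x \<in> {x \<in> carrier R. x \<otimes> y \<in> K}"
    using a x ideal_closed(6)[OF K x] by auto
qed

end

locale adic = cring A for A (structure) +
  fixes \<mm>
  assumes max: "maximalideal \<mm> A"
begin

definition P where "P n = ideal_pow A \<mm> n"

lemma mm: "ideal \<mm> A" using max by (simp add: maximalideal_def)

lemma P_ideal: "ideal (P n) A" unfolding P_def by (rule ideal_pow_ideal[OF is_cring mm])

lemma P_0: "P 0 = carrier A" unfolding P_def by (rule ideal_pow_0)
lemma P_1: "P (Suc 0) = \<mm>" unfolding P_def by (rule ideal_pow_1[OF is_cring mm])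
lemma P_Suc: "P (Suc n) = P n \<cdot> \<mm>" unfolding P_def by (rule ideal_pow_Suc)
lemma P_mono: "i \<le> l \<Longrightarrow> P l \<subseteq> P i" unfolding P_def by (rule ideal_pow_mono[OF is_cring mm])

lemma P_mult: "\<lbrakk>x \<in> P i; y \<in> P j\<rbrakk> \<Longrightarrow> x \<otimes> y \<in> P (i + j)"
proof (induction j arbitrary: y)
  case 0
  then show ?case using ideal_closed(7)[OF P_ideal] by (simp add: P_0)
next
  case (Suc j)
  have xc: "x \<in> carrier A" using Suc ideal_closed(1)[OF P_ideal] by blast
  have "P j \<cdot> \<mm> \<subseteq> {y \<in> carrier A. y \<otimes> x \<in> P (i + Suc j)}"
  proof (rule prod_least[OF colon_ideal[OF P_ideal xc]])
    fix u v assume uv: "u \<in> P j" "v \<in> \<mm>"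
    then have c: "u \<in> carrier A" "v \<in> carrier A" using ideal_closed(1)[OF P_ideal] ideal_closed(1)[OF mm] by auto
    have "(x \<otimes> u) \<otimes> v \<in> P (i + j) \<cdot> \<mm>" using Suc uv by (intro ideal_prod.prod) auto
    then show "u \<otimes> v \<in> {y \<in> carrier A. y \<otimes> x \<in> P (i + Suc j)}"
      using c xc by (simp add: P_Suc m_ac)
  qed
  then have "y \<otimes> x \<in> P (i + Suc j)" "y \<in> carrier A" using Suc(3) by (auto simp: P_Suc)
  then show ?case using xc by (simp add: m_comm)
qed

lemma P_pow: "t \<in> \<mm> \<Longrightarrow> t [^] (n::nat) \<in> P n"
proof (induction n)
  case 0
  then show ?case by (simp add: P_0)
next
  case (Suc n)
  then show ?case using P_mult[of "t [^] n" n t "Suc 0"] by (simp add: P_1)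
qed

lemma m_sub_carrier: "x \<in> \<mm> \<Longrightarrow> x \<in> carrier A" using ideal_closed(1)[OF mm] .

lemma one_notin: "\<one> \<notin> \<mm>"
  using max by (metis maximalideal.I_notcarr mm ideal.one_imp_carrier)

lemma inverse_mod:
  assumes a: "a \<in> carrier A" "a \<notin> \<mm>"
  obtains b \<mu> where "b \<in> carrier A" "\<mu> \<in> \<mm>" "\<one> = b \<otimes> a \<oplus> \<mu>"
proof -
  have id: "ideal (PIdl a <+>\<^bsub>A\<^esub> \<mm>) A" by (intro add_ideals cgenideal_ideal a mm)
  have "a \<in> PIdl a <+>\<^bsub>A\<^esub> \<mm>" using sum_left[OF cgenideal_ideal[OF a(1)] mm] principal_self[OF a(1)] by blast
  moreover have "\<mm> \<subseteq> PIdl a <+>\<^bsub>A\<^esub> \<mm>" by (rule sum_right[OF cgenideal_ideal[OF a(1)] mm])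
  ultimately have "PIdl a <+>\<^bsub>A\<^esub> \<mm> = carrier A"
    using maximalideal.I_maximal[OF max id] a ideal_closed(1)[OF id] by blast
  then have "\<one> \<in> PIdl a <+>\<^bsub>A\<^esub> \<mm>" by simp
  then show ?thesis using that by (auto simp: in_sum principal)
qed

lemma cancel_unit:
  assumes K: "ideal K A" and a: "a \<in> carrier A" "a \<notin> \<mm>" and y: "y \<in> carrier A"
    and ay: "a \<otimes> y \<in> K" and my: "\<And>\<mu>. \<mu> \<in> \<mm> \<Longrightarrow> \<mu> \<otimes> y \<in> K"
  shows "y \<in> K"
proof -
  obtain b \<mu> where b: "b \<in> carrier A" "\<mu> \<in> \<mm>" "\<one> = b \<otimes> a \<oplus> \<mu>" by (rule inverse_mod[OF a])
  have "y = \<one> \<otimes> y" using y by simp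
  also have "\<dots> = b \<otimes> (a \<otimes> y) \<oplus> \<mu> \<otimes> y" unfolding b(3) using a b(1) y m_sub_carrier[OF b(2)] by (simp add: l_distr m_assoc)
  finally have "y = b \<otimes> (a \<otimes> y) \<oplus> \<mu> \<otimes> y" .
  moreover have "b \<otimes> (a \<otimes> y) \<oplus> \<mu> \<otimes> y \<in> K" using ideal_closed(3,6)[OF K] ay my b(1,2) by simp
  ultimately show ?thesis by (rule ssubst)
qed

lemma prime: "\<lbrakk>a \<in> carrier A; b \<in> carrier A; a \<notin> \<mm>; b \<notin> \<mm>\<rbrakk> \<Longrightarrow> a \<otimes> b \<notin> \<mm>"
  using cancel_unit[OF mm, of a b] ideal_closed(7)[OF mm] by blast

end

section \<open>Transversal ideals and curves\<close>

context adic
begin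

text \<open>The inclusion says that \<open>J/J\<mm> \<rightarrow> \<mm>/\<mm>\<^sup>2\<close> is injective: minimal generators of \<open>J\<close> remain
  independent in \<open>\<mm>/\<mm>\<^sup>2\<close>.\<close>

definition transversal :: "'a set \<Rightarrow> bool" where
  "transversal J \<longleftrightarrow> ideal J A \<and> J \<subseteq> \<mm> \<and> J \<inter> P 2 \<subseteq> J \<cdot> \<mm>"

lemma transversalD: "transversal J \<Longrightarrow> ideal J A" "transversal J \<Longrightarrow> J \<subseteq> \<mm>" "\<lbrakk>transversal J; x \<in> J; x \<in> P 2\<rbrakk> \<Longrightarrow> x \<in> J \<cdot> \<mm>"
  by (auto simp: transversal_def)

lemma transversal_zero: "transversal {\<zero>}"
proof -
  have "\<zero> \<otimes> \<zero> \<in> {\<zero>} \<cdot> \<mm>" using ideal_closed(2)[OF mm] by (intro ideal_prod.prod) auto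
  then show ?thesis using zeroideal ideal_closed(2)[OF mm] by (auto simp: transversal_def)
qed

lemma P2_in: "\<lbrakk>x \<in> \<mm>; y \<in> \<mm>\<rbrakk> \<Longrightarrow> x \<otimes> y \<in> P 2"
  using P_mult[of x "Suc 0" y "Suc 0"] by (simp add: P_1 numeral_2_eq_2)

text \<open>If \<open>j + a y\<close> lies in \<open>\<mm>\<^sup>2\<close>, then \<open>a \<in> \<mm>\<close>, for otherwise \<open>y\<close> would lie in \<open>J + \<mm>\<^sup>2\<close>; then both
  summands lie in \<open>\<mm>\<^sup>2\<close> separately.\<close>

lemma transversal_extend:
  assumes J: "transversal J" and y: "y \<in> \<mm>" "y \<notin> J <+>\<^bsub>A\<^esub> P 2"
  shows "transversal (J <+>\<^bsub>A\<^esub> PIdl y)"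
proof -
  note Ji = transversalD(1)[OF J]
  have yc: "y \<in> carrier A" using y m_sub_carrier by blast
  note Yi = cgenideal_ideal[OF yc]
  have S: "ideal (J <+>\<^bsub>A\<^esub> P 2) A" by (intro add_ideals Ji P_ideal)
  have sub: "J \<cdot> \<mm> \<subseteq> (J <+>\<^bsub>A\<^esub> PIdl y) \<cdot> \<mm>" "(PIdl y) \<cdot> \<mm> \<subseteq> (J <+>\<^bsub>A\<^esub> PIdl y) \<cdot> \<mm>"
    by (intro prod_mono sum_left sum_right Ji Yi order_refl)+
  have int: "x \<in> (J <+>\<^bsub>A\<^esub> PIdl y) \<cdot> \<mm>" if x: "x \<in> J <+>\<^bsub>A\<^esub> PIdl y" "x \<in> P 2" for x
  proof -
    obtain j a where ja: "j \<in> J" "a \<in> carrier A" "x = j \<oplus> a \<otimes> y" using x(1) by (auto simp: in_sum principal)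
    have jc: "j \<in> carrier A" using ideal_closed(1)[OF Ji ja(1)] .
    have ay: "a \<otimes> y = \<ominus> j \<oplus> x" using ja jc yc by (simp add: r_neg2 r_neg1)
    have am: "a \<in> \<mm>"
    proof (rule ccontr)
      assume "a \<notin> \<mm>"
      moreover have "a \<otimes> y \<in> J <+>\<^bsub>A\<^esub> P 2" unfolding ay using ideal_closed(4)[OF Ji ja(1)] x(2) by (auto simp: in_sum)
      moreover have "\<mu> \<otimes> y \<in> J <+>\<^bsub>A\<^esub> P 2" if "\<mu> \<in> \<mm>" for \<mu>
        using sum_right[OF Ji P_ideal] P2_in[OF that y(1)] by blast
      ultimately have "y \<in> J <+>\<^bsub>A\<^esub> P 2" using cancel_unit[OF S ja(2) _ yc] by blast
      then show False using y by simp
    qed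
    then have ayP: "a \<otimes> y \<in> P 2" using P2_in y by blast
    have "j = x \<ominus> a \<otimes> y" using ja jc yc unfolding ja(3) by algebra
    then have "j \<in> P 2" using ideal_closed(5)[OF P_ideal x(2) ayP] by simp
    then have "j \<in> J \<cdot> \<mm>" using transversalD(3)[OF J ja(1)] by simp
    moreover have "y \<otimes> a \<in> (PIdl y) \<cdot> \<mm>" using principal_self[OF yc] am by (rule ideal_prod.prod)
    ultimately have "j \<in> (J <+>\<^bsub>A\<^esub> PIdl y) \<cdot> \<mm>" "a \<otimes> y \<in> (J <+>\<^bsub>A\<^esub> PIdl y) \<cdot> \<mm>"
      using sub m_comm[OF yc ja(2)] by auto
    then show ?thesis
      unfolding ja(3) by (rule ideal_closed(3)[OF ideal_prod_is_ideal[OF add_ideals[OF Ji Yi] mm]])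
  qed
  have "J <+>\<^bsub>A\<^esub> PIdl y \<subseteq> \<mm>"
    by (intro sum_least mm transversalD(2)[OF J] principal_least y)
  moreover have "(J <+>\<^bsub>A\<^esub> PIdl y) \<inter> P 2 \<subseteq> (J <+>\<^bsub>A\<^esub> PIdl y) \<cdot> \<mm>"
    by (rule subsetI, erule IntE, rule int)
  ultimately show ?thesis using add_ideals[OF Ji Yi] unfolding transversal_def by (intro conjI)
qed

text \<open>Linear independence in \<open>\<mm>/(J + \<mm>\<^sup>2)\<close> over the residue field, expressed one vector at a time.\<close>

primrec seq_indep :: "'a set \<Rightarrow> 'a list \<Rightarrow> bool" where
  "seq_indep J [] = True"
| "seq_indep J (x # xs) = (x \<notin> J <+>\<^bsub>A\<^esub> P 2 \<and> seq_indep (J <+>\<^bsub>A\<^esub> PIdl x) xs)"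

lemma seq_indep_cong:
  assumes "ideal J A" "ideal J' A" "J <+>\<^bsub>A\<^esub> P 2 = J' <+>\<^bsub>A\<^esub> P 2" "set xs \<subseteq> carrier A"
  shows "seq_indep J xs \<longleftrightarrow> seq_indep J' xs"
  using assms
proof (induction xs arbitrary: J J')
  case (Cons x xs)
  have x: "ideal (PIdl x) A" using Cons(5) by (intro cgenideal_ideal) auto
  have "(J <+>\<^bsub>A\<^esub> PIdl x) <+>\<^bsub>A\<^esub> P 2 = (J' <+>\<^bsub>A\<^esub> PIdl x) <+>\<^bsub>A\<^esub> P 2"
    using sum_right_commute[OF Cons(2) x P_ideal] sum_right_commute[OF Cons(3) x P_ideal] Cons(4) by simp
  then show ?case
    using Cons.IH[OF add_ideals[OF Cons(2) x] add_ideals[OF Cons(3) x]] Cons.prems by simp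
qed simp

text \<open>A vector \<open>y\<close> outside the span of an independent sequence can be put in front of it.  If \<open>x\<close> became dependent, the
  coefficient of \<open>y\<close> in the dependence would be a unit, and \<open>y\<close> would lie in the span.\<close>

lemma seq_indep_exchange:
  assumes "ideal J A" "set xs \<subseteq> \<mm>" "y \<in> \<mm>" "y \<notin> (J <+>\<^bsub>A\<^esub> Idl (set xs)) <+>\<^bsub>A\<^esub> P 2" "seq_indep J xs"
  shows "seq_indep (J <+>\<^bsub>A\<^esub> PIdl y) xs"
  using assms
proof (induction xs arbitrary: J)
  case (Cons x xs)
  note J = Cons(2)
  have xm: "x \<in> \<mm>" "set xs \<subseteq> \<mm>" using Cons by auto
  have c: "x \<in> carrier A" "y \<in> carrier A" "set (x # xs) \<subseteq> carrier A" "set xs \<subseteq> carrier A"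
    using Cons.prems m_sub_carrier by auto
  have id: "ideal (PIdl x) A" "ideal (PIdl y) A" "ideal (Idl (set (x # xs))) A" "ideal (Idl (set xs)) A"
    using c by (auto intro!: cgenideal_ideal genideal_ideal)
  have xI: "PIdl x \<subseteq> Idl (set (x # xs))" "Idl (set xs) \<subseteq> Idl (set (x # xs))"
  proof -
    note self = genideal_self[OF c(3)]
    show "PIdl x \<subseteq> Idl (set (x # xs))" by (rule principal_least[OF id(3)]) (use self in auto)
    show "Idl (set xs) \<subseteq> Idl (set (x # xs))" by (rule genideal_minimal[OF id(3)]) (use self in auto)
  qed
  have big: "J <+>\<^bsub>A\<^esub> PIdl x \<subseteq> J <+>\<^bsub>A\<^esub> Idl (set (x # xs))" by (intro sum_mono xI order_refl)
  have H: "ideal ((J <+>\<^bsub>A\<^esub> PIdl x) <+>\<^bsub>A\<^esub> P 2) A" by (intro add_ideals J id P_ideal)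
  have y1: "y \<notin> (J <+>\<^bsub>A\<^esub> PIdl x) <+>\<^bsub>A\<^esub> P 2"
    using Cons.prems(4) sum_mono[OF big order_refl[of "P 2"]] by blast
  have "x \<notin> (J <+>\<^bsub>A\<^esub> PIdl y) <+>\<^bsub>A\<^esub> P 2"
  proof
    assume xin: "x \<in> (J <+>\<^bsub>A\<^esub> PIdl y) <+>\<^bsub>A\<^esub> P 2"
    then obtain i p where i: "i \<in> J <+>\<^bsub>A\<^esub> PIdl y" and p: "p \<in> P 2" "x = i \<oplus> p"
      by (rule in_sumE)
    obtain j z where j: "j \<in> J" "i = j \<oplus> z" and z: "z \<in> PIdl y" using i by (rule in_sumE)
    obtain a where a: "a \<in> carrier A" "z = a \<otimes> y" using z unfolding principal by blast
    have e: "j \<in> J" "a \<in> carrier A" "p \<in> P 2" "x = (j \<oplus> a \<otimes> y) \<oplus> p"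
      using j a p by simp_all
    have jp: "j \<in> carrier A" "p \<in> carrier A" using e ideal_closed(1)[OF J] ideal_closed(1)[OF P_ideal] by auto
    show False
    proof (cases "a \<in> \<mm>")
      case True
      then have "a \<otimes> y \<oplus> p \<in> P 2" using P2_in[OF True Cons.prems(3)] e ideal_closed(3)[OF P_ideal] by simp
      moreover have "x = j \<oplus> (a \<otimes> y \<oplus> p)" using e(4) jp c e(2) by (simp add: a_assoc)
      ultimately have "x \<in> J <+>\<^bsub>A\<^esub> P 2" using e(1) in_sumI by simp
      then show False using Cons.prems(5) by simp
    next
      case False
      have "a \<otimes> y = (\<ominus> j \<oplus> \<one> \<otimes> x) \<oplus> \<ominus> p"
      proof -
        have "\<one> \<otimes> x = (j \<oplus> a \<otimes> y) \<oplus> p" using e(4) c by simp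
        then show ?thesis using jp c(2) e(2) by (simp only:) algebra
      qed
      moreover have "\<ominus> j \<in> J" "\<one> \<otimes> x \<in> PIdl x" "\<ominus> p \<in> P 2"
        using ideal_closed(4)[OF J] ideal_closed(4)[OF P_ideal] e by (auto simp: principal)
      ultimately have "a \<otimes> y \<in> (J <+>\<^bsub>A\<^esub> PIdl x) <+>\<^bsub>A\<^esub> P 2" by (simp only: in_sumI)
      moreover have "\<mu> \<otimes> y \<in> (J <+>\<^bsub>A\<^esub> PIdl x) <+>\<^bsub>A\<^esub> P 2" if "\<mu> \<in> \<mm>" for \<mu>
        using P2_in[OF that Cons.prems(3)] sum_right[OF add_ideals[OF J id(1)] P_ideal] by blast
      ultimately have "y \<in> (J <+>\<^bsub>A\<^esub> PIdl x) <+>\<^bsub>A\<^esub> P 2" by (rule cancel_unit[OF H e(2) False c(2)])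
      then show False using y1 by simp
    qed
  qed
  moreover have "seq_indep ((J <+>\<^bsub>A\<^esub> PIdl x) <+>\<^bsub>A\<^esub> PIdl y) xs"
  proof (rule Cons.IH[OF add_ideals[OF J id(1)] xm(2) Cons.prems(3)])
    have "(J <+>\<^bsub>A\<^esub> PIdl x) <+>\<^bsub>A\<^esub> Idl (set xs) \<subseteq> J <+>\<^bsub>A\<^esub> Idl (set (x # xs))"
      by (intro sum_least add_ideals J id sum_left[OF J id(3)] order_trans[OF xI(1) sum_right[OF J id(3)]]
          order_trans[OF xI(2) sum_right[OF J id(3)]])
    then show "y \<notin> ((J <+>\<^bsub>A\<^esub> PIdl x) <+>\<^bsub>A\<^esub> Idl (set xs)) <+>\<^bsub>A\<^esub> P 2"
      using Cons.prems(4) sum_mono[OF _ order_refl[of "P 2"]] by blast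
    show "seq_indep (J <+>\<^bsub>A\<^esub> PIdl x) xs" using Cons.prems(5) by simp
  qed
  ultimately show ?case by (simp add: sum_right_commute[OF J id(1,2)])
qed simp

lemma chain_union_ideal:
  assumes "C \<noteq> {}" "\<And>J. J \<in> C \<Longrightarrow> ideal J A" "\<And>J K. \<lbrakk>J \<in> C; K \<in> C\<rbrakk> \<Longrightarrow> J \<subseteq> K \<or> K \<subseteq> J"
  shows "ideal (\<Union>C) A"
proof -
  have "subset.chain {I. ideal I A} C"
    using assms(2,3) by (auto simp: subset_chain_def)
  from chain_Union_is_ideal[OF this] show ?thesis using assms(1) by simp
qed

lemma seq_indep_union:
  assumes "C \<noteq> {}" "\<And>J. J \<in> C \<Longrightarrow> ideal J A" "\<And>J K. \<lbrakk>J \<in> C; K \<in> C\<rbrakk> \<Longrightarrow> J \<subseteq> K \<or> K \<subseteq> J"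
    "\<And>J. J \<in> C \<Longrightarrow> seq_indep J xs" "set xs \<subseteq> carrier A"
  shows "seq_indep (\<Union>C) xs"
  using assms
proof (induction xs arbitrary: C)
  case (Cons x xs)
  let ?C = "(\<lambda>J. J <+>\<^bsub>A\<^esub> PIdl x) ` C"
  have x: "ideal (PIdl x) A" using Cons(6) by (intro cgenideal_ideal) auto
  have "\<Union>C <+>\<^bsub>A\<^esub> PIdl x = \<Union>?C" by (auto elim!: in_sumE intro: in_sumI)
  moreover have "seq_indep (\<Union>?C) xs"
  proof (rule Cons.IH)
    show "?C \<noteq> {}" using Cons(2) by simp
    show "ideal J A" if "J \<in> ?C" for J using that Cons(3) x add_ideals by blast
    show "seq_indep J xs" if "J \<in> ?C" for J using that Cons(5) by auto
    show "J \<subseteq> K \<or> K \<subseteq> J" if JK': "J \<in> ?C" "K \<in> ?C" for J K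
    proof -
      obtain J' K' where JK: "J' \<in> C" "K' \<in> C" "J = J' <+>\<^bsub>A\<^esub> PIdl x" "K = K' <+>\<^bsub>A\<^esub> PIdl x" using JK' by blast
      then show ?thesis using Cons(4)[OF JK(1,2)] sum_mono[OF _ order_refl[of "PIdl x"]] by blast
    qed
    show "set xs \<subseteq> carrier A" using Cons(6) by simp
  qed
  moreover have "x \<notin> \<Union>C <+>\<^bsub>A\<^esub> P 2"
  proof
    assume "x \<in> \<Union>C <+>\<^bsub>A\<^esub> P 2"
    then obtain i p where ip: "i \<in> \<Union>C" "p \<in> P 2" "x = i \<oplus> p" by (rule in_sumE)
    then obtain J where "J \<in> C" "i \<in> J" by blast
    then have "J \<in> C" "x \<in> J <+>\<^bsub>A\<^esub> P 2" using ip in_sumI by simp_all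
    then show False using Cons(5) by auto
  qed
  ultimately show ?case by simp
qed simp

text \<open>Zorn's lemma yields a maximal transversal \<open>J\<close> modulo which \<open>xs\<close> is independent; an element of \<open>\<mm>\<close> missed by
  \<open>J\<close>, \<open>xs\<close> and \<open>\<mm>\<^sup>2\<close> could be added to \<open>J\<close>.\<close>

lemma transversal_complement:
  assumes xs: "set xs \<subseteq> \<mm>" "seq_indep {\<zero>} xs"
  shows "\<exists>J. transversal J \<and> seq_indep J xs \<and> \<mm> \<subseteq> (J <+>\<^bsub>A\<^esub> Idl (set xs)) <+>\<^bsub>A\<^esub> P 2"
proof -
  let ?G = "{J. transversal J \<and> seq_indep J xs}"
  have xc: "set xs \<subseteq> carrier A" using xs m_sub_carrier by blast
  have Yi: "ideal (Idl (set xs)) A" by (rule genideal_ideal[OF xc])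
  have "\<exists>J\<in>?G. \<forall>K\<in>?G. J \<subseteq> K \<longrightarrow> K = J"
  proof (rule subset_Zorn_nonempty)
    show "?G \<noteq> {}" using transversal_zero xs by blast
    fix C assume C: "C \<noteq> {}" "subset.chain ?G C"
    have g: "\<And>J. J \<in> C \<Longrightarrow> transversal J" "\<And>J. J \<in> C \<Longrightarrow> seq_indep J xs" "\<And>J K. \<lbrakk>J \<in> C; K \<in> C\<rbrakk> \<Longrightarrow> J \<subseteq> K \<or> K \<subseteq> J"
      using C(2) by (auto simp: subset_chain_def)
    note gi = g(1)[THEN transversalD(1)]
    have "x \<in> \<Union>C \<cdot> \<mm>" if x: "x \<in> \<Union>C" "x \<in> P 2" for x
    proof -
      obtain J where J: "J \<in> C" "x \<in> J" using x by blast
      then have "x \<in> J \<cdot> \<mm>" using transversalD(3)[OF g(1)] x by blast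
      then show ?thesis using prod_mono[of J "\<Union>C" \<mm> \<mm>] J(1) by blast
    qed
    then have "transversal (\<Union>C)"
      using chain_union_ideal[OF C(1) gi g(3)] transversalD(2)[OF g(1)] by (auto simp: transversal_def)
    then show "\<Union>C \<in> ?G" using seq_indep_union[OF C(1) gi g(3,2) xc] by simp
  qed
  then obtain J where J: "transversal J" "seq_indep J xs" and mx: "\<And>K. \<lbrakk>transversal K; seq_indep K xs; J \<subseteq> K\<rbrakk> \<Longrightarrow> K = J"
    by blast
  note Ji = transversalD(1)[OF J(1)]
  have "y \<in> (J <+>\<^bsub>A\<^esub> Idl (set xs)) <+>\<^bsub>A\<^esub> P 2" if y: "y \<in> \<mm>" for y
  proof (rule ccontr)
    assume n: "y \<notin> (J <+>\<^bsub>A\<^esub> Idl (set xs)) <+>\<^bsub>A\<^esub> P 2"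
    have yc: "y \<in> carrier A" using y m_sub_carrier by blast
    note yi = cgenideal_ideal[OF yc]
    have "J <+>\<^bsub>A\<^esub> P 2 \<subseteq> (J <+>\<^bsub>A\<^esub> Idl (set xs)) <+>\<^bsub>A\<^esub> P 2" by (intro sum_mono sum_left Ji Yi order_refl)
    then have n': "y \<notin> J <+>\<^bsub>A\<^esub> P 2" using n by blast
    have "J <+>\<^bsub>A\<^esub> PIdl y = J"
      by (rule mx[OF transversal_extend[OF J(1) y n'] seq_indep_exchange[OF Ji xs(1) y n J(2)] sum_left[OF Ji yi]])
    then have "y \<in> J" using sum_right[OF Ji yi] principal_self[OF yc] by blast
    then show False using n' sum_left[OF Ji P_ideal] by blast
  qed
  then show ?thesis using J by blast
qed

text \<open>The curve on which the \<open>i\<close>-th variable from the end, counted from \<open>0\<close>, is \<open>t\<close> to the power \<open>B\<^sup>i\<close>; the last variable is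
  therefore \<open>t\<close> itself.\<close>

primrec curve :: "'a set \<Rightarrow> 'a \<Rightarrow> nat \<Rightarrow> 'a list \<Rightarrow> bool" where
  "curve K t B [] = True"
| "curve K t B (x # xs) = (x \<ominus> t [^] (B ^ length xs) \<in> K \<and> curve K t B xs)"

text \<open>Except for the last variable, whose equation is trivial, the equations \<open>x - t\<^sup>e\<close> of the curve have exponents
  \<open>e \<ge> 2\<close>, hence agree with the \<open>x\<close> modulo \<open>\<mm>\<^sup>2\<close>, and the
  resulting ideal is transversal because the \<open>x\<close> are independent.  The bound \<open>2 \<le> B\<close> is what makes \<open>e \<ge> 2\<close>.\<close>

lemma curve_ideal:
  assumes "transversal J" "seq_indep J (xs @ [t])" "set xs \<subseteq> \<mm>" "t \<in> \<mm>" "2 \<le> B"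
    "\<mm> \<subseteq> (J <+>\<^bsub>A\<^esub> Idl (set (xs @ [t]))) <+>\<^bsub>A\<^esub> P 2"
  shows "\<exists>K. transversal K \<and> J \<subseteq> K \<and> curve K t B (xs @ [t]) \<and> t \<notin> K <+>\<^bsub>A\<^esub> P 2 \<and> \<mm> \<subseteq> (K <+>\<^bsub>A\<^esub> PIdl t) <+>\<^bsub>A\<^esub> P 2"
  using assms
proof (induction xs arbitrary: J)
  case Nil
  have tc: "t \<in> carrier A" using Nil m_sub_carrier by blast
  have "t \<ominus> t [^] (B ^ 0) \<in> J" using tc ideal_closed(2)[OF transversalD(1)[OF Nil(1)]] by (simp add: a_minus_def r_neg)
  moreover have "Idl {t} = PIdl t" using cgenideal_eq_genideal[OF tc] by simp
  ultimately show ?case using Nil by (intro exI[of _ J]) simp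
next
  case (Cons x xs)
  define p where "p = t [^] (B ^ Suc (length xs))"
  define y where "y = x \<ominus> p"
  note Ji = transversalD(1)[OF Cons(2)]
  have xm: "x \<in> \<mm>" "set xs \<subseteq> \<mm>" using Cons by auto
  have tc: "t \<in> carrier A" and xc: "x \<in> carrier A" using Cons xm m_sub_carrier by auto
  have "2 \<le> B ^ Suc (length xs)" using Cons(6) by (metis le_trans one_le_numeral power_increasing power_one_right Suc_leI zero_less_Suc One_nat_def)
  then have p: "p \<in> P 2" unfolding p_def using P_pow[OF Cons(5)] P_mono by blast
  have pc: "p \<in> carrier A" and pm: "p \<in> \<mm>" using ideal_closed(1)[OF P_ideal p] p P_mono[of "Suc 0" 2] P_1 by auto
  have ym: "y \<in> \<mm>" and yc: "y \<in> carrier A" using ideal_closed(5)[OF mm xm(1) pm] xc pc by (auto simp: y_def)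
  have id: "ideal (PIdl x) A" "ideal (PIdl y) A" using xc yc by (auto intro: cgenideal_ideal)
  have xy: "x = \<one> \<otimes> y \<oplus> p" "y = \<one> \<otimes> x \<oplus> \<ominus> p" using xc pc by (auto simp: y_def a_minus_def a_assoc l_neg)
  have JP: "(J <+>\<^bsub>A\<^esub> PIdl y) <+>\<^bsub>A\<^esub> P 2 = (J <+>\<^bsub>A\<^esub> PIdl x) <+>\<^bsub>A\<^esub> P 2"
  proof -
    have "(J <+>\<^bsub>A\<^esub> PIdl u) <+>\<^bsub>A\<^esub> P 2 \<subseteq> (J <+>\<^bsub>A\<^esub> PIdl v) <+>\<^bsub>A\<^esub> P 2"
      if c: "u \<in> carrier A" "v \<in> carrier A" and q: "q \<in> P 2" "u = \<one> \<otimes> v \<oplus> q" for u v q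
    proof -
      have iv: "ideal (PIdl v) A" by (rule cgenideal_ideal[OF c(2)])
      note H = add_ideals[OF add_ideals[OF Ji iv] P_ideal[of 2]]
      have sub: "J \<subseteq> (J <+>\<^bsub>A\<^esub> PIdl v) <+>\<^bsub>A\<^esub> P 2" "PIdl v \<subseteq> (J <+>\<^bsub>A\<^esub> PIdl v) <+>\<^bsub>A\<^esub> P 2" "P 2 \<subseteq> (J <+>\<^bsub>A\<^esub> PIdl v) <+>\<^bsub>A\<^esub> P 2"
        using sum_left[OF Ji iv] sum_right[OF Ji iv] sum_left[OF add_ideals[OF Ji iv] P_ideal[of 2]]
          sum_right[OF add_ideals[OF Ji iv] P_ideal[of 2]] by auto
      have "v \<in> (J <+>\<^bsub>A\<^esub> PIdl v) <+>\<^bsub>A\<^esub> P 2" "q \<in> (J <+>\<^bsub>A\<^esub> PIdl v) <+>\<^bsub>A\<^esub> P 2"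
        using sub principal_self[OF c(2)] q(1) by auto
      then have "u \<in> (J <+>\<^bsub>A\<^esub> PIdl v) <+>\<^bsub>A\<^esub> P 2" unfolding q(2) using ideal_closed(3)[OF H] c by simp
      then show ?thesis by (intro sum_least H sub principal_least)
    qed
    from this[OF yc xc _ xy(2)] this[OF xc yc p xy(1)] show ?thesis
      using ideal_closed(4)[OF P_ideal p] by blast
  qed
  have ynot: "y \<notin> J <+>\<^bsub>A\<^esub> P 2"
  proof
    assume y: "y \<in> J <+>\<^bsub>A\<^esub> P 2"
    note H = add_ideals[OF Ji P_ideal[of 2]]
    have "p \<in> J <+>\<^bsub>A\<^esub> P 2" using sum_right[OF Ji P_ideal] p by blast
    then have "\<one> \<otimes> y \<oplus> p \<in> J <+>\<^bsub>A\<^esub> P 2" using ideal_closed(3)[OF H y] yc by simp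
    then have "x \<in> J <+>\<^bsub>A\<^esub> P 2" using xy(1) by (rule ssubst[rotated])
    then show False using Cons(3) by simp
  qed
  have J1: "transversal (J <+>\<^bsub>A\<^esub> PIdl y)" by (rule transversal_extend[OF Cons(2) ym ynot])
  have sc: "set (xs @ [t]) \<subseteq> carrier A" "set ((x # xs) @ [t]) \<subseteq> carrier A" using xm xc tc m_sub_carrier by auto
  have "\<exists>K. transversal K \<and> J <+>\<^bsub>A\<^esub> PIdl y \<subseteq> K \<and> curve K t B (xs @ [t]) \<and> t \<notin> K <+>\<^bsub>A\<^esub> P 2 \<and> \<mm> \<subseteq> (K <+>\<^bsub>A\<^esub> PIdl t) <+>\<^bsub>A\<^esub> P 2"
  proof (rule Cons.IH[OF J1 _ xm(2) Cons(5,6)])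
    show "seq_indep (J <+>\<^bsub>A\<^esub> PIdl y) (xs @ [t])"
      using Cons(3) seq_indep_cong[OF add_ideals[OF Ji id(2)] add_ideals[OF Ji id(1)] JP sc(1)] by simp
    let ?I = "Idl (set (xs @ [t]))"
    have Ii: "ideal ?I A" by (rule genideal_ideal[OF sc(1)])
    note H1 = add_ideals[OF add_ideals[OF Ji id(2)] Ii] 
    note H = add_ideals[OF H1 P_ideal[of 2]]
    let ?H = "((J <+>\<^bsub>A\<^esub> PIdl y) <+>\<^bsub>A\<^esub> ?I) <+>\<^bsub>A\<^esub> P 2"
    have s0: "J \<subseteq> ?H" "PIdl y \<subseteq> ?H" "?I \<subseteq> ?H" "P 2 \<subseteq> ?H"
      using sum_left[OF Ji id(2)] sum_right[OF Ji id(2)] sum_left[OF add_ideals[OF Ji id(2)] Ii]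
        sum_right[OF add_ideals[OF Ji id(2)] Ii] sum_left[OF H1 P_ideal[of 2]] sum_right[OF H1 P_ideal[of 2]]
      by auto
    have "y \<in> ?H" "p \<in> ?H" using s0 principal_self[OF yc] p by auto
    then have "\<one> \<otimes> y \<oplus> p \<in> ?H" using ideal_closed(3)[OF H] yc by simp
    then have "x \<in> ?H" using xy(1) by (rule ssubst[rotated])
    moreover have "set (xs @ [t]) \<subseteq> ?H" using genideal_self[OF sc(1)] s0 by blast
    ultimately have "Idl (set ((x # xs) @ [t])) \<subseteq> ?H" by (intro genideal_minimal[OF H]) auto
    then have "(J <+>\<^bsub>A\<^esub> Idl (set ((x # xs) @ [t]))) <+>\<^bsub>A\<^esub> P 2 \<subseteq> ?H" by (intro sum_least H s0)
    then show "\<mm> \<subseteq> ?H" using Cons(7) by blast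
  qed
  then obtain K where K: "transversal K" "J <+>\<^bsub>A\<^esub> PIdl y \<subseteq> K" "curve K t B (xs @ [t])" "t \<notin> K <+>\<^bsub>A\<^esub> P 2" "\<mm> \<subseteq> (K <+>\<^bsub>A\<^esub> PIdl t) <+>\<^bsub>A\<^esub> P 2"
    by blast
  have "y \<in> K" "J \<subseteq> K" using K(2) sum_left[OF Ji id(2)] sum_right[OF Ji id(2)] principal_self[OF yc] by auto
  then show ?case using K by (intro exI[of _ K]) (simp add: y_def p_def)
qed

text \<open>Nakayama's argument modulo a power of \<open>\<mm>\<close>: substituting the inclusion into its own term \<open>\<mm>\<^sup>2\<close> replaces \<open>\<mm>\<^sup>2\<close> by
  higher and higher powers.\<close>

lemma curve_max_gen:
  assumes K: "ideal K A" and t: "t \<in> \<mm>" and gen: "\<mm> \<subseteq> (K <+>\<^bsub>A\<^esub> PIdl t) <+>\<^bsub>A\<^esub> P 2"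
  shows "\<mm> \<subseteq> PIdl t <+>\<^bsub>A\<^esub> (K <+>\<^bsub>A\<^esub> P (Suc n))"
proof (induction n)
  case 0
  show ?case
    using sum_right[OF K P_ideal[of "Suc 0"]] sum_right[OF cgenideal_ideal[OF m_sub_carrier[OF t]] add_ideals[OF K P_ideal[of "Suc 0"]]]
    by (auto simp: P_1)
next
  case (Suc n)
  have tc: "t \<in> carrier A" using t m_sub_carrier by blast
  note ti = cgenideal_ideal[OF tc]
  let ?Q = "PIdl t <+>\<^bsub>A\<^esub> (K <+>\<^bsub>A\<^esub> P (Suc (Suc n)))"
  have Q: "ideal ?Q A" by (intro add_ideals ti K P_ideal)
  have sub: "PIdl t \<subseteq> ?Q" "K \<subseteq> ?Q" "P (Suc (Suc n)) \<subseteq> ?Q"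
    using sum_left[OF ti add_ideals[OF K P_ideal]] sum_right[OF ti add_ideals[OF K P_ideal]]
      sum_left[OF K P_ideal] sum_right[OF K P_ideal] by blast+
  have "P (Suc n) \<subseteq> ?Q"
    unfolding P_Suc[of n]
  proof (rule prod_least[OF Q])
    fix p x assume p: "p \<in> P n" and x: "x \<in> \<mm>"
    have pc: "p \<in> carrier A" using ideal_closed(1)[OF P_ideal p] .
    note C = colon_ideal[OF Q pc]
    have tq: "t \<in> ?Q" using sub(1) principal_self[OF tc] by blast
    have kq: "k \<otimes> p \<in> ?Q" if "k \<in> ?Q" for k using ideal_closed(7)[OF Q pc that] .
    have "K \<subseteq> {x \<in> carrier A. x \<otimes> p \<in> ?Q}" using kq sub ideal_closed(1)[OF K] by blast
    moreover have "PIdl t \<subseteq> {x \<in> carrier A. x \<otimes> p \<in> ?Q}" using kq tq tc by (intro principal_least C) auto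
    moreover have "P 2 \<subseteq> {x \<in> carrier A. x \<otimes> p \<in> ?Q}"
    proof
      fix q assume q: "q \<in> P 2"
      have "q \<otimes> p \<in> P (Suc (Suc n))" using P_mult[OF q p] by simp
      then show "q \<in> {x \<in> carrier A. x \<otimes> p \<in> ?Q}" using sub(3) ideal_closed(1)[OF P_ideal q] by blast
    qed
    ultimately have "\<mm> \<subseteq> {x \<in> carrier A. x \<otimes> p \<in> ?Q}"
      using gen sum_least[OF C sum_least[OF C]] by blast
    then show "p \<otimes> x \<in> ?Q" using x pc by (auto simp: m_comm)
  qed
  then have "PIdl t <+>\<^bsub>A\<^esub> (K <+>\<^bsub>A\<^esub> P (Suc n)) \<subseteq> ?Q" by (intro sum_least Q sub)
  then show ?case using Suc.IH by (rule order_trans[rotated])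
qed

end

text \<open>The relation that \<open>formally_regular_relation\<close> derives from formal regularity; from here on only this relation and separatedness enter.\<close>

locale regular_adic = adic +
  assumes relation: "\<lbrakk>ideal I A; 1 \<le> n; P n \<subseteq> I; I \<subseteq> \<mm>; t \<in> \<mm>; \<mm> \<subseteq> PIdl t <+>\<^bsub>A\<^esub> I; u \<in> \<mm>; t \<otimes> u \<in> I \<cdot> \<mm>\<rbrakk>
    \<Longrightarrow> u \<in> I"
begin

text \<open>If \<open>t\<^sup>V = k + g\<close> with \<open>k \<in> K\<close> and \<open>g \<in> \<mm>\<^sup>V\<^sup>+\<^sup>1\<close>, then \<open>k \<in> \<mm>\<^sup>2\<close> and so \<open>k \<in> K\<mm>\<close> by
  transversality.  Hence \<open>t\<^sup>V\<close> lies in \<open>I\<mm>\<close> for \<open>I = K + \<mm>\<^sup>V\<close>, and the relation lowers the exponent by one.\<close>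

lemma curve_order:
  assumes K: "transversal K" and t: "t \<in> \<mm>" "t \<notin> K <+>\<^bsub>A\<^esub> P 2" and gen: "\<mm> \<subseteq> (K <+>\<^bsub>A\<^esub> PIdl t) <+>\<^bsub>A\<^esub> P 2"
  shows "t [^] V \<notin> K <+>\<^bsub>A\<^esub> P (Suc V)"
proof (induction V rule: less_induct)
  case (less V)
  note Ki = transversalD(1)[OF K]
  have tc: "t \<in> carrier A" using t m_sub_carrier by blast
  consider "V = 0" | "V = Suc 0" | v where "V = Suc (Suc v)" by (metis not0_implies_Suc)
  then show ?case
  proof cases
    case 1
    have "K <+>\<^bsub>A\<^esub> P (Suc 0) \<subseteq> \<mm>" using transversalD(2)[OF K] by (intro sum_least mm) (simp_all add: P_1)
    then show ?thesis using 1 one_notin by auto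
  next
    case 2
    then show ?thesis using t tc by (simp add: numeral_2_eq_2)
  next
    case (3 v)
    let ?I = "K <+>\<^bsub>A\<^esub> P V"
    have I: "ideal ?I A" by (intro add_ideals Ki P_ideal)
    have Im: "?I \<subseteq> \<mm>" using transversalD(2)[OF K] P_mono[of "Suc 0" V] 3 by (intro sum_least mm) (simp_all add: P_1)
    show ?thesis
    proof
      assume "t [^] V \<in> K <+>\<^bsub>A\<^esub> P (Suc V)"
      then obtain k g where kg: "k \<in> K" "g \<in> P (Suc V)" "t [^] V = k \<oplus> g" by (rule in_sumE)
      have kc: "k \<in> carrier A" "g \<in> carrier A" using kg ideal_closed(1)[OF Ki] ideal_closed(1)[OF P_ideal] by auto
      have "k = t [^] V \<ominus> g" unfolding kg(3) using kc by algebra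
      moreover have "t [^] V \<in> P 2" using P_pow[OF t(1), of V] P_mono[of 2 V] 3 by (simp add: subset_iff del: nat_pow_Suc)
      moreover have "g \<in> P 2" using kg(2) P_mono[of 2 "Suc V"] 3 by auto
      ultimately have "k \<in> P 2" using ideal_closed(5)[OF P_ideal] by simp
      then have "k \<in> K \<cdot> \<mm>" by (rule transversalD(3)[OF K kg(1)])
      then have k: "k \<in> ?I \<cdot> \<mm>" using prod_mono[OF sum_left[OF Ki P_ideal] order_refl] by blast
      have g: "g \<in> ?I \<cdot> \<mm>" using kg(2) prod_mono[OF sum_right[OF Ki P_ideal] order_refl] unfolding P_Suc by blast
      have "t \<otimes> t [^] Suc v = t [^] V" using tc 3 by (simp add: m_comm)
      then have "t \<otimes> t [^] Suc v \<in> ?I \<cdot> \<mm>"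
        using kg(3) ideal_closed(3)[OF ideal_prod_is_ideal[OF I mm] k g] by simp
      moreover have "t [^] Suc v \<in> \<mm>" using P_pow[OF t(1), of "Suc v"] P_mono[of "Suc 0" "Suc v"] by (auto simp: P_1)
      moreover have "\<mm> \<subseteq> PIdl t <+>\<^bsub>A\<^esub> ?I" using curve_max_gen[OF Ki t(1) gen, of "Suc v"] 3 by simp
      ultimately have "t [^] Suc v \<in> ?I"
        using relation[OF I _ sum_right[OF Ki P_ideal] Im t(1)] 3 by simp
      then show False using less[of "Suc v"] 3 by simp
    qed
  qed
qed

end

section \<open>Powers of finitely generated ideals\<close>

context adic
begin

lemma ideal_pow_sub:
  assumes "ideal I A" "ideal I' A" "I \<subseteq> I'"
  shows "ideal_pow A I n \<subseteq> ideal_pow A I' n"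
proof (induction n)
  case 0
  then show ?case unfolding ideal_pow_0 by simp
next
  case (Suc n)
  then show ?case unfolding ideal_pow_Suc by (intro prod_mono assms)
qed

text \<open>Multiplying the inclusion for the generators \<open>n\<close> times, each error term either stays in \<open>J\<close> or gains a factor in \<open>\<mm>\<close>.\<close>

lemma ideal_pow_approx:
  assumes I: "ideal I A" and I': "ideal I' A" and J: "ideal J A"
    and sub: "I \<subseteq> (I' <+>\<^bsub>A\<^esub> J) <+>\<^bsub>A\<^esub> P 2" and m: "I \<subseteq> \<mm>" "I' \<subseteq> \<mm>"
  shows "ideal_pow A I n \<subseteq> (ideal_pow A I' n <+>\<^bsub>A\<^esub> J) <+>\<^bsub>A\<^esub> P (Suc n)"
proof (induction n)
  case 0
  note c = ideal_pow_ideal[OF is_cring I', of 0]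
  have "carrier A \<subseteq> ideal_pow A I' 0" unfolding ideal_pow_0 by simp
  also have "\<dots> \<subseteq> ideal_pow A I' 0 <+>\<^bsub>A\<^esub> J" by (rule sum_left[OF c J])
  also have "\<dots> \<subseteq> (ideal_pow A I' 0 <+>\<^bsub>A\<^esub> J) <+>\<^bsub>A\<^esub> P (Suc 0)" by (rule sum_left[OF add_ideals[OF c J] P_ideal])
  finally show ?case unfolding ideal_pow_0[of A I] .
next
  case (Suc n)
  let ?H = "(ideal_pow A I' (Suc n) <+>\<^bsub>A\<^esub> J) <+>\<^bsub>A\<^esub> P (Suc (Suc n))"
  note pi = ideal_pow_ideal[OF is_cring I']
  have H: "ideal ?H A" by (intro add_ideals pi J P_ideal)
  have s: "ideal_pow A I' (Suc n) \<subseteq> ?H" "J \<subseteq> ?H" "P (Suc (Suc n)) \<subseteq> ?H"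
    using sum_left[OF pi J, of "Suc n"] sum_right[OF pi J, of "Suc n"]
      sum_left[OF add_ideals[OF pi J] P_ideal, of "Suc n" "Suc (Suc n)"] sum_right[OF add_ideals[OF pi J] P_ideal, of "Suc (Suc n)" "Suc n"]
    by (meson order_trans)+
  show ?case
    unfolding ideal_pow_Suc[of A I]
  proof (rule prod_least[OF H])
    fix p x assume p: "p \<in> ideal_pow A I n" and x: "x \<in> I"
    have xc: "x \<in> carrier A" and xm: "x \<in> \<mm>" using x ideal_closed(1)[OF I] m by auto
    note C = colon_ideal[OF H xc]
    have "ideal_pow A I' n \<subseteq> {z \<in> carrier A. z \<otimes> x \<in> ?H}"
    proof
      fix z assume z: "z \<in> ideal_pow A I' n"
      have zc: "z \<in> carrier A" using ideal_closed(1)[OF pi z] .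
      have zP: "z \<in> P n" using ideal_pow_sub[OF I' mm m(2)] z unfolding P_def by blast
      note C' = colon_ideal[OF H zc]
      have "I' \<subseteq> {u \<in> carrier A. u \<otimes> z \<in> ?H}"
      proof
        fix u assume u: "u \<in> I'"
        have "z \<otimes> u \<in> ideal_pow A I' (Suc n)" unfolding ideal_pow_Suc using z u by (rule ideal_prod.prod)
        then show "u \<in> {u \<in> carrier A. u \<otimes> z \<in> ?H}"
          using s(1) zc ideal_closed(1)[OF I' u] by (auto simp: m_comm)
      qed
      moreover have "J \<subseteq> {u \<in> carrier A. u \<otimes> z \<in> ?H}"
        using s(2) ideal_closed(1)[OF J] ideal_closed(7)[OF J zc] by blast
      moreover have "P 2 \<subseteq> {u \<in> carrier A. u \<otimes> z \<in> ?H}"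
      proof
        fix u assume u: "u \<in> P 2"
        have "u \<otimes> z \<in> P (Suc (Suc n))" using P_mult[OF u zP] by simp
        then show "u \<in> {u \<in> carrier A. u \<otimes> z \<in> ?H}" using s(3) ideal_closed(1)[OF P_ideal u] by blast
      qed
      ultimately have "(I' <+>\<^bsub>A\<^esub> J) <+>\<^bsub>A\<^esub> P 2 \<subseteq> {u \<in> carrier A. u \<otimes> z \<in> ?H}" by (intro sum_least C')
      then have "x \<otimes> z \<in> ?H" using sub x by blast
      then show "z \<in> {z \<in> carrier A. z \<otimes> x \<in> ?H}" using zc xc by (simp add: m_comm)
    qed
    moreover have "J \<subseteq> {z \<in> carrier A. z \<otimes> x \<in> ?H}"
      using s(2) ideal_closed(1)[OF J] ideal_closed(7)[OF J xc] by blast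
    moreover have "P (Suc n) \<subseteq> {z \<in> carrier A. z \<otimes> x \<in> ?H}"
    proof
      fix z assume z: "z \<in> P (Suc n)"
      have "z \<otimes> x \<in> P (Suc (Suc n))" unfolding P_Suc[of "Suc n"] using z xm by (rule ideal_prod.prod)
      then show "z \<in> {z \<in> carrier A. z \<otimes> x \<in> ?H}" using s(3) ideal_closed(1)[OF P_ideal z] by blast
    qed
    ultimately have "(ideal_pow A I' n <+>\<^bsub>A\<^esub> J) <+>\<^bsub>A\<^esub> P (Suc n) \<subseteq> {z \<in> carrier A. z \<otimes> x \<in> ?H}" by (intro sum_least C)
    then show "p \<otimes> x \<in> ?H" using Suc.IH p by blast
  qed
qed

lemma P_finitely_generated:
  "a \<in> P n \<Longrightarrow> \<exists>xs. set xs \<subseteq> \<mm> \<and> a \<in> ideal_pow A (Idl (set xs)) n"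
proof (induction n arbitrary: a)
  case 0
  then show ?case by (intro exI[of _ "[]"]) (simp only: ideal_pow_0 P_0 set_simps empty_subsetI simp_thms)
next
  case (Suc n)
  have mono: "Idl (set xs) \<subseteq> Idl (set (xs @ ys))" "Idl (set ys) \<subseteq> Idl (set (xs @ ys))"
    "ideal (Idl (set xs)) A" "ideal (Idl (set ys)) A" "ideal (Idl (set (xs @ ys))) A"
    if "set xs \<subseteq> \<mm>" "set ys \<subseteq> \<mm>" for xs ys
  proof -
    have c: "set xs \<subseteq> carrier A" "set ys \<subseteq> carrier A" "set (xs @ ys) \<subseteq> carrier A" using that m_sub_carrier by auto
    show i: "ideal (Idl (set xs)) A" "ideal (Idl (set ys)) A" "ideal (Idl (set (xs @ ys))) A"
      using c by (auto intro: genideal_ideal)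
    show "Idl (set xs) \<subseteq> Idl (set (xs @ ys))" "Idl (set ys) \<subseteq> Idl (set (xs @ ys))"
      using genideal_self[OF c(3)] by (intro genideal_minimal[OF i(3)]; simp)+
  qed
  note mono' = ideal_pow_sub[OF _ _ mono(1)] ideal_pow_sub[OF _ _ mono(2)]
  show ?case
    using Suc(2) unfolding P_Suc
  proof (induction rule: ideal_prod.induct)
    case (prod p x)
    obtain xs where xs: "set xs \<subseteq> \<mm>" "p \<in> ideal_pow A (Idl (set xs)) n" using Suc.IH prod by blast
    have x1: "set [x] \<subseteq> \<mm>" using prod by simp
    note mo = mono[OF xs(1) x1]
    have "x \<in> Idl (set (xs @ [x]))"
      using genideal_self[of "set (xs @ [x])"] xs x1 m_sub_carrier by auto
    moreover have "p \<in> ideal_pow A (Idl (set (xs @ [x]))) n" using ideal_pow_sub[OF mo(3,5,1)] xs(2) by blast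
    ultimately have "p \<otimes> x \<in> ideal_pow A (Idl (set (xs @ [x]))) (Suc n)"
      unfolding ideal_pow_Suc by (intro ideal_prod.prod)
    then show ?case using xs x1 by (intro exI[of _ "xs @ [x]"]) auto
  next
    case (sum s1 s2)
    then obtain xs ys where xs: "set xs \<subseteq> \<mm>" "s1 \<in> ideal_pow A (Idl (set xs)) (Suc n)"
      and ys: "set ys \<subseteq> \<mm>" "s2 \<in> ideal_pow A (Idl (set ys)) (Suc n)" by blast
    note mo = mono[OF xs(1) ys(1)]
    have "s1 \<oplus> s2 \<in> ideal_pow A (Idl (set (xs @ ys))) (Suc n)"
      by (rule ideal_closed(3)[OF ideal_pow_ideal[OF is_cring mo(5)] subsetD[OF ideal_pow_sub[OF mo(3,5,1)] xs(2)]
            subsetD[OF ideal_pow_sub[OF mo(4,5,2)] ys(2)]])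
    then show ?case using xs ys by (intro exI[of _ "xs @ ys"]) auto
  qed
qed

text \<open>The first dependent element of the sequence is dropped.\<close>

lemma dependent_reduce:
  assumes "ideal J A" "set xs \<subseteq> \<mm>" "\<not> seq_indep J xs"
  shows "\<exists>ys. length ys < length xs \<and> set ys \<subseteq> \<mm> \<and> Idl (set xs) \<subseteq> (Idl (set ys) <+>\<^bsub>A\<^esub> J) <+>\<^bsub>A\<^esub> P 2"
  using assms
proof (induction xs arbitrary: J)
  case (Cons x xs)
  have c: "x \<in> carrier A" "set xs \<subseteq> carrier A" and xm: "x \<in> \<mm>" "set xs \<subseteq> \<mm>"
    using Cons.prems m_sub_carrier by auto
  note J = Cons.prems(1)
  show ?case
  proof (cases "x \<in> J <+>\<^bsub>A\<^esub> P 2")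
    case True
    let ?H = "(Idl (set xs) <+>\<^bsub>A\<^esub> J) <+>\<^bsub>A\<^esub> P 2"
    have i: "ideal (Idl (set xs)) A" by (rule genideal_ideal[OF c(2)])
    have H: "ideal ?H A" by (intro add_ideals i J P_ideal)
    have "J <+>\<^bsub>A\<^esub> P 2 \<subseteq> ?H" by (intro sum_mono sum_right i J order_refl)
    then have "x \<in> ?H" using True by blast
    moreover have "set xs \<subseteq> ?H"
      using genideal_self[OF c(2)] sum_left[OF i J] sum_left[OF add_ideals[OF i J] P_ideal[of 2]] by blast
    ultimately have "Idl (set (x # xs)) \<subseteq> ?H" by (intro genideal_minimal[OF H]) simp
    then show ?thesis using xm by (intro exI[of _ xs]) simp
  next
    case False
    have xi: "ideal (PIdl x) A" by (rule cgenideal_ideal[OF c(1)])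
    have "\<not> seq_indep (J <+>\<^bsub>A\<^esub> PIdl x) xs" using False Cons.prems(3) by simp
    from Cons.IH[OF add_ideals[OF J xi] xm(2) this]
    obtain ys where ys: "length ys < length xs" "set ys \<subseteq> \<mm>"
      "Idl (set xs) \<subseteq> (Idl (set ys) <+>\<^bsub>A\<^esub> (J <+>\<^bsub>A\<^esub> PIdl x)) <+>\<^bsub>A\<^esub> P 2" by blast
    have yc: "set ys \<subseteq> carrier A" "set (x # ys) \<subseteq> carrier A" using ys(2) c m_sub_carrier by auto
    let ?H = "(Idl (set (x # ys)) <+>\<^bsub>A\<^esub> J) <+>\<^bsub>A\<^esub> P 2"
    have i: "ideal (Idl (set ys)) A" "ideal (Idl (set (x # ys))) A" using yc by (auto intro: genideal_ideal)
    have H: "ideal ?H A" by (intro add_ideals i J P_ideal)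
    have s: "Idl (set (x # ys)) \<subseteq> ?H" "J \<subseteq> ?H" "P 2 \<subseteq> ?H"
      using sum_left[OF i(2) J] sum_right[OF i(2) J] sum_left[OF add_ideals[OF i(2) J] P_ideal[of 2]]
        sum_right[OF add_ideals[OF i(2) J] P_ideal[of 2]] by (meson order_trans)+
    have self: "set (x # ys) \<subseteq> ?H" using genideal_self[OF yc(2)] s(1) by (rule order_trans)
    have "Idl (set ys) \<subseteq> ?H" by (rule genideal_minimal[OF H]) (use self in auto)
    moreover have "PIdl x \<subseteq> ?H" by (rule principal_least[OF H]) (use self in auto)
    ultimately have "(Idl (set ys) <+>\<^bsub>A\<^esub> (J <+>\<^bsub>A\<^esub> PIdl x)) <+>\<^bsub>A\<^esub> P 2 \<subseteq> ?H" by (intro sum_least H s)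
    then have "set xs \<subseteq> ?H" using ys(3) genideal_self[OF c(2)] by (meson order_trans)
    then have "Idl (set (x # xs)) \<subseteq> ?H" using self by (intro genideal_minimal[OF H]) simp
    then show ?thesis using ys xm by (intro exI[of _ "x # ys"]) simp
  qed
qed simp

end

section \<open>Monomial expansions\<close>

definition exps :: "nat \<Rightarrow> nat \<Rightarrow> nat list set" where
  "exps r n = {\<alpha>. length \<alpha> = r \<and> sum_list \<alpha> = n}"

definition exps_below :: "nat \<Rightarrow> nat \<Rightarrow> nat list set" where
  "exps_below r n = {\<alpha>. length \<alpha> = r \<and> sum_list \<alpha> < n}"

lemma finite_exps_below: "finite (exps_below r n)"
proof (rule finite_subset)
  show "exps_below r n \<subseteq> {\<alpha>. set \<alpha> \<subseteq> {..n} \<and> length \<alpha> = r}"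
    unfolding exps_below_def using member_le_sum_list by (fastforce intro: less_imp_le)
  show "finite {\<alpha>. set \<alpha> \<subseteq> {..n} \<and> length \<alpha> = r}" by (rule finite_lists_length_eq) simp
qed

lemma exps_sub: "exps r n \<subseteq> exps_below r (Suc n)"
  by (auto simp: exps_def exps_below_def)

lemma finite_exps: "finite (exps r n)"
  using exps_sub finite_exps_below by (rule finite_subset)

text \<open>The order in \<open>t\<close> of the monomial with exponents \<open>\<alpha>\<close> along the curve; the exponents are read as digits to base \<open>B\<close>.\<close>

primrec weight :: "nat \<Rightarrow> nat list \<Rightarrow> nat" where
  "weight B [] = 0"
| "weight B (a # \<alpha>) = a * B ^ length \<alpha> + weight B \<alpha>"

lemma sum_list_le_weight: "1 \<le> B \<Longrightarrow> sum_list \<alpha> \<le> weight B \<alpha>"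
proof (induction \<alpha>)
  case (Cons a \<alpha>)
  have "a * 1 \<le> a * B ^ length \<alpha>" using Cons by (intro mult_le_mono2) simp
  from add_mono[OF this Cons.IH[OF Cons.prems]] show ?case by simp
qed simp

text \<open>The set \<open>S\<close> may be infinite, and one bound \<open>B0\<close> has to serve all its elements.  It does, since \<open>\<alpha>\<close> is the lexicographic minimum:
  once \<open>B\<close> exceeds the digits of \<open>\<alpha>\<close>, already the first digit at which another exponent is larger outweighs the rest of \<open>\<alpha>\<close>.
  The bound \<open>weight B \<alpha> < B ^ r\<close> carries the induction.\<close>

lemma lex_min_weight:
  assumes "S \<noteq> {}" "\<And>\<alpha>. \<alpha> \<in> S \<Longrightarrow> length \<alpha> = r"
  shows "\<exists>\<alpha>\<in>S. \<exists>B0. \<forall>B\<ge>B0. weight B \<alpha> < B ^ r \<and> (\<forall>\<beta>\<in>S. \<beta> \<noteq> \<alpha> \<longrightarrow> weight B \<alpha> < weight B \<beta>)"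
  using assms
proof (induction r arbitrary: S)
  case 0
  then have "S = {[]}" by auto
  then show ?case by auto
next
  case (Suc r)
  define e where "e = (LEAST a. \<exists>\<alpha>. a # \<alpha> \<in> S)"
  obtain \<alpha>0 where "\<alpha>0 \<in> S" using Suc.prems(1) by blast
  then have "\<exists>a \<alpha>. a # \<alpha> \<in> S" using Suc.prems(2) by (cases \<alpha>0) force+
  then have ex: "\<exists>\<alpha>. e # \<alpha> \<in> S" unfolding e_def by (rule LeastI_ex)
  have le: "e \<le> a" if "a # \<alpha> \<in> S" for a \<alpha> unfolding e_def using that by (intro Least_le) blast
  let ?S = "{\<alpha>. e # \<alpha> \<in> S}"
  have "?S \<noteq> {}" using ex by blast
  moreover have "length \<alpha> = r" if "\<alpha> \<in> ?S" for \<alpha> using Suc.prems(2)[of "e # \<alpha>"] that by simp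
  ultimately obtain \<alpha> B0 where \<alpha>: "e # \<alpha> \<in> S"
    and B0: "\<And>B. B \<ge> B0 \<Longrightarrow> weight B \<alpha> < B ^ r \<and> (\<forall>\<beta>\<in>?S. \<beta> \<noteq> \<alpha> \<longrightarrow> weight B \<alpha> < weight B \<beta>)"
    using Suc.IH[of ?S] by blast
  have len: "length \<alpha> = r" using Suc.prems(2)[OF \<alpha>] by simp
  show ?case
  proof (intro bexI[OF _ \<alpha>] exI[of _ "max B0 (Suc e)"] allI impI conjI ballI)
    fix B assume B: "max B0 (Suc e) \<le> B"
    have w: "weight B \<alpha> < B ^ r" using B0[of B] B by simp
    have step: "weight B (e # \<alpha>) < Suc e * B ^ r" using w len by simp
    also have "\<dots> \<le> B * B ^ r" using B by (intro mult_le_mono1) simp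
    also have "\<dots> = B ^ Suc r" by simp
    finally show "weight B (e # \<alpha>) < B ^ Suc r" .
    fix \<beta> assume \<beta>: "\<beta> \<in> S" "\<beta> \<noteq> e # \<alpha>"
    obtain b \<gamma> where b: "\<beta> = b # \<gamma>" using Suc.prems(2)[OF \<beta>(1)] by (cases \<beta>) auto
    have lg: "length \<gamma> = r" using Suc.prems(2)[OF \<beta>(1)] b by simp
    show "weight B (e # \<alpha>) < weight B \<beta>"
    proof (cases "b = e")
      case True
      then show ?thesis using B0[of B] B \<beta> b len lg by auto
    next
      case False
      then have "Suc e \<le> b" using le[of b \<gamma>] \<beta>(1) b by simp
      then have "Suc e * B ^ r \<le> b * B ^ r" by (rule mult_le_mono1)
      then show ?thesis using step b lg by simp
    qed
  qed
qed

context adic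
begin

primrec mon :: "'a list \<Rightarrow> nat list \<Rightarrow> 'a" where
  "mon [] \<alpha> = \<one>"
| "mon (x # xs) \<alpha> = x [^] hd \<alpha> \<otimes> mon xs (tl \<alpha>)"

lemma mon_closed: "set xs \<subseteq> carrier A \<Longrightarrow> mon xs \<alpha> \<in> carrier A"
  by (induction xs arbitrary: \<alpha>) auto

lemma mon_bump:
  assumes "set xs \<subseteq> carrier A" "length \<alpha> = length xs" "i < length xs"
  shows "mon xs (\<alpha>[i := Suc (\<alpha> ! i)]) = mon xs \<alpha> \<otimes> xs ! i"
  using assms
proof (induction xs arbitrary: \<alpha> i)
  case (Cons x xs)
  obtain a \<beta> where a: "\<alpha> = a # \<beta>" using Cons.prems by (cases \<alpha>) auto
  have c: "x \<in> carrier A" "set xs \<subseteq> carrier A" "mon xs \<beta> \<in> carrier A" using Cons.prems mon_closed by auto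
  show ?case
  proof (cases i)
    case 0
    then show ?thesis using a c by (simp add: m_ac)
  next
    case (Suc j)
    then have "xs ! j \<in> carrier A" using c Cons.prems by auto
    then show ?thesis using Suc a c Cons.IH[OF c(2), of \<beta> j] Cons.prems by (simp add: m_assoc)
  qed
qed simp

lemma mon_P: "\<lbrakk>set xs \<subseteq> \<mm>; length \<alpha> = length xs\<rbrakk> \<Longrightarrow> mon xs \<alpha> \<in> P (sum_list \<alpha>)"
proof (induction xs arbitrary: \<alpha>)
  case Nil
  then show ?case by (simp add: P_0)
next
  case (Cons x xs)
  then obtain a \<beta> where "\<alpha> = a # \<beta>" by (cases \<alpha>) auto
  then show ?case using Cons P_mult[OF P_pow] by simp
qed

text \<open>The power is generated by the monomials of degree \<open>n\<close>; it is convenient to say so through the ideals \<open>H\<close> containing them.\<close>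

lemma ideal_pow_monomials:
  assumes "set xs \<subseteq> carrier A" "ideal H A" "\<And>\<alpha>. \<alpha> \<in> exps (length xs) n \<Longrightarrow> mon xs \<alpha> \<in> H"
  shows "ideal_pow A (Idl (set xs)) n \<subseteq> H"
  using assms(2,3)
proof (induction n arbitrary: H)
  case 0
  have one: "mon ys (replicate (length ys) 0) = \<one>" if "set ys \<subseteq> carrier A" for ys
    using that by (induction ys) auto
  have "replicate (length xs) 0 \<in> exps (length xs) 0" by (simp add: exps_def)
  then have "\<one> \<in> H" using 0(2) one[OF assms(1)] by metis
  then have "H = carrier A" using ideal.one_imp_carrier[OF 0(1)] by simp
  then show ?case unfolding ideal_pow_0 by simp
next
  case (Suc n)
  have Yi: "ideal (Idl (set xs)) A" by (rule genideal_ideal[OF assms(1)])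
  show ?case
    unfolding ideal_pow_Suc
  proof (rule prod_least[OF Suc.prems(1)])
    fix p x assume p: "p \<in> ideal_pow A (Idl (set xs)) n" and x: "x \<in> Idl (set xs)"
    have pc: "p \<in> carrier A" using ideal_closed(1)[OF ideal_pow_ideal[OF is_cring Yi] p] .
    have xc: "x \<in> carrier A" using ideal_closed(1)[OF Yi x] .
    have "set xs \<subseteq> {x \<in> carrier A. x \<otimes> p \<in> H}"
    proof
      fix u assume "u \<in> set xs"
      then obtain i where i: "i < length xs" "u = xs ! i" by (metis in_set_conv_nth)
      have uc: "u \<in> carrier A" using \<open>u \<in> set xs\<close> assms(1) by blast
      have "ideal_pow A (Idl (set xs)) n \<subseteq> {z \<in> carrier A. z \<otimes> u \<in> H}"
      proof (rule Suc.IH[OF colon_ideal[OF Suc.prems(1) uc]])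
        fix \<alpha> assume \<alpha>: "\<alpha> \<in> exps (length xs) n"
        then have "\<alpha>[i := Suc (\<alpha> ! i)] \<in> exps (length xs) (Suc n)"
          using i by (auto simp: exps_def sum_list_update elem_le_sum_list)
        from Suc.prems(2)[OF this] show "mon xs \<alpha> \<in> {z \<in> carrier A. z \<otimes> u \<in> H}"
          using mon_bump[OF assms(1), of \<alpha> i] \<alpha> i mon_closed[OF assms(1)] by (simp add: exps_def)
      qed
      then have "p \<otimes> u \<in> H" using p by blast
      then show "u \<in> {x \<in> carrier A. x \<otimes> p \<in> H}" using uc pc by (simp add: m_comm)
    qed
    from genideal_minimal[OF colon_ideal[OF Suc.prems(1) pc] this]
    show "p \<otimes> x \<in> H" using x pc xc by (auto simp: m_comm)
  qed
qed

definition comb :: "'a list \<Rightarrow> nat list set \<Rightarrow> (nat list \<Rightarrow> 'a) \<Rightarrow> 'a" where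
  "comb xs D c = (\<Oplus>\<alpha>\<in>D. c \<alpha> \<otimes> mon xs \<alpha>)"

lemma ideal_finsum:
  assumes "finite D" "ideal K A" "\<And>\<alpha>. \<alpha> \<in> D \<Longrightarrow> f \<alpha> \<in> K"
  shows "finsum A f D \<in> K"
  using assms(1,3)
proof (induction D rule: finite_induct)
  case empty
  then show ?case using ideal_closed(2)[OF assms(2)] by simp
next
  case (insert x F)
  then have "f x \<in> carrier A" "f \<in> F \<rightarrow> carrier A" using ideal_closed(1)[OF assms(2)] by auto
  then show ?case using insert ideal_closed(3)[OF assms(2)] by simp
qed

lemma comb_closed:
  assumes "set xs \<subseteq> carrier A" "\<And>\<alpha>. c \<alpha> \<in> carrier A"
  shows "comb xs D c \<in> carrier A"
  unfolding comb_def by (rule finsum_closed) (use assms mon_closed in auto)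

lemma comb_add:
  assumes "set xs \<subseteq> carrier A" "\<And>\<alpha>. c \<alpha> \<in> carrier A" "\<And>\<alpha>. d \<alpha> \<in> carrier A"
  shows "comb xs D (\<lambda>\<alpha>. c \<alpha> \<oplus> d \<alpha>) = comb xs D c \<oplus> comb xs D d"
proof -
  have "comb xs D (\<lambda>\<alpha>. c \<alpha> \<oplus> d \<alpha>) = (\<Oplus>\<alpha>\<in>D. c \<alpha> \<otimes> mon xs \<alpha> \<oplus> d \<alpha> \<otimes> mon xs \<alpha>)"
    unfolding comb_def by (rule finsum_cong') (use assms mon_closed in \<open>auto simp: l_distr\<close>)
  then show ?thesis
    unfolding comb_def by (simp add: finsum_addf assms mon_closed Pi_def)
qed

lemma comb_smult:
  assumes "finite D" "set xs \<subseteq> carrier A" "\<And>\<alpha>. c \<alpha> \<in> carrier A" "a \<in> carrier A"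
  shows "comb xs D (\<lambda>\<alpha>. a \<otimes> c \<alpha>) = a \<otimes> comb xs D c"
proof -
  have "a \<otimes> comb xs D c = (\<Oplus>\<alpha>\<in>D. a \<otimes> (c \<alpha> \<otimes> mon xs \<alpha>))"
    unfolding comb_def by (rule finsum_rdistr) (use assms mon_closed in auto)
  also have "\<dots> = comb xs D (\<lambda>\<alpha>. a \<otimes> c \<alpha>)"
    unfolding comb_def by (rule finsum_cong') (use assms mon_closed in \<open>auto simp: m_assoc\<close>)
  finally show ?thesis by simp
qed

lemma comb_zero: "set xs \<subseteq> carrier A \<Longrightarrow> (\<And>\<alpha>. \<alpha> \<in> D \<Longrightarrow> c \<alpha> = \<zero>) \<Longrightarrow> comb xs D c = \<zero>"
  unfolding comb_def by (rule add.finprod_one_eqI) (simp add: mon_closed)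

lemma comb_cong:
  assumes "set xs \<subseteq> carrier A" "\<And>\<alpha>. d \<alpha> \<in> carrier A" "\<And>\<alpha>. \<alpha> \<in> D \<Longrightarrow> c \<alpha> = d \<alpha>"
  shows "comb xs D c = comb xs D d"
  unfolding comb_def by (rule finsum_cong') (use assms mon_closed in auto)

lemma comb_superset:
  assumes "set xs \<subseteq> carrier A" "\<And>\<alpha>. c \<alpha> \<in> carrier A" "finite E" "D \<subseteq> E" "\<And>\<alpha>. \<alpha> \<in> E - D \<Longrightarrow> c \<alpha> = \<zero>"
  shows "comb xs D c = comb xs E c"
  unfolding comb_def
  by (rule add.finprod_mono_neutral_cong_left) (use assms mon_closed in auto)

text \<open>Every coefficient is zero or a unit modulo \<open>\<mm>\<close>.\<close>

definition reduced :: "(nat list \<Rightarrow> 'a) \<Rightarrow> bool" where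
  "reduced c \<longleftrightarrow> (\<forall>\<alpha>. c \<alpha> \<in> carrier A \<and> (c \<alpha> \<noteq> \<zero> \<longrightarrow> c \<alpha> \<notin> \<mm>))"

text \<open>The elements admitting some expansion modulo \<open>K\<close> form an ideal containing the monomials.  Coefficients in \<open>\<mm>\<close> may then be
  replaced by \<open>0\<close>, as their terms lie in \<open>\<mm>\<^sup>n\<^sup>+\<^sup>1\<close>.\<close>

lemma homogeneous_expansion:
  assumes xs: "set xs \<subseteq> \<mm>" and K: "ideal K A" "P (Suc n) \<subseteq> K"
    and g: "g \<in> ideal_pow A (Idl (set xs)) n <+>\<^bsub>A\<^esub> K"
  shows "\<exists>c. reduced c \<and> g \<ominus> comb xs (exps (length xs) n) c \<in> K"
proof -
  let ?D = "exps (length xs) n"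
  have xc: "set xs \<subseteq> carrier A" using xs m_sub_carrier by blast
  let ?H = "{y \<in> carrier A. \<exists>c. (\<forall>\<alpha>. c \<alpha> \<in> carrier A) \<and> y \<ominus> comb xs ?D c \<in> K}"
  have H: "ideal ?H A"
  proof (rule idealI[OF ring_axioms])
    show "subgroup ?H (add_monoid A)"
    proof (rule subgroup.intro, goal_cases)
      case (2 x y)
      then obtain c d where c: "\<And>\<alpha>. c \<alpha> \<in> carrier A" "x \<ominus> comb xs ?D c \<in> K"
        and d: "\<And>\<alpha>. d \<alpha> \<in> carrier A" "y \<ominus> comb xs ?D d \<in> K" by blast
      have xy: "x \<in> carrier A" "y \<in> carrier A" using 2 by auto
      have "(x \<oplus> y) \<ominus> (comb xs ?D c \<oplus> comb xs ?D d) = (x \<ominus> comb xs ?D c) \<oplus> (y \<ominus> comb xs ?D d)"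
        using xy comb_closed[where c=c, OF xc c(1)] comb_closed[where c=d, OF xc d(1)] by algebra
      then have "(x \<oplus> y) \<ominus> comb xs ?D (\<lambda>\<alpha>. c \<alpha> \<oplus> d \<alpha>) \<in> K"
        using comb_add[where c=c and d=d, OF xc c(1) d(1)] ideal_closed(3)[OF K(1) c(2) d(2)] by simp
      then show ?case using xy c(1) d(1) by (auto intro!: exI[of _ "\<lambda>\<alpha>. c \<alpha> \<oplus> d \<alpha>"])
    next
      case 3
      have "\<zero> \<ominus> comb xs ?D (\<lambda>_. \<zero>) \<in> K"
        using comb_zero[OF xc, of ?D "\<lambda>_. \<zero>"] ideal_closed(2)[OF K(1)] by (simp add: a_minus_def)
      then show ?case by (auto intro!: exI[of _ "\<lambda>_. \<zero>"])
    next
      case (4 x)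
      then obtain c where c: "\<And>\<alpha>. c \<alpha> \<in> carrier A" "x \<ominus> comb xs ?D c \<in> K" and x: "x \<in> carrier A" by blast
      have "(\<ominus> x) \<ominus> (\<ominus> \<one> \<otimes> comb xs ?D c) = \<ominus> (x \<ominus> comb xs ?D c)"
        using x comb_closed[where c=c, OF xc c(1)] by algebra
      then have "(\<ominus> x) \<ominus> comb xs ?D (\<lambda>\<alpha>. \<ominus> \<one> \<otimes> c \<alpha>) \<in> K"
        using comb_smult[where c=c, OF finite_exps xc c(1), of "\<ominus> \<one>"] ideal_closed(4)[OF K(1) c(2)] by simp
      then show ?case using x c(1) by (auto intro!: exI[of _ "\<lambda>\<alpha>. \<ominus> \<one> \<otimes> c \<alpha>"] simp flip: a_inv_def)
    qed auto
    fix x a assume x: "x \<in> ?H" and a: "a \<in> carrier A"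
    then obtain c where c: "\<And>\<alpha>. c \<alpha> \<in> carrier A" "x \<ominus> comb xs ?D c \<in> K" and xA: "x \<in> carrier A" by blast
    have "a \<otimes> x \<ominus> a \<otimes> comb xs ?D c = a \<otimes> (x \<ominus> comb xs ?D c)"
      using a xA comb_closed[where c=c, OF xc c(1)] by algebra
    then have "a \<otimes> x \<ominus> comb xs ?D (\<lambda>\<alpha>. a \<otimes> c \<alpha>) \<in> K"
      using comb_smult[where c=c, OF finite_exps xc c(1) a] ideal_closed(6)[OF K(1) a c(2)] by simp
    then show "a \<otimes> x \<in> ?H" using xA a c(1) by (auto intro!: exI[of _ "\<lambda>\<alpha>. a \<otimes> c \<alpha>"])
    then show "x \<otimes> a \<in> ?H" using xA a by (simp add: m_comm)
  qed
  have "ideal_pow A (Idl (set xs)) n \<subseteq> ?H"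
  proof (rule ideal_pow_monomials[OF xc H])
    fix \<alpha> assume \<alpha>: "\<alpha> \<in> ?D"
    let ?c = "\<lambda>\<beta>. if \<beta> = \<alpha> then \<one> else \<zero>"
    have "comb xs {\<alpha>} ?c = comb xs ?D ?c" by (rule comb_superset[OF xc _ finite_exps]) (use \<alpha> in auto)
    moreover have "comb xs {\<alpha>} ?c = mon xs \<alpha>" unfolding comb_def using mon_closed[OF xc] by simp
    ultimately have eq: "comb xs ?D ?c = mon xs \<alpha>" by (rule trans[OF sym])
    have "mon xs \<alpha> \<ominus> comb xs ?D ?c \<in> K"
      unfolding eq using mon_closed[OF xc] ideal_closed(2)[OF K(1)] by (simp add: a_minus_def r_neg)
    then show "mon xs \<alpha> \<in> ?H" using mon_closed[OF xc] by (auto intro!: exI[of _ ?c])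
  qed
  moreover have "K \<subseteq> ?H"
  proof
    fix y assume y: "y \<in> K"
    then have "y \<ominus> comb xs ?D (\<lambda>_. \<zero>) \<in> K"
      using comb_zero[OF xc, of ?D "\<lambda>_. \<zero>"] ideal_closed(1)[OF K(1)] by (simp add: a_minus_def)
    then show "y \<in> ?H" using ideal_closed(1)[OF K(1) y] by (auto intro!: exI[of _ "\<lambda>_. \<zero>"])
  qed
  ultimately have "g \<in> ?H" by (rule subsetD[OF sum_least[OF H] g])
  then obtain c where c: "\<And>\<alpha>. c \<alpha> \<in> carrier A" "g \<ominus> comb xs ?D c \<in> K" and gA: "g \<in> carrier A" by blast
  define u where "u \<alpha> = (if c \<alpha> \<in> \<mm> then c \<alpha> else \<zero>)" for \<alpha>
  define d where "d \<alpha> = (if c \<alpha> \<in> \<mm> then \<zero> else c \<alpha>)" for \<alpha>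
  have cl: "\<And>\<alpha>. u \<alpha> \<in> carrier A" "\<And>\<alpha>. d \<alpha> \<in> carrier A" using c(1) by (auto simp: u_def d_def)
  have "(\<lambda>\<alpha>. u \<alpha> \<oplus> d \<alpha>) = c" using c(1) by (auto simp: u_def d_def)
  then have sum: "comb xs ?D c = comb xs ?D u \<oplus> comb xs ?D d" using comb_add[where c=u and d=d, OF xc cl, of ?D] by (simp only:)
  have "comb xs ?D u \<in> K"
    unfolding comb_def
  proof (rule ideal_finsum[OF finite_exps K(1)])
    fix \<alpha> assume \<alpha>: "\<alpha> \<in> ?D"
    have "u \<alpha> \<in> \<mm>" using ideal_closed(2)[OF mm] by (simp add: u_def)
    then have "u \<alpha> \<otimes> mon xs \<alpha> \<in> P (Suc n)"
      using P_mult[of "u \<alpha>" "Suc 0" "mon xs \<alpha>" n] mon_P[OF xs, of \<alpha>] \<alpha> by (simp add: P_1 exps_def)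
    then show "u \<alpha> \<otimes> mon xs \<alpha> \<in> K" using K(2) by blast
  qed
  moreover have "g \<ominus> comb xs ?D d = (g \<ominus> comb xs ?D c) \<oplus> comb xs ?D u"
    unfolding sum using gA comb_closed[where c=u, OF xc cl(1)] comb_closed[where c=d, OF xc cl(2)] by algebra
  ultimately have "g \<ominus> comb xs ?D d \<in> K" using ideal_closed(3)[OF K(1) c(2)] by simp
  moreover have "reduced d" using c(1) by (auto simp: reduced_def d_def)
  ultimately show ?thesis by blast
qed

lemma comb_union:
  assumes "set xs \<subseteq> carrier A" "\<And>\<alpha>. c \<alpha> \<in> carrier A" "finite D" "finite E" "D \<inter> E = {}"
  shows "comb xs (D \<union> E) c = comb xs D c \<oplus> comb xs E c"
  unfolding comb_def by (rule finsum_Un_disjoint) (use assms mon_closed in auto)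

lemma exps_below_Suc: "exps_below r (Suc n) = exps_below r n \<union> exps r n" "exps_below r n \<inter> exps r n = {}"
  by (auto simp: exps_below_def exps_def)

text \<open>Successive approximation: the remainder of order \<open>N\<close> is expanded in the monomials of degree \<open>N\<close>, which span \<open>\<mm>\<^sup>N\<close> modulo \<open>J\<close> and
  \<open>\<mm>\<^sup>N\<^sup>+\<^sup>1\<close>.  One coefficient function \<open>F\<close> serves all degrees; the series is only ever used through its finite partial sums.\<close>

lemma series_expansion:
  assumes xs: "set xs \<subseteq> \<mm>" and J: "ideal J A" and gen: "\<mm> \<subseteq> (J <+>\<^bsub>A\<^esub> Idl (set xs)) <+>\<^bsub>A\<^esub> P 2"
    and g: "g \<in> J <+>\<^bsub>A\<^esub> P n"
  shows "\<exists>F. reduced F \<and> (\<forall>\<alpha>. sum_list \<alpha> < n \<longrightarrow> F \<alpha> = \<zero>) \<and>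
    (\<forall>k. g \<ominus> comb xs (exps_below (length xs) (n + k)) F \<in> J <+>\<^bsub>A\<^esub> P (n + k))"
proof -
  let ?r = "length xs"
  have xc: "set xs \<subseteq> carrier A" using xs m_sub_carrier by blast
  have Yi: "ideal (Idl (set xs)) A" by (rule genideal_ideal[OF xc])
  have Ym: "Idl (set xs) \<subseteq> \<mm>" by (rule genideal_minimal[OF mm xs])
  have step: "\<exists>c. y \<in> J <+>\<^bsub>A\<^esub> P N \<longrightarrow> reduced c \<and> y \<ominus> comb xs (exps ?r N) c \<in> J <+>\<^bsub>A\<^esub> P (Suc N)" for y N
  proof -
    have K: "ideal (J <+>\<^bsub>A\<^esub> P (Suc N)) A" by (intro add_ideals J P_ideal)
    note pY = ideal_pow_ideal[OF is_cring Yi, of N]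
    let ?H = "ideal_pow A (Idl (set xs)) N <+>\<^bsub>A\<^esub> (J <+>\<^bsub>A\<^esub> P (Suc N))"
    have H: "ideal ?H A" by (intro add_ideals pY K)
    have s: "ideal_pow A (Idl (set xs)) N \<subseteq> ?H" "J \<subseteq> ?H" "P (Suc N) \<subseteq> ?H"
      using sum_left[OF pY K] order_trans[OF sum_left[OF J P_ideal] sum_right[OF pY K]]
        order_trans[OF sum_right[OF J P_ideal] sum_right[OF pY K]] .
    have "\<mm> \<subseteq> (Idl (set xs) <+>\<^bsub>A\<^esub> J) <+>\<^bsub>A\<^esub> P 2" using gen sum_commute[OF J Yi] by simp
    from ideal_pow_approx[OF mm Yi J this order_refl Ym, of N]
    have "P N \<subseteq> (ideal_pow A (Idl (set xs)) N <+>\<^bsub>A\<^esub> J) <+>\<^bsub>A\<^esub> P (Suc N)" unfolding P_def[of N] .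
    also have "\<dots> \<subseteq> ?H" by (intro sum_least H s)
    finally have "J <+>\<^bsub>A\<^esub> P N \<subseteq> ?H" by (intro sum_least H s)
    then show ?thesis using homogeneous_expansion[OF xs K sum_right[OF J P_ideal], of y] by blast
  qed
  define ch where "ch N y = (SOME c. y \<in> J <+>\<^bsub>A\<^esub> P N \<longrightarrow> reduced c \<and> y \<ominus> comb xs (exps ?r N) c \<in> J <+>\<^bsub>A\<^esub> P (Suc N))" for N y
  have "y \<in> J <+>\<^bsub>A\<^esub> P N \<longrightarrow> reduced (ch N y) \<and> y \<ominus> comb xs (exps ?r N) (ch N y) \<in> J <+>\<^bsub>A\<^esub> P (Suc N)" for N y
    unfolding ch_def using step[of y N] by (rule someI_ex)
  then have ch: "\<And>N y. y \<in> J <+>\<^bsub>A\<^esub> P N \<Longrightarrow> reduced (ch N y)"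
    "\<And>N y. y \<in> J <+>\<^bsub>A\<^esub> P N \<Longrightarrow> y \<ominus> comb xs (exps ?r N) (ch N y) \<in> J <+>\<^bsub>A\<^esub> P (Suc N)" by blast+
  define rem where "rem = rec_nat g (\<lambda>k y. y \<ominus> comb xs (exps ?r (n + k)) (ch (n + k) y))"
  have rem0: "rem 0 = g" and remS: "rem (Suc k) = rem k \<ominus> comb xs (exps ?r (n + k)) (ch (n + k) (rem k))" for k
    by (simp_all add: rem_def)
  have rem_in: "rem k \<in> J <+>\<^bsub>A\<^esub> P (n + k)" for k
  proof (induction k)
    case 0
    then show ?case using g by (simp add: rem0)
  next
    case (Suc k)
    then show ?case unfolding remS using ch(2)[OF Suc] by simp
  qed
  define F where "F \<alpha> = (if sum_list \<alpha> < n then \<zero> else ch (sum_list \<alpha>) (rem (sum_list \<alpha> - n)) \<alpha>)" for \<alpha>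
  have red: "reduced F"
    unfolding reduced_def
  proof
    fix \<alpha>
    show "F \<alpha> \<in> carrier A \<and> (F \<alpha> \<noteq> \<zero> \<longrightarrow> F \<alpha> \<notin> \<mm>)"
    proof (cases "sum_list \<alpha> < n")
      case False
      then have "reduced (ch (sum_list \<alpha>) (rem (sum_list \<alpha> - n)))"
        using ch(1) rem_in[of "sum_list \<alpha> - n"] by simp
      then show ?thesis using False by (simp add: F_def reduced_def)
    qed (simp add: F_def)
  qed
  have Fc: "F \<alpha> \<in> carrier A" for \<alpha> using red by (simp add: reduced_def)
  have gA: "g \<in> carrier A" using g ideal_closed(1)[OF add_ideals[OF J P_ideal]] by blast
  have "rem k = g \<ominus> comb xs (exps_below ?r (n + k)) F" for k
  proof (induction k)
    case 0
    have "comb xs (exps_below ?r n) F = \<zero>" by (rule comb_zero[OF xc]) (simp add: F_def exps_below_def)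
    then show ?case using gA by (simp add: rem0 a_minus_def)
  next
    case (Suc k)
    have chc: "ch (n + k) (rem k) \<alpha> \<in> carrier A" for \<alpha> using ch(1)[OF rem_in] by (simp add: reduced_def)
    have e: "comb xs (exps ?r (n + k)) F = comb xs (exps ?r (n + k)) (ch (n + k) (rem k))"
      by (rule comb_cong[OF xc chc]) (auto simp: F_def exps_def)
    have u: "comb xs (exps_below ?r (Suc (n + k))) F = comb xs (exps_below ?r (n + k)) F \<oplus> comb xs (exps ?r (n + k)) F"
      unfolding exps_below_Suc(1) by (rule comb_union[where c=F, OF xc Fc finite_exps_below finite_exps exps_below_Suc(2)])
    have alg: "(x \<ominus> y) \<ominus> z = x \<ominus> (y \<oplus> z)" if "x \<in> carrier A" "y \<in> carrier A" "z \<in> carrier A" for x y z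
      using that by algebra
    show ?case
      unfolding remS e[symmetric]
      unfolding Suc add_Suc_right u by (rule alg[OF gA comb_closed[where c=F, OF xc Fc] comb_closed[where c=F, OF xc Fc]])
  qed
  then show ?thesis using red rem_in F_def by (intro exI[of _ F]) auto
qed

text \<open>The leading form is expanded modulo \<open>\<mm>\<^sup>n\<^sup>+\<^sup>1\<close> rather than modulo \<open>J + \<mm>\<^sup>n\<^sup>+\<^sup>1\<close>.  This forces a nonzero coefficient, since
  \<open>a \<notin> \<mm>\<^sup>n\<^sup>+\<^sup>1\<close>, even if \<open>a\<close> happens to lie in \<open>J + \<mm>\<^sup>n\<^sup>+\<^sup>1\<close>.\<close>

lemma nonzero_series:
  assumes xs: "set xs \<subseteq> \<mm>" and J: "ideal J A" and gen: "\<mm> \<subseteq> (J <+>\<^bsub>A\<^esub> Idl (set xs)) <+>\<^bsub>A\<^esub> P 2"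
    and a: "a \<in> carrier A" "a \<notin> P (Suc n)" "a \<in> ideal_pow A (Idl (set xs)) n <+>\<^bsub>A\<^esub> P (Suc n)"
  shows "\<exists>F. reduced F \<and> (\<exists>\<alpha>. length \<alpha> = length xs \<and> F \<alpha> \<noteq> \<zero>) \<and>
    (\<forall>N>n. a \<ominus> comb xs (exps_below (length xs) N) F \<in> J <+>\<^bsub>A\<^esub> P N)"
proof -
  let ?r = "length xs"
  have xc: "set xs \<subseteq> carrier A" using xs m_sub_carrier by blast
  obtain f where f: "reduced f" "a \<ominus> comb xs (exps ?r n) f \<in> P (Suc n)"
    using homogeneous_expansion[OF xs P_ideal order_refl a(3)] by blast
  have fc: "f \<alpha> \<in> carrier A" for \<alpha> using f(1) by (simp add: reduced_def)
  have ex: "\<exists>\<alpha>\<in>exps ?r n. f \<alpha> \<noteq> \<zero>"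
  proof (rule ccontr)
    assume "\<not> (\<exists>\<alpha>\<in>exps ?r n. f \<alpha> \<noteq> \<zero>)"
    then have "comb xs (exps ?r n) f = \<zero>" by (intro comb_zero[OF xc]) auto
    then show False using f(2) a by (simp add: a_minus_def)
  qed
  let ?g = "a \<ominus> comb xs (exps ?r n) f"
  have "?g \<in> J <+>\<^bsub>A\<^esub> P (Suc n)" using f(2) sum_right[OF J P_ideal] by blast
  from series_expansion[OF xs J gen this]
  obtain F where F: "reduced F" "\<And>\<alpha>. sum_list \<alpha> < Suc n \<Longrightarrow> F \<alpha> = \<zero>"
    "\<And>k. ?g \<ominus> comb xs (exps_below ?r (Suc n + k)) F \<in> J <+>\<^bsub>A\<^esub> P (Suc n + k)" by blast
  have Fc: "F \<alpha> \<in> carrier A" for \<alpha> using F(1) by (simp add: reduced_def)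
  define f' where "f' \<alpha> = (if sum_list \<alpha> = n then f \<alpha> else \<zero>)" for \<alpha>
  have f'c: "f' \<alpha> \<in> carrier A" for \<alpha> using fc by (simp add: f'_def)
  define G where "G \<alpha> = f' \<alpha> \<oplus> F \<alpha>" for \<alpha>
  have G: "G \<alpha> = (if sum_list \<alpha> = n then f \<alpha> else F \<alpha>)" for \<alpha>
    using F(2)[of \<alpha>] fc Fc by (simp add: G_def f'_def)
  have red: "reduced G" using f(1) F(1) by (simp add: reduced_def G)
  have "a \<ominus> comb xs (exps_below ?r N) G \<in> J <+>\<^bsub>A\<^esub> P N" if N: "n < N" for N
  proof -
    obtain k where k: "N = Suc n + k" using N by (metis less_iff_Suc_add add_Suc)
    have "comb xs (exps ?r n) f' = comb xs (exps_below ?r N) f'"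
      by (rule comb_superset[where c=f', OF xc f'c finite_exps_below]) (use N in \<open>auto simp: exps_def exps_below_def f'_def\<close>)
    moreover have "comb xs (exps ?r n) f' = comb xs (exps ?r n) f"
      by (rule comb_cong[where d=f, OF xc fc]) (simp add: f'_def exps_def)
    ultimately have 1: "comb xs (exps_below ?r N) f' = comb xs (exps ?r n) f" by simp
    have 2: "comb xs (exps_below ?r N) G = comb xs (exps ?r n) f \<oplus> comb xs (exps_below ?r N) F"
      unfolding G_def comb_add[where c=f' and d=F, OF xc f'c Fc] 1 ..
    have alg: "x \<ominus> (y \<oplus> z) = (x \<ominus> y) \<ominus> z" if "x \<in> carrier A" "y \<in> carrier A" "z \<in> carrier A" for x y z
      using that by algebra
    show ?thesis
      unfolding 2 alg[OF a(1) comb_closed[where c=f, OF xc fc] comb_closed[where c=F, OF xc Fc]] using F(3)[of k] k by simp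
  qed
  moreover have "\<exists>\<alpha>. length \<alpha> = ?r \<and> G \<alpha> \<noteq> \<zero>" using ex by (auto simp: exps_def G)
  ultimately show ?thesis using red by blast
qed

lemma cong_mult:
  assumes K: "ideal K A" and c: "x \<in> carrier A" "y \<in> carrier A" "u \<in> carrier A" "v \<in> carrier A"
    and xy: "x \<ominus> y \<in> K" and uv: "u \<ominus> v \<in> K"
  shows "x \<otimes> u \<ominus> y \<otimes> v \<in> K"
proof -
  have "x \<otimes> u \<ominus> y \<otimes> v = (x \<ominus> y) \<otimes> u \<oplus> y \<otimes> (u \<ominus> v)" using c by algebra
  then show ?thesis using ideal_closed(3)[OF K ideal_closed(7)[OF K c(3) xy] ideal_closed(6)[OF K c(2) uv]] by simp
qed

lemma cong_pow:
  assumes K: "ideal K A" and c: "x \<in> carrier A" "y \<in> carrier A" and xy: "x \<ominus> y \<in> K"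
  shows "x [^] (n::nat) \<ominus> y [^] n \<in> K"
proof (induction n)
  case 0
  then show ?case using ideal_closed(2)[OF K] by (simp add: a_minus_def r_neg)
next
  case (Suc n)
  then show ?case using cong_mult[OF K _ _ c Suc xy] c by simp
qed

lemma mon_curve:
  assumes K: "ideal K A" and t: "t \<in> carrier A"
    and "set xs \<subseteq> carrier A" "curve K t B xs" "length \<alpha> = length xs"
  shows "mon xs \<alpha> \<ominus> t [^] weight B \<alpha> \<in> K"
  using assms(3-)
proof (induction xs arbitrary: \<alpha>)
  case Nil
  then show ?case using ideal_closed(2)[OF K] by (simp add: a_minus_def r_neg)
next
  case (Cons x xs)
  then obtain a \<beta> where a: "\<alpha> = a # \<beta>" "length \<beta> = length xs" by (cases \<alpha>) auto
  have c: "x \<in> carrier A" "set xs \<subseteq> carrier A" using Cons by auto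
  have "x [^] a \<ominus> (t [^] (B ^ length xs)) [^] a \<in> K"
    using Cons.prems by (intro cong_pow K c nat_pow_closed t) simp
  moreover have "(t [^] (B ^ length xs)) [^] a = t [^] (a * B ^ length \<beta>)"
    using t a by (simp add: nat_pow_pow mult.commute)
  ultimately have 1: "x [^] a \<ominus> t [^] (a * B ^ length \<beta>) \<in> K" by simp
  have 2: "mon xs \<beta> \<ominus> t [^] weight B \<beta> \<in> K" using Cons.IH[OF c(2) _ a(2)] Cons.prems by simp
  show ?case
    using cong_mult[OF K _ _ mon_closed[OF c(2)] _ 1 2] t c a by (simp add: nat_pow_mult)
qed

text \<open>Along the curve the monomial with exponent \<open>\<beta>\<close> has order \<open>weight B \<beta>\<close>, which for \<open>B \<ge> B0\<close> is least for a single exponent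
  \<open>\<alpha>\<close> with nonzero coefficient.  As the degree is at most the weight, a partial sum of degree above \<open>weight B \<alpha>\<close> contains the
  term of \<open>\<alpha>\<close>.\<close>

lemma leading_term:
  assumes xs: "set xs \<subseteq> \<mm>" and J: "ideal J A" and t: "t \<in> \<mm>" and a: "a \<in> carrier A"
    and F: "reduced F" "\<exists>\<alpha>. length \<alpha> = length xs \<and> F \<alpha> \<noteq> \<zero>"
    and approx: "\<And>N. n < N \<Longrightarrow> a \<ominus> comb xs (exps_below (length xs) N) F \<in> J <+>\<^bsub>A\<^esub> P N"
  shows "\<exists>B0. \<forall>B\<ge>B0. \<exists>W c. c \<in> carrier A \<and> c \<notin> \<mm> \<and>
    (\<forall>K. ideal K A \<longrightarrow> J \<subseteq> K \<longrightarrow> curve K t B xs \<longrightarrow> a \<ominus> c \<otimes> t [^] W \<in> K <+>\<^bsub>A\<^esub> P (Suc W))"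
proof -
  let ?r = "length xs"
  have xc: "set xs \<subseteq> carrier A" and tc: "t \<in> carrier A" using xs t m_sub_carrier by auto
  have Fc: "F \<alpha> \<in> carrier A" for \<alpha> using F(1) by (simp add: reduced_def)
  let ?S = "{\<alpha>. length \<alpha> = ?r \<and> F \<alpha> \<noteq> \<zero>}"
  have "?S \<noteq> {}" using F(2) by blast
  then obtain \<alpha> B0 where \<alpha>: "\<alpha> \<in> ?S"
    and B0: "\<And>B. B \<ge> B0 \<Longrightarrow> \<forall>\<beta>\<in>?S. \<beta> \<noteq> \<alpha> \<longrightarrow> weight B \<alpha> < weight B \<beta>"
    using lex_min_weight[of ?S ?r] by blast
  have lead: "a \<ominus> F \<alpha> \<otimes> t [^] weight B \<alpha> \<in> K <+>\<^bsub>A\<^esub> P (Suc (weight B \<alpha>))"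
    if B: "max 1 B0 \<le> B" and K: "ideal K A" "J \<subseteq> K" "curve K t B xs" for B K
  proof -
    let ?W = "weight B \<alpha>" and ?N = "Suc (max n (weight B \<alpha>))"
    let ?H = "K <+>\<^bsub>A\<^esub> P (Suc ?W)"
    let ?D = "exps_below ?r ?N"
    have H: "ideal ?H A" by (intro add_ideals K P_ideal)
    have s: "K \<subseteq> ?H" "P (Suc ?W) \<subseteq> ?H" using sum_left[OF K(1) P_ideal] sum_right[OF K(1) P_ideal] by auto
    have "J <+>\<^bsub>A\<^esub> P ?N \<subseteq> ?H" using K(2) P_mono[of "Suc ?W" ?N] by (intro sum_mono) auto
    then have 1: "a \<ominus> comb xs ?D F \<in> ?H" using approx[of ?N] by auto
    have "sum_list \<alpha> \<le> ?W" using sum_list_le_weight B by simp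
    then have \<alpha>D: "\<alpha> \<in> ?D" using \<alpha> by (simp add: exps_below_def)
    have W: "t [^] ?W \<in> carrier A" using tc by simp
    have mc: "mon xs \<beta> \<in> carrier A" for \<beta> by (rule mon_closed[OF xc])
    have cong: "mon xs \<beta> \<ominus> t [^] weight B \<beta> \<in> ?H" if "length \<beta> = ?r" for \<beta>
      using mon_curve[OF K(1) tc xc K(3) that] s(1) by blast
    have rest: "comb xs (?D - {\<alpha>}) F \<in> ?H"
      unfolding comb_def
    proof (rule ideal_finsum[OF _ H])
      show "finite (?D - {\<alpha>})" by (simp add: finite_exps_below)
      fix \<beta> assume \<beta>: "\<beta> \<in> ?D - {\<alpha>}"
      show "F \<beta> \<otimes> mon xs \<beta> \<in> ?H"
      proof (cases "F \<beta> = \<zero>")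
        case True
        then show ?thesis using mc ideal_closed(2)[OF H] by simp
      next
        case False
        then have \<beta>S: "length \<beta> = ?r" "Suc ?W \<le> weight B \<beta>"
          using B0[of B] B \<beta> by (auto simp: exps_below_def)
        have "t [^] weight B \<beta> \<in> ?H" using P_pow[OF t] P_mono[OF \<beta>S(2)] s(2) by blast
        then have "(mon xs \<beta> \<ominus> t [^] weight B \<beta>) \<oplus> t [^] weight B \<beta> \<in> ?H"
          using ideal_closed(3)[OF H cong[OF \<beta>S(1)]] by simp
        moreover have "(mon xs \<beta> \<ominus> t [^] weight B \<beta>) \<oplus> t [^] weight B \<beta> = mon xs \<beta>"
          using mc[of \<beta>] nat_pow_closed[OF tc, of "weight B \<beta>"] by algebra
        ultimately show ?thesis using ideal_closed(6)[OF H Fc] by simp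
      qed
    qed
    have "?D = (?D - {\<alpha>}) \<union> {\<alpha>}" using \<alpha>D by blast
    then have "comb xs ?D F = comb xs (?D - {\<alpha>}) F \<oplus> comb xs {\<alpha>} F"
      using comb_union[where c=F, OF xc Fc, of "?D - {\<alpha>}" "{\<alpha>}"] finite_exps_below by auto
    also have "comb xs {\<alpha>} F = F \<alpha> \<otimes> mon xs \<alpha>" unfolding comb_def using mc Fc by simp
    finally have 2: "comb xs ?D F = comb xs (?D - {\<alpha>}) F \<oplus> F \<alpha> \<otimes> mon xs \<alpha>" .
    have alg: "x \<ominus> f \<otimes> w = ((x \<ominus> (y \<oplus> f \<otimes> m)) \<oplus> y) \<oplus> f \<otimes> (m \<ominus> w)"
      if "x \<in> carrier A" "y \<in> carrier A" "f \<in> carrier A" "m \<in> carrier A" "w \<in> carrier A" for x y f m w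
      using that by algebra
    have len: "length \<alpha> = ?r" using \<alpha> by simp
    show ?thesis
      unfolding alg[OF a comb_closed[where c=F and D="?D - {\<alpha>}", OF xc Fc] Fc[of \<alpha>] mc[of \<alpha>] W] 2[symmetric]
      by (intro ideal_closed(3,6)[OF H] 1 rest cong[OF len] Fc)
  qed
  have unit: "F \<alpha> \<in> carrier A" "F \<alpha> \<notin> \<mm>" using F(1) \<alpha> by (auto simp: reduced_def)
  show ?thesis
  proof (rule exI[of _ "max 1 B0"], intro allI impI)
    fix B assume B: "max 1 B0 \<le> B"
    show "\<exists>W c. c \<in> carrier A \<and> c \<notin> \<mm> \<and>
      (\<forall>K. ideal K A \<longrightarrow> J \<subseteq> K \<longrightarrow> curve K t B xs \<longrightarrow> a \<ominus> c \<otimes> t [^] W \<in> K <+>\<^bsub>A\<^esub> P (Suc W))"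
      by (rule exI[of _ "weight B \<alpha>"], rule exI[of _ "F \<alpha>"], intro conjI unit allI impI) (rule lead[OF B])
  qed
qed

lemma order_exists:
  assumes sep: "(\<Inter>n\<in>{1..}. P n) = {\<zero>}" and a: "a \<in> carrier A" "a \<noteq> \<zero>"
  obtains n where "a \<in> P n" "a \<notin> P (Suc n)"
proof -
  obtain k where k: "a \<notin> P k" using sep a by blast
  define l where "l = (LEAST k. a \<notin> P k)"
  have l: "a \<notin> P l" unfolding l_def using k by (rule LeastI)
  have "l \<noteq> 0" using l a by (metis P_0)
  then obtain n where n: "l = Suc n" by (metis not0_implies_Suc)
  have "n < (LEAST k. a \<notin> P k)" using n l_def by simp
  then have "a \<in> P n" using not_less_Least by blast
  moreover have "a \<notin> P (Suc n)" using l unfolding n .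
  ultimately show ?thesis by (rule that)
qed

end

section \<open>Products of nonzero elements\<close>

context adic
begin

text \<open>The product of the two leading terms is the leading term of the product, which is \<open>0\<close>; its coefficient \<open>c d\<close> is a unit
  modulo \<open>\<mm>\<close> and can be cancelled.\<close>

lemma leading_terms_mult:
  assumes K: "ideal K A" and t: "t \<in> \<mm>" and a: "a \<in> carrier A" and b: "b \<in> carrier A" and ab: "a \<otimes> b = \<zero>"
    and c: "c \<in> carrier A" "c \<notin> \<mm>" "a \<ominus> c \<otimes> t [^] W \<in> K <+>\<^bsub>A\<^esub> P (Suc W)"
    and d: "d \<in> carrier A" "d \<notin> \<mm>" "b \<ominus> d \<otimes> t [^] V \<in> K <+>\<^bsub>A\<^esub> P (Suc V)"
  shows "t [^] (W + V) \<in> K <+>\<^bsub>A\<^esub> P (Suc (W + V))"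
proof -
  have tc: "t \<in> carrier A" by (rule m_sub_carrier[OF t])
  obtain k u where k: "k \<in> K" "u \<in> P (Suc W)" "a \<ominus> c \<otimes> t [^] W = k \<oplus> u" using c(3) by (rule in_sumE)
  obtain l v where l: "l \<in> K" "v \<in> P (Suc V)" "b \<ominus> d \<otimes> t [^] V = l \<oplus> v" using d(3) by (rule in_sumE)
  have kl: "k \<in> carrier A" "l \<in> carrier A" "u \<in> carrier A" "v \<in> carrier A"
    by (rule ideal_closed(1)[OF K k(1)] ideal_closed(1)[OF K l(1)]
        ideal_closed(1)[OF P_ideal k(2)] ideal_closed(1)[OF P_ideal l(2)])+
  define x y where "x = t [^] W" and "y = t [^] V"
  have xy: "x \<in> carrier A" "y \<in> carrier A" "x \<otimes> y = t [^] (W + V)" using tc by (simp_all add: x_def y_def nat_pow_mult)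
  define p q where "p = k \<oplus> u" and "q = l \<oplus> v"
  have pq: "p \<in> carrier A" "q \<in> carrier A" unfolding p_def q_def using kl by simp_all
  let ?H = "K <+>\<^bsub>A\<^esub> P (Suc (W + V))"
  have H: "ideal ?H A" by (intro add_ideals K P_ideal)
  note H_add = ideal_closed(3)[OF H] and H_lmult = ideal_closed(6)[OF H] and H_rmult = ideal_closed(7)[OF H]
  have KH: "k \<in> ?H" "l \<in> ?H" by (rule subsetD[OF sum_left[OF K P_ideal]], rule k l)+
  have PH: "z \<in> ?H" if "z \<in> P (Suc (W + V))" for z by (rule subsetD[OF sum_right[OF K P_ideal] that])
  have "x \<otimes> v \<in> P (W + Suc V)" "y \<otimes> u \<in> P (V + Suc W)" "u \<otimes> v \<in> P (Suc W + Suc V)"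
    unfolding x_def y_def by (rule P_mult[OF P_pow[OF t] l(2)] P_mult[OF P_pow[OF t] k(2)] P_mult[OF k(2) l(2)])+
  then have "x \<otimes> v \<in> P (Suc (W + V))" "y \<otimes> u \<in> P (Suc (W + V))" "u \<otimes> v \<in> P (Suc (W + V))"
    using P_mono[of "Suc (W + V)" "Suc W + Suc V"] by (auto simp: add.commute)
  then have PH3: "x \<otimes> v \<in> ?H" "y \<otimes> u \<in> ?H" "u \<otimes> v \<in> ?H" by (auto intro: PH)
  have 1: "(c \<otimes> x) \<otimes> q \<in> ?H"
  proof -
    have "(c \<otimes> x) \<otimes> q = (c \<otimes> x) \<otimes> l \<oplus> c \<otimes> (x \<otimes> v)" unfolding q_def using c xy kl by (simp add: r_distr m_assoc)
    then show ?thesis using H_add[OF H_lmult[OF _ KH(2)] H_lmult[OF c(1) PH3(1)]] c xy by simp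
  qed
  have 2: "(d \<otimes> y) \<otimes> p \<in> ?H"
  proof -
    have "(d \<otimes> y) \<otimes> p = (d \<otimes> y) \<otimes> k \<oplus> d \<otimes> (y \<otimes> u)" unfolding p_def using d xy kl by (simp add: r_distr m_assoc)
    then show ?thesis using H_add[OF H_lmult[OF _ KH(1)] H_lmult[OF d(1) PH3(2)]] d xy by simp
  qed
  have 3: "p \<otimes> q \<in> ?H"
  proof -
    have "p \<otimes> q = p \<otimes> l \<oplus> (k \<otimes> v \<oplus> u \<otimes> v)" unfolding q_def using pq kl by (simp add: r_distr) (simp add: p_def l_distr kl)
    then show ?thesis using H_add[OF H_lmult[OF pq(1) KH(2)] H_add[OF H_rmult[OF kl(4) KH(1)] PH3(3)]] by simp
  qed
  have prod: "f \<otimes> g = (f \<oplus> p) \<otimes> (g \<oplus> q) \<ominus> (f \<otimes> q \<oplus> (g \<otimes> p \<oplus> p \<otimes> q))"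
    if "f \<in> carrier A" "g \<in> carrier A" for f g
    using that pq by algebra
  have diff: "f \<oplus> (g \<ominus> f) = g" if "f \<in> carrier A" "g \<in> carrier A" for f g using that by algebra
  have ab': "c \<otimes> x \<oplus> p = a" "d \<otimes> y \<oplus> q = b"
    unfolding p_def q_def k(3)[symmetric] l(3)[symmetric] x_def y_def using a b c d tc by (simp_all add: diff)
  have cx: "c \<otimes> x \<in> carrier A" "d \<otimes> y \<in> carrier A" using c d xy by auto
  have "(c \<otimes> x) \<otimes> (d \<otimes> y) \<in> ?H"
    unfolding prod[OF cx] ab' ab by (intro ideal_closed(5)[OF H] ideal_closed(2)[OF H] H_add 1 2 3)
  also have "(c \<otimes> x) \<otimes> (d \<otimes> y) = (c \<otimes> d) \<otimes> (x \<otimes> y)" using c d xy(1,2) by (simp add: m_ac)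
  finally have cd: "(c \<otimes> d) \<otimes> t [^] (W + V) \<in> ?H" unfolding xy(3) .
  show ?thesis
  proof (rule cancel_unit[OF H m_closed[OF c(1) d(1)] prime[OF c(1) d(1) c(2) d(2)] _ cd])
    show "t [^] (W + V) \<in> carrier A" using tc by simp
    fix \<mu> assume "\<mu> \<in> \<mm>"
    then have "\<mu> \<otimes> t [^] (W + V) \<in> P (Suc 0 + (W + V))" by (intro P_mult P_pow t) (simp add: P_1)
    then show "\<mu> \<otimes> t [^] (W + V) \<in> ?H" by (intro PH) simp
  qed
qed

end

context regular_adic
begin

theorem separated_imp_domain:
  assumes sep: "(\<Inter>n\<in>{1..}. P n) = {\<zero>}"
  shows "domain A"
proof (rule domainI[OF is_cring])
  show "\<one> \<noteq> \<zero>" using one_notin ideal_closed(2)[OF mm] by metis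
  fix a b assume ab: "a \<otimes> b = \<zero>" "a \<in> carrier A" "b \<in> carrier A"
  show "a = \<zero> \<or> b = \<zero>"
  proof (rule ccontr)
    assume "\<not> (a = \<zero> \<or> b = \<zero>)"
    then have nz: "a \<noteq> \<zero>" "b \<noteq> \<zero>" by auto
    obtain n where n: "a \<in> P n" "a \<notin> P (Suc n)" by (rule order_exists[OF sep ab(2) nz(1)])
    obtain p where p: "b \<in> P p" "b \<notin> P (Suc p)" by (rule order_exists[OF sep ab(3) nz(2)])
    define ok where "ok xs \<longleftrightarrow> set xs \<subseteq> \<mm> \<and> a \<in> ideal_pow A (Idl (set xs)) n <+>\<^bsub>A\<^esub> P (Suc n) \<and>
      b \<in> ideal_pow A (Idl (set xs)) p <+>\<^bsub>A\<^esub> P (Suc p)" for xs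
    have ideals: "ideal (Idl (set xs)) A" "Idl (set xs) \<subseteq> \<mm>" if "set xs \<subseteq> \<mm>" for xs
      using genideal_ideal[of "set xs"] genideal_minimal[OF mm that] that m_sub_carrier by auto
    have "\<exists>xs. ok xs"
    proof -
      obtain xs where xs: "set xs \<subseteq> \<mm>" "a \<in> ideal_pow A (Idl (set xs)) n"
        using P_finitely_generated[OF n(1)] by blast
      obtain ys where ys: "set ys \<subseteq> \<mm>" "b \<in> ideal_pow A (Idl (set ys)) p"
        using P_finitely_generated[OF p(1)] by blast
      have u: "set (xs @ ys) \<subseteq> \<mm>" using xs ys by simp
      have self: "set (xs @ ys) \<subseteq> Idl (set (xs @ ys))" using u m_sub_carrier by (intro genideal_self) blast
      have "Idl (set xs) \<subseteq> Idl (set (xs @ ys))" "Idl (set ys) \<subseteq> Idl (set (xs @ ys))"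
        by (rule genideal_minimal[OF ideals(1)[OF u]]; use self in simp)+
      then have "a \<in> ideal_pow A (Idl (set (xs @ ys))) n" "b \<in> ideal_pow A (Idl (set (xs @ ys))) p"
        using subsetD[OF ideal_pow_sub[OF ideals(1)[OF xs(1)] ideals(1)[OF u]] xs(2)]
          subsetD[OF ideal_pow_sub[OF ideals(1)[OF ys(1)] ideals(1)[OF u]] ys(2)] by simp_all
      note in_pow = this
      have "ok (xs @ ys)"
        unfolding ok_def
        by (intro conjI u subsetD[OF sum_left[OF ideal_pow_ideal[OF is_cring ideals(1)[OF u]] P_ideal]] in_pow)
      then show ?thesis by blast
    qed
    then obtain xs where xs: "ok xs" and min: "\<And>ys. ok ys \<Longrightarrow> length xs \<le> length ys"
      using ex_has_least_nat[of ok _ length] by blast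
    have xm: "set xs \<subseteq> \<mm>" using xs by (simp add: ok_def)
    have indep: "seq_indep {\<zero>} xs"
    proof (rule ccontr)
      assume "\<not> seq_indep {\<zero>} xs"
      from dependent_reduce[OF zeroideal xm this]
      obtain ys where ys: "length ys < length xs" "set ys \<subseteq> \<mm>"
        "Idl (set xs) \<subseteq> (Idl (set ys) <+>\<^bsub>A\<^esub> {\<zero>}) <+>\<^bsub>A\<^esub> P 2" by blast
      note app = ideal_pow_approx[OF ideals(1)[OF xm] ideals(1)[OF ys(2)] zeroideal ys(3) ideals(2)[OF xm] ideals(2)[OF ys(2)]]
      have "ideal_pow A (Idl (set xs)) k <+>\<^bsub>A\<^esub> P (Suc k) \<subseteq> ideal_pow A (Idl (set ys)) k <+>\<^bsub>A\<^esub> P (Suc k)" for k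
      proof -
        note pi = ideal_pow_ideal[OF is_cring ideals(1)[OF ys(2)], of k]
        have "ideal_pow A (Idl (set ys)) k <+>\<^bsub>A\<^esub> {\<zero>} \<subseteq> ideal_pow A (Idl (set ys)) k"
          using ideal_closed(2)[OF pi] by (intro sum_least pi) auto
        then have "(ideal_pow A (Idl (set ys)) k <+>\<^bsub>A\<^esub> {\<zero>}) <+>\<^bsub>A\<^esub> P (Suc k) \<subseteq> ideal_pow A (Idl (set ys)) k <+>\<^bsub>A\<^esub> P (Suc k)"
          by (intro sum_mono order_refl)
        with app[of k] show ?thesis
          by (intro sum_least add_ideals pi P_ideal sum_right[OF pi P_ideal]) blast
      qed
      then have "ok ys" using xs ys(2) unfolding ok_def by blast
      then show False using min[of ys] ys(1) by simp
    qed
    obtain J where J: "transversal J" "seq_indep J xs" "\<mm> \<subseteq> (J <+>\<^bsub>A\<^esub> Idl (set xs)) <+>\<^bsub>A\<^esub> P 2"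
      using transversal_complement[OF xm indep] by blast
    note Ji = transversalD(1)[OF J(1)]
    obtain F where F: "reduced F" "\<exists>\<alpha>. length \<alpha> = length xs \<and> F \<alpha> \<noteq> \<zero>"
      "\<And>N. n < N \<Longrightarrow> a \<ominus> comb xs (exps_below (length xs) N) F \<in> J <+>\<^bsub>A\<^esub> P N"
      using nonzero_series[OF xm Ji J(3) ab(2) n(2)] xs unfolding ok_def by blast
    obtain G where G: "reduced G" "\<exists>\<alpha>. length \<alpha> = length xs \<and> G \<alpha> \<noteq> \<zero>"
      "\<And>N. p < N \<Longrightarrow> b \<ominus> comb xs (exps_below (length xs) N) G \<in> J <+>\<^bsub>A\<^esub> P N"
      using nonzero_series[OF xm Ji J(3) ab(3) p(2)] xs unfolding ok_def by blast
    show False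
    proof (cases xs rule: rev_cases)
      case Nil
      \<comment> \<open>Without generators, only elements of order zero have a nonzero expansion.\<close>
      have "x \<notin> \<mm>" if x: "x \<in> carrier A" "x \<notin> P (Suc k)" "x \<in> ideal_pow A (Idl (set xs)) k <+>\<^bsub>A\<^esub> P (Suc k)" for x k
      proof -
        obtain f where f: "reduced f" "x \<ominus> comb xs (exps 0 k) f \<in> P (Suc k)"
          using homogeneous_expansion[OF xm P_ideal order_refl x(3)] Nil by auto
        have "k = 0"
        proof (rule ccontr)
          assume "k \<noteq> 0"
          then have "exps 0 k = {}" by (auto simp: exps_def)
          then show False using f(2) x by (simp add: comb_def a_minus_def)
        qed
        then show ?thesis using x(2) by (simp add: P_1)
      qed
      then have "a \<notin> \<mm>" "b \<notin> \<mm>" using ab n(2) p(2) xs unfolding ok_def by blast+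
      then show False using prime[OF ab(2,3)] ab(1) ideal_closed(2)[OF mm] by simp
    next
      case (snoc us t)
      have t: "t \<in> \<mm>" and us: "set us \<subseteq> \<mm>" using xm snoc by auto
      have tc: "t \<in> carrier A" using t m_sub_carrier by blast
      obtain B1 where B1: "\<forall>B\<ge>B1. \<exists>W c. c \<in> carrier A \<and> c \<notin> \<mm> \<and>
        (\<forall>K. ideal K A \<longrightarrow> J \<subseteq> K \<longrightarrow> curve K t B xs \<longrightarrow> a \<ominus> c \<otimes> t [^] W \<in> K <+>\<^bsub>A\<^esub> P (Suc W))"
        using leading_term[OF xm Ji t ab(2) F] by blast
      obtain B2 where B2: "\<forall>B\<ge>B2. \<exists>W c. c \<in> carrier A \<and> c \<notin> \<mm> \<and>
        (\<forall>K. ideal K A \<longrightarrow> J \<subseteq> K \<longrightarrow> curve K t B xs \<longrightarrow> b \<ominus> c \<otimes> t [^] W \<in> K <+>\<^bsub>A\<^esub> P (Suc W))"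
        using leading_term[OF xm Ji t ab(3) G] by blast
      define B where "B = max 2 (max B1 B2)"
      have Bge: "B1 \<le> B" "B2 \<le> B" "2 \<le> B" by (auto simp: B_def)
      obtain K where K: "transversal K" "J \<subseteq> K" "curve K t B xs" "t \<notin> K <+>\<^bsub>A\<^esub> P 2" "\<mm> \<subseteq> (K <+>\<^bsub>A\<^esub> PIdl t) <+>\<^bsub>A\<^esub> P 2"
        using curve_ideal[OF J(1) _ us t Bge(3)] J(2,3) unfolding snoc by blast
      note Ki = transversalD(1)[OF K(1)]
      obtain W c where c: "c \<in> carrier A" "c \<notin> \<mm>" "a \<ominus> c \<otimes> t [^] W \<in> K <+>\<^bsub>A\<^esub> P (Suc W)"
        using B1[rule_format, OF Bge(1)] Ki K(2,3) by blast
      obtain V d where d: "d \<in> carrier A" "d \<notin> \<mm>" "b \<ominus> d \<otimes> t [^] V \<in> K <+>\<^bsub>A\<^esub> P (Suc V)"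
        using B2[rule_format, OF Bge(2)] Ki K(2,3) by blast
      have "t [^] (W + V) \<in> K <+>\<^bsub>A\<^esub> P (Suc (W + V))"
        by (rule leading_terms_mult[OF Ki t ab(2,3,1) c d])
      then show False using curve_order[OF K(1) t K(4,5)] by blast
    qed
  qed
qed

end

section \<open>Formally regular local rings\<close>

text \<open>The splitting \<open>\<theta>\<close> is linear and thus vanishes on \<open>I\<mm>\<close>, while \<open>\<theta> (t u) = t \<theta>(u)\<close> is the class of \<open>u\<close>.\<close>

lemma formally_regular_relation:
  assumes A: "cring A" and mm: "ideal \<mm> A" and reg: "formally_regular TYPE('a list set) (A :: ('a, 'q) ring_scheme) \<mm>"
    and I: "ideal I A" and n: "1 \<le> n" and sub: "ideal_pow A \<mm> n \<subseteq> I" "I \<subseteq> \<mm>"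
    and t: "t \<in> \<mm>" and gen: "\<mm> \<subseteq> PIdl\<^bsub>A\<^esub> t <+>\<^bsub>A\<^esub> I"
    and u: "u \<in> \<mm>" and tu: "t \<otimes>\<^bsub>A\<^esub> u \<in> I \<cdot>\<^bsub>A\<^esub> \<mm>"
  shows "u \<in> I"
proof -
  interpret A: cring A by (rule A)
  interpret mm: ideal \<mm> A by (rule mm)
  interpret I: ideal I A by (rule I)
  interpret Q: cring "A Quot I" by (rule I.quotient_is_cring[OF A])
  have tc: "t \<in> carrier A" by (rule mm.Icarr[OF t])
  have gen': "\<exists>a\<in>carrier A. \<exists>i\<in>I. x = t \<otimes>\<^bsub>A\<^esub> a \<oplus>\<^bsub>A\<^esub> i" if "x \<in> \<mm>" for x
  proof -
    note x = subsetD[OF gen that]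
    obtain y i where yi: "y \<in> PIdl\<^bsub>A\<^esub> t" "i \<in> I" "x = y \<oplus>\<^bsub>A\<^esub> i" using x by (rule A.in_sumE)
    obtain a where a: "a \<in> carrier A" "y = a \<otimes>\<^bsub>A\<^esub> t" using yi(1) by (auto simp: cgenideal_def)
    have "x = t \<otimes>\<^bsub>A\<^esub> a \<oplus>\<^bsub>A\<^esub> i" unfolding yi(3) a(2) using A.m_comm[OF a(1) tc] by simp
    then show ?thesis using a(1) yi(2) by blast
  qed
  obtain \<theta> where closed: "\<And>a. a \<in> \<mm> \<Longrightarrow> \<theta> a \<in> carrier (A Quot I)"
    and t\<theta>: "\<And>a. a \<in> \<mm> \<Longrightarrow> (I +>\<^bsub>A\<^esub> t) \<otimes>\<^bsub>A Quot I\<^esub> \<theta> a = I +>\<^bsub>A\<^esub> a"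
    and add: "\<And>a b. \<lbrakk>a \<in> \<mm>; b \<in> \<mm>\<rbrakk> \<Longrightarrow> \<theta> (a \<oplus>\<^bsub>A\<^esub> b) = \<theta> a \<oplus>\<^bsub>A Quot I\<^esub> \<theta> b"
    and lin: "\<And>r a. \<lbrakk>r \<in> carrier A; a \<in> \<mm>\<rbrakk> \<Longrightarrow> \<theta> (r \<otimes>\<^bsub>A\<^esub> a) = (I +>\<^bsub>A\<^esub> r) \<otimes>\<^bsub>A Quot I\<^esub> \<theta> a"
    using formally_regular_splitting[OF A mm reg I n sub t gen'] by metis
  have "x \<in> \<mm> \<and> \<theta> x = \<zero>\<^bsub>A Quot I\<^esub>" if "x \<in> I \<cdot>\<^bsub>A\<^esub> \<mm>" for x
    using that
  proof (induction x rule: ideal_prod.induct)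
    case (prod i j)
    have "I +>\<^bsub>A\<^esub> i = \<zero>\<^bsub>A Quot I\<^esub>" using prod(1) using I.a_rcos_const[OF prod(1)] by (simp add: FactRing_def)
    then show ?case using lin[OF I.Icarr[OF prod(1)] prod(2)] closed[OF prod(2)] prod
      by (simp add: mm.I_l_closed)
  next
    case (sum x y)
    then show ?case using add[of x y] by simp
  qed
  then have "\<theta> (t \<otimes>\<^bsub>A\<^esub> u) = \<zero>\<^bsub>A Quot I\<^esub>" using tu by blast
  then have "I +>\<^bsub>A\<^esub> u = \<zero>\<^bsub>A Quot I\<^esub>" using lin[OF tc u] t\<theta>[OF u] by simp
  then show "u \<in> I" using I.a_rcos_self[OF mm.Icarr[OF u]] by (simp add: FactRing_def)
qed

theorem corollary1p25:
  fixes A :: "('a, 'q) ring_scheme" and \<mm> :: "'a set"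
  assumes "local_ring A \<mm>"
    and "formally_regular TYPE('a list set) A \<mm>"
    and "(\<Inter>n\<in>{1..}. ideal_pow A \<mm> n) = {\<zero>\<^bsub>A\<^esub>}"
  shows "domain A"
proof -
  have A: "cring A" and max: "maximalideal \<mm> A" using assms(1) by (simp_all add: local_ring_def)
  interpret A: adic A \<mm> by (intro adic.intro adic_axioms.intro A max)
  interpret A: regular_adic A \<mm>
    by unfold_locales (rule formally_regular_relation[OF A A.mm assms(2)], simp_all add: A.P_def)
  show ?thesis by (rule A.separated_imp_domain) (unfold A.P_def, rule assms(3))
qed

end
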